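(* Let $R=\mathbb{Z}$, or $R=\mathbb{Z}/p\mathbb{Z}$ with $p\ge 3$ an odd integer, and let $m\ge 1$. For a vector $v=(a_1,\dots,a_{2m})\in R^{2m}$ put $\Delta(v)=\sum_{i=1}^{2m}(-1)^{i-1}a_i\in R$. Then the following are equivalent. (i) There exists an $R$-colored classical $m$-string tangle diagram $(T,C)$ such that $\partial(T,C)=v$. (ii) $\Delta(v)=0$. Moreover, such a diagram $T$ can be chosen to satisfy the property $\mathrm{P}_1$ (that is, whenever these conditions hold, there is an $R$-colored classical $m$-string tangle diagram $(T,C)$ with $\partial(T,C)=v$ such that $T$ satisfies $\mathrm{P}_1$), where $\mathrm{P}_1$: $T$ can be transformed into a trivial tangle diagram by a finite sequence of moves (a), each of which interchanges adjacent endpoints of strings along the boundary of the $2$-disk containing $T$.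
   Context: An $m$-string virtual tangle diagram $T$ ($m\ge1$) consists of $m$ intervals (strings) properly immersed in a $2$-disk $D^2$ (so there are $2m$ boundary points on $\partial D^2$, and no closed components), whose singularities are only transverse double points. Each double point is designated either a classical crossing (with over/under information) or a virtual crossing (no over/under information). $T$ is classical if it has no virtual crossings. Diagrams are considered up to planar isotopy. An arc of $T$ is a connected component obtained from the diagram by removing all under-crossings (arcs pass through virtual crossings and over-crossings). An $R$-coloring of $T$ is a map $C:\{\text{arcs of }T\}\to R$ such that at each classical crossing $C(x)+C(z)=2C(y)$, where $x,z$ are the two under-arcs and $y$ is the over-arc; no condition is imposed at virtual crossings. The pair $(T,C)$ is called an $R$-colored diagram. Its boundary color vector $\partial(T,C)=(a_1,\dots,a_{2m})\in R^{2m}$ lists the colors at the $2m$ boundary points in cyclic order along $\partial D^2$ (the choice of the starting endpoint is arbitrary). A trivial tangle diagram is a tangle diagram with no crossings. Move (a): if two endpoints adjacent along $\partial D^2$ are such that the strings starting at them cross each other at a classical crossing immediately next to the boundary (the two initial segments up to this crossing, together with the boundary interval between the endpoints, bound a triangular region whose interior is disjoint from $T$), remove this crossing by interchanging the two endpoints along $\partial D^2$; the crossing may be of either over/under type. *)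

theory Defs
  imports "HOL-Analysis.Analysis" "HOL-Algebra.IntRing" "HOL-Number_Theory.Residues"
begin

section \<open>Tangle diagrams\<close>

text \<open>
  The unit disk in the complex plane serves as the 2-disk. The points of the strings are addressed
  by parameters: \<open>(i, t)\<close> is the point at time \<open>t\<close> of the \<open>i\<close>-th string. The strings carry neither a
  preferred order nor an orientation, see \<open>planar_isotopic\<close> below. A crossing is a pair of distinct
  parameters with the same image; \<open>under\<close> is the set of parameters at which a string passes
  under another one (or itself). A crossing with exactly one of its two parameters in \<open>under\<close> is
  classical, a crossing with none of them in \<open>under\<close> is virtual.
\<close>

type_synonym param = "nat \<times> real"

record tangle =
  strand :: "nat \<Rightarrow> real \<Rightarrow> complex"
  under :: "param set"

definition params :: "nat \<Rightarrow> param set" where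
  "params m = {..<m} \<times> {0..1}"

definition endpoints :: "nat \<Rightarrow> param set" where
  "endpoints m = {..<m} \<times> {0, 1}"

definition pt :: "tangle \<Rightarrow> param \<Rightarrow> complex" where
  "pt T x = strand T (fst x) (snd x)"

definition velocity :: "tangle \<Rightarrow> param \<Rightarrow> complex" where
  "velocity T x = vector_derivative (strand T (fst x)) (at (snd x))"

definition crossing :: "nat \<Rightarrow> tangle \<Rightarrow> param \<Rightarrow> param \<Rightarrow> bool" where
  "crossing m T x y \<longleftrightarrow> x \<in> params m \<and> y \<in> params m \<and> x \<noteq> y \<and> pt T x = pt T y"

text \<open>
  Immersed means continuously differentiable with nowhere vanishing velocity. The derivatives at the
  ends of the unit interval are two-sided; this is no restriction, since the functions may be
  extended arbitrarily beyond it. Non-collinearity with 0 is linear independence over the reals,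
  i.e. transversality. An endpoint cannot be a double point, since only endpoints lie on the
  boundary circle and they are pairwise distinct.
\<close>

definition virtual_tangle_diagram :: "nat \<Rightarrow> tangle \<Rightarrow> bool" where
  "virtual_tangle_diagram m T \<longleftrightarrow>
     1 \<le> m \<and>
     (\<forall>i<m. strand T i C1_differentiable_on {0..1}) \<and>
     (\<forall>x\<in>params m. velocity T x \<noteq> 0) \<and>
     pt T ` params m \<subseteq> cball 0 1 \<and>
     (\<forall>x\<in>params m. pt T x \<in> sphere 0 1 \<longleftrightarrow> x \<in> endpoints m) \<and>
     inj_on (pt T) (endpoints m) \<and>
     (\<forall>x y. crossing m T x y \<longrightarrow> \<not> collinear {0, velocity T x, velocity T y}) \<and>
     (\<forall>x y z. crossing m T x y \<and> crossing m T x z \<longrightarrow> y = z) \<and>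
     (\<forall>x\<in>under T. \<exists>y. crossing m T x y) \<and>
     (\<forall>x y. crossing m T x y \<longrightarrow> \<not> (x \<in> under T \<and> y \<in> under T))"

definition classical_tangle_diagram :: "nat \<Rightarrow> tangle \<Rightarrow> bool" where
  "classical_tangle_diagram m T \<longleftrightarrow>
     virtual_tangle_diagram m T \<and>
     (\<forall>x y. crossing m T x y \<longrightarrow> x \<in> under T \<or> y \<in> under T)"

definition trivial_tangle_diagram :: "nat \<Rightarrow> tangle \<Rightarrow> bool" where
  "trivial_tangle_diagram m T \<longleftrightarrow>
     virtual_tangle_diagram m T \<and> (\<nexists>x y. crossing m T x y)"


section \<open>Colorings\<close>

text \<open>
  Removing the under-crossings is done on the parameters rather than on the image in the disk:
  arcs must pass through over-crossings and virtual crossings without being joined to the other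
  string there.
\<close>

definition diagram_arcs :: "nat \<Rightarrow> tangle \<Rightarrow> param set set" where
  "diagram_arcs m T = components (params m - under T)"

text \<open>The two under-arcs at an under-crossing \<open>u\<close> are the two arcs having \<open>u\<close> as a limit point.\<close>

definition coloring :: "int ring \<Rightarrow> nat \<Rightarrow> tangle \<Rightarrow> (param set \<Rightarrow> int) \<Rightarrow> bool" where
  "coloring R m T C \<longleftrightarrow>
     (\<forall>A\<in>diagram_arcs m T. C A \<in> carrier R) \<and>
     (\<forall>u v X Y Z. u \<in> under T \<and> crossing m T u v \<and>
        X \<in> diagram_arcs m T \<and> Z \<in> diagram_arcs m T \<and> X \<noteq> Z \<and> u \<in> closure X \<and> u \<in> closure Z \<and>
        Y \<in> diagram_arcs m T \<and> v \<in> Y \<longrightarrow>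
        C X \<oplus>\<^bsub>R\<^esub> C Z = [(2::nat)] \<cdot>\<^bsub>R\<^esub> C Y)"

text \<open>
  The boundary color vector depends on the choice of a first endpoint, so this is a relation. The
  endpoints are listed counterclockwise.
\<close>

definition boundary_color_vector ::
    "nat \<Rightarrow> tangle \<Rightarrow> (param set \<Rightarrow> int) \<Rightarrow> int list \<Rightarrow> bool" where
  "boundary_color_vector m T C v \<longleftrightarrow>
     length v = 2 * m \<and>
     (\<exists>(e :: nat \<Rightarrow> param) (\<theta> :: nat \<Rightarrow> real).
        bij_betw e {..<2 * m} (endpoints m) \<and>
        (\<forall>k<2 * m. pt T (e k) = cis (\<theta> k)) \<and>
        (\<forall>k l. k < l \<and> l < 2 * m \<longrightarrow> \<theta> k < \<theta> l \<and> \<theta> l < \<theta> k + 2 * pi) \<and>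
        (\<forall>k<2 * m. \<exists>A\<in>diagram_arcs m T. e k \<in> A \<and> v ! k = C A))"

text \<open>The index of a list starts at 0, hence the exponent \<open>i\<close>.\<close>

definition alternating_sum :: "int ring \<Rightarrow> int list \<Rightarrow> int" where
  "alternating_sum R v =
     (\<Oplus>\<^bsub>R\<^esub>i\<in>{..<length v}. ((\<ominus>\<^bsub>R\<^esub> \<one>\<^bsub>R\<^esub>) [^]\<^bsub>R\<^esub> i) \<otimes>\<^bsub>R\<^esub> (v ! i))"


section \<open>Planar isotopy and the move (a)\<close>

text \<open>
  \<open>H\<close> is an ambient isotopy of the disk. The homeomorphism \<open>\<phi>\<close> of the parameter spaces permutes,
  reverses and reparametrizes the strings.
\<close>

definition planar_isotopic :: "nat \<Rightarrow> tangle \<Rightarrow> tangle \<Rightarrow> bool" where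
  "planar_isotopic m T T' \<longleftrightarrow>
     virtual_tangle_diagram m T \<and> virtual_tangle_diagram m T' \<and>
     (\<exists>(H :: real \<Rightarrow> complex \<Rightarrow> complex) \<phi> \<psi>.
        continuous_on ({0..1} \<times> cball 0 1) (\<lambda>(s, z). H s z) \<and>
        (\<forall>s\<in>{0..1}. \<exists>G. homeomorphism (cball 0 1) (cball 0 1) (H s) G) \<and>
        (\<forall>z\<in>cball 0 1. H 0 z = z) \<and>
        homeomorphism (params m) (params m) \<phi> \<psi> \<and>
        (\<forall>x\<in>params m. pt T' (\<phi> x) = H 1 (pt T x)) \<and>
        under T' = \<phi> ` under T)"

definition param_segment :: "param \<Rightarrow> param \<Rightarrow> param set" where
  "param_segment x y = {fst x} \<times> closed_segment (snd x) (snd y)"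

text \<open>
  The strings starting at the endpoints \<open>e\<close> and \<open>f\<close>, which are adjacent along the boundary interval
  from \<open>cis \<theta>\<close> to \<open>cis \<theta>'\<close>, meet in a classical crossing (with parameter \<open>u\<close> on the first and \<open>w\<close>
  on the second string), and the simple closed curve formed by the two initial segments and the
  boundary interval bounds a region which is disjoint from the diagram.
\<close>

definition boundary_crossing ::
    "nat \<Rightarrow> tangle \<Rightarrow> param \<Rightarrow> param \<Rightarrow> param \<Rightarrow> param \<Rightarrow> real \<Rightarrow> real \<Rightarrow> bool" where
  "boundary_crossing m T e f u w \<theta> \<theta>' \<longleftrightarrow>
     e \<in> endpoints m \<and> f \<in> endpoints m \<and>
     \<theta> < \<theta>' \<and> \<theta>' < \<theta> + 2 * pi \<and> pt T e = cis \<theta> \<and> pt T f = cis \<theta>' \<and>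
     pt T ` endpoints m \<inter> cis ` {\<theta><..<\<theta>'} = {} \<and>
     fst u = fst e \<and> fst w = fst f \<and> crossing m T u w \<and> (u \<in> under T \<or> w \<in> under T) \<and>
     inj_on (pt T) (param_segment e u) \<and> inj_on (pt T) (param_segment f w) \<and>
     pt T ` param_segment e u \<inter> pt T ` param_segment f w = {pt T u} \<and>
     inside (pt T ` param_segment e u \<union> pt T ` param_segment f w \<union> cis ` {\<theta>..\<theta>'})
       \<inter> pt T ` params m = {}"

text \<open>
  The move takes place in a disk \<open>N\<close> around the triangular region, which the two strings leave for
  good shortly after the crossing, at the parameters \<open>e'\<close> and \<open>f'\<close>; nothing else of the diagram
  meets \<open>N\<close>. Inside \<open>N\<close> the two crossing pieces of string are replaced by two disjoint ones, which
  start at the interchanged endpoints and, by continuity, leave \<open>N\<close> at the same points as before.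
\<close>

definition move_a :: "nat \<Rightarrow> tangle \<Rightarrow> tangle \<Rightarrow> bool" where
  "move_a m T T' \<longleftrightarrow>
     virtual_tangle_diagram m T \<and> virtual_tangle_diagram m T' \<and>
     (\<exists>e f u w \<theta> \<theta>' e' f' E F (N :: complex set).
        boundary_crossing m T e f u w \<theta> \<theta>' \<and>
        e' \<in> params m - endpoints m \<and> f' \<in> params m - endpoints m \<and>
        fst e' = fst e \<and> fst f' = fst f \<and>
        E = param_segment e e' \<and> F = param_segment f f' \<and> E \<inter> F = {} \<and>
        u \<in> E - {e'} \<and> w \<in> F - {f'} \<and>
        N homeomorphic (cball 0 1 :: complex set) \<and> N \<subseteq> cball 0 1 \<and> cis ` {\<theta>..\<theta>'} \<subseteq> N \<and>
        (\<forall>x\<in>params m. pt T x \<in> N \<longleftrightarrow> x \<in> E \<union> F) \<and>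
        (\<forall>x\<in>E \<union> F. \<forall>y. crossing m T x y \<longrightarrow> {x, y} = {u, w}) \<and>
        pt T' e = pt T f \<and> pt T' f = pt T e \<and>
        pt T' ` (E \<union> F) \<subseteq> N \<and> inj_on (pt T') (E \<union> F) \<and>
        (\<forall>x\<in>params m - (E \<union> F). pt T' x = pt T x) \<and>
        under T' = under T - {u, w})"

text \<open>Diagrams are considered up to planar isotopy, which is therefore allowed between the moves.\<close>

definition property_P1 :: "nat \<Rightarrow> tangle \<Rightarrow> bool" where
  "property_P1 m T \<longleftrightarrow>
     (\<exists>T0. trivial_tangle_diagram m T0 \<and>
        (\<lambda>S S'. planar_isotopic m S S' \<or> move_a m S S')\<^sup>*\<^sup>* T T0)"

end

theory Submission
  imports Defs
begin

text \<open>
  Necessity. The complement of the diagram is colored with signs like a checkerboard, the sign of \<open>z\<close> being the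
  product over all strings \<open>\<gamma>\<close> of the monodromies of the square root of \<open>\<gamma> - z\<close>, where \<open>\<gamma>\<close> is closed up by rays to
  infinity. Multiply the color of a point of a string by the sign of the region to its left. Along a string the
  sign changes at each crossing, with opposite changes on the two strings, so that by the coloring relation the
  jumps of the signed color at the two parameters of a crossing cancel. Since the sign to the left of the inward
  direction at the \<open>k\<close>-th endpoint is \<open>(-1)\<^sup>k\<close>, the sum of all jumps is up to sign the alternating sum of the boundary colors.

  Sufficiency. Start with cups joining the neighboring endpoints \<open>2k\<close> and \<open>2k + 1\<close> and add crossings next to the
  boundary, which the moves (a) remove again. A crossing replaces neighboring boundary colors \<open>a, b\<close> by \<open>2a - b, a\<close> or by
  \<open>b, 2b - a\<close>. By Euclid's algorithm on the differences of three consecutive colors, these operations lead from every integer vector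
  of alternating sum 0 to one with two equal neighbors, which are split off as a cup. Over a residue ring, first lift the colors to
  integers of alternating sum 0.
\<close>

section \<open>Square roots along a path\<close>

text \<open>The strings are merely continuously differentiable, may cross themselves and may even be
  tangent to the circle at their ends. Square roots reduce the parity of a winding number to the
  continuity of branches; derivatives serve only locally, to tell on which side of a string a nearby
  point lies. The rays make all signs explicit outside the disk, and the signs inside are carried
  over from there along connected sets that avoid the diagram. Tangential endpoints make this
  passage at the circle the most delicate one. In the construction the obstacle is to keep every
  condition on a diagram checkable through arbitrarily many added crossings. Therefore all strings
  share one radial profile, so that meetings are decided by angles alone, and each diagram keeps a
  collar of depth \<open>\<epsilon>\<close> at the circle in which its strings run radially at
  equally spaced angles. A new crossing is made inside the collar and leaves a collar of a third of
  the depth. The triangle and the disk of a move are then described by explicit sectors.\<close>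

lemma C1_strong_derivative:
  fixes f :: "real \<Rightarrow> 'a::real_normed_vector"
  assumes f: "f C1_differentiable_on {a..b}" and t0: "t0 \<in> {a..b}" and \<kappa>: "0 < \<kappa>"
  obtains \<delta> where "0 < \<delta>"
    "\<And>s t. \<lbrakk>s \<in> {a..b}; t \<in> {a..b}; \<bar>s - t0\<bar> < \<delta>; \<bar>t - t0\<bar> < \<delta>\<rbrakk> \<Longrightarrow>
       norm (f s - f t - (s - t) *\<^sub>R vector_derivative f (at t0)) \<le> \<kappa> * \<bar>s - t\<bar>"
proof -
  let ?D = "\<lambda>t. vector_derivative f (at t)"
  from f have diff: "\<And>x. x \<in> {a..b} \<Longrightarrow> f differentiable at x" and cont: "continuous_on {a..b} ?D"
    by (auto simp: C1_differentiable_on_eq)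
  have "\<exists>\<delta>>0. \<forall>x\<in>{a..b}. dist x t0 < \<delta> \<longrightarrow> dist (?D x) (?D t0) < \<kappa>"
    using cont t0 \<kappa> unfolding continuous_on_iff by blast
  then obtain \<delta> where \<delta>: "0 < \<delta>"
    "\<And>x. x \<in> {a..b} \<Longrightarrow> dist x t0 < \<delta> \<Longrightarrow> dist (?D x) (?D t0) < \<kappa>"
    by blast
  show ?thesis
  proof (rule that[OF \<delta>(1)])
    fix s t assume st: "s \<in> {a..b}" "t \<in> {a..b}" "\<bar>s - t0\<bar> < \<delta>" "\<bar>t - t0\<bar> < \<delta>"
    let ?S = "{a..b} \<inter> ball t0 \<delta>"
    \<comment> \<open>Mean value inequality for \<open>f\<close> minus its linear part at
      \<open>t0\<close>: the remainder has derivative \<open>?D x - ?D t0\<close>, which is small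
      near \<open>t0\<close>. As both arguments may vary, the estimate also gives local
      injectivity.\<close>
    let ?g = "\<lambda>x. f x - x *\<^sub>R ?D t0"
    have "norm (?g s - ?g t) \<le> \<kappa> * norm (s - t)"
    proof (rule differentiable_bound[where S = ?S and f' = "\<lambda>x h. h *\<^sub>R (?D x - ?D t0)"])
      show "convex ?S" by (intro convex_Int) auto
      fix x assume x: "x \<in> ?S"
      then have "(f has_vector_derivative ?D x) (at x)"
        using diff vector_derivative_works by blast
      then have "(f has_derivative (\<lambda>h. h *\<^sub>R ?D x)) (at x within ?S)"
        unfolding has_vector_derivative_def by (rule has_derivative_at_withinI)
      then show "(?g has_derivative (\<lambda>h. h *\<^sub>R (?D x - ?D t0))) (at x within ?S)"
        by (auto intro!: derivative_eq_intros simp: algebra_simps)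
      have "norm (?D x - ?D t0) < \<kappa>"
        using x \<delta>(2)[of x] by (auto simp: dist_commute dist_norm norm_minus_commute)
      then show "onorm (\<lambda>h. h *\<^sub>R (?D x - ?D t0)) \<le> \<kappa>"
        using \<kappa> by (intro onorm_bound) (simp_all add: mult.commute[of \<kappa>] mult_left_mono)
    qed (use st in \<open>auto simp: dist_real_def dist_commute\<close>)
    then show "norm (f s - f t - (s - t) *\<^sub>R ?D t0) \<le> \<kappa> * \<bar>s - t\<bar>"
      by (simp add: algebra_simps)
  qed
qed

text \<open>Cramer's rule with determinant \<open>Im (cnj a * b)\<close>: pairing with one vector
  isolates the coefficient of the other. It turns transversality into a lower bound against which
  the errors of linear approximations are weighed.\<close>

lemma linear_independent_bound:
  fixes a b :: complex
  assumes "Im (cnj a * b) \<noteq> 0"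
  obtains c where "0 < c" "\<And>x y. c * (\<bar>x\<bar> + \<bar>y\<bar>) \<le> norm (x *\<^sub>R a + y *\<^sub>R b)"
proof -
  let ?D = "Im (cnj a * b)"
  have ab: "a \<noteq> 0" "b \<noteq> 0" using assms by auto
  have 1: "\<bar>x\<bar> * \<bar>?D\<bar> \<le> norm b * norm (x *\<^sub>R a + y *\<^sub>R b)" for x y
  proof -
    have "x * ?D = - Im (cnj b * (x *\<^sub>R a + y *\<^sub>R b))" by (simp add: algebra_simps)
    then have "\<bar>x\<bar> * \<bar>?D\<bar> = \<bar>Im (cnj b * (x *\<^sub>R a + y *\<^sub>R b))\<bar>" by (metis abs_minus abs_mult)
    also have "\<dots> \<le> norm (cnj b * (x *\<^sub>R a + y *\<^sub>R b))" by (rule abs_Im_le_cmod)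
    finally show ?thesis by (simp add: norm_mult)
  qed
  have 2: "\<bar>y\<bar> * \<bar>?D\<bar> \<le> norm a * norm (x *\<^sub>R a + y *\<^sub>R b)" for x y
  proof -
    have "y * ?D = Im (cnj a * (x *\<^sub>R a + y *\<^sub>R b))" by (simp add: algebra_simps)
    then have "\<bar>y\<bar> * \<bar>?D\<bar> = \<bar>Im (cnj a * (x *\<^sub>R a + y *\<^sub>R b))\<bar>" by (metis abs_mult)
    also have "\<dots> \<le> norm (cnj a * (x *\<^sub>R a + y *\<^sub>R b))" by (rule abs_Im_le_cmod)
    finally show ?thesis by (simp add: norm_mult)
  qed
  show ?thesis
  proof
    show "0 < \<bar>?D\<bar> / (norm a + norm b)" using assms ab by (intro divide_pos_pos) (auto intro: add_pos_pos)
    show "\<bar>?D\<bar> / (norm a + norm b) * (\<bar>x\<bar> + \<bar>y\<bar>) \<le> norm (x *\<^sub>R a + y *\<^sub>R b)" for x y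
    proof -
      have pos: "0 < norm a + norm b" using ab by (auto intro: add_pos_pos)
      have "\<bar>?D\<bar> * (\<bar>x\<bar> + \<bar>y\<bar>) \<le> norm (x *\<^sub>R a + y *\<^sub>R b) * (norm a + norm b)"
        using 1[of x y] 2[of y x] by (simp add: algebra_simps)
      then show ?thesis using pos by (simp add: field_simps)
    qed
  qed
qed

lemma collinear_0_iff_Im:
  fixes a b :: complex
  shows "collinear {0, a, b} \<longleftrightarrow> Im (cnj a * b) = 0"
proof (cases "a = 0")
  case True then show ?thesis by (simp)
next
  case False
  have "Im (cnj a * b) = 0 \<longleftrightarrow> (\<exists>c. b = c *\<^sub>R a)"
  proof
    assume "Im (cnj a * b) = 0"
    then have "cnj a * b = of_real (Re (cnj a * b))" by (simp add: complex_eq_iff)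
    then have "a * cnj a * b = of_real (Re (cnj a * b)) * a" by (metis mult.assoc mult.commute)
    then have "of_real ((norm a)\<^sup>2) * b = of_real (Re (cnj a * b)) * a"
      by (simp only: complex_norm_square)
    then have "b = of_real (Re (cnj a * b) / (norm a)\<^sup>2) * a"
      using False by (simp add: field_simps)
    then show "\<exists>c. b = c *\<^sub>R a" by (metis scaleR_conv_of_real)
  qed (auto simp: algebra_simps)
  then show ?thesis using False by (auto simp: collinear_lemma)
qed

text \<open>Below, \<open>side \<gamma> \<alpha> \<beta>\<close> is the sign which tells, modulo 2, how often the closed curve passes around
  \<open>z\<close> that consists of \<open>\<gamma>\<close>, from \<open>cis \<alpha>\<close> to \<open>cis \<beta>\<close>, and the two radial rays from these points to
  infinity. It is the monodromy of the square root of \<open>\<gamma> - z\<close>; the function \<open>ray_root\<close> gives the branch of the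
  square root of \<open>cis \<alpha> - z\<close> that is cut along the ray.\<close>

definition ray_root :: "real \<Rightarrow> complex \<Rightarrow> complex" where
  "ray_root \<alpha> z = cis (\<alpha> / 2) * csqrt (1 - z * cis (- \<alpha>))"

definition root_path :: "(real \<Rightarrow> complex) \<Rightarrow> complex \<Rightarrow> (real \<Rightarrow> complex) \<Rightarrow> bool" where
  "root_path \<gamma> z g \<longleftrightarrow> continuous_on {0..1} g \<and> (\<forall>t\<in>{0..1}. (g t)\<^sup>2 = \<gamma> t - z)"

definition side :: "(real \<Rightarrow> complex) \<Rightarrow> real \<Rightarrow> real \<Rightarrow> complex \<Rightarrow> complex" where
  "side \<gamma> \<alpha> \<beta> z = (let g = (SOME g. root_path \<gamma> z g) in
     (g 1 * ray_root \<alpha> z) / (g 0 * ray_root \<beta> z))"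

definition ray :: "real \<Rightarrow> complex set" where
  "ray \<alpha> = {of_real r * cis \<alpha> | r. 1 \<le> r}"

lemma ray_root_squared: "(ray_root \<alpha> z)\<^sup>2 = cis \<alpha> - z"
proof -
  have "(cis (\<alpha> / 2))\<^sup>2 = cis \<alpha>" by (simp add: power2_eq_square cis_mult)
  then show ?thesis
    by (simp add: ray_root_def power_mult_distrib right_diff_distrib cis_mult mult.left_commute)
qed

lemma nonpos_Reals_ray:
  assumes "z \<notin> ray \<alpha>" shows "1 - z * cis (- \<alpha>) \<notin> \<real>\<^sub>\<le>\<^sub>0"
proof
  assume "1 - z * cis (- \<alpha>) \<in> \<real>\<^sub>\<le>\<^sub>0"
  then obtain r where "1 - z * cis (- \<alpha>) = of_real r" "r \<le> 0" by (auto elim!: nonpos_Reals_cases)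
  then have "z * cis (- \<alpha>) = of_real (1 - r)" by (simp add: algebra_simps)
  then have "z * cis (- \<alpha>) * cis \<alpha> = of_real (1 - r) * cis \<alpha>" by simp
  then have "z = of_real (1 - r) * cis \<alpha>" by (simp add: mult.assoc cis_mult)
  with \<open>r \<le> 0\<close> assms show False unfolding ray_def by (smt (verit) mem_Collect_eq)
qed

lemma closed_ray: "closed (ray \<alpha>)"
proof -
  have "z \<in> ray \<alpha> \<longleftrightarrow> 1 \<le> Re (z * cis (- \<alpha>)) \<and> Im (z * cis (- \<alpha>)) = 0" for z
  proof
    assume "z \<in> ray \<alpha>"
    then obtain r where r: "z = of_real r * cis \<alpha>" "1 \<le> r" unfolding ray_def by blast
    then have eq: "z * cis (- \<alpha>) = of_real r" by (simp add: mult.assoc cis_mult)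
    show "1 \<le> Re (z * cis (- \<alpha>)) \<and> Im (z * cis (- \<alpha>)) = 0" unfolding eq using r by simp
  next
    assume a: "1 \<le> Re (z * cis (- \<alpha>)) \<and> Im (z * cis (- \<alpha>)) = 0"
    then have "z * cis (- \<alpha>) = of_real (Re (z * cis (- \<alpha>)))" by (simp add: complex_eq_iff)
    then have "z * cis (- \<alpha>) * cis \<alpha> = of_real (Re (z * cis (- \<alpha>))) * cis \<alpha>" by metis
    then have "z = of_real (Re (z * cis (- \<alpha>))) * cis \<alpha>" by (simp only: mult.assoc cis_mult) simp
    then show "z \<in> ray \<alpha>" using a unfolding ray_def by blast
  qed
  then have "ray \<alpha> = {z. 1 \<le> Re (z * cis (- \<alpha>)) \<and> Im (z * cis (- \<alpha>)) = 0}" by blast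
  moreover have "closed \<dots>"
    by (intro closed_Collect_conj closed_Collect_le closed_Collect_eq continuous_intros)
  ultimately show ?thesis by simp
qed

lemma ray_nonzero: "z \<notin> ray \<alpha> \<Longrightarrow> ray_root \<alpha> z \<noteq> 0"
  using nonpos_Reals_ray by (fastforce simp: ray_root_def)

lemma ray_root_continuous: "z \<notin> ray \<alpha> \<Longrightarrow> isCont (ray_root \<alpha>) z"
  unfolding ray_root_def by (intro continuous_intros isCont_csqrt' nonpos_Reals_ray) auto

lemma root_path_exists:
  assumes "continuous_on {0..1} \<gamma>" "z \<notin> \<gamma> ` {0..1}"
  shows "\<exists>g. root_path \<gamma> z g"
proof -
  have "contractible {0..1::real}" by (simp add: convex_imp_contractible)
  moreover have "continuous_on {0..1} (\<lambda>t. \<gamma> t - z)"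
    using assms(1) by (intro continuous_intros)
  moreover have "\<gamma> t - z \<noteq> 0" if "t \<in> {0..1}" for t using assms(2) that by auto
  ultimately obtain g where "continuous_on {0..1} g" "\<And>t. t \<in> {0..1} \<Longrightarrow> \<gamma> t - z = (g t)\<^sup>2"
    using continuous_sqrt_on_contractible[of "{0..1}" "\<lambda>t. \<gamma> t - z"] by metis
  then have "root_path \<gamma> z g" by (simp add: root_path_def)
  then show ?thesis by blast
qed

text \<open>The quotient of two branches is continuous with values in \<open>{1, -1}\<close>, hence
  constant. So the choice made by \<open>SOME\<close> in \<open>side\<close> does not affect its
  value.\<close>

lemma root_path_ratio:
  assumes "root_path \<gamma> z g" "root_path \<gamma> z h" "z \<notin> \<gamma> ` {0..1}"
  shows "g 1 / g 0 = h 1 / h 0"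
proof -
  have nz: "g t \<noteq> 0" "h t \<noteq> 0" if "t \<in> {0..1}" for t
    using assms that unfolding root_path_def
    by (metis cancel_comm_monoid_add_class.diff_cancel image_eqI power_zero_numeral right_minus_eq zero_power2)+
  have "continuous_on {0..1} (\<lambda>t. g t / h t)"
    using assms nz by (auto simp: root_path_def intro!: continuous_intros)
  moreover have "(\<lambda>t. g t / h t) ` {0..1} \<subseteq> {1, -1}"
  proof (rule image_subsetI)
    fix t :: real assume t: "t \<in> {0..1}"
    have "(g t)\<^sup>2 = (h t)\<^sup>2" using assms t by (auto simp: root_path_def)
    then show "g t / h t \<in> {1, -1}" using nz[OF t] by (auto simp: power2_eq_iff)
  qed
  then have "finite ((\<lambda>t. g t / h t) ` {0..1})" by (rule finite_subset) auto
  ultimately have "(\<lambda>t. g t / h t) constant_on {0..1}"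
    by (intro continuous_finite_range_constant) auto
  then have "g 1 / h 1 = g 0 / h 0" unfolding constant_on_def by (metis atLeastAtMost_iff order_refl zero_le_one)
  then show ?thesis using nz[of 0] nz[of 1] by (simp add: field_simps)
qed

lemma side_eq:
  assumes "root_path \<gamma> z g" "z \<notin> \<gamma> ` {0..1}"
  shows "side \<gamma> \<alpha> \<beta> z = (g 1 * ray_root \<alpha> z) / (g 0 * ray_root \<beta> z)"
proof -
  have "root_path \<gamma> z (SOME g. root_path \<gamma> z g)" using assms(1) by (rule someI[where P = "root_path \<gamma> z"])
  from root_path_ratio[OF this assms] show ?thesis
    unfolding side_def Let_def by (metis times_divide_times_eq)
qed

text \<open>Numerator and denominator have the same square
  \<open>(cis \<alpha> - z) * (cis \<beta> - z)\<close>.\<close>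

lemma side_values:
  assumes "continuous_on {0..1} \<gamma>" "z \<notin> \<gamma> ` {0..1}" "\<gamma> 0 = cis \<alpha>" "\<gamma> 1 = cis \<beta>"
  shows "side \<gamma> \<alpha> \<beta> z \<in> {1, -1}"
proof -
  obtain g where g: "root_path \<gamma> z g" using root_path_exists assms by blast
  have "(g 0)\<^sup>2 = cis \<alpha> - z" "(g 1)\<^sup>2 = cis \<beta> - z" using g assms by (auto simp: root_path_def)
  moreover have "cis \<alpha> - z \<noteq> 0" "cis \<beta> - z \<noteq> 0" using assms by force+
  ultimately have "(side \<gamma> \<alpha> \<beta> z)\<^sup>2 = 1"
    by (simp add: side_eq[OF g assms(2)] power_divide power_mult_distrib ray_root_squared)
  then show ?thesis by (simp add: power2_eq_1_iff)
qed

text \<open>A branch at \<open>z0\<close> is corrected to one at a nearby \<open>z\<close> by the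
  principal root of \<open>(\<gamma> t - z) / (\<gamma> t - z0)\<close>, which is within distance 1
  of 1 and thus off the cut. Hence \<open>side\<close> is locally an explicit continuous
  expression.\<close>

lemma side_continuous:
  assumes \<gamma>: "continuous_on {0..1} \<gamma>" and z: "z0 \<notin> \<gamma> ` {0..1}" "z0 \<notin> ray \<alpha>" "z0 \<notin> ray \<beta>"
  shows "isCont (side \<gamma> \<alpha> \<beta>) z0"
proof -
  obtain g where g: "root_path \<gamma> z0 g" using root_path_exists \<gamma> z by blast
  have "closed (\<gamma> ` {0..1})" using \<gamma> by (intro compact_imp_closed compact_continuous_image) auto
  then obtain r where r: "0 < r" "\<And>x. x \<in> \<gamma> ` {0..1} \<Longrightarrow> r \<le> dist z0 x"
    using separate_point_closed[OF _ z(1)] by blast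
  have g0: "g t \<noteq> 0" if "t \<in> {0..1}" for t
    using g z that unfolding root_path_def
    by (metis cancel_comm_monoid_add_class.diff_cancel image_eqI right_minus_eq zero_power2)
  define q where "q z t = 1 + (z0 - z) / (\<gamma> t - z0)" for z t
  have q: "q z t \<notin> \<real>\<^sub>\<le>\<^sub>0" if "z \<in> ball z0 r" "t \<in> {0..1}" for z t
  proof -
    have "norm ((z0 - z) / (\<gamma> t - z0)) < 1"
    proof -
      have "r \<le> norm (\<gamma> t - z0)" using r(2)[of "\<gamma> t"] that by (simp add: dist_norm norm_minus_commute)
      moreover have "norm (z0 - z) < r" using that by (simp add: dist_norm)
      ultimately show ?thesis using r(1) by (simp add: norm_divide divide_simps)
    qed
    then have "\<bar>Re ((z0 - z) / (\<gamma> t - z0))\<bar> < 1" using abs_Re_le_cmod le_less_trans by blast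
    then have "Re (q z t) > 0" by (simp add: q_def)
    then show ?thesis by (simp add: complex_nonpos_Reals_iff)
  qed
  have eq: "side \<gamma> \<alpha> \<beta> z =
      (g 1 * csqrt (q z 1) * ray_root \<alpha> z) / (g 0 * csqrt (q z 0) * ray_root \<beta> z)"
    if z': "z \<in> ball z0 r" for z
  proof -
    have zn: "z \<notin> \<gamma> ` {0..1}" using r(2)[of z] z' by auto
    have "root_path \<gamma> z (\<lambda>t. g t * csqrt (q z t))"
      unfolding root_path_def
    proof safe
      have "continuous_on {0..1} (\<lambda>t. csqrt (q z t))"
      proof (rule continuous_on_compose2[OF continuous_on_csqrt])
        show "continuous_on {0..1} (q z)" unfolding q_def using \<gamma> z(1)
          by (intro continuous_intros) auto
      qed (use q z' in auto)
      then show "continuous_on {0..1} (\<lambda>t. g t * csqrt (q z t))"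
        using g by (auto simp: root_path_def intro: continuous_intros)
      fix t :: real assume t: "t \<in> {0..1}"
      then have "\<gamma> t - z0 \<noteq> 0" using z(1) by auto
      then show "(g t * csqrt (q z t))\<^sup>2 = \<gamma> t - z"
        using bspec[OF conjunct2[OF g[unfolded root_path_def]] t]
        by (simp add: power_mult_distrib q_def distrib_left)
    qed
    from side_eq[OF this zn] show ?thesis .
  qed
  have qz: "q z0 t = 1" for t by (simp add: q_def)
  have "isCont (\<lambda>z. (g 1 * csqrt (q z 1) * ray_root \<alpha> z) / (g 0 * csqrt (q z 0) * ray_root \<beta> z)) z0"
    using z g0[of 0] ray_nonzero[OF z(3)] ray_root_continuous
    by (intro continuous_intros isCont_csqrt')
       (auto simp: qz q_def[abs_def] intro!: continuous_intros)
  then show ?thesis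
  proof (rule isCont_cong[THEN iffD2, rotated])
    show "\<forall>\<^sub>F z in nhds z0. side \<gamma> \<alpha> \<beta> z =
      (g 1 * csqrt (q z 1) * ray_root \<alpha> z) / (g 0 * csqrt (q z 0) * ray_root \<beta> z)"
    using eq r(1) by (auto simp: eventually_nhds intro!: exI[of _ "ball z0 r"])
  qed
qed

section \<open>The side of a point outside the disk\<close>

lemma Im_complex_of_real_mult: "Im (of_real a * z) = a * Im z" by simp

text \<open>Both sides have the square \<open>w - 1\<close>; only the sign is at stake. Here
  \<open>w\<close> is a point outside the disk in coordinates where an endpoint is 1, and
  \<open>u\<close> is the difference of the lifted angles. The root
  \<open>sqrt r * cis (u / 2)\<close> of \<open>w\<close> depends on that lift and not only on
  \<open>w\<close>, whence the factor \<open>sgn u\<close>.\<close>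

lemma ray_root_exterior:
  fixes u r :: real
  assumes r: "1 < r" and u: "\<bar>u\<bar> < 2 * pi" "u \<noteq> 0"
  defines "w \<equiv> of_real r * cis u"
  shows "csqrt (1 - 1 / w) * of_real (sqrt r) * cis (u / 2) = of_real (sgn u) * \<i> * csqrt (1 - w)"
proof -
  define s where "s = sgn u"
  have s: "s = 1 \<or> s = -1" "s * u > 0" using u(2) by (auto simp: s_def sgn_if)
  have w0: "w \<noteq> 0" and nw: "norm w = r" using r by (auto simp: w_def norm_mult)
  have w1: "w \<noteq> 1" using nw r by auto
  define X where "X = csqrt (1 - w) / (of_real (sqrt r) * cis (u / 2))"
  have W2: "(of_real (sqrt r) * cis (u / 2))\<^sup>2 = w"
  proof -
    have "(cis (u / 2))\<^sup>2 = cis u" by (simp add: power2_eq_square cis_mult)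
    moreover have "(of_real (sqrt r))\<^sup>2 = (of_real r :: complex)" using r by (simp flip: of_real_power)
    ultimately show ?thesis by (simp add: w_def power_mult_distrib)
  qed
  have X2: "X\<^sup>2 = (1 - w) / w" by (simp add: X_def power_divide W2)
  define y where "y = csqrt (1 - w)"
  have y2: "y\<^sup>2 = 1 - w" by (simp add: y_def)

  have sn: "s * sin (u / 2) > 0"
    using s u sin_gt_zero[of "s * u / 2"] by (auto simp: sin_minus)
  have Rey: "0 \<le> Re y" unfolding y_def using csqrt_principal[of "1 - w"] by auto
  have "Im (y\<^sup>2) = - r * sin u" using y2 by (simp add: w_def)
  then have "2 * Re y * Im y = - r * sin u" by (simp only: Im_power2)
  moreover have "sin u = 2 * sin (u / 2) * cos (u / 2)" using sin_double[of "u / 2"] by simp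
  ultimately have "2 * Re y * Im y = - r * (2 * sin (u / 2) * cos (u / 2))" by metis
  moreover have "a * b = - r * (c * d)" if "2 * a * b = - r * (2 * c * d)" for a b c d
    using that by (simp add: algebra_simps)
  ultimately have Imy: "Re y * Im y = - r * (sin (u / 2) * cos (u / 2))" by blast
  \<comment> \<open>This places \<open>of_real s * \<i> * X\<close> in the right half-plane, so that
    it is the principal root of its square. After multiplication by \<open>Re y\<close> the term
    with \<open>Im y\<close> gets its sign from \<open>Imy\<close>.\<close>
  have "s * Im (y * cis (- u / 2)) < 0"
  proof (cases "Re y = 0")
    case True
    then have "cos (u / 2) = 0" using Imy sn r by auto
    then have "(sin (u/2))\<^sup>2 = 1" using sin_cos_squared_add[of "u/2"] by simp
    moreover have "cos u = 2 * (cos (u/2))\<^sup>2 - 1" using cos_double_cos[of "u/2"] by simp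
    moreover have "sin u = 2 * sin (u / 2) * cos (u / 2)" using sin_double[of "u / 2"] by simp
    ultimately have "w = - of_real r" using \<open>cos (u / 2) = 0\<close> by (simp add: w_def complex_eq_iff)
    then have "1 - w = of_real (1 + r)" by simp
    moreover have "csqrt (of_real (1 + r)) = of_real (sqrt (1 + r))"
      using r by (subst csqrt_of_real_nonneg) auto
    ultimately have "y = of_real (sqrt (1 + r))" unfolding y_def by metis
    then have "Re y > 0" using r by simp
    with True show ?thesis by simp
  next
    case False
    with Rey have pos: "Re y > 0" by simp
    have "Re y * (s * (Im y * cos (u / 2))) = - r * (s * sin (u / 2)) * (cos (u / 2))\<^sup>2"
      using arg_cong[OF Imy, of "\<lambda>a. s * cos (u / 2) * a"] by (simp only: power2_eq_square mult_ac minus_mult_left[symmetric] minus_mult_right[symmetric])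
    also have "\<dots> \<le> 0" using sn r by (simp add: mult_nonneg_nonneg)
    finally have "s * (Im y * cos (u / 2)) \<le> 0" using pos by (simp add: mult_le_0_iff)
    moreover have "s * (Re y * sin (u / 2)) > 0"
      using mult_pos_pos[OF pos sn] by (simp add: algebra_simps)
    ultimately show ?thesis by (simp add: algebra_simps)
  qed
  moreover have "X = of_real (1 / sqrt r) * (y * cis (- u / 2))"
  proof -
    have "inverse (cis (u / 2)) = cis (- u / 2)" by simp
    moreover have "y / (of_real (sqrt r) * cis (u / 2)) = of_real (1 / sqrt r) * (y * inverse (cis (u / 2)))"
      by (simp only: divide_inverse inverse_mult_distrib of_real_mult of_real_inverse of_real_1 mult_1_left mult_ac)
    ultimately show ?thesis by (simp only: X_def y_def)
  qed
  then have "Im X = 1 / sqrt r * Im (y * cis (- u / 2))" by (metis Im_complex_of_real_mult)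
  then have "s * Im X = 1 / sqrt r * (s * Im (y * cis (- u / 2)))" by (simp only: mult.left_commute)
  ultimately have ImX: "s * Im X < 0" using r
    by (metis less_trans mult_pos_neg real_sqrt_gt_0_iff zero_less_divide_1_iff zero_less_one)
  have "csqrt ((of_real s * \<i> * X)\<^sup>2) = of_real s * \<i> * X"
    using ImX s by (intro csqrt_square) auto
  moreover have "(of_real s * \<i> * X)\<^sup>2 = 1 - 1 / w"
    using s w0 by (auto simp: power_mult_distrib X2 field_simps)
  ultimately have "csqrt (1 - 1 / w) = of_real s * \<i> * X" by simp
  then show ?thesis unfolding s_def[symmetric] using r by (simp add: X_def)
qed

text \<open>For \<open>z\<close> outside the disk \<open>1 - \<gamma> t / z\<close> has positive
  real part, so \<open>csqrt (- z) * csqrt (1 - \<gamma> t / z)\<close> is a branch along the whole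
  string. The monodromy then depends on the two ends only, and each contributes the sign by which
  this branch differs, up to a common factor, from its ray branch.\<close>

lemma side_exterior:
  assumes \<gamma>: "continuous_on {0..1} \<gamma>" and cb: "\<gamma> ` {0..1} \<subseteq> cball 0 1"
    and ends: "\<gamma> 0 = cis \<alpha>" "\<gamma> 1 = cis \<beta>"
    and r: "1 < r" and \<psi>: "\<bar>\<psi> - \<alpha>\<bar> < 2 * pi" "\<bar>\<psi> - \<beta>\<bar> < 2 * pi" "\<psi> \<noteq> \<alpha>" "\<psi> \<noteq> \<beta>"
  shows "side \<gamma> \<alpha> \<beta> (of_real r * cis \<psi>) = of_real (sgn (\<psi> - \<alpha>) * sgn (\<psi> - \<beta>))"
proof -
  define z where "z = of_real r * cis \<psi>"
  have nz: "norm z = r" using r by (simp add: z_def norm_mult)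
  then have z0: "z \<noteq> 0" using r by auto
  have zn: "z \<notin> \<gamma> ` {0..1}" using cb nz r by (auto simp: subset_iff)
  have q: "1 - \<gamma> t / z \<notin> \<real>\<^sub>\<le>\<^sub>0" if "t \<in> {0..1}" for t
  proof -
    have "norm (\<gamma> t) \<le> 1" using that cb by (metis image_eqI mem_cball_0 subsetD)
    then have "norm (\<gamma> t / z) < 1" using nz r by (auto simp: norm_divide divide_simps)
    then have "Re (\<gamma> t / z) < 1" using complex_Re_le_cmod le_less_trans by blast
    then show ?thesis by (simp add: complex_nonpos_Reals_iff)
  qed
  define c where "c = csqrt (- z)"
  have c2: "c\<^sup>2 = - z" by (simp add: c_def)
  have c0: "c \<noteq> 0" using z0 by (simp add: c_def)
  have g: "root_path \<gamma> z (\<lambda>t. c * csqrt (1 - \<gamma> t / z))"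
    unfolding root_path_def
  proof (intro conjI ballI)
    have "continuous_on {0..1} (\<lambda>t. csqrt (1 - \<gamma> t / z))"
    proof (rule continuous_on_compose2[OF continuous_on_csqrt])
      show "continuous_on {0..1} (\<lambda>t. 1 - \<gamma> t / z)" using \<gamma> z0 by (intro continuous_intros) auto
    qed (use q in auto)
    then show "continuous_on {0..1} (\<lambda>t. c * csqrt (1 - \<gamma> t / z))" by (intro continuous_intros)
    show "(c * csqrt (1 - \<gamma> t / z))\<^sup>2 = \<gamma> t - z" for t
      using z0 by (simp add: power_mult_distrib c2 field_simps)
  qed
  have *: "csqrt (1 - cis \<theta> / z) = of_real (sgn (\<psi> - \<theta>)) * (\<i> * ray_root \<theta> z / (of_real (sqrt r) * cis (\<psi> / 2)))"
    if "\<bar>\<psi> - \<theta>\<bar> < 2 * pi" "\<psi> \<noteq> \<theta>" for \<theta>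
  proof -
    have w: "of_real r * cis (\<psi> - \<theta>) = z * cis (- \<theta>)" by (simp add: z_def cis_mult mult.assoc)
    have "csqrt (1 - 1 / (z * cis (- \<theta>))) * of_real (sqrt r) * cis ((\<psi> - \<theta>) / 2) =
        of_real (sgn (\<psi> - \<theta>)) * \<i> * csqrt (1 - z * cis (- \<theta>))"
      using ray_root_exterior[OF r that(1)] that(2) by (simp add: w)
    moreover have "1 / (z * cis (- \<theta>)) = cis \<theta> / z"
      by (simp add: divide_inverse cis_inverse inverse_mult_distrib)
    moreover have "cis ((\<psi> - \<theta>) / 2) * cis (\<theta> / 2) = cis (\<psi> / 2)"
      by (simp add: cis_mult flip: add_divide_distrib)
    ultimately have "csqrt (1 - cis \<theta> / z) * (of_real (sqrt r) * cis (\<psi> / 2)) =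
        of_real (sgn (\<psi> - \<theta>)) * \<i> * ray_root \<theta> z"
      unfolding ray_root_def by (metis mult.assoc mult.commute)
    then show ?thesis using r by (simp add: field_simps)
  qed
  have na: "ray_root \<alpha> z \<noteq> 0" "ray_root \<beta> z \<noteq> 0"
  proof -
    have "cis \<alpha> - z \<noteq> 0" "cis \<beta> - z \<noteq> 0" using zn ends by force+
    then show "ray_root \<alpha> z \<noteq> 0" "ray_root \<beta> z \<noteq> 0"
      by (metis ray_root_squared zero_power2)+
  qed
  have sg: "sgn (\<psi> - \<alpha>) \<noteq> 0" "sgn (\<psi> - \<alpha>) = 1 / sgn (\<psi> - \<alpha>)" using \<psi> by (auto simp: sgn_if)
  have "side \<gamma> \<alpha> \<beta> z = (c * csqrt (1 - cis \<beta> / z) * ray_root \<alpha> z) / (c * csqrt (1 - cis \<alpha> / z) * ray_root \<beta> z)"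
    using side_eq[OF g zn] ends by simp
  also have "\<dots> = of_real (sgn (\<psi> - \<beta>)) / of_real (sgn (\<psi> - \<alpha>))"
    using c0 na r sg(1) unfolding *[OF \<psi>(1,3)] *[OF \<psi>(2,4)] by simp
  also have "\<dots> = of_real (sgn (\<psi> - \<alpha>) * sgn (\<psi> - \<beta>))"
    using \<psi> by (auto simp: sgn_if)
  finally show ?thesis by (simp add: z_def)
qed

section \<open>The change of side across a curve\<close>

lemma csqrt_near_neg_real_axis:
  fixes t0 :: real
  assumes q: "continuous (at t0 within S) q" "q t0 = -1"
    and pos: "\<And>t. t \<in> S - {t0} \<Longrightarrow> 0 < Im (q t)"
  shows "((\<lambda>t. csqrt (q t)) \<longlongrightarrow> \<i>) (at t0 within S)"
proof -
  \<comment> \<open>In the upper half-plane the principal roots of \<open>q t\<close> and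
    \<open>- q t\<close> differ by the factor \<i>, and the latter is continuous at
    \<open>t0\<close>, where \<open>- q t0 = 1\<close>.\<close>
  have eq: "csqrt (q t) = \<i> * csqrt (- q t)" if "t \<in> S - {t0}" for t
  proof -
    have "csqrt ((\<i> * csqrt (- q t))\<^sup>2) = \<i> * csqrt (- q t)"
    proof (rule csqrt_square)
      have "2 * Re (csqrt (- q t)) * Im (csqrt (- q t)) = Im (- q t)"
        by (metis Im_power2 power2_csqrt)
      then have "Re (csqrt (- q t)) * Im (csqrt (- q t)) < 0" using pos[OF that] by simp
      moreover have "0 \<le> Re (csqrt (- q t))" using csqrt_principal[of "- q t"] by auto
      ultimately have "Im (csqrt (- q t)) < 0" by (simp add: mult_less_0_iff)
      then show "0 < Re (\<i> * csqrt (- q t)) \<or> Re (\<i> * csqrt (- q t)) = 0 \<and> 0 \<le> Im (\<i> * csqrt (- q t))"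
        by simp
    qed
    then show ?thesis by (simp add: power_mult_distrib)
  qed
  have "continuous (at t0 within S) (\<lambda>t. \<i> * csqrt (- q t))"
  proof (intro continuous_intros)
    have "continuous (at (- q t0)) csqrt" using q(2) by (intro continuous_at_csqrt) auto
    then show "continuous (at t0 within S) (\<lambda>t. csqrt (- q t))"
      using continuous_within_compose3[of "\<lambda>t. - q t" t0 csqrt S] q(1) by (auto intro: continuous_intros)
  qed
  then have "((\<lambda>t. \<i> * csqrt (- q t)) \<longlongrightarrow> \<i>) (at t0 within S)"
    using q(2) by (simp add: continuous_within)
  then show ?thesis
    by (rule Lim_transform_within[where d = 1]) (auto simp: eq)
qed

lemma continuous_csqrt_to_neg_real_axis:
  fixes q :: "real \<Rightarrow> complex"
  assumes q: "continuous_on S q" "q t0 = -1" and t0: "t0 \<in> S" and \<delta>: "0 < \<delta>"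
    and pos: "\<And>t. t \<in> S - {t0} \<Longrightarrow> \<bar>t - t0\<bar> < \<delta> \<Longrightarrow> 0 < Im (q t)"
    and nn: "\<And>t. t \<in> S - {t0} \<Longrightarrow> q t \<notin> \<real>\<^sub>\<le>\<^sub>0"
  shows "continuous_on S (\<lambda>t. if t = t0 then \<i> else csqrt (q t))"
  unfolding continuous_on_eq_continuous_within
proof
  fix t assume t: "t \<in> S"
  show "continuous (at t within S) (\<lambda>t. if t = t0 then \<i> else csqrt (q t))"
  proof (cases "t = t0")
    case True
    have "continuous (at t0 within S \<inter> ball t0 \<delta>) q"
      using q t0 by (meson IntD1 continuous_on_eq_continuous_within continuous_within_subset inf_le1)
    then have "((\<lambda>t. csqrt (q t)) \<longlongrightarrow> \<i>) (at t0 within S \<inter> ball t0 \<delta>)"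
      by (rule csqrt_near_neg_real_axis) (use q pos in \<open>auto simp: dist_real_def abs_minus_commute\<close>)
    moreover have "at t0 within S \<inter> ball t0 \<delta> = at t0 within S"
      by (rule at_within_nhd[where S = "ball t0 \<delta>"]) (use \<delta> in auto)
    ultimately have "((\<lambda>t. csqrt (q t)) \<longlongrightarrow> \<i>) (at t0 within S)" by simp
    then have "((\<lambda>t. if t = t0 then \<i> else csqrt (q t)) \<longlongrightarrow> \<i>) (at t0 within S)"
      by (rule Lim_transform_within[where d = 1]) auto
    then show ?thesis using True by (simp add: continuous_within)
  next
    case False
    have "continuous (at t within S) q" using q t by (simp add: continuous_on_eq_continuous_within)
    moreover have "continuous (at (q t)) csqrt" using nn t False by (intro continuous_at_csqrt) auto
    ultimately have "continuous (at t within S) (\<lambda>t. csqrt (q t))"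
      using continuous_within_compose3 by blast
    moreover have "\<forall>\<^sub>F s in at t within S. (if s = t0 then \<i> else csqrt (q s)) = csqrt (q s)"
      using False by (auto simp: eventually_at dist_commute intro!: exI[of _ "dist t t0"])
    ultimately show ?thesis
      using False by (simp add: continuous_within tendsto_cong)
  qed
qed

text \<open>When \<open>q\<close> passes through -1 from the upper to the lower half-plane,
  continuing its root means changing from the principal root to its negative. The second half is the
  first one conjugated: the principal root of \<open>cnj q\<close> tends to \<i> as well, and
  \<open>- cnj \<i> = \<i>\<close>.\<close>

lemma continuous_sqrt_across_neg_real_axis:
  fixes q :: "real \<Rightarrow> complex"
  assumes q: "continuous_on {a..b} q" "q t0 = -1" and t0: "t0 \<in> {a..b}" and \<delta>: "0 < \<delta>"
    and pos: "\<And>t. t \<in> {a..<t0} \<Longrightarrow> \<bar>t - t0\<bar> < \<delta> \<Longrightarrow> 0 < Im (q t)"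
    and neg: "\<And>t. t \<in> {t0<..b} \<Longrightarrow> \<bar>t - t0\<bar> < \<delta> \<Longrightarrow> Im (q t) < 0"
    and nn: "\<And>t. t \<in> {a..b} - {t0} \<Longrightarrow> q t \<notin> \<real>\<^sub>\<le>\<^sub>0"
  shows "continuous_on {a..b} (\<lambda>t. if t = t0 then \<i> else if t < t0 then csqrt (q t) else - csqrt (q t))"
    (is "continuous_on _ ?h")
proof -
  have "continuous_on {a..t0} (\<lambda>t. if t = t0 then \<i> else csqrt (q t))"
    by (rule continuous_csqrt_to_neg_real_axis[OF _ _ _ \<delta>])
       (use q t0 pos nn in \<open>auto intro: continuous_on_subset\<close>)
  then have "continuous_on {a..t0} ?h" by (rule continuous_on_eq) auto
  moreover have "continuous_on {t0..b} (\<lambda>t. if t = t0 then \<i> else csqrt (cnj (q t)))"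
  proof (rule continuous_csqrt_to_neg_real_axis[OF _ _ _ \<delta>])
    have "continuous_on {t0..b} q" using q(1) by (rule continuous_on_subset) (use t0 in auto)
    then show "continuous_on {t0..b} (\<lambda>t. cnj (q t))" by (intro continuous_intros)
    show "cnj (q t) \<notin> \<real>\<^sub>\<le>\<^sub>0" if "t \<in> {t0..b} - {t0}" for t
      using nn[of t] that t0 by (auto simp: complex_nonpos_Reals_iff)
  qed (use q t0 neg in auto)
  then have "continuous_on {t0..b} (\<lambda>t. - cnj (if t = t0 then \<i> else csqrt (cnj (q t))) + 0)"
    by (intro continuous_intros)
  then have "continuous_on {t0..b} ?h"
  proof (rule continuous_on_eq)
    fix t assume t: "t \<in> {t0..b}"
    show "- cnj (if t = t0 then \<i> else csqrt (cnj (q t))) + 0 = ?h t"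
      using nn[of t] t t0 by (auto simp: cnj_csqrt complex_nonpos_Reals_iff)
  qed
  ultimately have "continuous_on ({a..t0} \<union> {t0..b}) ?h" by (intro continuous_on_closed_Un) auto
  moreover have "{a..t0} \<union> {t0..b} = {a..b}" using t0 by auto
  ultimately show ?thesis by simp
qed

text \<open>For the two points just left and just right of \<open>\<gamma> t0\<close>, the quotient
  of the functions \<open>\<gamma> t - z\<close> is -1 at \<open>t0\<close> and meets the negative
  real axis only there, so its continued root ends with the sign opposite to the principal one. The
  ratio of the two sides therefore tends to -1; as sides are signs, it is eventually -1.\<close>

lemma side_jump:
  assumes C1: "\<gamma> C1_differentiable_on {0..1}" and t0: "t0 \<in> {0<..<1}"
    and a: "vector_derivative \<gamma> (at t0) \<noteq> 0"
    and simple: "\<And>t. t \<in> {0..1} \<Longrightarrow> t \<noteq> t0 \<Longrightarrow> \<gamma> t \<noteq> \<gamma> t0"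
    and nray: "\<gamma> t0 \<notin> ray \<alpha>" "\<gamma> t0 \<notin> ray \<beta>"
    and ends: "\<gamma> 0 = cis \<alpha>" "\<gamma> 1 = cis \<beta>"
  defines "n \<equiv> \<i> * vector_derivative \<gamma> (at t0)"
  shows "\<forall>\<^sub>F \<epsilon> in at_right 0. side \<gamma> \<alpha> \<beta> (\<gamma> t0 + of_real \<epsilon> * n) = - side \<gamma> \<alpha> \<beta> (\<gamma> t0 - of_real \<epsilon> * n)"
proof -
  define a where "a = vector_derivative \<gamma> (at t0)"
  have a0: "a \<noteq> 0" and na: "n = \<i> * a" using a by (auto simp: a_def n_def)
  define P where "P = \<gamma> t0"
  have cont: "continuous_on {0..1} \<gamma>" using C1 by (rule C1_differentiable_imp_continuous_on)
  obtain \<delta> where \<delta>: "0 < \<delta>" "\<And>s t. \<lbrakk>s \<in> {0..1}; t \<in> {0..1}; \<bar>s - t0\<bar> < \<delta>; \<bar>t - t0\<bar> < \<delta>\<rbrakk> \<Longrightarrow>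
       norm (\<gamma> s - \<gamma> t - (s - t) *\<^sub>R a) \<le> norm a / 2 * \<bar>s - t\<bar>"
    using C1_strong_derivative[OF C1, of t0 "norm a / 2"] t0 a0 by (auto simp: a_def)
  \<comment> \<open>\<open>Im (w * cnj n)\<close> is minus the inner product of \<open>w\<close>
    with the velocity: its sign separates the parts of the string before and after
    \<open>t0\<close>, and it vanishes for multiples of \<open>n\<close>.\<close>
  have near: "(s < t0 \<longrightarrow> 0 < Im ((\<gamma> s - P) * cnj n)) \<and> (t0 < s \<longrightarrow> Im ((\<gamma> s - P) * cnj n) < 0)"
    if s: "s \<in> {0..1}" "\<bar>s - t0\<bar> < \<delta>" for s
  proof -
    define e where "e = \<gamma> s - P - (s - t0) *\<^sub>R a"
    have e: "norm e \<le> norm a / 2 * \<bar>s - t0\<bar>" using \<delta>(2)[of s t0] s t0 \<delta>(1) by (simp add: e_def P_def)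
    have "(\<gamma> s - P) * cnj n = of_real (s - t0) * (a * cnj n) + e * cnj n"
      by (simp add: e_def algebra_simps scaleR_conv_of_real)
    moreover have "a * cnj n = - \<i> * of_real ((norm a)\<^sup>2)"
      by (simp only: complex_norm_square) (simp add: na)
    ultimately have "(\<gamma> s - P) * cnj n = of_real (s - t0) * (- \<i> * of_real ((norm a)\<^sup>2)) + e * cnj n"
      by (simp only:)
    moreover have "Im (of_real x * (- \<i> * of_real A) + w) = A * - x + Im w" for x A w by simp
    ultimately have 1: "Im ((\<gamma> s - P) * cnj n) = (norm a)\<^sup>2 * (t0 - s) + Im (e * cnj n)"
      by (simp only: minus_diff_eq)
    have "\<bar>Im (e * cnj n)\<bar> \<le> norm e * norm a"
      using abs_Im_le_cmod[of "e * cnj n"] by (simp add: norm_mult na)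
    also have "\<dots> \<le> norm a / 2 * \<bar>s - t0\<bar> * norm a" by (intro mult_right_mono e) auto
    finally have 2: "\<bar>Im (e * cnj n)\<bar> \<le> (norm a)\<^sup>2 * \<bar>s - t0\<bar> / 2" by (simp add: power2_eq_square mult_ac)
    have 3: "s < t0 \<Longrightarrow> 0 < (norm a)\<^sup>2 * (t0 - s)" "t0 < s \<Longrightarrow> 0 < (norm a)\<^sup>2 * (s - t0)" using a0 by auto
    show ?thesis
    proof (intro conjI impI)
      assume *: "s < t0"
      then have "(norm a)\<^sup>2 * \<bar>s - t0\<bar> = (norm a)\<^sup>2 * (t0 - s)" by simp
      with 1 2 3(1)[OF *] show "0 < Im ((\<gamma> s - P) * cnj n)" by linarith
    next
      assume *: "t0 < s"
      then have "(norm a)\<^sup>2 * \<bar>s - t0\<bar> = (norm a)\<^sup>2 * (s - t0)" by simp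
      moreover have "(norm a)\<^sup>2 * (t0 - s) = - ((norm a)\<^sup>2 * (s - t0))" by (simp add: algebra_simps)
      ultimately show "Im ((\<gamma> s - P) * cnj n) < 0" using 1 2 3(2)[OF *] by linarith
    qed
  qed
  have "compact (\<gamma> ` ({0..1} - ball t0 \<delta>))"
    using cont by (intro compact_continuous_image compact_diff) (auto intro: continuous_on_subset)
  moreover have "P \<notin> \<gamma> ` ({0..1} - ball t0 \<delta>)"
  proof
    assume "P \<in> \<gamma> ` ({0..1} - ball t0 \<delta>)"
    then obtain s where "s \<in> {0..1}" "s \<notin> ball t0 \<delta>" "\<gamma> s = P" by auto
    moreover from this \<delta>(1) have "s \<noteq> t0" by auto
    ultimately show False using simple[of s] by (auto simp: P_def)
  qed
  ultimately obtain c where c: "0 < c" "\<And>x. x \<in> \<gamma> ` ({0..1} - ball t0 \<delta>) \<Longrightarrow> c \<le> dist P x"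
    using separate_point_closed[of "\<gamma> ` ({0..1} - ball t0 \<delta>)" P] compact_imp_closed by blast
  \<comment> \<open>Ensures \<open>3 * norm (of_real \<epsilon> * n) < c\<close> for
    \<open>\<epsilon> < e0\<close>, so that away from \<open>t0\<close> the quotient
    \<open>q\<close> differs from 1 by less than 1 and avoids the cut.\<close>
  define e0 where "e0 = c / (3 * norm a)"
  have e0: "0 < e0" using c a0 by (simp add: e0_def)
  define q where "q \<epsilon> s = (\<gamma> s - P - of_real \<epsilon> * n) / (\<gamma> s - P + of_real \<epsilon> * n)" for \<epsilon> s
  \<comment> \<open>The ratio of the two sides, written so that it is continuous at
    \<open>\<epsilon> = 0\<close> with value -1. The leading minus sign records the passage of
    \<open>q\<close> across the cut.\<close>
  define L where "L \<epsilon> = - (csqrt (q \<epsilon> 1) / csqrt (q \<epsilon> 0)) *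
     (ray_root \<alpha> (P + of_real \<epsilon> * n) / ray_root \<alpha> (P - of_real \<epsilon> * n)) *
     (ray_root \<beta> (P - of_real \<epsilon> * n) / ray_root \<beta> (P + of_real \<epsilon> * n))" for \<epsilon>
  have main: "(P + of_real \<epsilon> * n) \<notin> \<gamma> ` {0..1} \<and> (P - of_real \<epsilon> * n) \<notin> \<gamma> ` {0..1} \<and>
     (side \<gamma> \<alpha> \<beta> (P - of_real \<epsilon> * n) = 0 \<or>
     side \<gamma> \<alpha> \<beta> (P + of_real \<epsilon> * n) / side \<gamma> \<alpha> \<beta> (P - of_real \<epsilon> * n) = L \<epsilon>)"
    if \<epsilon>: "0 < \<epsilon>" "\<epsilon> < e0" for \<epsilon>
  proof -
    let ?n = "of_real \<epsilon> * n"
    have nn: "3 * norm ?n < c" "?n \<noteq> 0" using \<epsilon> a0 by (auto simp: e0_def na norm_mult field_simps)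
    have far: "c \<le> norm (\<gamma> s - P)" if "s \<in> {0..1}" "\<not> \<bar>s - t0\<bar> < \<delta>" for s
      using c(2)[of "\<gamma> s"] that by (force simp: dist_norm dist_real_def norm_minus_commute abs_minus_commute)
    have nz: "\<gamma> s - P + ?n \<noteq> 0" "\<gamma> s - P - ?n \<noteq> 0" if s: "s \<in> {0..1}" for s
    proof -
      have "\<gamma> s - P \<noteq> - ?n \<and> \<gamma> s - P \<noteq> ?n"
      proof (cases "\<bar>s - t0\<bar> < \<delta>")
        case True
        show ?thesis
        proof (cases "s = t0")
          case False
          have "Im (- ?n * cnj n) = 0" "Im (?n * cnj n) = 0" by (simp_all add: algebra_simps)
          moreover have "Im ((\<gamma> s - P) * cnj n) \<noteq> 0" using near[OF s True] False by (auto simp: neq_iff)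
          ultimately show ?thesis by metis
        qed (use nn in \<open>auto simp: P_def\<close>)
      next
        case False
        then show ?thesis using far[OF s] nn(1) c(1) by auto
      qed
      then show "\<gamma> s - P + ?n \<noteq> 0" "\<gamma> s - P - ?n \<noteq> 0" by (auto simp: add_eq_0_iff2)
    qed
    have Imq: "Im (q \<epsilon> s) = 2 * \<epsilon> * Im ((\<gamma> s - P) * cnj n) / (norm (\<gamma> s - P + ?n))\<^sup>2" for s
    proof -
      have "Im (x / y) = Im (x * cnj y) / (norm y)\<^sup>2" for x y
        by (simp add: complex_div_cnj[of x y] Im_divide_of_real flip: of_real_power)
      then have "Im (q \<epsilon> s) = Im ((\<gamma> s - P - ?n) * cnj (\<gamma> s - P + ?n)) / (norm (\<gamma> s - P + ?n))\<^sup>2"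
        unfolding q_def by blast
      moreover have "Im ((g - of_real \<epsilon> * m) * cnj (g + of_real \<epsilon> * m)) = 2 * \<epsilon> * Im (g * cnj m)" for g m
        by (simp add: algebra_simps)
      ultimately show ?thesis by (simp only:)
    qed
    have pos: "0 < Im (q \<epsilon> s)" if "s \<in> {0..<t0}" "\<bar>s - t0\<bar> < \<delta>" for s
      using near[of s] nz(1)[of s] that t0 \<epsilon> unfolding Imq by (intro divide_pos_pos mult_pos_pos) auto
    have neg: "Im (q \<epsilon> s) < 0" if "s \<in> {t0<..1}" "\<bar>s - t0\<bar> < \<delta>" for s
      using near[of s] nz(1)[of s] that t0 \<epsilon> unfolding Imq by (intro divide_neg_pos mult_pos_neg) auto
    have nnr: "q \<epsilon> s \<notin> \<real>\<^sub>\<le>\<^sub>0" if s: "s \<in> {0..1} - {t0}" for s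
    proof (cases "\<bar>s - t0\<bar> < \<delta>")
      case True
      then have "Im (q \<epsilon> s) \<noteq> 0" using pos[of s] neg[of s] s by (cases "s < t0") auto
      then show ?thesis by (simp add: complex_nonpos_Reals_iff)
    next
      case False
      have d: "\<gamma> s - P + ?n \<noteq> 0" using nz s by auto
      have "1 - q \<epsilon> s = 2 * ?n / (\<gamma> s - P + ?n)" using d by (simp add: q_def field_simps)
      then have "norm (1 - q \<epsilon> s) = 2 * norm ?n / norm (\<gamma> s - P + ?n)" by (simp add: norm_divide norm_mult)
      moreover have "2 * norm ?n < norm (\<gamma> s - P + ?n)"
        using far[of s] False s nn(1) norm_diff_ineq[of "\<gamma> s - P" ?n] by auto
      ultimately have "norm (1 - q \<epsilon> s) < 1" using d by simp
      then have "Re (1 - q \<epsilon> s) < 1" using complex_Re_le_cmod le_less_trans by blast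
      then show ?thesis by (simp add: complex_nonpos_Reals_iff)
    qed
    define h where "h t = (if t = t0 then \<i> else if t < t0 then csqrt (q \<epsilon> t) else - csqrt (q \<epsilon> t))" for t
    have "continuous_on {0..1} h"
      unfolding h_def
    proof (rule continuous_sqrt_across_neg_real_axis[OF _ _ _ \<delta>(1)])
      show "continuous_on {0..1} (q \<epsilon>)" unfolding q_def using nz cont by (intro continuous_intros) auto
      show "q \<epsilon> t0 = -1" using nn(2) by (simp add: q_def P_def)
    qed (use t0 pos neg nnr in auto)
    moreover have h2: "(h s)\<^sup>2 = q \<epsilon> s" if "s \<in> {0..1}" for s
      using nn(2) by (auto simp: h_def q_def P_def)
    moreover have zn: "P + ?n \<notin> \<gamma> ` {0..1}" "P - ?n \<notin> \<gamma> ` {0..1}"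
      using nz by (force simp: algebra_simps)+
    ultimately obtain g where g: "root_path \<gamma> (P - ?n) g" using root_path_exists cont by blast
    have "root_path \<gamma> (P + ?n) (\<lambda>t. g t * h t)"
      unfolding root_path_def
    proof (intro conjI ballI)
      show "continuous_on {0..1} (\<lambda>t. g t * h t)"
        using g \<open>continuous_on {0..1} h\<close> by (auto simp: root_path_def intro: continuous_intros)
      fix s :: real assume s: "s \<in> {0..1}"
      have "(g s)\<^sup>2 = \<gamma> s - P + ?n" using g s by (simp add: root_path_def)
      then show "(g s * h s)\<^sup>2 = \<gamma> s - (P + ?n)"
        using nz(1)[OF s] by (simp add: power_mult_distrib h2[OF s] q_def)
    qed
    from side_eq[OF this zn(1)] have "side \<gamma> \<alpha> \<beta> (P + ?n) =
        g 1 * h 1 * ray_root \<alpha> (P + ?n) / (g 0 * h 0 * ray_root \<beta> (P + ?n))" .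
    moreover have "side \<gamma> \<alpha> \<beta> (P - ?n) = g 1 * ray_root \<alpha> (P - ?n) / (g 0 * ray_root \<beta> (P - ?n))"
      by (rule side_eq[OF g zn(2)])
    moreover have "h 1 = - csqrt (q \<epsilon> 1)" "h 0 = csqrt (q \<epsilon> 0)" using t0 by (auto simp: h_def)
    ultimately have "side \<gamma> \<alpha> \<beta> (P - ?n) = 0 \<or>
       side \<gamma> \<alpha> \<beta> (P + ?n) / side \<gamma> \<alpha> \<beta> (P - ?n) = L \<epsilon>"
      unfolding L_def by (auto simp: mult_ac)
    with zn show ?thesis by blast
  qed
  have P01: "\<gamma> 0 - P \<noteq> 0" "\<gamma> 1 - P \<noteq> 0" using simple[of 0] simple[of 1] t0 by (auto simp: P_def)
  have "isCont L 0"
  proof -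
    have rc: "isCont (\<lambda>\<epsilon>. ray_root \<theta> (P + of_real \<epsilon> * n)) 0" "isCont (\<lambda>\<epsilon>. ray_root \<theta> (P - of_real \<epsilon> * n)) 0"
      if "P \<notin> ray \<theta>" for \<theta>
      by (rule isCont_o2[where g = "ray_root \<theta>"], (intro continuous_intros)?, simp add: ray_root_continuous[OF that])+
    show ?thesis unfolding L_def q_def using nray P01
      by (intro continuous_intros isCont_csqrt' rc) (auto simp: P_def ray_nonzero)
  qed
  moreover have "L 0 = -1"
    using nray P01 by (simp add: L_def q_def ray_nonzero P_def)
  ultimately have "(L \<longlongrightarrow> -1) (at_right 0)"
    by (metis filterlim_at_split isCont_def)
  then have "\<forall>\<^sub>F \<epsilon> in at_right 0. dist (L \<epsilon>) (-1) < 1"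
    using tendstoD by (metis zero_less_one)
  moreover have "\<forall>\<^sub>F \<epsilon> in at_right 0. 0 < \<epsilon> \<and> \<epsilon> < e0"
    using e0 by (auto simp: eventually_at_right_field)
  ultimately show ?thesis
  proof eventually_elim
    case (elim \<epsilon>)
    let ?n = "of_real \<epsilon> * n"
    have m: "(P + ?n) \<notin> \<gamma> ` {0..1}" "(P - ?n) \<notin> \<gamma> ` {0..1}"
      "side \<gamma> \<alpha> \<beta> (P - ?n) = 0 \<or> side \<gamma> \<alpha> \<beta> (P + ?n) / side \<gamma> \<alpha> \<beta> (P - ?n) = L \<epsilon>"
      using main elim by auto
    have v: "side \<gamma> \<alpha> \<beta> (P + ?n) \<in> {1, -1}" "side \<gamma> \<alpha> \<beta> (P - ?n) \<in> {1, -1}"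
      using side_values[OF cont _ ends] m by auto
    have "L \<epsilon> \<noteq> 1" using elim(1) by (auto simp: dist_norm)
    have "side \<gamma> \<alpha> \<beta> (P + ?n) \<noteq> side \<gamma> \<alpha> \<beta> (P - ?n)"
    proof
      assume "side \<gamma> \<alpha> \<beta> (P + ?n) = side \<gamma> \<alpha> \<beta> (P - ?n)"
      with v m(3) have "L \<epsilon> = 1" by auto
      with \<open>L \<epsilon> \<noteq> 1\<close> show False ..
    qed
    with v show ?case unfolding P_def[symmetric] by auto
  qed
qed

section \<open>The checkerboard sign\<close>

locale diagram =
  fixes m :: nat and T :: tangle and e :: "nat \<Rightarrow> param" and \<theta> :: "nat \<Rightarrow> real"
  assumes vtd: "virtual_tangle_diagram m T"
    and e_bij: "bij_betw e {..<2 * m} (endpoints m)"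
    and e_pt: "\<And>k. k < 2 * m \<Longrightarrow> pt T (e k) = cis (\<theta> k)"
    and \<theta>_mono: "\<And>k l. k < l \<Longrightarrow> l < 2 * m \<Longrightarrow> \<theta> k < \<theta> l \<and> \<theta> l < \<theta> k + 2 * pi"
begin

text \<open>A lifted angle rather than \<open>Arg\<close>: the signs outside the disk depend on the
  lift, and the turn in which the angles are taken begins at an arbitrary first endpoint.\<close>

definition ang :: "param \<Rightarrow> real" where
  "ang x = \<theta> (the_inv_into {..<2 * m} e x)"

definition clear_region :: "complex set" where
  "clear_region = - (pt T ` params m \<union> (\<Union>x\<in>endpoints m. ray (ang x)))"

definition shade :: "complex \<Rightarrow> complex" where
  "shade z = (\<Prod>i<m. side (strand T i) (ang (i, 0)) (ang (i, 1)) z)"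

definition regular :: "param \<Rightarrow> bool" where
  "regular x \<longleftrightarrow> x \<in> params m - endpoints m \<and> (\<forall>y. \<not> crossing m T x y)"

lemmas vtd_unfolded = vtd[unfolded virtual_tangle_diagram_def]

lemma m_pos: "1 \<le> m"
  using vtd_unfolded by (rule conjunct1)

lemma C1: "i < m \<Longrightarrow> strand T i C1_differentiable_on {0..1}"
  using vtd_unfolded by simp

lemma velocity_nz: "x \<in> params m \<Longrightarrow> velocity T x \<noteq> 0"
  using vtd_unfolded by simp

lemma norm_pt: "x \<in> params m \<Longrightarrow> norm (pt T x) \<le> 1"
  using vtd_unfolded by (simp add: image_subset_iff)

lemma norm_pt_1: "x \<in> params m \<Longrightarrow> norm (pt T x) = 1 \<longleftrightarrow> x \<in> endpoints m"
  using vtd_unfolded by simp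

lemma inj_endpoints: "inj_on (pt T) (endpoints m)"
  using vtd_unfolded by (elim conjE)

lemma transversal: "crossing m T x y \<Longrightarrow> Im (cnj (velocity T x) * velocity T y) \<noteq> 0"
  using vtd_unfolded unfolding collinear_0_iff_Im by (elim conjE) blast

lemma crossing_unique: "crossing m T x y \<Longrightarrow> crossing m T x z \<Longrightarrow> y = z"
  using vtd_unfolded by (elim conjE) blast

lemma crossing_sym: "crossing m T x y \<longleftrightarrow> crossing m T y x"
  by (auto simp: crossing_def)

lemma endpoints_subset: "endpoints m \<subseteq> params m"
  by (auto simp: endpoints_def params_def)

lemma finite_endpoints: "finite (endpoints m)" by (simp add: endpoints_def)

lemma ang_e: "k < 2 * m \<Longrightarrow> ang (e k) = \<theta> k"
  using e_bij by (simp add: ang_def the_inv_into_f_f bij_betw_def)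

lemma pt_endpoint: "x \<in> endpoints m \<Longrightarrow> pt T x = cis (ang x)"
  using e_bij e_pt ang_e by (metis bij_betw_imp_surj_on imageE lessThan_iff)

lemma strand_ends: "i < m \<Longrightarrow> strand T i 0 = cis (ang (i, 0))" "i < m \<Longrightarrow> strand T i 1 = cis (ang (i, 1))"
  using pt_endpoint[of "(i, 0)"] pt_endpoint[of "(i, 1)"] by (auto simp: endpoints_def pt_def)

lemma endpoint_not_crossing:
  assumes "x \<in> endpoints m" shows "\<not> crossing m T x y"
proof
  assume c: "crossing m T x y"
  then have "norm (pt T y) = 1" using assms norm_pt_1[of x] endpoints_subset by (auto simp: crossing_def)
  then have "y \<in> endpoints m" using c norm_pt_1 by (auto simp: crossing_def)
  with c assms inj_endpoints show False by (auto simp: crossing_def dest: inj_onD)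
qed

lemma norm_pt_less: "x \<in> params m - endpoints m \<Longrightarrow> norm (pt T x) < 1"
  using norm_pt norm_pt_1 by (metis Diff_iff order_less_le)

lemma strand_continuous: "i < m \<Longrightarrow> continuous_on {0..1} (strand T i)"
  using C1 by (rule C1_differentiable_imp_continuous_on)

lemma compact_params: "compact (params m)"
  by (auto simp: params_def intro: compact_Times finite_imp_compact)

lemma pt_continuous: "continuous_on (params m) (pt T)"
proof -
  have "continuous_on ({i} \<times> {0..1}) (pt T)" if "i < m" for i
  proof -
    have "continuous_on ({i} \<times> {0..1::real}) (\<lambda>x. strand T i (snd x))"
      by (rule continuous_on_compose2[OF strand_continuous[OF that]]) (auto intro: continuous_intros)
    then show ?thesis by (rule continuous_on_eq) (auto simp: pt_def)
  qed
  then have "continuous_on (\<Union>i\<in>{..<m}. {i} \<times> {0..1}) (pt T)"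
    by (intro continuous_on_closed_Union) (auto intro: closed_Times)
  moreover have "(\<Union>i\<in>{..<m}. {i} \<times> {0..1}) = params m" by (auto simp: params_def)
  ultimately show ?thesis by simp
qed

text \<open>Compactness of the parameter space: whatever part of the diagram comes close to
  \<open>P\<close> has parameters close to the preimages of \<open>P\<close>. This keeps the rest of
  the diagram out of all local arguments.\<close>

lemma preimage_nbhd:
  assumes "open U" "\<And>y. y \<in> params m \<Longrightarrow> pt T y = P \<Longrightarrow> y \<in> U"
  obtains r where "0 < r" "\<And>y. y \<in> params m \<Longrightarrow> norm (pt T y - P) < r \<Longrightarrow> y \<in> U"
proof -
  have "compact (pt T ` (params m - U))"
    using assms(1) by (intro compact_continuous_image compact_diff compact_params)
      (auto intro: continuous_on_subset[OF pt_continuous])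
  moreover have "P \<notin> pt T ` (params m - U)" using assms(2) by auto
  ultimately obtain r where "0 < r" "\<And>x. x \<in> pt T ` (params m - U) \<Longrightarrow> r \<le> dist P x"
    using separate_point_closed[of "pt T ` (params m - U)" P] compact_imp_closed by blast
  then show ?thesis by (intro that[of r]) (force simp: dist_norm norm_minus_commute)+
qed

text \<open>Near a point that is not a crossing the diagram is a single, nearly straight piece of
  string. The estimate is uniform in the base point \<open>t'\<close>, so it applies along a whole
  stretch of the string. Endpoints are included.\<close>

lemma local_form:
  assumes x: "(i, t) \<in> params m" "\<And>y. \<not> crossing m T (i, t) y" and \<kappa>: "0 < \<kappa>"
  obtains r \<eta> where "0 < r" "0 < \<eta>"
    "\<And>y t'. \<lbrakk>y \<in> params m; t' \<in> {0..1}; \<bar>t' - t\<bar> < \<eta>; norm (pt T y - strand T i t') < r\<rbrakk> \<Longrightarrow>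
      fst y = i \<and> norm (pt T y - strand T i t' - (snd y - t') *\<^sub>R velocity T (i, t)) \<le> \<kappa> * \<bar>snd y - t'\<bar>"
proof -
  have i: "i < m" and t: "t \<in> {0..1}" using x by (auto simp: params_def)
  obtain \<delta> where \<delta>: "0 < \<delta>" "\<And>s t'. \<lbrakk>s \<in> {0..1}; t' \<in> {0..1}; \<bar>s - t\<bar> < \<delta>; \<bar>t' - t\<bar> < \<delta>\<rbrakk> \<Longrightarrow>
       norm (strand T i s - strand T i t' - (s - t') *\<^sub>R velocity T (i, t)) \<le> \<kappa> * \<bar>s - t'\<bar>"
    using C1_strong_derivative[OF C1[OF i] t \<kappa>] by (auto simp: velocity_def)
  have "open ({i} \<times> ball t \<delta>)" by (intro open_Times open_ball) (simp add: open_discrete)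
  moreover have "y \<in> {i} \<times> ball t \<delta>" if "y \<in> params m" "pt T y = pt T (i, t)" for y
  proof -
    have "y = (i, t)" using x that unfolding crossing_def by metis
    then show ?thesis using \<delta>(1) by simp
  qed
  ultimately obtain r where r: "0 < r" "\<And>y. y \<in> params m \<Longrightarrow> norm (pt T y - pt T (i, t)) < r \<Longrightarrow> y \<in> {i} \<times> ball t \<delta>"
    using preimage_nbhd[of "{i} \<times> ball t \<delta>" "pt T (i, t)"] by blast
  have "\<exists>d>0. \<forall>t'\<in>{0..1}. dist t' t < d \<longrightarrow> dist (strand T i t') (strand T i t) < r / 2"
    using strand_continuous[OF i] t half_gt_zero[OF r(1)] unfolding continuous_on_iff by blast
  then obtain d where d: "0 < d" "\<And>t'. t' \<in> {0..1} \<Longrightarrow> \<bar>t' - t\<bar> < d \<Longrightarrow> norm (strand T i t' - strand T i t) < r / 2"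
    by (auto simp: dist_norm)
  show ?thesis
  proof (rule that)
    show "0 < r / 2" "0 < min d \<delta>" using r d \<delta> by auto
    fix y t' assume y: "y \<in> params m" "t' \<in> {0..1}" "\<bar>t' - t\<bar> < min d \<delta>" "norm (pt T y - strand T i t') < r / 2"
    have "norm (pt T y - pt T (i, t)) < r"
      using norm_triangle_lt[of "pt T y - strand T i t'" "strand T i t' - strand T i t" r] d(2)[of t'] y
      by (simp add: pt_def)
    then have "y \<in> {i} \<times> ball t \<delta>" using r y by blast
    then have "fst y = i" "\<bar>snd y - t\<bar> < \<delta>" by (auto simp: dist_real_def abs_minus_commute)
    then show "fst y = i \<and> norm (pt T y - strand T i t' - (snd y - t') *\<^sub>R velocity T (i, t)) \<le> \<kappa> * \<bar>snd y - t'\<bar>"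
      using \<delta>(2)[of "snd y" t'] y by (auto simp: pt_def params_def)
  qed
qed

text \<open>An immersed string is locally injective and nothing else comes near, so crossings cannot
  accumulate at a point that is not itself a crossing.\<close>

lemma regular_near:
  assumes x: "(i, t) \<in> params m" "\<And>y. \<not> crossing m T (i, t) y"
  obtains \<eta> where "0 < \<eta>" "\<And>t'. \<lbrakk>t' \<in> {0<..<1}; \<bar>t' - t\<bar> < \<eta>\<rbrakk> \<Longrightarrow> regular (i, t')"
proof -
  define \<kappa> where "\<kappa> = norm (velocity T (i, t)) / 2"
  have \<kappa>: "0 < \<kappa>" using velocity_nz[OF x(1)] by (simp add: \<kappa>_def)
  obtain r \<eta> where lf: "0 < r" "0 < \<eta>"
    "\<And>y t'. \<lbrakk>y \<in> params m; t' \<in> {0..1}; \<bar>t' - t\<bar> < \<eta>; norm (pt T y - strand T i t') < r\<rbrakk> \<Longrightarrow>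
      fst y = i \<and> norm (pt T y - strand T i t' - (snd y - t') *\<^sub>R velocity T (i, t)) \<le> \<kappa> * \<bar>snd y - t'\<bar>"
    using local_form[OF x \<kappa>] by blast
  show ?thesis
  proof (rule that[OF lf(2)])
    fix t' :: real assume t': "t' \<in> {0<..<1}" "\<bar>t' - t\<bar> < \<eta>"
    have "\<not> crossing m T (i, t') y" for y
    proof
      assume c: "crossing m T (i, t') y"
      then have y: "y \<in> params m" "pt T y = strand T i t'" "y \<noteq> (i, t')" by (auto simp: crossing_def pt_def)
      from lf(3)[of y t'] y t' lf(1)
      have *: "fst y = i" "\<bar>snd y - t'\<bar> * norm (velocity T (i, t)) \<le> \<kappa> * \<bar>snd y - t'\<bar>" by auto
      then have "\<bar>snd y - t'\<bar> * norm (velocity T (i, t)) \<le> 0" using \<kappa> by (simp add: \<kappa>_def)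
      then have "snd y = t'" using \<kappa> by (simp add: \<kappa>_def mult_le_0_iff)
      with * y show False by (metis prod.collapse)
    qed
    then show "regular (i, t')" using t' x by (auto simp: regular_def params_def endpoints_def)
  qed
qed

section \<open>Signs on the two sides of a string\<close>

lemma not_on_ray: "norm z < 1 \<Longrightarrow> z \<notin> ray \<alpha>"
  by (auto simp: ray_def norm_mult)

lemma clear_regionI: "z \<notin> pt T ` params m \<Longrightarrow> norm z < 1 \<Longrightarrow> z \<in> clear_region"
  using not_on_ray by (auto simp: clear_region_def)

lemma clear_regionD:
  assumes "z \<in> clear_region" "i < m"
  shows "z \<notin> strand T i ` {0..1}" "z \<notin> ray (ang (i, 0))" "z \<notin> ray (ang (i, 1))"
  using assms by (force simp: clear_region_def params_def endpoints_def pt_def)+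

lemma shade_values:
  assumes "z \<in> clear_region" shows "shade z \<in> {1, -1}"
proof -
  have "(\<Prod>i\<in>A. side (strand T i) (ang (i, 0)) (ang (i, 1)) z) \<in> {1, -1}" if "A \<subseteq> {..<m}" "finite A" for A
    using that(2,1)
  proof (induction A)
    case (insert i A)
    then have "i < m" by auto
    have "side (strand T i) (ang (i, 0)) (ang (i, 1)) z \<in> {1, -1}"
      by (rule side_values[OF strand_continuous[OF \<open>i < m\<close>] clear_regionD(1)[OF assms \<open>i < m\<close>]
            strand_ends(1)[OF \<open>i < m\<close>] strand_ends(2)[OF \<open>i < m\<close>]])
    with insert show ?case by auto
  qed auto
  then show ?thesis by (simp add: shade_def)
qed

lemma shade_constant:
  assumes S: "connected S" "S \<subseteq> clear_region" and xy: "x \<in> S" "y \<in> S"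
  shows "shade x = shade y"
proof -
  have "continuous_on S shade"
    unfolding shade_def
  proof (intro continuous_on_prod continuous_at_imp_continuous_on ballI)
    fix i z assume "i \<in> {..<m}" "z \<in> S"
    with S clear_regionD[of z i] show "isCont (side (strand T i) (ang (i, 0)) (ang (i, 1))) z"
      by (intro side_continuous strand_continuous) auto
  qed
  moreover have "shade ` S \<subseteq> {1, -1}" using shade_values S(2) by blast
  then have "finite (shade ` S)" by (rule finite_subset) auto
  ultimately have "shade constant_on S" using S(1) by (intro continuous_finite_range_constant)
  with xy show ?thesis unfolding constant_on_def by metis
qed

text \<open>Near \<open>x\<close> the diagram stays in a thin double cone around the tangent, so
  displacements with a definite normal component avoid it. \<open>\<kappa>\<close> measures that
  component, scaled by the speed.\<close>

lemma cone_clear: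
  assumes x: "regular x" and \<kappa>: "0 < \<kappa>"
  obtains r where "0 < r"
    "\<And>z. \<lbrakk>0 < norm z; norm z < r; \<kappa> * norm z \<le> \<bar>Im (cnj (velocity T x) * z)\<bar>\<rbrakk> \<Longrightarrow> pt T x + z \<in> clear_region"
proof -
  obtain i t where xit: "x = (i, t)" by (cases x)
  define w where "w = velocity T x"
  have xp: "x \<in> params m" using x by (auto simp: regular_def)
  then have w: "w \<noteq> 0" by (simp add: velocity_nz w_def)
  \<comment> \<open>The bound \<open>norm w / 2\<close> gives
    \<open>norm w * \<bar>s\<bar> \<le> 2 * norm z\<close>; the bound \<open>\<kappa> / 3\<close>
    then limits the normal component of \<open>z\<close> to two thirds of what was assumed.\<close>
  define k where "k = min (norm w / 2) (\<kappa> / 3)"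
  have k: "0 < k" using w \<kappa> by (simp add: k_def)
  obtain r \<eta> where lf: "0 < r" "0 < \<eta>"
    "\<And>y t'. \<lbrakk>y \<in> params m; t' \<in> {0..1}; \<bar>t' - t\<bar> < \<eta>; norm (pt T y - strand T i t') < r\<rbrakk> \<Longrightarrow>
      fst y = i \<and> norm (pt T y - strand T i t' - (snd y - t') *\<^sub>R w) \<le> k * \<bar>snd y - t'\<bar>"
    using local_form[of i t k] x k unfolding xit w_def regular_def by blast
  have P: "norm (pt T x) < 1" using x norm_pt_less by (auto simp: regular_def)
  show ?thesis
  proof (rule that)
    show "0 < min r (1 - norm (pt T x))" using lf P by simp
    fix z assume z: "0 < norm z" "norm z < min r (1 - norm (pt T x))"
      "\<kappa> * norm z \<le> \<bar>Im (cnj (velocity T x) * z)\<bar>"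
    have "pt T x + z \<notin> pt T ` params m"
    proof
      assume "pt T x + z \<in> pt T ` params m"
      then obtain y where y: "y \<in> params m" "pt T y = pt T x + z" by auto
      define s where "s = snd y - t"
      have *: "norm (z - s *\<^sub>R w) \<le> k * \<bar>s\<bar>"
        using lf(3)[of y t] y xp z lf(2) unfolding xit s_def by (auto simp: pt_def params_def)
      have "k * \<bar>s\<bar> \<le> norm w / 2 * \<bar>s\<bar>" by (intro mult_right_mono) (auto simp: k_def)
      moreover have "norm (s *\<^sub>R w) - norm z \<le> norm (z - s *\<^sub>R w)"
        by (metis norm_minus_commute norm_triangle_ineq2)
      ultimately have 1: "norm w * \<bar>s\<bar> \<le> 2 * norm z" using * by (simp add: mult_ac)
      have "Im (cnj w * z) = Im (cnj w * (z - s *\<^sub>R w))" by (simp add: algebra_simps)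
      then have "\<bar>Im (cnj w * z)\<bar> \<le> norm w * norm (z - s *\<^sub>R w)"
        by (metis abs_Im_le_cmod complex_mod_cnj norm_mult)
      also have "\<dots> \<le> norm w * (k * \<bar>s\<bar>)" using * by (intro mult_left_mono) auto
      also have "\<dots> = k * (norm w * \<bar>s\<bar>)" by simp
      also have "\<dots> \<le> \<kappa> / 3 * (2 * norm z)" by (rule mult_mono) (use 1 \<kappa> in \<open>auto simp: k_def\<close>)
      finally have "\<kappa> * norm z \<le> 2 / 3 * (\<kappa> * norm z)" using z(3) by (simp add: w_def)
      moreover have "0 < \<kappa> * norm z" using \<kappa> z by simp
      ultimately show False by linarith
    qed
    moreover have "norm (pt T x + z) < 1" using z norm_triangle_ineq[of "pt T x" z] by auto
    ultimately show "pt T x + z \<in> clear_region" by (rule clear_regionI)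
  qed
qed

text \<open>That an eventual value exists, as \<open>SOME\<close> presupposes, is established for
  regular parameters within \<open>left_shade_cone\<close>.\<close>

definition left_shade :: "param \<Rightarrow> complex" where
  "left_shade x = (SOME c. \<forall>\<^sub>F \<epsilon> in at_right 0. shade (pt T x + of_real \<epsilon> * (\<i> * velocity T x)) = c)"

lemma eventually_at_right_0: "0 < b \<Longrightarrow> \<forall>\<^sub>F \<epsilon> in at_right 0. 0 < \<epsilon> \<and> \<epsilon> < (b::real)"
  unfolding eventually_at_right_field by (auto intro!: exI[of _ b])

text \<open>Exactly one factor of \<open>shade\<close> changes sign, that of the string through the
  point. All other strings miss the point, so their factors are continuous there.\<close>

lemma shade_jump:
  assumes x: "regular x"
  shows "\<forall>\<^sub>F \<epsilon> in at_right 0. shade (pt T x + of_real \<epsilon> * (\<i> * velocity T x)) =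
     - shade (pt T x - of_real \<epsilon> * (\<i> * velocity T x))"
proof -
  obtain i t where xit: "x = (i, t)" by (cases x)
  define n where "n = \<i> * velocity T x"
  define P where "P = pt T x"
  define f where "f k z = side (strand T k) (ang (k, 0)) (ang (k, 1)) z" for k z
  have xp: "x \<in> params m" "x \<notin> endpoints m" using x by (auto simp: regular_def)
  then have i: "i < m" and t: "t \<in> {0<..<1}" by (auto simp: xit params_def endpoints_def)
  have Pt: "P = strand T i t" by (simp add: P_def xit pt_def)
  have nP: "norm P < 1" using xp norm_pt_less by (simp add: P_def)
  have own: "\<forall>\<^sub>F \<epsilon> in at_right 0. f i (P + of_real \<epsilon> * n) = - f i (P - of_real \<epsilon> * n)"
    unfolding f_def Pt n_def velocity_def xit fst_conv snd_conv
  proof (rule side_jump[OF C1[OF i] t])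
    show "vector_derivative (strand T i) (at t) \<noteq> 0"
      using velocity_nz[OF xp(1)] by (simp add: velocity_def xit)
    show "strand T i s \<noteq> strand T i t" if "s \<in> {0..1}" "s \<noteq> t" for s
    proof
      assume "strand T i s = strand T i t"
      then have "crossing m T x (i, s)" using that xp i by (auto simp: crossing_def xit params_def pt_def)
      with x show False by (auto simp: regular_def)
    qed
  qed (use nP strand_ends[OF i] not_on_ray Pt in auto)
  have dir: "\<forall>\<^sub>F \<epsilon> in at_right 0. P + of_real \<epsilon> * n \<in> clear_region \<and> P - of_real \<epsilon> * n \<in> clear_region"
  proof -
    have v: "velocity T x \<noteq> 0" using xp by (simp add: velocity_nz)
    then have "0 < norm (velocity T x)" by simp
    then obtain r where r: "0 < r" "\<And>z. \<lbrakk>0 < norm z; norm z < r;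
        norm (velocity T x) * norm z \<le> \<bar>Im (cnj (velocity T x) * z)\<bar>\<rbrakk> \<Longrightarrow> pt T x + z \<in> clear_region"
      using cone_clear[OF x] by metis
    have "\<forall>\<^sub>F \<epsilon> in at_right 0. 0 < \<epsilon> \<and> \<epsilon> < r / norm n"
      using r v by (intro eventually_at_right_0) (auto simp: n_def)
    then show ?thesis
    proof eventually_elim
      case (elim \<epsilon>)
      have "cnj (velocity T x) * (of_real \<epsilon> * n) = of_real (\<epsilon> * (norm (velocity T x))\<^sup>2) * \<i>"
        using complex_norm_square[of "velocity T x"] by (simp add: n_def mult_ac)
      moreover have "\<bar>Im (of_real A * \<i>)\<bar> = \<bar>A\<bar>" for A by simp
      ultimately have "\<bar>Im (cnj (velocity T x) * (of_real \<epsilon> * n))\<bar> = \<epsilon> * (norm (velocity T x))\<^sup>2"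
        using elim by (simp only: abs_mult abs_power2) simp
      moreover have "norm (of_real \<epsilon> * n) = \<epsilon> * norm (velocity T x)" using elim by (simp add: n_def norm_mult)
      moreover have "norm (of_real \<epsilon> * n) < r" using elim v by (simp add: n_def norm_mult field_simps)
      moreover have "0 < \<epsilon> * norm (velocity T x)" using elim v by simp
      ultimately have z: "0 < norm z" "norm z < r" "norm (velocity T x) * norm z \<le> \<bar>Im (cnj (velocity T x) * z)\<bar>"
        if "z = of_real \<epsilon> * n" for z
        unfolding that by (simp_all only: power2_eq_square mult.assoc mult.left_commute order_refl)
      moreover have "\<bar>Im (cnj (velocity T x) * - z)\<bar> = \<bar>Im (cnj (velocity T x) * z)\<bar>" for z
        by (simp only: mult_minus_right uminus_complex.sel abs_minus_cancel)
      ultimately have "pt T x + of_real \<epsilon> * n \<in> clear_region" "pt T x + - (of_real \<epsilon> * n) \<in> clear_region"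
        by (intro r(2); metis norm_minus_cancel)+
      then show ?case by (simp add: P_def)
    qed
  qed
  have other: "\<forall>\<^sub>F \<epsilon> in at_right 0. f k (P + of_real \<epsilon> * n) = f k (P - of_real \<epsilon> * n)"
    if k: "k < m" "k \<noteq> i" for k
  proof -
    have "P \<notin> strand T k ` {0..1}"
    proof
      assume "P \<in> strand T k ` {0..1}"
      then obtain s where "s \<in> {0..1}" "P = strand T k s" by auto
      then have "crossing m T x (k, s)" using k xp by (auto simp: crossing_def xit params_def P_def pt_def)
      with x show False by (auto simp: regular_def)
    qed
    then have "isCont (f k) P"
      unfolding f_def using k nP by (intro side_continuous strand_continuous not_on_ray) auto
    then have "isCont (\<lambda>\<epsilon>. f k (P + of_real \<epsilon> * n)) 0" "isCont (\<lambda>\<epsilon>. f k (P - of_real \<epsilon> * n)) 0"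
      by (auto intro!: isCont_o2[where g = "f k" and f = "\<lambda>\<epsilon>. P + of_real \<epsilon> * n"]
           isCont_o2[where g = "f k" and f = "\<lambda>\<epsilon>. P - of_real \<epsilon> * n"])
    then have "isCont (\<lambda>\<epsilon>. f k (P + of_real \<epsilon> * n) - f k (P - of_real \<epsilon> * n)) 0"
      by (intro continuous_intros)
    then have "((\<lambda>\<epsilon>. f k (P + of_real \<epsilon> * n) - f k (P - of_real \<epsilon> * n)) \<longlongrightarrow> 0) (at_right 0)"
      by (simp add: isCont_def filterlim_at_split)
    \<comment> \<open>Two signs at distance less than 2 are equal.\<close>
    then have "\<forall>\<^sub>F \<epsilon> in at_right 0. norm (f k (P + of_real \<epsilon> * n) - f k (P - of_real \<epsilon> * n)) < 2"
      using tendstoD[of _ 0 _ 2] by (force simp: dist_norm)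
    with dir show ?thesis
    proof eventually_elim
      case (elim \<epsilon>)
      have "f k (P + of_real \<epsilon> * n) \<in> {1, -1}" "f k (P - of_real \<epsilon> * n) \<in> {1, -1}"
        unfolding f_def using elim k
        by (intro side_values strand_continuous strand_ends clear_regionD(1); simp)+
      with elim(2) show ?case by auto
    qed
  qed
  have "\<forall>\<^sub>F \<epsilon> in at_right 0. \<forall>k\<in>{..<m} - {i}. f k (P + of_real \<epsilon> * n) = f k (P - of_real \<epsilon> * n)"
    using other by (intro eventually_ball_finite) auto
  with own show ?thesis
  proof eventually_elim
    case (elim \<epsilon>)
    have split: "shade z = f i z * (\<Prod>k\<in>{..<m} - {i}. f k z)" for z
      using i by (simp add: shade_def f_def prod.remove)
    have "(\<Prod>k\<in>{..<m} - {i}. f k (P + of_real \<epsilon> * n)) = (\<Prod>k\<in>{..<m} - {i}. f k (P - of_real \<epsilon> * n))"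
      using elim(2) by (intro prod.cong) auto
    with elim(1) show ?case by (simp add: split flip: P_def n_def)
  qed
qed

text \<open>\<open>norm\<close> is convex and \<open>Im (v * z)\<close> is linear in
  \<open>z\<close>; positivity of \<open>\<kappa>\<close> keeps the apex out of convex combinations.
  Convexity makes each half of the double cone connected.\<close>

lemma convex_cone_section:
  assumes "0 < \<kappa>"
  shows "convex {z::complex. 0 < norm z \<and> norm z < r \<and> \<kappa> * norm z \<le> Im (v * z)}"
proof (rule convexI)
  fix x y :: complex and s t :: real
  assume x: "x \<in> {z. 0 < norm z \<and> norm z < r \<and> \<kappa> * norm z \<le> Im (v * z)}"
    and y: "y \<in> {z. 0 < norm z \<and> norm z < r \<and> \<kappa> * norm z \<le> Im (v * z)}"
    and st: "0 \<le> s" "0 \<le> t" "s + t = 1"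
  let ?z = "s *\<^sub>R x + t *\<^sub>R y"
  have le: "norm ?z \<le> s * norm x + t * norm y"
    using norm_triangle_ineq[of "s *\<^sub>R x" "t *\<^sub>R y"] st by simp
  have Im: "Im (v * ?z) = s * Im (v * x) + t * Im (v * y)" by (simp add: algebra_simps)
  have "s * (\<kappa> * norm x) \<le> s * Im (v * x)" "t * (\<kappa> * norm y) \<le> t * Im (v * y)"
    using x y st by (auto intro: mult_left_mono)
  then have 1: "\<kappa> * (s * norm x + t * norm y) \<le> Im (v * ?z)" unfolding Im by (simp add: algebra_simps)
  have 2: "0 < s * norm x + t * norm y"
    using x y st by (cases "s = 0") (auto intro!: add_pos_nonneg mult_pos_pos)
  then have "0 < Im (v * ?z)" using 1 assms by (smt (verit) mult_pos_pos)
  then have "?z \<noteq> 0" by (metis less_irrefl mult_zero_right zero_complex.sel(2))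
  moreover have "s * norm x + t * norm y < r"
  proof -
    have "s * norm x + t * norm y \<le> s * max (norm x) (norm y) + t * max (norm x) (norm y)"
      using st by (intro add_mono mult_left_mono) auto
    also have "\<dots> = max (norm x) (norm y)" using st by (metis distrib_right mult_1)
    also have "\<dots> < r" using x y by auto
    finally show ?thesis .
  qed
  moreover have "\<kappa> * norm ?z \<le> Im (v * ?z)" using 1 mult_left_mono[OF le, of \<kappa>] assms by linarith
  ultimately show "?z \<in> {z. 0 < norm z \<and> norm z < r \<and> \<kappa> * norm z \<le> Im (v * z)}" using le by auto
qed

text \<open>Both half cones are connected and clear, so \<open>shade\<close> is constant on each,
  and \<open>shade_jump\<close> makes the two constants opposite. Thus any direction with a definite
  normal component can be used to read off \<open>left_shade\<close>.\<close>

lemma left_shade_cone: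
  assumes x: "regular x" and \<kappa>: "0 < \<kappa>"
  obtains r where "0 < r"
    "\<And>z. \<lbrakk>0 < norm z; norm z < r; \<kappa> * norm z \<le> Im (cnj (velocity T x) * z)\<rbrakk> \<Longrightarrow>
       pt T x + z \<in> clear_region \<and> shade (pt T x + z) = left_shade x"
    "\<And>z. \<lbrakk>0 < norm z; norm z < r; Im (cnj (velocity T x) * z) \<le> - (\<kappa> * norm z)\<rbrakk> \<Longrightarrow>
       pt T x + z \<in> clear_region \<and> shade (pt T x + z) = - left_shade x"
proof -
  define w where "w = velocity T x"
  have w: "w \<noteq> 0" using x velocity_nz by (auto simp: w_def regular_def)
  \<comment> \<open>At most \<open>norm w\<close>, so that the normal \<open>\<i> * w\<close> itself
    points into the cone.\<close>
  define k where "k = min \<kappa> (norm w)"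
  have k: "0 < k" using \<kappa> w by (simp add: k_def)
  obtain r where r: "0 < r"
    "\<And>z. \<lbrakk>0 < norm z; norm z < r; k * norm z \<le> \<bar>Im (cnj w * z)\<bar>\<rbrakk> \<Longrightarrow> pt T x + z \<in> clear_region"
    using cone_clear[OF x k] unfolding w_def by blast
  define C where "C v = (\<lambda>z. pt T x + z) ` {z. 0 < norm z \<and> norm z < r \<and> k * norm z \<le> Im (v * z)}" for v
  have conn: "connected (C v)" for v
    unfolding C_def using convex_cone_section[OF k]
    by (intro connected_continuous_image continuous_intros convex_connected)
  have sub: "C (cnj w) \<subseteq> clear_region" "C (- cnj w) \<subseteq> clear_region"
    using r(2) by (auto simp: C_def)
  have in1: "pt T x + z \<in> C (cnj w)" if "0 < norm z" "norm z < r" "k * norm z \<le> Im (cnj w * z)" for z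
    using that by (auto simp: C_def)
  have in2: "pt T x + z \<in> C (- cnj w)" if "0 < norm z" "norm z < r" "Im (cnj w * z) \<le> - (k * norm z)" for z
    using that by (auto simp: C_def)
  have wi: "cnj w * (of_real \<epsilon> * (\<i> * w)) = of_real (\<epsilon> * (norm w)\<^sup>2) * \<i>" for \<epsilon>
    using complex_norm_square[of w] by (simp add: mult_ac)
  have ev: "\<forall>\<^sub>F \<epsilon> in at_right 0. 0 < \<epsilon> \<and> \<epsilon> < r / norm w"
    using r w by (intro eventually_at_right_0) auto
  have "\<forall>\<^sub>F \<epsilon> in at_right 0. pt T x + of_real \<epsilon> * (\<i> * w) \<in> C (cnj w) \<and>
          pt T x - of_real \<epsilon> * (\<i> * w) \<in> C (- cnj w)"
    using ev
  proof eventually_elim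
    case (elim \<epsilon>)
    define z where "z = of_real \<epsilon> * (\<i> * w)"
    have nz: "norm z = \<epsilon> * norm w" using elim by (simp add: z_def norm_mult)
    then have z1: "0 < norm z" "norm z < r" using elim w by (auto simp: field_simps)
    have "Im (cnj w * z) = \<epsilon> * (norm w)\<^sup>2" unfolding z_def wi by simp
    then have Imz: "Im (cnj w * z) = norm w * norm z" by (simp add: nz power2_eq_square)
    have "k * norm z \<le> norm w * norm z" by (intro mult_right_mono) (auto simp: k_def)
    then have "pt T x + z \<in> C (cnj w)" using z1 Imz by (intro in1) auto
    moreover have "pt T x + (- z) \<in> C (- cnj w)"
      using z1 Imz \<open>k * norm z \<le> norm w * norm z\<close> by (intro in2) (auto simp del: mult_minus_right simp: mult_minus_right[of "cnj w"])
    ultimately show ?case by (simp add: z_def)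
  qed
  then obtain \<epsilon>0 where \<epsilon>0: "pt T x + of_real \<epsilon>0 * (\<i> * w) \<in> C (cnj w)"
      "pt T x - of_real \<epsilon>0 * (\<i> * w) \<in> C (- cnj w)"
      "shade (pt T x + of_real \<epsilon>0 * (\<i> * w)) = - shade (pt T x - of_real \<epsilon>0 * (\<i> * w))"
    using eventually_conj[OF _ shade_jump[OF x, folded w_def], THEN eventually_happens'[OF trivial_limit_at_right_real]]
    by blast
  define c where "c = shade (pt T x + of_real \<epsilon>0 * (\<i> * w))"
  have c1: "shade z = c" if "z \<in> C (cnj w)" for z
    unfolding c_def using shade_constant[OF conn sub(1) that \<epsilon>0(1)] .
  have c2: "shade z = - c" if "z \<in> C (- cnj w)" for z
    unfolding c_def using shade_constant[OF conn sub(2) that \<epsilon>0(2)] \<epsilon>0(3) by simp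
  have "\<forall>\<^sub>F \<epsilon> in at_right 0. shade (pt T x + of_real \<epsilon> * (\<i> * w)) = c"
    using \<open>\<forall>\<^sub>F \<epsilon> in at_right 0. _ \<in> C (cnj w) \<and> _\<close> by eventually_elim (simp add: c1)
  then have ls: "\<forall>\<^sub>F \<epsilon> in at_right 0. shade (pt T x + of_real \<epsilon> * (\<i> * w)) = left_shade x"
    unfolding left_shade_def w_def by (rule someI)
  have "left_shade x = c"
  proof -
    have "\<forall>\<^sub>F \<epsilon> in at_right (0::real). left_shade x = c"
      using ls \<open>\<forall>\<^sub>F \<epsilon> in at_right 0. shade _ = c\<close> by eventually_elim simp
    then show ?thesis by simp
  qed
  have le: "k * norm z \<le> \<kappa> * norm z" for z :: complex by (intro mult_right_mono) (auto simp: k_def)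
  show ?thesis
  proof (rule that[OF r(1)])
    fix z assume z: "0 < norm z" "norm z < r" "\<kappa> * norm z \<le> Im (cnj (velocity T x) * z)"
    then have "k * norm z \<le> Im (cnj w * z)" using le[of z] unfolding w_def by linarith
    then have "pt T x + z \<in> C (cnj w)" using z by (intro in1)
    then show "pt T x + z \<in> clear_region \<and> shade (pt T x + z) = left_shade x"
      using c1 sub \<open>left_shade x = c\<close> by auto
  next
    fix z assume z: "0 < norm z" "norm z < r" "Im (cnj (velocity T x) * z) \<le> - (\<kappa> * norm z)"
    then have "Im (cnj w * z) \<le> - (k * norm z)" using le[of z] unfolding w_def by linarith
    then have "pt T x + z \<in> C (- cnj w)" using z by (intro in2)
    then show "pt T x + z \<in> clear_region \<and> shade (pt T x + z) = - left_shade x"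
      using c2 sub \<open>left_shade x = c\<close> by auto
  qed
qed

lemma velocity_near:
  assumes "(i, t) \<in> params m" "0 < \<kappa>"
  obtains \<eta> where "0 < \<eta>"
    "\<And>t'. t' \<in> {0..1} \<Longrightarrow> \<bar>t' - t\<bar> < \<eta> \<Longrightarrow> norm (velocity T (i, t') - velocity T (i, t)) < \<kappa>"
proof -
  have i: "i < m" "t \<in> {0..1}" using assms by (auto simp: params_def)
  have "continuous_on {0..1} (\<lambda>t. velocity T (i, t))"
    using C1[OF i(1)] by (simp add: C1_differentiable_on_eq velocity_def)
  then have "\<exists>d>0. \<forall>t'\<in>{0..1}. dist t' t < d \<longrightarrow> dist (velocity T (i, t')) (velocity T (i, t)) < \<kappa>"
    using i(2) assms(2) unfolding continuous_on_iff by blast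
  then show ?thesis using that by (auto simp: dist_norm)
qed

lemma left_shade_values: "regular x \<Longrightarrow> left_shade x \<in> {1, -1}"
proof -
  assume x: "regular x"
  define w where "w = velocity T x"
  have w: "w \<noteq> 0" using x velocity_nz by (auto simp: w_def regular_def)
  then have "0 < norm w" by simp
  obtain r where r: "0 < r" "\<And>z. \<lbrakk>0 < norm z; norm z < r; norm w * norm z \<le> Im (cnj w * z)\<rbrakk> \<Longrightarrow>
       pt T x + z \<in> clear_region \<and> shade (pt T x + z) = left_shade x"
    using left_shade_cone[OF x \<open>0 < norm w\<close>] unfolding w_def by metis
  define \<epsilon> where "\<epsilon> = r / (2 * norm w)"
  define z where "z = of_real \<epsilon> * (\<i> * w)"
  have \<epsilon>: "0 < \<epsilon>" "\<epsilon> * norm w = r / 2" using w r by (auto simp: \<epsilon>_def)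
  have nz: "norm z = r / 2" using \<epsilon> by (simp add: z_def norm_mult)
  have "cnj w * z = of_real (\<epsilon> * (norm w)\<^sup>2) * \<i>"
    using complex_norm_square[of w] by (simp add: z_def mult_ac)
  moreover have "Im (of_real A * \<i>) = A" for A by simp
  ultimately have "Im (cnj w * z) = \<epsilon> * (norm w)\<^sup>2" by (simp only:)
  then have "Im (cnj w * z) = norm w * norm z" unfolding nz \<epsilon>(2)[symmetric] by (simp only: power2_eq_square mult_ac)
  moreover have "0 < norm z" "norm z < r" using nz r(1) by auto
  ultimately have "pt T x + z \<in> clear_region \<and> shade (pt T x + z) = left_shade x"
    by (intro r(2)) simp_all
  then show "left_shade x \<in> {1, -1}" using shade_values by metis
qed

text \<open>The strip between the string and its translate to the left is connected.\<close>

lemma left_shade_locally_constant: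
  assumes x: "regular (i, t)"
  obtains \<eta> where "0 < \<eta>" "\<And>t'. \<bar>t' - t\<bar> < \<eta> \<Longrightarrow> regular (i, t') \<and> left_shade (i, t') = left_shade (i, t)"
proof -
  define w where "w = velocity T (i, t)"
  define n where "n = \<i> * w"
  have xp: "(i, t) \<in> params m" "\<And>y. \<not> crossing m T (i, t) y" using x by (auto simp: regular_def)
  have i: "i < m" and t: "t \<in> {0<..<1}" using x by (auto simp: regular_def params_def endpoints_def)
  have w: "w \<noteq> 0" using xp velocity_nz by (simp add: w_def)
  then have w2: "0 < norm w / 2" by simp
  obtain r \<eta>1 where lf: "0 < r" "0 < \<eta>1"
    "\<And>y t'. \<lbrakk>y \<in> params m; t' \<in> {0..1}; \<bar>t' - t\<bar> < \<eta>1; norm (pt T y - strand T i t') < r\<rbrakk> \<Longrightarrow>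
      fst y = i \<and> norm (pt T y - strand T i t' - (snd y - t') *\<^sub>R w) \<le> norm w / 2 * \<bar>snd y - t'\<bar>"
    using local_form[OF xp w2] unfolding w_def by blast
  obtain \<eta>2 where reg: "0 < \<eta>2" "\<And>t'. t' \<in> {0<..<1} \<Longrightarrow> \<bar>t' - t\<bar> < \<eta>2 \<Longrightarrow> regular (i, t')"
    using regular_near[OF xp] by blast
  obtain \<eta>3 where vel: "0 < \<eta>3"
    "\<And>t'. t' \<in> {0..1} \<Longrightarrow> \<bar>t' - t\<bar> < \<eta>3 \<Longrightarrow> norm (velocity T (i, t') - w) < norm w / 2"
    using velocity_near[OF xp(1) w2] unfolding w_def by blast
  define d where "d = (1 - norm (strand T i t)) / 2"
  have d: "0 < d" using norm_pt_less[of "(i, t)"] x by (simp add: d_def regular_def pt_def)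
  have "\<exists>\<eta>>0. \<forall>t'\<in>{0..1}. dist t' t < \<eta> \<longrightarrow> dist (strand T i t') (strand T i t) < d"
  proof -
    have "t \<in> {0..1}" using t by auto
    then show ?thesis using strand_continuous[OF i] d unfolding continuous_on_iff by blast
  qed
  then obtain \<eta>4 where \<eta>4: "0 < \<eta>4" "\<And>t'. t' \<in> {0..1} \<Longrightarrow> \<bar>t' - t\<bar> < \<eta>4 \<Longrightarrow> norm (strand T i t' - strand T i t) < d"
    by (auto simp: dist_norm)
  define \<eta> where "\<eta> = Min {\<eta>1, \<eta>2, \<eta>3, \<eta>4, t, 1 - t}"
  have \<eta>0: "0 < \<eta>" using lf(2) reg(1) vel(1) \<eta>4(1) t by (simp add: \<eta>_def)
  have \<eta>: "\<eta> \<le> \<eta>1" "\<eta> \<le> \<eta>2" "\<eta> \<le> \<eta>3" "\<eta> \<le> \<eta>4" "\<eta> \<le> t" "\<eta> \<le> 1 - t"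
    by (simp_all only: \<eta>_def Min_le finite.intros insert_iff refl simp_thms)
  define \<epsilon>0 where "\<epsilon>0 = min r d / norm w"
  have \<epsilon>0: "0 < \<epsilon>0" using lf(1) d w by (simp add: \<epsilon>0_def)
  define S where "S = (\<lambda>(t', \<epsilon>). strand T i t' + of_real \<epsilon> * n) ` (ball t \<eta> \<times> {0<..<\<epsilon>0})"
  have t'01: "t' \<in> {0<..<1}" if "\<bar>t' - t\<bar> < \<eta>" for t' using that \<eta> by (auto simp: abs_less_iff)
  have "continuous_on (ball t \<eta> \<times> {0<..<\<epsilon>0}) (\<lambda>(t', \<epsilon>). strand T i t' + of_real \<epsilon> * n)"
    unfolding case_prod_beta
  proof (intro continuous_intros continuous_on_compose2[OF strand_continuous[OF i]])
    show "fst ` (ball t \<eta> \<times> {0<..<\<epsilon>0}) \<subseteq> {0..1}"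
      using t'01 by (fastforce simp: dist_real_def abs_minus_commute)
  qed
  then have conn: "connected S"
    unfolding S_def by (intro connected_continuous_image convex_connected convex_Times) auto
  have sub: "S \<subseteq> clear_region"
  proof
    fix z assume "z \<in> S"
    then obtain t' \<epsilon> where z: "z = strand T i t' + of_real \<epsilon> * n" "\<bar>t' - t\<bar> < \<eta>" "0 < \<epsilon>" "\<epsilon> < \<epsilon>0"
      by (auto simp: S_def dist_real_def abs_minus_commute)
    have n: "norm (of_real \<epsilon> * n) = \<epsilon> * norm w" using z by (simp add: n_def norm_mult)
    have nlt: "\<epsilon> * norm w < r" "\<epsilon> * norm w < d" using z w by (auto simp: \<epsilon>0_def field_simps)
    have "z \<notin> pt T ` params m"
    proof
      assume "z \<in> pt T ` params m"
      then obtain y where y: "y \<in> params m" "pt T y = z" by auto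
      define s where "s = snd y - t'"
      have "norm (of_real \<epsilon> * n - s *\<^sub>R w) \<le> norm w / 2 * \<bar>s\<bar>"
        using lf(3)[of y t'] y z t'01[OF z(2)] \<eta> n nlt by (auto simp: s_def)
      \<comment> \<open>The displacement to the left is orthogonal to the motion along the string,
        so their difference is at least \<open>norm w * \<bar>s\<bar>\<close> long; against the
        bound \<open>norm w / 2 * \<bar>s\<bar>\<close> this leaves only
        \<open>\<epsilon> = 0\<close>.\<close>
      moreover have "of_real \<epsilon> * n - s *\<^sub>R w = w * Complex (- s) \<epsilon>"
        by (simp add: n_def scaleR_conv_of_real complex_eq_iff)
      moreover have "\<bar>s\<bar> \<le> norm (Complex (- s) \<epsilon>)" using abs_Re_le_cmod[of "Complex (- s) \<epsilon>"] by simp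
      ultimately have *: "norm w * norm (Complex (- s) \<epsilon>) \<le> norm w * (\<bar>s\<bar> / 2)" by (simp add: norm_mult)
      then have "norm (Complex (- s) \<epsilon>) \<le> \<bar>s\<bar> / 2" using w by simp
      with \<open>\<bar>s\<bar> \<le> norm (Complex (- s) \<epsilon>)\<close> have "norm (Complex (- s) \<epsilon>) \<le> 0" by linarith
      then have "Complex (- s) \<epsilon> = 0" by simp
      then show False using z(3) by (simp add: complex_eq_iff)
    qed
    moreover have "norm z < 1"
    proof -
      have "norm z \<le> norm (strand T i t' - strand T i t) + norm (strand T i t) + norm (of_real \<epsilon> * n)"
        using norm_triangle_ineq[of "strand T i t'" "of_real \<epsilon> * n"]
          norm_triangle_ineq[of "strand T i t' - strand T i t" "strand T i t"] by (simp add: z(1))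
      also have "\<dots> < d + norm (strand T i t) + d"
        using \<eta>4(2)[of t'] z t'01[OF z(2)] \<eta> n nlt by auto
      finally show ?thesis by (simp add: d_def)
    qed
    ultimately show "z \<in> clear_region" by (rule clear_regionI)
  qed
  have reg': "regular (i, t')" if "\<bar>t' - t\<bar> < \<eta>" for t' using reg(2)[of t'] t'01[OF that] that \<eta> by auto
  \<comment> \<open>The strip uses the normal \<open>n\<close> of the point \<open>t\<close>
    throughout. For nearby \<open>t'\<close> the velocity differs from \<open>w\<close> by less than
    \<open>norm w / 2\<close>, so \<open>n\<close> still points to the left of the string
    there.\<close>
  have ls: "\<exists>z\<in>S. left_shade (i, t') = shade z" if t': "\<bar>t' - t\<bar> < \<eta>" for t'
  proof -
    define v where "v = velocity T (i, t')"
    have v: "norm (v - w) < norm w / 2" using vel(2)[of t'] t' t'01[OF t'] \<eta> by (auto simp: v_def)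
    have "cnj v * n = cnj (v - w) * n + of_real ((norm w)\<^sup>2) * \<i>"
      using complex_norm_square[of w] by (simp add: n_def algebra_simps)
    then have "Im (cnj v * n) = Im (cnj (v - w) * n) + (norm w)\<^sup>2" by simp
    moreover have "\<bar>Im (cnj (v - w) * n)\<bar> \<le> norm (v - w) * norm w"
      using abs_Im_le_cmod[of "cnj (v - w) * n"] by (simp add: norm_mult n_def del: complex_cnj_diff)
    moreover have "norm (v - w) * norm w \<le> norm w / 2 * norm w" using v by (intro mult_right_mono) auto
    ultimately have *: "norm w / 2 * norm n \<le> Im (cnj v * n)" by (simp add: power2_eq_square n_def norm_mult)
    obtain \<rho> where \<rho>: "0 < \<rho>" "\<And>z. \<lbrakk>0 < norm z; norm z < \<rho>; norm w / 2 * norm z \<le> Im (cnj v * z)\<rbrakk> \<Longrightarrow>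
       pt T (i, t') + z \<in> clear_region \<and> shade (pt T (i, t') + z) = left_shade (i, t')"
      using left_shade_cone[OF reg'[OF t'] w2] unfolding v_def by metis
    define \<epsilon> where "\<epsilon> = min (\<rho> / norm w) \<epsilon>0 / 2"
    have "0 < \<rho> / norm w" using \<rho>(1) w by simp
    then have "0 < \<epsilon> \<and> \<epsilon> < \<epsilon>0 \<and> \<epsilon> < \<rho> / norm w" using \<epsilon>0 unfolding \<epsilon>_def min_def by argo
    then have \<epsilon>: "0 < \<epsilon>" "\<epsilon> < \<epsilon>0" "\<epsilon> < \<rho> / norm w" by blast+
    have nn: "norm (of_real \<epsilon> * n) = \<epsilon> * norm w" using \<epsilon> by (simp add: n_def norm_mult)
    have "Im (cnj v * (of_real \<epsilon> * n)) = \<epsilon> * Im (cnj v * n)" by (simp add: algebra_simps)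
    moreover have "norm w / 2 * norm (of_real \<epsilon> * n) = \<epsilon> * (norm w / 2 * norm n)"
      using nn by (simp add: n_def norm_mult)
    ultimately have "norm w / 2 * norm (of_real \<epsilon> * n) \<le> Im (cnj v * (of_real \<epsilon> * n))"
      using mult_left_mono[OF *, of \<epsilon>] \<epsilon>(1) by linarith
    moreover have "0 < norm (of_real \<epsilon> * n)" "norm (of_real \<epsilon> * n) < \<rho>"
      unfolding nn using \<epsilon> w by (simp_all add: pos_less_divide_eq)
    ultimately have "left_shade (i, t') = shade (strand T i t' + of_real \<epsilon> * n)"
      using \<rho>(2)[of "of_real \<epsilon> * n"] by (simp only: pt_def fst_conv snd_conv)
    moreover have "strand T i t' + of_real \<epsilon> * n \<in> S"
      using t' \<epsilon> by (auto simp: S_def dist_real_def abs_minus_commute intro!: image_eqI[of _ _ "(t', \<epsilon>)"])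
    ultimately show ?thesis by blast
  qed
  show ?thesis
  proof (rule that[OF \<eta>0])
    fix t' assume t': "\<bar>t' - t\<bar> < \<eta>"
    obtain z where "z \<in> S" "left_shade (i, t') = shade z" using ls[OF t'] by blast
    moreover obtain z' where "z' \<in> S" "left_shade (i, t) = shade z'" using ls[of t] \<eta>0 by auto
    ultimately show "regular (i, t') \<and> left_shade (i, t') = left_shade (i, t)"
      using shade_constant[OF conn sub] reg'[OF t'] by metis
  qed
qed

subsection \<open>Crossings\<close>

lemma crossing_interior:
  assumes "crossing m T x y"
  shows "x \<in> params m - endpoints m" "y \<in> params m - endpoints m"
  using assms endpoint_not_crossing[of x y] endpoint_not_crossing[of y x] crossing_sym[of x y]
  unfolding crossing_def by blast+

text \<open>The counterpart of \<open>local_form\<close> at a crossing: two nearly straight pieces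
  and nothing else, because only two parameters share the point. The pieces may belong to the same
  string.\<close>

lemma crossing_local_form:
  assumes c: "crossing m T (i, t0) (j, t1)" and \<kappa>: "0 < \<kappa>"
  obtains r \<delta> where "0 < r" "0 < \<delta>" "\<delta> \<le> t0" "\<delta> \<le> 1 - t0" "\<delta> \<le> t1" "\<delta> \<le> 1 - t1"
    "\<And>s t. \<bar>s - t0\<bar> < \<delta> \<Longrightarrow> \<bar>t - t0\<bar> < \<delta> \<Longrightarrow>
       norm (strand T i s - strand T i t - (s - t) *\<^sub>R velocity T (i, t0)) \<le> \<kappa> * \<bar>s - t\<bar>"
    "\<And>s t. \<bar>s - t1\<bar> < \<delta> \<Longrightarrow> \<bar>t - t1\<bar> < \<delta> \<Longrightarrow>
       norm (strand T j s - strand T j t - (s - t) *\<^sub>R velocity T (j, t1)) \<le> \<kappa> * \<bar>s - t\<bar>"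
    "\<And>y. y \<in> params m \<Longrightarrow> norm (pt T y - strand T i t0) < r \<Longrightarrow>
       fst y = i \<and> \<bar>snd y - t0\<bar> < \<delta> \<or> fst y = j \<and> \<bar>snd y - t1\<bar> < \<delta>"
proof -
  have ij: "i < m" "j < m" and t: "0 < t0" "t0 < 1" "0 < t1" "t1 < 1"
    using crossing_interior[OF c] by (auto simp: params_def endpoints_def)
  have t01: "t0 \<in> {0..1}" "t1 \<in> {0..1}" using t by auto
  obtain \<delta>1 where d1: "0 < \<delta>1" "\<And>s t. \<lbrakk>s \<in> {0..1}; t \<in> {0..1}; \<bar>s - t0\<bar> < \<delta>1; \<bar>t - t0\<bar> < \<delta>1\<rbrakk> \<Longrightarrow>
       norm (strand T i s - strand T i t - (s - t) *\<^sub>R velocity T (i, t0)) \<le> \<kappa> * \<bar>s - t\<bar>"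
    using C1_strong_derivative[OF C1[OF ij(1)] t01(1) \<kappa>] unfolding velocity_def fst_conv snd_conv by metis
  obtain \<delta>2 where d2: "0 < \<delta>2" "\<And>s t. \<lbrakk>s \<in> {0..1}; t \<in> {0..1}; \<bar>s - t1\<bar> < \<delta>2; \<bar>t - t1\<bar> < \<delta>2\<rbrakk> \<Longrightarrow>
       norm (strand T j s - strand T j t - (s - t) *\<^sub>R velocity T (j, t1)) \<le> \<kappa> * \<bar>s - t\<bar>"
    using C1_strong_derivative[OF C1[OF ij(2)] t01(2) \<kappa>] unfolding velocity_def fst_conv snd_conv by metis
  define \<delta> where "\<delta> = Min {\<delta>1, \<delta>2, t0, 1 - t0, t1, 1 - t1}"
  have \<delta>0: "0 < \<delta>" using d1(1) d2(1) t by (simp add: \<delta>_def)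
  have \<delta>: "\<delta> \<le> \<delta>1" "\<delta> \<le> \<delta>2" "\<delta> \<le> t0" "\<delta> \<le> 1 - t0" "\<delta> \<le> t1" "\<delta> \<le> 1 - t1"
    by (simp_all only: \<delta>_def Min_le finite.intros insert_iff refl simp_thms)
  let ?U = "{i} \<times> ball t0 \<delta> \<union> {j} \<times> ball t1 \<delta>"
  have "open ?U" by (intro open_Un open_Times open_ball) (simp_all add: open_discrete)
  moreover have "y \<in> ?U" if "y \<in> params m" "pt T y = strand T i t0" for y
  proof (cases "y = (i, t0)")
    case False
    then have "crossing m T (i, t0) y" using that c by (auto simp: crossing_def pt_def)
    then have "y = (j, t1)" using crossing_unique[OF c] by auto
    then show ?thesis using \<delta>0 by simp
  qed (use \<delta>0 in simp)
  ultimately obtain r where r: "0 < r" "\<And>y. y \<in> params m \<Longrightarrow> norm (pt T y - strand T i t0) < r \<Longrightarrow> y \<in> ?U"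
    using preimage_nbhd[of ?U "strand T i t0"] by blast
  have in01: "s \<in> {0..1}" if "\<bar>s - t0\<bar> < \<delta> \<or> \<bar>s - t1\<bar> < \<delta>" for s using that \<delta> by (auto simp: abs_less_iff)
  show ?thesis
  proof (rule that[OF r(1) \<delta>0 \<delta>(3-6)])
    fix s t assume "\<bar>s - t0\<bar> < \<delta>" "\<bar>t - t0\<bar> < \<delta>"
    then show "norm (strand T i s - strand T i t - (s - t) *\<^sub>R velocity T (i, t0)) \<le> \<kappa> * \<bar>s - t\<bar>"
      using \<delta>(1) in01 by (intro d1(2)) auto
  next
    fix s t assume "\<bar>s - t1\<bar> < \<delta>" "\<bar>t - t1\<bar> < \<delta>"
    then show "norm (strand T j s - strand T j t - (s - t) *\<^sub>R velocity T (j, t1)) \<le> \<kappa> * \<bar>s - t\<bar>"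
      using \<delta>(2) in01 by (intro d2(2)) auto
  next
    fix y assume "y \<in> params m" "norm (pt T y - strand T i t0) < r"
    from r(2)[OF this] show "fst y = i \<and> \<bar>snd y - t0\<bar> < \<delta> \<or> fst y = j \<and> \<bar>snd y - t1\<bar> < \<delta>"
      by (auto simp: dist_real_def abs_minus_commute)
  qed
qed

text \<open>The sum of the two displacements serves as a local chart: it maps the axes
  \<open>\<tau> = 0\<close> and \<open>\<sigma> = 0\<close> to the two strings and is a small
  perturbation of an injective linear map. Points off both axes therefore miss the diagram, and no
  further crossing lies on string \<open>i\<close> nearby.\<close>

lemma crossing_quadrants:
  assumes c: "crossing m T (i, t0) (j, t1)"
  obtains \<eta> where "0 < \<eta>"
    "\<And>\<sigma> \<tau>. \<lbrakk>0 < \<bar>\<sigma>\<bar>; \<bar>\<sigma>\<bar> < \<eta>; 0 < \<bar>\<tau>\<bar>; \<bar>\<tau>\<bar> < \<eta>\<rbrakk> \<Longrightarrow>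
       strand T i (t0 + \<sigma>) + strand T j (t1 + \<tau>) - strand T i t0 \<in> clear_region"
    "\<And>\<sigma>. 0 < \<bar>\<sigma>\<bar> \<Longrightarrow> \<bar>\<sigma>\<bar> < \<eta> \<Longrightarrow> t0 + \<sigma> \<in> {0<..<1} \<and> t1 + \<sigma> \<in> {0<..<1} \<and> regular (i, t0 + \<sigma>)"
proof -
  define a where "a = velocity T (i, t0)"
  define b where "b = velocity T (j, t1)"
  define P where "P = strand T i t0"
  have P: "P = strand T j t1" using c by (simp add: crossing_def P_def pt_def)
  have im: "i < m" using c by (auto simp: crossing_def params_def)
  have nP: "norm P < 1" using crossing_interior[OF c] norm_pt_less by (auto simp: P_def pt_def)
  have "Im (cnj a * b) \<noteq> 0" using transversal[OF c] by (simp add: a_def b_def)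
  then obtain k where k: "0 < k" "\<And>x y. k * (\<bar>x\<bar> + \<bar>y\<bar>) \<le> norm (x *\<^sub>R a + y *\<^sub>R b)"
    using linear_independent_bound by blast
  have ka: "k \<le> norm a" "k \<le> norm b" using k(2)[of 1 0] k(2)[of 0 1] by auto
  have k2: "0 < k / 2" using k by simp
  obtain r \<delta> where r: "0 < r" and d: "0 < \<delta>" "\<delta> \<le> t0" "\<delta> \<le> 1 - t0" "\<delta> \<le> t1" "\<delta> \<le> 1 - t1"
    and di: "\<And>s t. \<bar>s - t0\<bar> < \<delta> \<Longrightarrow> \<bar>t - t0\<bar> < \<delta> \<Longrightarrow>
       norm (strand T i s - strand T i t - (s - t) *\<^sub>R a) \<le> k / 2 * \<bar>s - t\<bar>"
    and dj: "\<And>s t. \<bar>s - t1\<bar> < \<delta> \<Longrightarrow> \<bar>t - t1\<bar> < \<delta> \<Longrightarrow>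
       norm (strand T j s - strand T j t - (s - t) *\<^sub>R b) \<le> k / 2 * \<bar>s - t\<bar>"
    and near: "\<And>y. y \<in> params m \<Longrightarrow> norm (pt T y - P) < r \<Longrightarrow>
       fst y = i \<and> \<bar>snd y - t0\<bar> < \<delta> \<or> fst y = j \<and> \<bar>snd y - t1\<bar> < \<delta>"
    using crossing_local_form[OF c k2] unfolding a_def b_def P_def by blast
  define M where "M = norm a + norm b + k"
  define \<rho> where "\<rho> = min r (1 - norm P)"
  \<comment> \<open>Each displacement has length at most \<open>\<bar>\<sigma>\<bar> * M\<close>,
    hence below \<open>\<rho> / 2\<close>; the sum of two keeps the point inside the disk and in the
    ball where \<open>near\<close> applies.\<close>
  define \<eta> where "\<eta> = min \<delta> (\<rho> / (3 * M))"
  have M: "0 < M" using k by (simp add: M_def add_nonneg_pos)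
  have \<rho>: "0 < \<rho>" using r nP by (simp add: \<rho>_def)
  have \<eta>: "0 < \<eta>" "\<eta> \<le> \<delta>" "\<eta> \<le> \<rho> / (3 * M)" using d(1) \<rho> M by (simp_all add: \<eta>_def)
  have small: "norm (v - s *\<^sub>R u) \<le> k / 2 * \<bar>s\<bar> \<Longrightarrow> \<bar>s\<bar> < \<eta> \<Longrightarrow> norm u \<le> norm a + norm b \<Longrightarrow> norm v < \<rho> / 2" for u v s
  proof -
    assume v: "norm (v - s *\<^sub>R u) \<le> k / 2 * \<bar>s\<bar>" and s: "\<bar>s\<bar> < \<eta>" and u: "norm u \<le> norm a + norm b"
    have "norm v \<le> norm (v - s *\<^sub>R u) + norm (s *\<^sub>R u)" using norm_triangle_sub by (metis add.commute)
    also have "\<dots> \<le> k / 2 * \<bar>s\<bar> + \<bar>s\<bar> * (norm a + norm b)"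
      using v u by (intro add_mono) (auto intro: mult_left_mono)
    also have "\<dots> \<le> \<bar>s\<bar> * M" using k(1) by (simp add: M_def algebra_simps)
    also have "\<dots> \<le> \<rho> / (3 * M) * M" using s \<eta>(3) M by (intro mult_right_mono) auto
    also have "\<dots> < \<rho> / 2" using M \<rho> by simp
    finally show "norm v < \<rho> / 2" .
  qed
  have ai: "norm (strand T i (t0 + \<sigma>) - P) < \<rho> / 2" if "\<bar>\<sigma>\<bar> < \<eta>" for \<sigma>
    using di[of "t0 + \<sigma>" t0] that \<eta> d(1) by (intro small[of _ \<sigma> a]) (auto simp: P_def)
  have aj: "norm (strand T j (t1 + \<tau>) - P) < \<rho> / 2" if "\<bar>\<tau>\<bar> < \<eta>" for \<tau>
    using dj[of "t1 + \<tau>" t1] that \<eta> d(1) by (intro small[of _ \<tau> b]) (auto simp: P)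
  show ?thesis
  proof (rule that[OF \<eta>(1)])
    fix \<sigma> \<tau> :: real assume s: "0 < \<bar>\<sigma>\<bar>" "\<bar>\<sigma>\<bar> < \<eta>" and u: "0 < \<bar>\<tau>\<bar>" "\<bar>\<tau>\<bar> < \<eta>"
    define z where "z = strand T i (t0 + \<sigma>) + strand T j (t1 + \<tau>) - P"
    have zP: "norm (z - P) < \<rho>"
      using norm_triangle_ineq[of "strand T i (t0 + \<sigma>) - P" "strand T j (t1 + \<tau>) - P"] ai[OF s(2)] aj[OF u(2)]
      by (simp add: z_def algebra_simps)
    have e1: "norm (strand T i (t0 + \<sigma>) - strand T i s' - (t0 + \<sigma> - s') *\<^sub>R a) \<le> k / 2 * \<bar>t0 + \<sigma> - s'\<bar>"
      if "\<bar>s' - t0\<bar> < \<delta>" for s' using di[of "t0 + \<sigma>" s'] that s \<eta> by auto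
    have e2: "norm (strand T j (t1 + \<tau>) - strand T j s' - (t1 + \<tau> - s') *\<^sub>R b) \<le> k / 2 * \<bar>t1 + \<tau> - s'\<bar>"
      if "\<bar>s' - t1\<bar> < \<delta>" for s' using dj[of "t1 + \<tau>" s'] that u \<eta> by auto
    \<comment> \<open>Linear independence in approximate form: errors bounded with half of the
      constant \<open>k\<close> cannot cancel a nonzero combination of \<open>a\<close> and
      \<open>b\<close>.\<close>
    have sum0: "x = 0 \<and> y = 0" if "u + v = 0" "norm (u - x *\<^sub>R a) \<le> k / 2 * \<bar>x\<bar>" "norm (v - y *\<^sub>R b) \<le> k / 2 * \<bar>y\<bar>" for u v x y
    proof -
      have "x *\<^sub>R a + y *\<^sub>R b = - ((u - x *\<^sub>R a) + (v - y *\<^sub>R b))" using that(1) by (simp add: algebra_simps)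
      then have "norm (x *\<^sub>R a + y *\<^sub>R b) \<le> norm (u - x *\<^sub>R a) + norm (v - y *\<^sub>R b)"
        by (metis norm_minus_cancel norm_triangle_ineq)
      also have "\<dots> \<le> k / 2 * (\<bar>x\<bar> + \<bar>y\<bar>)" using that by (simp add: algebra_simps)
      finally have "k * (\<bar>x\<bar> + \<bar>y\<bar>) \<le> k / 2 * (\<bar>x\<bar> + \<bar>y\<bar>)" using k(2)[of x y] by linarith
      then have "\<bar>x\<bar> + \<bar>y\<bar> \<le> 0" using k(1) by simp
      then have "\<bar>x\<bar> = 0" "\<bar>y\<bar> = 0" by linarith+
      then show ?thesis by simp
    qed
    have "z \<notin> pt T ` params m"
    proof
      assume "z \<in> pt T ` params m"
      then obtain y where y: "y \<in> params m" "pt T y = z" by auto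
      then have "norm (pt T y - P) < r" using zP by (simp add: \<rho>_def)
      from near[OF y(1) this] show False
      proof
        assume *: "fst y = i \<and> \<bar>snd y - t0\<bar> < \<delta>"
        then have "(strand T i (t0 + \<sigma>) - strand T i (snd y)) + (strand T j (t1 + \<tau>) - strand T j t1) = 0"
          using y by (simp add: pt_def z_def P)
        from sum0[OF this e1 e2] * d(1) u show False by auto
      next
        assume *: "fst y = j \<and> \<bar>snd y - t1\<bar> < \<delta>"
        then have "(strand T i (t0 + \<sigma>) - strand T i t0) + (strand T j (t1 + \<tau>) - strand T j (snd y)) = 0"
          using y by (simp add: pt_def z_def P_def)
        from sum0[OF this e1 e2] * d(1) s show False by auto
      qed
    qed
    moreover have "norm z < 1"
      using zP norm_triangle_sub[of z P] by (simp add: \<rho>_def)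
    ultimately show "strand T i (t0 + \<sigma>) + strand T j (t1 + \<tau>) - strand T i t0 \<in> clear_region"
      unfolding z_def P_def by (rule clear_regionI)
  next
    fix \<sigma> :: real assume s: "0 < \<bar>\<sigma>\<bar>" "\<bar>\<sigma>\<bar> < \<eta>"
    have t01: "t0 + \<sigma> \<in> {0<..<1}" "t1 + \<sigma> \<in> {0<..<1}" using s \<eta>(2) d by (auto simp: abs_less_iff)
    have "\<not> crossing m T (i, t0 + \<sigma>) y" for y
    proof
      assume cy: "crossing m T (i, t0 + \<sigma>) y"
      then have y: "y \<in> params m" "pt T y = strand T i (t0 + \<sigma>)" "y \<noteq> (i, t0 + \<sigma>)"
        by (auto simp: crossing_def pt_def)
      have "norm (pt T y - P) < \<rho> / 2" using ai[OF s(2)] y by simp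
      then have "norm (pt T y - P) < r" using \<rho> by (simp add: \<rho>_def)
      from near[OF y(1) this] show False
      proof
        assume *: "fst y = i \<and> \<bar>snd y - t0\<bar> < \<delta>"
        define x where "x = t0 + \<sigma> - snd y"
        have "norm (strand T i (t0 + \<sigma>) - strand T i (snd y) - x *\<^sub>R a) \<le> k / 2 * \<bar>x\<bar>"
          using di[of "t0 + \<sigma>" "snd y"] * s \<eta> by (auto simp: x_def)
        moreover have "strand T i (t0 + \<sigma>) - strand T i (snd y) = 0" using y * by (simp add: pt_def)
        ultimately have "\<bar>x\<bar> * norm a \<le> k / 2 * \<bar>x\<bar>" by simp
        moreover have "k * \<bar>x\<bar> \<le> norm a * \<bar>x\<bar>" using ka by (intro mult_right_mono) auto
        ultimately have "k * \<bar>x\<bar> \<le> 0" by (simp add: mult_ac)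
        then have "x = 0" using k(1) by (simp add: mult_le_0_iff)
        then show False using y(3) * by (metis x_def eq_iff_diff_eq_0 prod.collapse)
      next
        assume *: "fst y = j \<and> \<bar>snd y - t1\<bar> < \<delta>"
        define x where "x = snd y - t1"
        have 1: "norm (strand T i (t0 + \<sigma>) - P - \<sigma> *\<^sub>R a) \<le> k / 2 * \<bar>\<sigma>\<bar>"
          using di[of "t0 + \<sigma>" t0] s \<eta> d(1) by (simp add: P_def)
        have 2: "norm (strand T i (t0 + \<sigma>) - P - x *\<^sub>R b) \<le> k / 2 * \<bar>x\<bar>"
          using dj[of "snd y" t1] * d(1) y by (simp add: P x_def pt_def)
        have "\<sigma> *\<^sub>R a + (- x) *\<^sub>R b = (strand T i (t0 + \<sigma>) - P - x *\<^sub>R b) - (strand T i (t0 + \<sigma>) - P - \<sigma> *\<^sub>R a)"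
          by simp
        then have "norm (\<sigma> *\<^sub>R a + (- x) *\<^sub>R b) \<le> k / 2 * \<bar>x\<bar> + k / 2 * \<bar>\<sigma>\<bar>"
          using order_trans[OF norm_triangle_ineq4 add_mono[OF 2 1]] by (simp only:)
        then have "k * (\<bar>\<sigma>\<bar> + \<bar>x\<bar>) \<le> k / 2 * (\<bar>\<sigma>\<bar> + \<bar>x\<bar>)" using k(2)[of \<sigma> "- x"] by (simp add: algebra_simps)
        then have "\<bar>\<sigma>\<bar> + \<bar>x\<bar> \<le> 0" using k(1) by simp
        then show False using s(1) by linarith
      qed
    qed
    then show "t0 + \<sigma> \<in> {0<..<1} \<and> t1 + \<sigma> \<in> {0<..<1} \<and> regular (i, t0 + \<sigma>)"
      using t01 im by (auto simp: regular_def params_def endpoints_def)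
  qed
qed

text \<open>At parameters \<open>\<sigma>\<close> and \<open>\<tau>\<close> past a crossing the point \<open>\<gamma>\<^sub>i(t\<^sub>0 + \<sigma>) + \<gamma>\<^sub>j(t\<^sub>1 + \<tau>) - P\<close> lies in one of
  four quadrants according to the signs of \<open>\<sigma>\<close> and \<open>\<tau>\<close>. As \<open>\<tau>\<close> tends to 0, it approaches the first
  string from the side which depends on the sign of \<open>\<tau>\<close>.\<close>

lemma left_shade_crossing_side:
  assumes c: "crossing m T (i, t0) (j, t1)"
  defines "d \<equiv> Im (cnj (velocity T (i, t0)) * velocity T (j, t1))"
  obtains \<eta> where "0 < \<eta>" "\<And>\<sigma>. 0 < \<bar>\<sigma>\<bar> \<Longrightarrow> \<bar>\<sigma>\<bar> < \<eta> \<Longrightarrow> regular (i, t0 + \<sigma>) \<and> (\<exists>\<tau>0>0. \<forall>\<tau>. 0 < \<bar>\<tau>\<bar> \<longrightarrow> \<bar>\<tau>\<bar> < \<tau>0 \<longrightarrow>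
     shade (strand T i (t0 + \<sigma>) + strand T j (t1 + \<tau>) - strand T i t0) = of_real (sgn (d * \<tau>)) * left_shade (i, t0 + \<sigma>))"
proof -
  define a where "a = velocity T (i, t0)"
  define b where "b = velocity T (j, t1)"
  define P where "P = strand T i t0"
  have P: "P = strand T j t1" using c by (simp add: crossing_def P_def pt_def)
  have d: "d = Im (cnj a * b)" "d \<noteq> 0" using transversal[OF c] by (simp_all add: a_def b_def d_def)
  then have ab: "a \<noteq> 0" "b \<noteq> 0" by auto
  \<comment> \<open>The first bound yields
    \<open>norm z \<le> 2 * norm b * \<bar>\<tau>\<bar>\<close>. The second one, with the speed of
    string \<open>i\<close> at most doubled, keeps the error of the linear approximation of string
    \<open>j\<close> within a quarter of \<open>\<bar>\<tau> * d\<bar>\<close>.\<close>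
  define k where "k = min (norm b) (\<bar>d\<bar> / (8 * norm a))"
  have k: "0 < k" "k \<le> norm b" "k \<le> \<bar>d\<bar> / (8 * norm a)" using ab d by (simp_all add: k_def)
  obtain \<delta> where \<delta>: "0 < \<delta>" "\<And>s t. \<bar>s - t1\<bar> < \<delta> \<Longrightarrow> \<bar>t - t1\<bar> < \<delta> \<Longrightarrow>
       norm (strand T j s - strand T j t - (s - t) *\<^sub>R b) \<le> k * \<bar>s - t\<bar>"
    using crossing_local_form[OF c k(1)] unfolding b_def by metis
  obtain \<eta>1 where \<eta>1: "0 < \<eta>1" "\<And>\<sigma>. 0 < \<bar>\<sigma>\<bar> \<Longrightarrow> \<bar>\<sigma>\<bar> < \<eta>1 \<Longrightarrow>
      t0 + \<sigma> \<in> {0<..<1} \<and> t1 + \<sigma> \<in> {0<..<1} \<and> regular (i, t0 + \<sigma>)"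
    using crossing_quadrants[OF c] by metis
  have "0 < min (norm a) (\<bar>d\<bar> / (4 * norm b))" using ab d by simp
  then obtain \<eta>2 where \<eta>2: "0 < \<eta>2" "\<And>t. t \<in> {0..1} \<Longrightarrow> \<bar>t - t0\<bar> < \<eta>2 \<Longrightarrow>
      norm (velocity T (i, t) - a) < min (norm a) (\<bar>d\<bar> / (4 * norm b))"
    using velocity_near[of i t0] c unfolding a_def crossing_def by blast
  show ?thesis
  proof (rule that)
    show "0 < min \<eta>1 \<eta>2" using \<eta>1(1) \<eta>2(1) by simp
    fix \<sigma> :: real assume s: "0 < \<bar>\<sigma>\<bar>" "\<bar>\<sigma>\<bar> < min \<eta>1 \<eta>2"
    define v where "v = velocity T (i, t0 + \<sigma>)"
    have reg: "regular (i, t0 + \<sigma>)" and t01: "t0 + \<sigma> \<in> {0<..<1}" using \<eta>1(2)[of \<sigma>] s by auto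
    have v: "norm (v - a) < norm a" "norm (v - a) < \<bar>d\<bar> / (4 * norm b)"
      using \<eta>2(2)[of "t0 + \<sigma>"] s t01 by (auto simp: v_def)
    have nv: "norm v \<le> 2 * norm a" using norm_triangle_sub[of v a] v(1) by simp
    \<comment> \<open>The turning of string \<open>i\<close> and the approximation of string
      \<open>j\<close> each cost at most a quarter of \<open>\<bar>\<tau> * d\<bar>\<close>. The
      half that remains is what membership in a cone of slope \<open>k'\<close> requires.\<close>
    define k' where "k' = \<bar>d\<bar> / (4 * norm b)"
    have k': "0 < k'" using d ab by (simp add: k'_def)
    obtain r where r: "0 < r"
      "\<And>z. \<lbrakk>0 < norm z; norm z < r; k' * norm z \<le> Im (cnj v * z)\<rbrakk> \<Longrightarrow>
         pt T (i, t0 + \<sigma>) + z \<in> clear_region \<and> shade (pt T (i, t0 + \<sigma>) + z) = left_shade (i, t0 + \<sigma>)"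
      "\<And>z. \<lbrakk>0 < norm z; norm z < r; Im (cnj v * z) \<le> - (k' * norm z)\<rbrakk> \<Longrightarrow>
         pt T (i, t0 + \<sigma>) + z \<in> clear_region \<and> shade (pt T (i, t0 + \<sigma>) + z) = - left_shade (i, t0 + \<sigma>)"
      using left_shade_cone[OF reg k', folded v_def] by metis
    define \<tau>0 where "\<tau>0 = min \<delta> (r / (2 * norm b))"
    have \<tau>0: "0 < \<tau>0" using \<delta>(1) r(1) ab by (simp add: \<tau>0_def)
    have "shade (strand T i (t0 + \<sigma>) + strand T j (t1 + \<tau>) - strand T i t0) = of_real (sgn (d * \<tau>)) * left_shade (i, t0 + \<sigma>)"
      if \<tau>: "0 < \<bar>\<tau>\<bar>" "\<bar>\<tau>\<bar> < \<tau>0" for \<tau>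
    proof -
      define z where "z = strand T j (t1 + \<tau>) - P"
      define f where "f = z - \<tau> *\<^sub>R b"
      have f: "norm f \<le> k * \<bar>\<tau>\<bar>" using \<delta>(2)[of "t1 + \<tau>" t1] \<tau> \<delta>(1) by (simp add: f_def z_def P \<tau>0_def)
      have "norm z \<le> norm f + \<bar>\<tau>\<bar> * norm b" using norm_triangle_ineq[of f "\<tau> *\<^sub>R b"] by (simp add: f_def)
      moreover have "k * \<bar>\<tau>\<bar> \<le> norm b * \<bar>\<tau>\<bar>" using k by (intro mult_right_mono) auto
      ultimately have nz: "norm z \<le> 2 * norm b * \<bar>\<tau>\<bar>" using f by (simp add: algebra_simps)
      have "\<bar>\<tau>\<bar> < r / (2 * norm b)" using \<tau> by (simp add: \<tau>0_def)
      then have "2 * norm b * \<bar>\<tau>\<bar> < r" using ab by (simp add: field_simps)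
      then have zr: "norm z < r" using nz by simp
      have "cnj v * z = of_real \<tau> * (cnj a * b) + of_real \<tau> * (cnj (v - a) * b) + cnj v * f"
        by (simp add: f_def scaleR_conv_of_real algebra_simps)
      moreover have "Im (of_real x * y) = x * Im y" for x y by simp
      ultimately have Im: "Im (cnj v * z) = \<tau> * d + \<tau> * Im (cnj (v - a) * b) + Im (cnj v * f)"
        unfolding d(1) by (simp only: plus_complex.sel)
      have "\<bar>Im (cnj (v - a) * b)\<bar> \<le> norm (v - a) * norm b"
        using abs_Im_le_cmod[of "cnj (v - a) * b"] by (simp only: norm_mult complex_mod_cnj)
      also have "\<dots> \<le> \<bar>d\<bar> / (4 * norm b) * norm b" using v by (intro mult_right_mono) auto
      finally have 1: "\<bar>\<tau> * Im (cnj (v - a) * b)\<bar> \<le> \<bar>\<tau>\<bar> * (\<bar>d\<bar> / 4)"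
        unfolding abs_mult using ab by (intro mult_left_mono) auto
      have "\<bar>Im (cnj v * f)\<bar> \<le> norm v * norm f"
        using abs_Im_le_cmod[of "cnj v * f"] by (simp only: norm_mult complex_mod_cnj)
      also have "\<dots> \<le> (2 * norm a) * (k * \<bar>\<tau>\<bar>)" using nv f by (intro mult_mono) auto
      also have "\<dots> \<le> (2 * norm a) * (\<bar>d\<bar> / (8 * norm a) * \<bar>\<tau>\<bar>)"
        using k by (intro mult_left_mono mult_right_mono) auto
      also have "\<dots> = \<bar>\<tau>\<bar> * (\<bar>d\<bar> / 4)" using ab by simp
      finally have 2: "\<bar>Im (cnj v * f)\<bar> \<le> \<bar>\<tau>\<bar> * (\<bar>d\<bar> / 4)" .
      have "k' * norm z \<le> k' * (2 * norm b * \<bar>\<tau>\<bar>)" using nz k' by (intro mult_left_mono) auto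
      also have "\<dots> = \<bar>\<tau>\<bar> * \<bar>d\<bar> / 2" using ab by (simp add: k'_def)
      finally have 3: "k' * norm z \<le> \<bar>\<tau>\<bar> * \<bar>d\<bar> / 2" .
      have pos: "0 < \<bar>\<tau>\<bar> * \<bar>d\<bar>" using \<tau> d by simp
      have eq: "strand T i (t0 + \<sigma>) + strand T j (t1 + \<tau>) - strand T i t0 = pt T (i, t0 + \<sigma>) + z"
        by (simp add: z_def pt_def P_def)
      have "Im (cnj v * z) \<noteq> 0" using Im 1 2 pos by (cases "0 < \<tau> * d") (auto simp: abs_mult[symmetric] abs_if split: if_splits)
      then have z0: "0 < norm z" by auto
      have td: "\<bar>\<tau>\<bar> * \<bar>d\<bar> = \<bar>\<tau> * d\<bar>" by (simp add: abs_mult)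
      show ?thesis
      proof (cases "0 < \<tau> * d")
        case True
        then have "k' * norm z \<le> Im (cnj v * z)" using Im 1 2 3 td by linarith
        then have "shade (pt T (i, t0 + \<sigma>) + z) = left_shade (i, t0 + \<sigma>)" using z0 zr r(2) by blast
        moreover have "sgn (d * \<tau>) = 1" using True by (simp add: mult.commute)
        ultimately show ?thesis by (simp add: eq)
      next
        case False
        then have neg: "\<tau> * d < 0" using pos td by linarith
        then have "Im (cnj v * z) \<le> - (k' * norm z)" using Im 1 2 3 td by linarith
        then have "shade (pt T (i, t0 + \<sigma>) + z) = - left_shade (i, t0 + \<sigma>)" using z0 zr r(3) by blast
        moreover have "sgn (d * \<tau>) = -1" using neg by (simp add: mult.commute)
        ultimately show ?thesis by (simp add: eq)
      qed
    qed
    with \<tau>0 reg show "regular (i, t0 + \<sigma>) \<and> (\<exists>\<tau>0>0. \<forall>\<tau>. 0 < \<bar>\<tau>\<bar> \<longrightarrow> \<bar>\<tau>\<bar> < \<tau>0 \<longrightarrow>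
      shade (strand T i (t0 + \<sigma>) + strand T j (t1 + \<tau>) - strand T i t0) = of_real (sgn (d * \<tau>)) * left_shade (i, t0 + \<sigma>))"
      by blast
  qed
qed

text \<open>Let \<open>Q s1 s2\<close> be the sign of the quadrant with
  \<open>sgn \<sigma> = s1\<close> and \<open>sgn \<tau> = s2\<close>. Each quadrant borders on both
  strings, so \<open>Q s1 s2\<close> is the left sign of string \<open>i\<close> times
  \<open>sgn d * s2\<close> and also that of string \<open>j\<close> times
  \<open>- sgn d * s1\<close>. Comparing three quadrants determines all four left signs from
  one.\<close>

lemma left_shade_at_crossing:
  assumes c: "crossing m T (i, t0) (j, t1)"
  obtains q \<eta> where "0 < \<eta>"
    "\<And>\<sigma>. 0 < \<sigma> \<Longrightarrow> \<sigma> < \<eta> \<Longrightarrow> regular (i, t0 - \<sigma>) \<and> regular (i, t0 + \<sigma>) \<and> regular (j, t1 - \<sigma>) \<and> regular (j, t1 + \<sigma>) \<and>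
      left_shade (i, t0 - \<sigma>) = q \<and> left_shade (i, t0 + \<sigma>) = - q \<and> left_shade (j, t1 - \<sigma>) = - q \<and> left_shade (j, t1 + \<sigma>) = q"
proof -
  define P where "P = strand T i t0"
  define \<Phi> where "\<Phi> \<sigma> \<tau> = strand T i (t0 + \<sigma>) + strand T j (t1 + \<tau>) - P" for \<sigma> \<tau>
  have P: "P = strand T j t1" using c by (simp add: crossing_def P_def pt_def)
  have c': "crossing m T (j, t1) (i, t0)" using c crossing_sym by blast
  define d where "d = Im (cnj (velocity T (i, t0)) * velocity T (j, t1))"
  have d': "Im (cnj (velocity T (j, t1)) * velocity T (i, t0)) = - d" by (simp add: d_def)
  have d0: "d \<noteq> 0" using transversal[OF c] by (simp only: d_def not_False_eq_True)
  have ij: "i < m" "j < m" using c by (auto simp: crossing_def params_def)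
  obtain \<eta>0 where \<eta>0: "0 < \<eta>0"
    "\<And>\<sigma> \<tau>. \<lbrakk>0 < \<bar>\<sigma>\<bar>; \<bar>\<sigma>\<bar> < \<eta>0; 0 < \<bar>\<tau>\<bar>; \<bar>\<tau>\<bar> < \<eta>0\<rbrakk> \<Longrightarrow> \<Phi> \<sigma> \<tau> \<in> clear_region"
    "\<And>\<sigma>. 0 < \<bar>\<sigma>\<bar> \<Longrightarrow> \<bar>\<sigma>\<bar> < \<eta>0 \<Longrightarrow> t0 + \<sigma> \<in> {0<..<1} \<and> t1 + \<sigma> \<in> {0<..<1}"
    using crossing_quadrants[OF c] unfolding \<Phi>_def P_def by metis
  obtain \<eta>1 where \<eta>1: "0 < \<eta>1" "\<And>\<sigma>. 0 < \<bar>\<sigma>\<bar> \<Longrightarrow> \<bar>\<sigma>\<bar> < \<eta>1 \<Longrightarrow> regular (i, t0 + \<sigma>) \<and> (\<exists>\<tau>0>0. \<forall>\<tau>. 0 < \<bar>\<tau>\<bar> \<longrightarrow> \<bar>\<tau>\<bar> < \<tau>0 \<longrightarrow>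
     shade (\<Phi> \<sigma> \<tau>) = of_real (sgn (d * \<tau>)) * left_shade (i, t0 + \<sigma>))"
    using left_shade_crossing_side[OF c] unfolding \<Phi>_def P_def d_def by blast
  \<comment> \<open>Exchanging the roles of the two strings reverses the orientation, hence the sign
    of \<open>d\<close>.\<close>
  obtain \<eta>2 where \<eta>2: "0 < \<eta>2" "\<And>\<tau>. 0 < \<bar>\<tau>\<bar> \<Longrightarrow> \<bar>\<tau>\<bar> < \<eta>2 \<Longrightarrow> regular (j, t1 + \<tau>) \<and> (\<exists>\<sigma>0>0. \<forall>\<sigma>. 0 < \<bar>\<sigma>\<bar> \<longrightarrow> \<bar>\<sigma>\<bar> < \<sigma>0 \<longrightarrow>
     shade (\<Phi> \<sigma> \<tau>) = of_real (sgn (- d * \<sigma>)) * left_shade (j, t1 + \<tau>))"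
    using left_shade_crossing_side[OF c'] unfolding \<Phi>_def P d' by (metis (no_types, lifting) add.commute)
  define \<eta> where "\<eta> = min \<eta>0 (min \<eta>1 \<eta>2)"
  have \<eta>: "0 < \<eta>" "\<eta> \<le> \<eta>0" "\<eta> \<le> \<eta>1" "\<eta> \<le> \<eta>2" using \<eta>0(1) \<eta>1(1) \<eta>2(1) by (simp_all add: \<eta>_def)
  define I where "I s = (if s = 1 then {0<..<\<eta>} else {-\<eta><..<0})" for s :: real
  have conn: "connected ((\<lambda>(\<sigma>, \<tau>). \<Phi> \<sigma> \<tau>) ` (I s1 \<times> I s2))" for s1 s2
  proof (rule connected_continuous_image)
    have *: "t0 + \<sigma> \<in> {0..1} \<and> t1 + \<sigma> \<in> {0..1}" if "\<sigma> \<in> I s" for s \<sigma>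
      using \<eta>0(3)[of \<sigma>] that \<eta> by (auto simp: I_def split: if_splits)
    show "continuous_on (I s1 \<times> I s2) (\<lambda>(\<sigma>, \<tau>). \<Phi> \<sigma> \<tau>)"
      unfolding \<Phi>_def case_prod_beta
    proof (intro continuous_intros)
      show "continuous_on (I s1 \<times> I s2) (\<lambda>x. strand T i (t0 + fst x))"
        by (rule continuous_on_compose2[OF strand_continuous[OF ij(1)]]) (use * in \<open>auto intro!: continuous_intros\<close>)
      show "continuous_on (I s1 \<times> I s2) (\<lambda>x. strand T j (t1 + snd x))"
        by (rule continuous_on_compose2[OF strand_continuous[OF ij(2)]]) (use * in \<open>auto intro!: continuous_intros\<close>)
    qed
    show "connected (I s1 \<times> I s2)" by (intro convex_connected convex_Times) (auto simp: I_def)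
  qed
  have sub: "(\<lambda>(\<sigma>, \<tau>). \<Phi> \<sigma> \<tau>) ` (I s1 \<times> I s2) \<subseteq> clear_region" for s1 s2
    using \<eta>0(2) \<eta> by (auto simp: I_def split: if_splits)
  define Q where "Q s1 s2 = shade (\<Phi> (s1 * \<eta> / 2) (s2 * \<eta> / 2))" for s1 s2
  have inI: "sgn x \<in> {1, -1} \<and> x \<in> I (sgn x) \<and> sgn x * \<eta> / 2 \<in> I (sgn x)" if "0 < \<bar>x\<bar>" "\<bar>x\<bar> < \<eta>" for x
    using that \<eta>(1) by (auto simp: I_def sgn_if)
  have Q: "shade (\<Phi> \<sigma> \<tau>) = Q (sgn \<sigma>) (sgn \<tau>)" if "0 < \<bar>\<sigma>\<bar>" "\<bar>\<sigma>\<bar> < \<eta>" "0 < \<bar>\<tau>\<bar>" "\<bar>\<tau>\<bar> < \<eta>" for \<sigma> \<tau>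
    unfolding Q_def
    by (rule shade_constant[OF conn[of "sgn \<sigma>" "sgn \<tau>"] sub])
       (use inI[OF that(1,2)] inI[OF that(3,4)] in auto)
  have A: "regular (i, t0 + \<sigma>) \<and> (\<forall>s\<in>{1, -1}. Q (sgn \<sigma>) s = of_real (sgn d * s) * left_shade (i, t0 + \<sigma>))"
    if s: "0 < \<bar>\<sigma>\<bar>" "\<bar>\<sigma>\<bar> < \<eta>" for \<sigma>
  proof -
    obtain \<tau>0 where \<tau>0: "0 < \<tau>0" "\<And>\<tau>. 0 < \<bar>\<tau>\<bar> \<Longrightarrow> \<bar>\<tau>\<bar> < \<tau>0 \<Longrightarrow>
        shade (\<Phi> \<sigma> \<tau>) = of_real (sgn (d * \<tau>)) * left_shade (i, t0 + \<sigma>)"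
      using \<eta>1(2)[of \<sigma>] s \<eta> by auto
    have "Q (sgn \<sigma>) s = of_real (sgn d * s) * left_shade (i, t0 + \<sigma>)" if "s \<in> {1, -1}" for s
    proof -
      define \<tau> where "\<tau> = s * min \<tau>0 \<eta> / 2"
      have "\<bar>\<tau>\<bar> = min \<tau>0 \<eta> / 2" "0 < min \<tau>0 \<eta>" using that \<tau>0(1) \<eta>(1) by (auto simp: \<tau>_def abs_mult)
      then have \<tau>: "0 < \<bar>\<tau>\<bar>" "\<bar>\<tau>\<bar> < \<tau>0" "\<bar>\<tau>\<bar> < \<eta>" by linarith+
      have sg: "sgn \<tau> = s" using that \<tau>0(1) \<eta>(1) by (auto simp: \<tau>_def sgn_mult)
      then show ?thesis using \<tau>0(2)[OF \<tau>(1,2)] Q[OF s \<tau>(1,3)] by (simp add: sgn_mult)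
    qed
    then show ?thesis using \<eta>1(2)[of \<sigma>] s \<eta> by auto
  qed
  have B: "regular (j, t1 + \<tau>) \<and> (\<forall>s\<in>{1, -1}. Q s (sgn \<tau>) = of_real (- sgn d * s) * left_shade (j, t1 + \<tau>))"
    if s: "0 < \<bar>\<tau>\<bar>" "\<bar>\<tau>\<bar> < \<eta>" for \<tau>
  proof -
    obtain \<sigma>0 where \<sigma>0: "0 < \<sigma>0" "\<And>\<sigma>. 0 < \<bar>\<sigma>\<bar> \<Longrightarrow> \<bar>\<sigma>\<bar> < \<sigma>0 \<Longrightarrow>
        shade (\<Phi> \<sigma> \<tau>) = of_real (sgn (- d * \<sigma>)) * left_shade (j, t1 + \<tau>)"
      using \<eta>2(2)[of \<tau>] s \<eta> by auto
    have "Q s (sgn \<tau>) = of_real (- sgn d * s) * left_shade (j, t1 + \<tau>)" if "s \<in> {1, -1}" for s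
    proof -
      define \<sigma> where "\<sigma> = s * min \<sigma>0 \<eta> / 2"
      have "\<bar>\<sigma>\<bar> = min \<sigma>0 \<eta> / 2" "0 < min \<sigma>0 \<eta>" using that \<sigma>0(1) \<eta>(1) by (auto simp: \<sigma>_def abs_mult)
      then have \<sigma>: "0 < \<bar>\<sigma>\<bar>" "\<bar>\<sigma>\<bar> < \<sigma>0" "\<bar>\<sigma>\<bar> < \<eta>" by linarith+
      have sg: "sgn \<sigma> = s" using that \<sigma>0(1) \<eta>(1) by (auto simp: \<sigma>_def sgn_mult)
      then show ?thesis using \<sigma>0(2)[OF \<sigma>(1,2)] Q[OF \<sigma>(1,3) s] by (simp add: sgn_mult sgn_minus)
    qed
    then show ?thesis using \<eta>2(2)[of \<tau>] s \<eta> by auto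
  qed
  have sd: "sgn d = 1 \<or> sgn d = -1" using d0 by (auto simp: sgn_if)
  show ?thesis
  proof (rule that[OF \<eta>(1), of "of_real (sgn d) * Q (-1) 1"])
    fix \<sigma> :: real assume "0 < \<sigma>" "\<sigma> < \<eta>"
    then have s: "0 < \<bar>\<sigma>\<bar>" "\<bar>\<sigma>\<bar> < \<eta>" "0 < \<bar>- \<sigma>\<bar>" "\<bar>- \<sigma>\<bar> < \<eta>" "sgn \<sigma> = 1" "sgn (- \<sigma>) = -1" by auto
    define c :: complex where "c = of_real (sgn d)"
    have cc: "c * c = 1" using sd by (auto simp: c_def)
    define li where "li x = left_shade (i, t0 + x)" for x
    define lj where "lj x = left_shade (j, t1 + x)" for x
    have Q1: "Q 1 1 = c * li \<sigma>" "Q (-1) 1 = c * li (- \<sigma>)" "Q (-1) (-1) = c * - li (- \<sigma>)"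
      using conjunct2[OF A[OF s(1,2)]] conjunct2[OF A[OF s(3,4)]] unfolding s(5,6) li_def c_def by simp_all
    have Q2: "Q 1 1 = c * - lj \<sigma>" "Q (-1) 1 = c * lj \<sigma>" "Q (-1) (-1) = c * lj (- \<sigma>)"
      using conjunct2[OF B[OF s(1,2)]] conjunct2[OF B[OF s(3,4)]] unfolding s(5,6) lj_def c_def by simp_all
    have inv: "x = c * y" if "y = c * x" for x y
      unfolding that mult.assoc[symmetric] cc by simp
    note f = Q1[THEN inv] Q2[THEN inv]
    have "li \<sigma> = - lj \<sigma>" "lj (- \<sigma>) = - li (- \<sigma>)"
      by (rule trans[OF f(1) f(4)[symmetric]], rule trans[OF f(6) f(3)[symmetric]])
    note g = this[unfolded f(2,5)] f(2,5)
    from g A[OF s(1,2)] A[OF s(3,4)] B[OF s(1,2)] B[OF s(3,4)]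
    show "regular (i, t0 - \<sigma>) \<and> regular (i, t0 + \<sigma>) \<and> regular (j, t1 - \<sigma>) \<and> regular (j, t1 + \<sigma>) \<and>
      left_shade (i, t0 - \<sigma>) = of_real (sgn d) * Q (-1) 1 \<and> left_shade (i, t0 + \<sigma>) = - (of_real (sgn d) * Q (-1) 1) \<and>
      left_shade (j, t1 - \<sigma>) = - (of_real (sgn d) * Q (-1) 1) \<and> left_shade (j, t1 + \<sigma>) = of_real (sgn d) * Q (-1) 1"
      by (simp add: li_def lj_def c_def)
  qed
qed

text \<open>Otherwise pairs of crossing parameters accumulate at a pair with equal images. A pair on
  the diagonal is excluded by the local injectivity of an immersion, and a crossing is isolated by
  transversality.\<close>

lemma finite_crossings: "finite {(x, y). crossing m T x y}"
proof (rule ccontr)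
  let ?X = "{(x, y). crossing m T x y}"
  let ?Z = "{z \<in> params m \<times> params m. pt T (fst z) - pt T (snd z) = 0}"
  assume inf: "infinite ?X"
  have "continuous_on (params m \<times> params m) (\<lambda>z. pt T (fst z) - pt T (snd z))"
    by (intro continuous_intros continuous_on_compose2[OF pt_continuous]) auto
  then have "closed ?Z"
    by (rule continuous_closed_preimage_constant)
       (rule compact_imp_closed[OF compact_Times[OF compact_params compact_params]])
  then have "compact ((params m \<times> params m) \<inter> ?Z)"
    by (rule compact_Int_closed[OF compact_Times[OF compact_params compact_params]])
  moreover have "(params m \<times> params m) \<inter> ?Z = ?Z" by blast
  ultimately have "compact ?Z" by simp
  moreover have "?X \<subseteq> ?Z" by (auto simp: crossing_def)
  ultimately obtain z where z: "z \<in> ?Z" "z islimpt ?X"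
    using inf Heine_Borel_imp_Bolzano_Weierstrass[of ?Z ?X] by blast
  obtain i t0 j t1 where zz: "z = ((i, t0), (j, t1))" by (metis prod.collapse)
  have no: False if U: "open U" "z \<in> U" "\<And>x y. (x, y) \<in> U \<Longrightarrow> crossing m T x y \<Longrightarrow> (x, y) = z" for U
    using z(2) U unfolding islimpt_def by blast
  show False
  proof (cases "crossing m T (i, t0) (j, t1)")
    case False
    then have ij: "j = i" "t1 = t0" and p: "(i, t0) \<in> params m" using z(1) by (auto simp: zz crossing_def)
    then have im: "i < m" "t0 \<in> {0..1}" by (auto simp: params_def)
    define w where "w = velocity T (i, t0)"
    have w: "0 < norm w" using velocity_nz[OF p] by (simp add: w_def)
    then have "0 < norm w / 2" by simp
    then obtain \<delta> where \<delta>: "0 < \<delta>" "\<And>s t. \<lbrakk>s \<in> {0..1}; t \<in> {0..1}; \<bar>s - t0\<bar> < \<delta>; \<bar>t - t0\<bar> < \<delta>\<rbrakk> \<Longrightarrow>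
       norm (strand T i s - strand T i t - (s - t) *\<^sub>R w) \<le> norm w / 2 * \<bar>s - t\<bar>"
      using C1_strong_derivative[OF C1[OF im(1)] im(2)] unfolding w_def velocity_def fst_conv snd_conv by metis
    let ?B = "{i} \<times> ball t0 \<delta>"
    show False
    proof (rule no)
      show "open (?B \<times> ?B)" by (intro open_Times open_ball) (simp_all add: open_discrete)
      show "z \<in> ?B \<times> ?B" using \<delta>(1) by (simp add: zz ij)
      fix x y assume xy: "(x, y) \<in> ?B \<times> ?B" "crossing m T x y"
      obtain s t where st: "x = (i, s)" "y = (i, t)" "\<bar>s - t0\<bar> < \<delta>" "\<bar>t - t0\<bar> < \<delta>"
        using xy(1) by (auto simp: dist_real_def abs_minus_commute)
      have "strand T i s = strand T i t" "s \<in> {0..1}" "t \<in> {0..1}" "s \<noteq> t"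
        using xy(2) by (auto simp: crossing_def st(1,2) pt_def params_def)
      then show "(x, y) = z" using \<delta>(2)[of s t] st w by (simp add: mult_ac mult_le_0_iff)
    qed
  next
    case True
    define a where "a = velocity T (i, t0)"
    define b where "b = velocity T (j, t1)"
    have P: "strand T i t0 = strand T j t1" using True by (simp add: crossing_def pt_def)
    have "Im (cnj a * b) \<noteq> 0" using transversal[OF True] by (simp add: a_def b_def)
    then obtain k where k: "0 < k" "\<And>x y. k * (\<bar>x\<bar> + \<bar>y\<bar>) \<le> norm (x *\<^sub>R a + y *\<^sub>R b)"
      using linear_independent_bound by blast
    then have "0 < k / 2" by simp
    then obtain \<delta> where \<delta>: "0 < \<delta>" "\<And>s t. \<bar>s - t0\<bar> < \<delta> \<Longrightarrow> \<bar>t - t0\<bar> < \<delta> \<Longrightarrow>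
       norm (strand T i s - strand T i t - (s - t) *\<^sub>R a) \<le> k / 2 * \<bar>s - t\<bar>"
     "\<And>s t. \<bar>s - t1\<bar> < \<delta> \<Longrightarrow> \<bar>t - t1\<bar> < \<delta> \<Longrightarrow>
       norm (strand T j s - strand T j t - (s - t) *\<^sub>R b) \<le> k / 2 * \<bar>s - t\<bar>"
      using crossing_local_form[OF True] unfolding a_def b_def by metis
    let ?U = "({i} \<times> ball t0 \<delta>) \<times> ({j} \<times> ball t1 \<delta>)"
    show False
    proof (rule no)
      show "open ?U" by (intro open_Times open_ball) (simp_all add: open_discrete)
      show "z \<in> ?U" using \<delta>(1) by (simp add: zz)
      fix x y assume xy: "(x, y) \<in> ?U" "crossing m T x y"
      obtain s t where st: "x = (i, s)" "y = (j, t)" "\<bar>s - t0\<bar> < \<delta>" "\<bar>t - t1\<bar> < \<delta>"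
        using xy(1) by (auto simp: dist_real_def abs_minus_commute)
      have eq: "strand T i s = strand T j t" using xy(2) by (auto simp: crossing_def st(1,2) pt_def)
      have 1: "norm (strand T i s - strand T i t0 - (s - t0) *\<^sub>R a) \<le> k / 2 * \<bar>s - t0\<bar>"
        using \<delta>(1) st by (intro \<delta>(2)) auto
      have 2: "norm (strand T i s - strand T i t0 - (t - t1) *\<^sub>R b) \<le> k / 2 * \<bar>t - t1\<bar>"
        using \<delta>(1) st unfolding eq P by (intro \<delta>(3)) auto
      have "(s - t0) *\<^sub>R a + (- (t - t1)) *\<^sub>R b = (strand T i s - strand T i t0 - (t - t1) *\<^sub>R b) - (strand T i s - strand T i t0 - (s - t0) *\<^sub>R a)"
        by (simp add: algebra_simps)
      then have "norm ((s - t0) *\<^sub>R a + (- (t - t1)) *\<^sub>R b) \<le> k / 2 * \<bar>t - t1\<bar> + k / 2 * \<bar>s - t0\<bar>"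
        using order_trans[OF norm_triangle_ineq4 add_mono[OF 2 1]] by (simp only:)
      moreover have "k * (\<bar>s - t0\<bar> + \<bar>t - t1\<bar>) \<le> norm ((s - t0) *\<^sub>R a + (- (t - t1)) *\<^sub>R b)"
        using k(2)[of "s - t0" "- (t - t1)"] by (simp only: abs_minus_cancel)
      ultimately have "k * (\<bar>s - t0\<bar> + \<bar>t - t1\<bar>) \<le> k / 2 * \<bar>t - t1\<bar> + k / 2 * \<bar>s - t0\<bar>"
        by (rule order_trans[rotated])
      then have "k * (\<bar>s - t0\<bar> + \<bar>t - t1\<bar>) \<le> 0" by (simp add: algebra_simps)
      then have "s = t0 \<and> t = t1" using k(1) by (auto simp: mult_le_0_iff)
      then show "(x, y) = z" by (simp add: zz st)
    qed
  qed
qed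

end

section \<open>The checkerboard sign at the boundary circle\<close>

lemma rayD:
  assumes "z \<in> ray \<alpha>" shows "1 \<le> Re (z * cis (- \<alpha>))" "Im (z * cis (- \<alpha>)) = 0"
proof -
  obtain r where r: "z = of_real r * cis \<alpha>" "1 \<le> r" using assms unfolding ray_def by blast
  have eq: "z * cis (- \<alpha>) = of_real r" unfolding r(1) mult.assoc cis_mult by simp
  show "1 \<le> Re (z * cis (- \<alpha>))" "Im (z * cis (- \<alpha>)) = 0" unfolding eq using r(2) by simp_all
qed

context diagram
begin

lemma endpoints_Times: "endpoints m = {..<m} \<times> {0, 1}" by (simp add: endpoints_def)

text \<open>Outside the disk a string contributes one sign for each of its ends, so the product over
  the strings regroups into a product over the endpoints, in which it no longer shows how these are
  joined.\<close>

lemma shade_exterior_point: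
  assumes R: "1 < R" and \<psi>: "\<And>k. k < 2 * m \<Longrightarrow> \<bar>\<psi> - \<theta> k\<bar> < 2 * pi \<and> \<psi> \<noteq> \<theta> k"
  shows "shade (of_real R * cis \<psi>) = of_real (\<Prod>k<2 * m. sgn (\<psi> - \<theta> k))"
proof -
  have ang: "\<bar>\<psi> - ang x\<bar> < 2 * pi \<and> \<psi> \<noteq> ang x" if "x \<in> endpoints m" for x
  proof -
    have "x \<in> e ` {..<2 * m}" using e_bij that by (simp add: bij_betw_def)
    then obtain k where "k < 2 * m" "x = e k" by auto
    then show ?thesis using \<psi> ang_e by auto
  qed
  have "side (strand T i) (ang (i, 0)) (ang (i, 1)) (of_real R * cis \<psi>) =
      (\<Prod>t\<in>{0, 1}. of_real (sgn (\<psi> - ang (i, t))))" if "i < m" for i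
  proof -
    have "strand T i ` {0..1} \<subseteq> cball 0 1"
    proof
      fix z assume "z \<in> strand T i ` {0..1}"
      then obtain t where "t \<in> {0..1}" "z = pt T (i, t)" by (auto simp: pt_def)
      then show "z \<in> cball 0 1" using norm_pt[of "(i, t)"] that by (auto simp: params_def)
    qed
    then have "side (strand T i) (ang (i, 0)) (ang (i, 1)) (of_real R * cis \<psi>) =
        of_real (sgn (\<psi> - ang (i, 0)) * sgn (\<psi> - ang (i, 1)))"
      using ang[of "(i, 0)"] ang[of "(i, 1)"] that
      by (intro side_exterior strand_continuous strand_ends R) (auto simp: endpoints_def)
    then show ?thesis by simp
  qed
  then have "shade (of_real R * cis \<psi>) = (\<Prod>i<m. \<Prod>t\<in>{0, 1}. of_real (sgn (\<psi> - ang (i, t))))"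
    unfolding shade_def by (intro prod.cong) auto
  also have "\<dots> = (\<Prod>x\<in>endpoints m. of_real (sgn (\<psi> - ang x)))"
    unfolding endpoints_Times by (subst prod.cartesian_product) (simp add: case_prod_beta)
  also have "\<dots> = (\<Prod>k<2 * m. of_real (sgn (\<psi> - ang (e k))))"
    by (rule prod.reindex_bij_betw[OF e_bij, symmetric])
  also have "\<dots> = of_real (\<Prod>k<2 * m. sgn (\<psi> - \<theta> k))"
    unfolding of_real_prod by (intro prod.cong) (auto simp: ang_e)
  finally show ?thesis .
qed

text \<open>The direction \<open>1 - \<i>\<close> points outward and clockwise, so the point has
  passed the endpoints before \<open>l\<close> and no others. The remaining \<open>2 * m - l\<close>
  factors are -1, and their number has the parity of \<open>l\<close>.\<close>

lemma shade_before_endpoint: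
  assumes l: "l < 2 * m"
  shows "\<forall>\<^sub>F \<epsilon> in at_right 0. shade (cis (\<theta> l) + of_real \<epsilon> * (cis (\<theta> l) * (1 - \<i>))) = (-1) ^ l"
proof -
  define \<omega> where "\<omega> \<epsilon> = Arg (1 + of_real \<epsilon> * (1 - \<i>))" for \<epsilon> :: real
  have "isCont \<omega> 0"
    unfolding \<omega>_def
    by (rule isCont_o2[where g = Arg]) (auto intro!: continuous_intros continuous_at_Arg)
  then have lim: "(\<omega> \<longlongrightarrow> 0) (at_right 0)"
    unfolding isCont_def by (simp add: \<omega>_def filterlim_at_split)
  have gap: "\<forall>\<^sub>F \<epsilon> in at_right 0. \<bar>\<omega> \<epsilon> + \<theta> l - \<theta> k\<bar> < 2 * pi \<and> (k < l \<longrightarrow> \<theta> k < \<theta> l + \<omega> \<epsilon>)" if k: "k < 2 * m" for k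
  proof -
    have "\<bar>\<theta> l - \<theta> k\<bar> < 2 * pi"
      using \<theta>_mono[of k l] \<theta>_mono[of l k] k l by (cases k l rule: linorder_cases) auto
    then have "0 < 2 * pi - \<bar>\<theta> l - \<theta> k\<bar>" by simp
    from tendstoD[OF lim this] have 1: "\<forall>\<^sub>F \<epsilon> in at_right 0. \<bar>\<omega> \<epsilon>\<bar> < 2 * pi - \<bar>\<theta> l - \<theta> k\<bar>" by simp
    have 2: "\<forall>\<^sub>F \<epsilon> in at_right 0. k < l \<longrightarrow> \<theta> k < \<theta> l + \<omega> \<epsilon>"
    proof (cases "k < l")
      case True
      then have "0 < \<theta> l - \<theta> k" using \<theta>_mono l by simp
      from tendstoD[OF lim this] have "\<forall>\<^sub>F \<epsilon> in at_right 0. \<bar>\<omega> \<epsilon>\<bar> < \<theta> l - \<theta> k" by simp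
      then show ?thesis by eventually_elim auto
    qed simp
    from 1 2 show ?thesis by eventually_elim linarith
  qed
  have "\<forall>\<^sub>F \<epsilon> in at_right 0. \<forall>k\<in>{..<2 * m}. \<bar>\<omega> \<epsilon> + \<theta> l - \<theta> k\<bar> < 2 * pi \<and> (k < l \<longrightarrow> \<theta> k < \<theta> l + \<omega> \<epsilon>)"
    using gap by (intro eventually_ball_finite) auto
  moreover have "\<forall>\<^sub>F \<epsilon> in at_right 0. 0 < \<epsilon> \<and> \<epsilon> < (1::real)" by (intro eventually_at_right_0) simp
  ultimately show ?thesis
  proof eventually_elim
    case (elim \<epsilon>)
    define z where "z = 1 + of_real \<epsilon> * (1 - \<i>)"
    define R where "R = norm z"
    have "Re z = 1 + \<epsilon>" "Im z = - \<epsilon>" by (simp_all add: z_def)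
    then have R: "1 < R" using elim complex_Re_le_cmod[of z] by (simp add: R_def)
    have neg: "\<omega> \<epsilon> < 0"
      using Arg_lt_pi[of z] Arg_eq_0_pi[of z] Arg_less_0[of z] \<open>Im z = - \<epsilon>\<close> elim(2) by (simp add: \<omega>_def z_def)
    have zR: "z = of_real R * cis (\<omega> \<epsilon>)"
      using rcis_cmod_Arg[of z] by (simp add: R_def \<omega>_def z_def rcis_def)
    have "cis (\<theta> l) + of_real \<epsilon> * (cis (\<theta> l) * (1 - \<i>)) = cis (\<theta> l) * z"
      by (simp add: z_def algebra_simps)
    also have "\<dots> = of_real R * cis (\<theta> l + \<omega> \<epsilon>)"
      by (simp add: zR cis_mult[symmetric] mult_ac)
    finally have eq: "cis (\<theta> l) + of_real \<epsilon> * (cis (\<theta> l) * (1 - \<i>)) = of_real R * cis (\<theta> l + \<omega> \<epsilon>)" .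
    have sgn: "sgn (\<theta> l + \<omega> \<epsilon> - \<theta> k) = (if k < l then 1 else -1)" "\<theta> l + \<omega> \<epsilon> \<noteq> \<theta> k" if "k < 2 * m" for k
    proof -
      have "l \<le> k \<Longrightarrow> \<theta> l \<le> \<theta> k" using \<theta>_mono[of l k] that by (cases "l = k") auto
      then show "sgn (\<theta> l + \<omega> \<epsilon> - \<theta> k) = (if k < l then 1 else -1)" "\<theta> l + \<omega> \<epsilon> \<noteq> \<theta> k"
        using elim(1) neg that by (cases "k < l"; force simp: sgn_if)+
    qed
    have "shade (of_real R * cis (\<theta> l + \<omega> \<epsilon>)) = of_real (\<Prod>k<2 * m. sgn (\<theta> l + \<omega> \<epsilon> - \<theta> k))"
      using elim(1) sgn(2) by (intro shade_exterior_point[OF R]) (auto simp: add.commute)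
    also have "(\<Prod>k<2 * m. sgn (\<theta> l + \<omega> \<epsilon> - \<theta> k)) = (\<Prod>k<2 * m. if k < l then 1 else -1)"
      using sgn(1) by (intro prod.cong) auto
    also have "\<dots> = (\<Prod>k\<in>{..<2 * m} - {..<l}. -1)"
      using l by (intro prod.mono_neutral_cong_right) (auto split: if_splits)
    also have "\<dots> = (-1) ^ (2 * m - l)" using l by (simp add: card_Diff_subset)
    also have "\<dots> = ((-1) ^ l :: real)" using l by (simp add: minus_one_power_iff)
    finally show ?case unfolding eq by simp
  qed
qed

text \<open>With \<open>a\<close> the direction in which the string leaves the endpoint \<open>b\<close>, the vector \<open>\<i> * (a - b)\<close> lies both
  to the left of \<open>a\<close> and strictly on the clockwise side of the line through 0 and \<open>b\<close>, even if the
  string is tangent to the circle.\<close>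

lemma left_shade_at_endpoint:
  assumes l: "l < 2 * m" and el: "e l = (i, t0)"
  defines "sg \<equiv> (if t0 = 0 then 1 else - 1 :: real)"
  obtains \<eta> where "0 < \<eta>" "\<And>u. 0 < u \<Longrightarrow> u < \<eta> \<Longrightarrow> regular (i, t0 + sg * u) \<and> of_real sg * left_shade (i, t0 + sg * u) = (-1) ^ l"
proof -
  have ep: "(i, t0) \<in> endpoints m" using bij_betwE[OF e_bij] l el by (metis lessThan_iff)
  then have pp: "(i, t0) \<in> params m" using endpoints_subset by blast
  have im: "i < m" and t0: "t0 = 0 \<or> t0 = 1" using ep by (auto simp: endpoints_def)
  have sg: "sg = 1 \<or> sg = -1" "sg * sg = 1" by (auto simp: sg_def)
  \<comment> \<open>Time measured from the endpoint, which treats both kinds of ends at once;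
    \<open>sg\<close> is -1 when the string arrives at the endpoint in its own orientation.\<close>
  define par where "par u = t0 + sg * u" for u
  have par01: "par u \<in> {0..1} \<longleftrightarrow> u \<in> {0..1}" for u using t0 by (auto simp: par_def sg_def)
  have par01': "par u \<in> {0<..<1} \<longleftrightarrow> u \<in> {0<..<1}" for u using t0 by (auto simp: par_def sg_def)
  have par_abs: "\<bar>par u - par v\<bar> = \<bar>u - v\<bar>" for u v
  proof -
    have "par u - par v = sg * (u - v)" by (simp add: par_def algebra_simps)
    then show ?thesis using sg(1) by (auto simp: abs_mult)
  qed
  have par0: "par 0 = t0" by (simp add: par_def)
  define \<gamma> where "\<gamma> u = strand T i (par u)" for u
  define w where "w = velocity T (i, t0)"
  define a where "a = of_real sg * w"
  define b where "b = cis (\<theta> l)"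
  have \<gamma>0: "\<gamma> 0 = b" using e_pt[OF l] by (simp add: el \<gamma>_def b_def pt_def par0)
  have w0: "w \<noteq> 0" using velocity_nz[OF pp] by (simp add: w_def)
  have na: "norm a = norm w" using sg(1) by (auto simp: a_def norm_mult)
  have a0: "0 < norm a" using w0 na by simp
  have cb: "cis (- \<theta> l) = cnj b" by (simp add: b_def cis_cnj)
  have bb: "b * cnj b = 1" "norm b = 1" by (simp_all add: b_def cis_cnj cis_mult)
  have \<gamma>1: "norm (\<gamma> u) \<le> 1" if "u \<in> {0..1}" for u
    using norm_pt[of "(i, par u)"] that im par01[of u] by (simp add: params_def \<gamma>_def pt_def)
  have \<gamma>lt: "norm (\<gamma> u) < 1" if "u \<in> {0<..<1}" for u
    using norm_pt_less[of "(i, par u)"] that im par01'[of u] by (auto simp: params_def endpoints_def \<gamma>_def pt_def)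
  have strong: "\<exists>\<delta>>0. \<forall>u\<in>{0..1}. u < \<delta> \<longrightarrow> norm (\<gamma> u - b - u *\<^sub>R a) \<le> \<kappa> * u" if \<kappa>: "0 < \<kappa>" for \<kappa>
  proof -
    have t01: "t0 \<in> {0..1}" using t0 by auto
    obtain \<delta> where \<delta>: "0 < \<delta>" "\<And>s t. \<lbrakk>s \<in> {0..1}; t \<in> {0..1}; \<bar>s - t0\<bar> < \<delta>; \<bar>t - t0\<bar> < \<delta>\<rbrakk> \<Longrightarrow>
       norm (strand T i s - strand T i t - (s - t) *\<^sub>R w) \<le> \<kappa> * \<bar>s - t\<bar>"
      using C1_strong_derivative[OF C1[OF im] t01 \<kappa>] unfolding w_def velocity_def fst_conv snd_conv by metis
    have "norm (\<gamma> u - b - u *\<^sub>R a) \<le> \<kappa> * u" if u: "u \<in> {0..1}" "u < \<delta>" for u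
    proof -
      have "\<bar>par u - t0\<bar> = u" using par_abs[of u 0] u by (simp add: par0)
      then have "norm (\<gamma> u - b - (par u - t0) *\<^sub>R w) \<le> \<kappa> * u"
        using \<delta>(2)[of "par u" t0] t01 par01[of u] u \<delta>(1) \<gamma>0 by (simp add: \<gamma>_def par0)
      moreover have "(par u - t0) *\<^sub>R w = u *\<^sub>R a" by (simp add: par_def a_def scaleR_conv_of_real)
      ultimately show ?thesis by simp
    qed
    with \<delta>(1) show ?thesis by blast
  qed
  \<comment> \<open>The direction of departure in coordinates where the endpoint is 1:
    \<open>x\<close> is its outward and \<open>y\<close> its counterclockwise component.\<close>
  define A where "A = a / of_real (norm a) * cnj b"
  define x where "x = Re A"
  define y where "y = Im A"
  have nA: "norm A = 1" using a0 bb by (simp add: A_def norm_mult norm_divide)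
  then have xy: "x\<^sup>2 + y\<^sup>2 = 1" by (simp add: x_def y_def cmod_def)
  have aA: "a * cnj b = of_real (norm a) * A" using a0 by (simp add: A_def)
  \<comment> \<open>A string departing with an outward component would leave the disk. Tangential
    departure, \<open>x = 0\<close>, remains possible.\<close>
  have x: "x \<le> 0"
  proof (rule ccontr)
    assume "\<not> x \<le> 0"
    then have \<rho>: "0 < norm a * x" using a0 by simp
    then have "0 < norm a * x / 2" by simp
    then obtain \<delta> where \<delta>: "0 < \<delta>" "\<And>u. u \<in> {0..1} \<Longrightarrow> u < \<delta> \<Longrightarrow> norm (\<gamma> u - b - u *\<^sub>R a) \<le> norm a * x / 2 * u"
      using strong by blast
    define u where "u = min \<delta> 1 / 2"
    have u: "0 < u" "u < \<delta>" "u \<in> {0..1}" using \<delta>(1) by (auto simp: u_def min_def)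
    define f where "f = \<gamma> u - b - u *\<^sub>R a"
    have "\<gamma> u * cnj b = b * cnj b + of_real u * (a * cnj b) + f * cnj b"
      by (simp add: f_def algebra_simps scaleR_conv_of_real)
    also have "\<dots> = 1 + of_real (u * norm a) * A + f * cnj b" by (simp add: bb aA)
    finally have "Re (\<gamma> u * cnj b) = 1 + u * norm a * x + Re (f * cnj b)" by (simp only: plus_complex.sel) (simp add: x_def)
    moreover have "\<bar>Re (f * cnj b)\<bar> \<le> norm f"
      using abs_Re_le_cmod[of "f * cnj b"] bb by (simp add: norm_mult)
    moreover have "norm f \<le> norm a * x / 2 * u" using \<delta>(2)[OF u(3,2)] by (simp add: f_def)
    moreover have "0 < norm a * x * u" using \<rho> u by simp
    ultimately have "1 < Re (\<gamma> u * cnj b)" by (simp add: algebra_simps abs_if split: if_splits)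
    moreover have "Re (\<gamma> u * cnj b) \<le> 1"
      using complex_Re_le_cmod[of "\<gamma> u * cnj b"] \<gamma>1[OF u(3)] bb by (simp add: norm_mult)
    ultimately show False by simp
  qed
  have y1: "\<bar>y\<bar> \<le> 1" using xy abs_Im_le_cmod[of A] nA by (simp add: y_def)
  define n where "n = \<i> * (a / of_real (norm a) - b)"
  \<comment> \<open>The direction in which \<open>shade_before_endpoint\<close> gives the
    sign.\<close>
  define n2 where "n2 = b * (1 - \<i>)"
  have nn: "norm n \<le> 2"
  proof -
    have "norm (a / of_real (norm a) - b) \<le> norm (a / of_real (norm a)) + norm b" by (rule norm_triangle_ineq4)
    then show ?thesis using a0 bb by (simp add: n_def norm_mult norm_divide)
  qed
  have nn2: "norm n2 \<le> 2"
  proof -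
    have "norm (1 - \<i>) \<le> norm (1 :: complex) + norm \<i>" by (rule norm_triangle_ineq4)
    then show ?thesis using bb by (simp add: n2_def norm_mult)
  qed
  have nb: "n * cnj b = Complex (- y) (x - 1)"
  proof -
    have "n * cnj b = \<i> * (A - b * cnj b)" by (simp add: n_def A_def algebra_simps)
    then show ?thesis by (simp add: bb x_def y_def complex_eq_iff)
  qed
  have n2b: "n2 * cnj b = 1 - \<i>" using bb(1) by (simp add: n2_def mult_ac)
  have cA: "cnj a * b = of_real (norm a) * cnj A" using arg_cong[OF aA, of cnj] by simp
  have caa: "cnj a * a = of_real ((norm a)\<^sup>2)" using complex_norm_square[of a] by (simp add: mult.commute)
  have an: "cnj a * n = of_real (norm a) * Complex (- y) (1 - x)"
  proof -
    have "cnj a * n = \<i> * (cnj a * a / of_real (norm a) - cnj a * b)" by (simp add: n_def algebra_simps)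
    also have "cnj a * a / of_real (norm a) = of_real (norm a)"
      unfolding caa using a0 by (simp add: power2_eq_square)
    finally show ?thesis unfolding cA by (simp add: x_def y_def complex_eq_iff algebra_simps)
  qed
  have an2: "cnj a * n2 = of_real (norm a) * Complex (x - y) (- x - y)"
  proof -
    have "cnj a * n2 = cnj a * b * (1 - \<i>)" by (simp add: n2_def mult_ac)
    then show ?thesis unfolding cA by (simp add: x_def y_def complex_eq_iff algebra_simps)
  qed
  \<comment> \<open>The second bound concerns strings that start clockwise, \<open>y < 0\<close>:
    the error of the linear approximation must not carry them to the counterclockwise side of the
    line through 0 and the endpoint.\<close>
  define \<kappa> where "\<kappa> = min (norm a / 8) (if y < 0 then norm a * (- y) else 1)"
  have \<kappa>: "0 < \<kappa>" "\<kappa> \<le> norm a / 8" "y < 0 \<Longrightarrow> \<kappa> \<le> norm a * (- y)" using a0 by (auto simp: \<kappa>_def mult_pos_neg)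
  obtain r \<eta>1 where r: "0 < r" "0 < \<eta>1" and lf0:
    "\<And>z t'. \<lbrakk>z \<in> params m; t' \<in> {0..1}; \<bar>t' - t0\<bar> < \<eta>1; norm (pt T z - strand T i t') < r\<rbrakk> \<Longrightarrow>
      fst z = i \<and> norm (pt T z - strand T i t' - (snd z - t') *\<^sub>R w) \<le> \<kappa> * \<bar>snd z - t'\<bar>"
    using local_form[OF pp endpoint_not_crossing[OF ep] \<kappa>(1)] unfolding w_def by blast
  have lf: "\<exists>s\<in>{0..1}. norm (pt T z - \<gamma> u - (s - u) *\<^sub>R a) \<le> \<kappa> * \<bar>s - u\<bar>"
    if z: "z \<in> params m" "u \<in> {0..1}" "u < \<eta>1" "norm (pt T z - \<gamma> u) < r" for z u
  proof -
    have "\<bar>par u - t0\<bar> = u" using par_abs[of u 0] z by (simp add: par0)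
    then have *: "norm (pt T z - \<gamma> u - (snd z - par u) *\<^sub>R w) \<le> \<kappa> * \<bar>snd z - par u\<bar>"
      using lf0[of z "par u"] z par01[of u] by (auto simp: \<gamma>_def)
    define s where "s = sg * (snd z - t0)"
    have ps: "par s = snd z" using sg by (simp add: par_def s_def mult.assoc[symmetric])
    have "(par s - par u) *\<^sub>R w = (s - u) *\<^sub>R a"
      by (simp add: par_def a_def scaleR_conv_of_real algebra_simps)
    moreover have "s \<in> {0..1}" using par01[of s] z(1) by (auto simp: ps params_def)
    ultimately show ?thesis using * par_abs[of s u] by (auto simp: ps)
  qed
  obtain \<delta> where \<delta>: "0 < \<delta>" "\<And>u. u \<in> {0..1} \<Longrightarrow> u < \<delta> \<Longrightarrow> norm (\<gamma> u - b - u *\<^sub>R a) \<le> \<kappa> * u"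
    using strong[OF \<kappa>(1)] by blast
  \<comment> \<open>The endpoints are distinct points of the circle, so near \<open>b\<close> the
    only ray to be avoided is its own.\<close>
  have "b \<notin> (\<Union>x\<in>endpoints m - {(i, t0)}. ray (ang x))"
  proof
    assume "b \<in> (\<Union>x\<in>endpoints m - {(i, t0)}. ray (ang x))"
    then obtain z r where z: "z \<in> endpoints m" "z \<noteq> (i, t0)" "b = of_real r * cis (ang z)" "1 \<le> r"
      by (auto simp: ray_def)
    then have "r = 1" using bb(2) by (simp add: norm_mult)
    then have "pt T z = pt T (i, t0)" using z pt_endpoint[of z] e_pt[OF l] by (simp add: el b_def)
    then show False using inj_onD[OF inj_endpoints _ z(1) ep] z(2) by simp
  qed
  moreover have "closed (\<Union>x\<in>endpoints m - {(i, t0)}. ray (ang x))"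
    using finite_endpoints by (intro closed_UN) (auto simp: closed_ray)
  ultimately obtain d where d: "0 < d" "\<And>z. z \<in> (\<Union>x\<in>endpoints m - {(i, t0)}. ray (ang x)) \<Longrightarrow> d \<le> dist b z"
    using separate_point_closed by metis
  have angl: "ang (i, t0) = \<theta> l" using ang_e[OF l] el by simp
  have clearI: "z \<in> clear_region" if "z \<notin> pt T ` params m" "norm (z - b) < d" "z \<notin> ray (\<theta> l)" for z
    using that d(2)[of z] angl by (fastforce simp: clear_region_def dist_norm norm_minus_commute)
  define M where "M = norm a + \<kappa>"
  have M: "0 < M" using a0 \<kappa> by (simp add: M_def)
  define \<eta> where "\<eta> = Min {\<eta>1, \<delta>, 1, d / (2 * M)}"
  have \<eta>0: "0 < \<eta>" using r(2) \<delta>(1) d(1) M by (simp add: \<eta>_def)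
  have \<eta>: "\<eta> \<le> \<eta>1" "\<eta> \<le> \<delta>" "\<eta> \<le> 1" "\<eta> \<le> d / (2 * M)"
    by (simp_all only: \<eta>_def Min_le finite.intros insert_iff refl simp_thms)
  define \<epsilon>0 where "\<epsilon>0 = min r d / 4"
  have \<epsilon>0: "0 < \<epsilon>0" "2 * \<epsilon>0 < r" "4 * \<epsilon>0 \<le> d" using r(1) d(1) by (auto simp: \<epsilon>0_def)
  have near: "norm (\<gamma> u - b) < d / 2" if u: "0 \<le> u" "u < \<eta>" for u
  proof -
    have "norm (\<gamma> u - b - u *\<^sub>R a) \<le> \<kappa> * u" using \<delta>(2)[of u] u \<eta> by auto
    then have "norm (\<gamma> u - b) \<le> \<kappa> * u + u * norm a"
      using norm_triangle_sub[of "\<gamma> u - b" "u *\<^sub>R a"] u by simp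
    also have "\<dots> = u * M" by (simp add: M_def algebra_simps)
    also have "\<dots> < d / (2 * M) * M" using u \<eta> M by (intro mult_strict_right_mono) auto
    finally show ?thesis using M by simp
  qed
  have clear1: "\<gamma> u + of_real \<epsilon> * n \<in> clear_region" if u: "0 \<le> u" "u < \<eta>" and \<epsilon>: "0 < \<epsilon>" "\<epsilon> < \<epsilon>0" for u \<epsilon>
  proof (rule clearI)
    have u01: "u \<in> {0..1}" using u \<eta> by auto
    have ne: "norm (of_real \<epsilon> * n) \<le> 2 * \<epsilon>" using nn \<epsilon> by (simp add: norm_mult)
    show "norm (\<gamma> u + of_real \<epsilon> * n - b) < d"
      using norm_triangle_ineq[of "\<gamma> u - b" "of_real \<epsilon> * n"] near[OF u] ne \<epsilon> \<epsilon>0 by (simp add: algebra_simps)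
    show "\<gamma> u + of_real \<epsilon> * n \<notin> pt T ` params m"
    proof
      assume "\<gamma> u + of_real \<epsilon> * n \<in> pt T ` params m"
      then obtain z where z: "z \<in> params m" "pt T z = \<gamma> u + of_real \<epsilon> * n" by auto
      then obtain s where s: "norm (of_real \<epsilon> * n - (s - u) *\<^sub>R a) \<le> \<kappa> * \<bar>s - u\<bar>"
        using lf[of z u] u01 u \<eta> ne \<epsilon> \<epsilon>0 by auto
      define h where "h = s - u"
      have "cnj a * (of_real \<epsilon> * n - h *\<^sub>R a) = of_real \<epsilon> * (cnj a * n) - of_real h * (cnj a * a)"
        by (simp add: algebra_simps scaleR_conv_of_real)
      also have "\<dots> = of_real (\<epsilon> * norm a) * Complex (- y) (1 - x) - of_real (h * (norm a)\<^sup>2)"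
        unfolding an caa by simp
      finally have "Im (cnj a * (of_real \<epsilon> * n - h *\<^sub>R a)) = \<epsilon> * norm a * (1 - x)" by (simp only:) simp
      moreover have "\<bar>Im (cnj a * (of_real \<epsilon> * n - h *\<^sub>R a))\<bar> \<le> norm a * norm (of_real \<epsilon> * n - h *\<^sub>R a)"
        by (metis abs_Im_le_cmod complex_mod_cnj norm_mult)
      ultimately have "\<epsilon> * norm a * (1 - x) \<le> norm a * (\<kappa> * \<bar>h\<bar>)"
        using mult_left_mono[OF s, of "norm a"] by (simp add: h_def)
      then have 1: "\<epsilon> * (1 - x) \<le> \<kappa> * \<bar>h\<bar>" using a0 by (simp add: mult_ac)
      have "\<epsilon> * 1 \<le> \<epsilon> * (1 - x)" using x \<epsilon> by (intro mult_left_mono) auto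
      \<comment> \<open>The normal component of the displacement forces
        \<open>\<epsilon> \<le> \<kappa> * \<bar>h\<bar>\<close>, while its length bounds
        \<open>\<bar>h\<bar>\<close> by a multiple of \<open>\<epsilon>\<close>; with
        \<open>\<kappa> \<le> norm a / 8\<close> the two leave only \<open>h = 0\<close>.\<close>
      then have 2: "\<epsilon> \<le> \<kappa> * \<bar>h\<bar>" using 1 by simp
      have "norm (h *\<^sub>R a) \<le> norm (of_real \<epsilon> * n) + norm (of_real \<epsilon> * n - h *\<^sub>R a)"
        using norm_triangle_sub[of "h *\<^sub>R a" "of_real \<epsilon> * n"] by (simp add: norm_minus_commute)
      then have "\<bar>h\<bar> * norm a \<le> 2 * \<epsilon> + \<kappa> * \<bar>h\<bar>" using ne s by (simp add: h_def)
      moreover have "\<kappa> * \<bar>h\<bar> \<le> norm a / 8 * \<bar>h\<bar>" using \<kappa> by (intro mult_right_mono) auto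
      ultimately have "\<bar>h\<bar> * norm a \<le> 3 / 8 * (\<bar>h\<bar> * norm a)" using 2 by (simp add: mult.commute)
      then have "\<bar>h\<bar> * norm a \<le> 0" by linarith
      then have "h = 0" using a0 by (simp add: mult_le_0_iff)
      then show False using 2 \<epsilon> by simp
    qed
    show "\<gamma> u + of_real \<epsilon> * n \<notin> ray (\<theta> l)"
    proof
      assume "\<gamma> u + of_real \<epsilon> * n \<in> ray (\<theta> l)"
      from rayD[OF this] have ry: "1 \<le> Re (\<gamma> u * cnj b + of_real \<epsilon> * (n * cnj b))"
        "Im (\<gamma> u * cnj b + of_real \<epsilon> * (n * cnj b)) = 0"
        by (simp_all only: cb distrib_right mult.assoc)
      define g where "g = \<gamma> u * cnj b"
      have ry': "1 \<le> Re g - \<epsilon> * y" "Im g + \<epsilon> * (x - 1) = 0" using ry unfolding nb g_def[symmetric] by simp_all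
      have ex: "\<epsilon> * (x - 1) < 0" using x \<epsilon> by (intro mult_pos_neg) auto
      have ng: "norm g \<le> 1" using \<gamma>1[OF u01] bb by (simp add: g_def norm_mult)
      show False
      \<comment> \<open>On the ray, \<open>Im g\<close> equals \<open>\<epsilon> * (1 - x)\<close>,
        which is positive. If \<open>y \<ge> 0\<close>, then \<open>Re g \<ge> 1\<close> and
        \<open>norm g \<le> 1\<close> force \<open>g = 1\<close>; if \<open>y < 0\<close>, the
        string has not moved counterclockwise, so \<open>Im g \<le> 0\<close>.\<close>
      proof (cases "y < 0")
        case False
        then have "1 \<le> Re g" using ry'(1) \<epsilon> mult_nonneg_nonneg[of \<epsilon> y] by linarith
        then have "Re g = 1" using ng complex_Re_le_cmod[of g] by linarith
        moreover have "(Re g)\<^sup>2 + (Im g)\<^sup>2 \<le> 1" using ng by (simp add: cmod_def)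
        ultimately have "Im g = 0" by simp
        then show False using ry'(2) ex by simp
      next
        case True
        define f where "f = \<gamma> u - b - u *\<^sub>R a"
        have "g = b * cnj b + of_real u * (a * cnj b) + f * cnj b"
          by (simp add: g_def f_def algebra_simps scaleR_conv_of_real)
        also have "\<dots> = 1 + of_real (u * norm a) * A + f * cnj b" by (simp add: bb aA)
        finally have "Im g = u * norm a * y + Im (f * cnj b)" by (simp only: plus_complex.sel) (simp add: y_def)
        moreover have "\<bar>Im (f * cnj b)\<bar> \<le> norm f"
          using abs_Im_le_cmod[of "f * cnj b"] bb by (simp add: norm_mult)
        moreover have "norm f \<le> \<kappa> * u" using \<delta>(2)[of u] u01 u \<eta> by (simp add: f_def)
        moreover have "\<kappa> * u \<le> norm a * (- y) * u" using \<kappa>(3)[OF True] u by (intro mult_right_mono) auto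
        ultimately have "Im g \<le> 0" by (simp add: algebra_simps abs_if split: if_splits)
        then show False using ry'(2) ex by simp
      qed
    qed
  qed
  \<comment> \<open>At the endpoint itself the displacement can be turned from \<open>n\<close> to
    \<open>n2\<close> without meeting the diagram or a ray. This joins the strip along the string to
    the point outside the disk whose sign is known.\<close>
  have clear2: "b + of_real \<epsilon> * z \<in> clear_region" if z: "z \<in> closed_segment n n2" and \<epsilon>: "0 < \<epsilon>" "\<epsilon> < \<epsilon>0" for z \<epsilon>
  proof (rule clearI)
    obtain q where q: "0 \<le> q" "q \<le> 1" "z = (1 - q) *\<^sub>R n + q *\<^sub>R n2" using z by (auto simp: in_segment)
    have "norm z \<le> (1 - q) * norm n + q * norm n2"
      unfolding q(3) using norm_triangle_ineq[of "(1 - q) *\<^sub>R n" "q *\<^sub>R n2"] q by simp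
    also have "\<dots> \<le> (1 - q) * 2 + q * 2" using nn nn2 q by (intro add_mono mult_left_mono) auto
    finally have nz: "norm (of_real \<epsilon> * z) \<le> 2 * \<epsilon>" using \<epsilon> by (simp add: norm_mult)
    then show "norm (b + of_real \<epsilon> * z - b) < d" using \<epsilon> \<epsilon>0 by simp
    have "z * cnj b = (1 - q) *\<^sub>R (n * cnj b) + q *\<^sub>R (n2 * cnj b)" by (simp add: q(3) algebra_simps)
    then have "Im (z * cnj b) = (1 - q) * (x - 1) - q" unfolding nb n2b by simp
    moreover have "(1 - q) * (x - 1) \<le> (1 - q) * (- 1)" using q x by (intro mult_left_mono) auto
    ultimately have Imz: "Im (z * cnj b) \<le> - 1" by simp
    show "b + of_real \<epsilon> * z \<notin> ray (\<theta> l)"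
    proof
      assume "b + of_real \<epsilon> * z \<in> ray (\<theta> l)"
      from rayD(2)[OF this] have "Im (b * cnj b + of_real \<epsilon> * (z * cnj b)) = 0"
        by (simp only: cb distrib_right mult.assoc)
      moreover have "Im (1 + of_real \<epsilon> * v) = \<epsilon> * Im v" for v by simp
      ultimately have "\<epsilon> * Im (z * cnj b) = 0" unfolding bb by (simp only:)
      then show False using \<epsilon> Imz by auto
    qed
    \<comment> \<open>On the segment all directions stay at least 45 degrees away from
      \<open>a\<close>, and near the endpoint the diagram extends only in directions close to
      \<open>a\<close>.\<close>
    have lz: "0 \<le> Im (cnj a * z) - Re (cnj a * z)"
    proof -
      have "cnj a * z = (1 - q) *\<^sub>R (cnj a * n) + q *\<^sub>R (cnj a * n2)" by (simp add: q(3) algebra_simps)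
      then have "Im (cnj a * z) = (1 - q) * Im (cnj a * n) + q * Im (cnj a * n2)"
        "Re (cnj a * z) = (1 - q) * Re (cnj a * n) + q * Re (cnj a * n2)"
        by (simp_all only: plus_complex.sel scaleR_complex.sel)
      moreover have "Im (cnj a * n) = norm a * (1 - x)" "Re (cnj a * n) = norm a * - y" unfolding an by simp_all
      moreover have "Im (cnj a * n2) = norm a * (- x - y)" "Re (cnj a * n2) = norm a * (x - y)" unfolding an2 by simp_all
      ultimately have "Im (cnj a * z) - Re (cnj a * z) = (1 - q) * (norm a * (1 - x + y)) + q * (norm a * (- 2 * x))"
        by (simp only:) (simp add: algebra_simps)
      moreover have "0 \<le> (1 - q) * (norm a * (1 - x + y))"
        by (intro mult_nonneg_nonneg) (use q x y1 in auto)
      moreover have "0 \<le> q * (norm a * (- 2 * x))" by (rule mult_nonneg_nonneg[OF q(1)], rule mult_nonneg_nonneg) (use x in auto)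
      ultimately show ?thesis by linarith
    qed
    show "b + of_real \<epsilon> * z \<notin> pt T ` params m"
    proof
      assume "b + of_real \<epsilon> * z \<in> pt T ` params m"
      then obtain p where p: "p \<in> params m" "pt T p = b + of_real \<epsilon> * z" by auto
      then obtain s where s: "s \<in> {0..1}" "norm (of_real \<epsilon> * z - s *\<^sub>R a) \<le> \<kappa> * s"
        using lf[of p 0] r \<gamma>0 nz \<epsilon> \<epsilon>0 by auto
      define f where "f = of_real \<epsilon> * z - s *\<^sub>R a"
      have "cnj a * f = of_real \<epsilon> * (cnj a * z) - of_real s * (cnj a * a)"
        by (simp add: f_def algebra_simps scaleR_conv_of_real)
      moreover have "Im (of_real c1 * v1 - of_real c2 * of_real c3) = c1 * Im v1"
        "Re (of_real c1 * v1 - of_real c2 * of_real c3) = c1 * Re v1 - c2 * c3" for c1 c2 c3 v1 by simp_all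
      ultimately have "Im (cnj a * f) - Re (cnj a * f) = \<epsilon> * (Im (cnj a * z) - Re (cnj a * z)) + s * (norm a)\<^sup>2"
        unfolding caa by (simp only: right_diff_distrib)
      moreover have "0 \<le> \<epsilon> * (Im (cnj a * z) - Re (cnj a * z))" using lz \<epsilon> by simp
      moreover have "\<bar>Im (cnj a * f)\<bar> \<le> norm a * norm f" "\<bar>Re (cnj a * f)\<bar> \<le> norm a * norm f"
        by (metis abs_Im_le_cmod abs_Re_le_cmod complex_mod_cnj norm_mult)+
      ultimately have "s * (norm a)\<^sup>2 \<le> 2 * (norm a * norm f)" by linarith
      also have "\<dots> \<le> 2 * (norm a * (\<kappa> * s))" using s(2) by (simp add: f_def mult_left_mono)
      also have "\<dots> \<le> 2 * (norm a * (norm a / 8 * s))"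
        using s(1) \<kappa> by (intro mult_left_mono mult_right_mono) auto
      finally have "s * (norm a)\<^sup>2 \<le> 1 / 4 * (s * (norm a)\<^sup>2)" by (simp add: power2_eq_square)
      then have "s * (norm a)\<^sup>2 \<le> 0" by linarith
      then have "s = 0" using a0 s(1) by (auto simp: mult_le_0_iff)
      then have "z = 0" using s(2) \<epsilon> by simp
      then show False using Imz by simp
    qed
  qed
  have \<gamma>_cont: "continuous_on {0..1} \<gamma>"
    unfolding \<gamma>_def
    by (rule continuous_on_compose2[OF strand_continuous[OF im]])
       (use par01 in \<open>auto simp: par_def[abs_def] image_subset_iff intro!: continuous_intros\<close>)
  let ?S = "(\<lambda>(u, \<epsilon>). \<gamma> u + of_real \<epsilon> * n) ` ({0..<\<eta>} \<times> {0<..<\<epsilon>0})"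
  have S: "connected ?S" "?S \<subseteq> clear_region"
  proof -
    have "continuous_on ({0..<\<eta>} \<times> {0<..<\<epsilon>0}) (\<lambda>(u, \<epsilon>). \<gamma> u + of_real \<epsilon> * n)"
      unfolding case_prod_beta using \<eta>(3)
      by (intro continuous_intros continuous_on_compose2[OF \<gamma>_cont]) auto
    then show "connected ?S" by (intro connected_continuous_image convex_connected convex_Times) auto
    show "?S \<subseteq> clear_region" using clear1 by auto
  qed
  \<comment> \<open>The strip and the segment are both connected and clear, and they share the point
    \<open>b + of_real \<epsilon>1 * n\<close>.\<close>
  have shade1: "shade (\<gamma> u + of_real \<epsilon> * n) = (-1) ^ l" if u: "0 \<le> u" "u < \<eta>" "0 < \<epsilon>" "\<epsilon> < \<epsilon>0" for u \<epsilon>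
  proof -
    have "\<forall>\<^sub>F \<epsilon> in at_right 0. 0 < \<epsilon> \<and> \<epsilon> < \<epsilon>0" using \<epsilon>0(1) by (rule eventually_at_right_0)
    with shade_before_endpoint[OF l] have "\<forall>\<^sub>F \<epsilon> in at_right 0. shade (b + of_real \<epsilon> * n2) = (-1) ^ l \<and> 0 < \<epsilon> \<and> \<epsilon> < \<epsilon>0"
      unfolding b_def n2_def by eventually_elim simp
    then obtain \<epsilon>1 where e1: "shade (b + of_real \<epsilon>1 * n2) = (-1) ^ l" "0 < \<epsilon>1" "\<epsilon>1 < \<epsilon>0"
      using eventually_happens'[OF trivial_limit_at_right_real] by blast
    let ?S2 = "(\<lambda>z. b + of_real \<epsilon>1 * z) ` closed_segment n n2"
    have "connected ?S2" by (intro connected_continuous_image continuous_intros convex_connected convex_closed_segment)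
    moreover have "?S2 \<subseteq> clear_region" using clear2 e1 by auto
    ultimately have "shade (b + of_real \<epsilon>1 * n) = shade (b + of_real \<epsilon>1 * n2)"
      by (rule shade_constant) auto
    moreover have "shade (\<gamma> u + of_real \<epsilon> * n) = shade (\<gamma> 0 + of_real \<epsilon>1 * n)"
      by (rule shade_constant[OF S]) (use u e1 \<eta>0 in \<open>force intro: image_eqI[of _ _ "(_, _)"]\<close>)+
    ultimately show ?thesis using e1 \<gamma>0 by simp
  qed
  obtain \<eta>2 where reg: "0 < \<eta>2" "\<And>t'. \<lbrakk>t' \<in> {0<..<1}; \<bar>t' - t0\<bar> < \<eta>2\<rbrakk> \<Longrightarrow> regular (i, t')"
    using regular_near[OF pp endpoint_not_crossing[OF ep]] by blast
  have "0 < norm a / 4" using a0 by simp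
  then obtain \<eta>3 where vel: "0 < \<eta>3"
    "\<And>t'. t' \<in> {0..1} \<Longrightarrow> \<bar>t' - t0\<bar> < \<eta>3 \<Longrightarrow> norm (velocity T (i, t') - w) < norm a / 4"
    using velocity_near[OF pp] unfolding w_def by blast
  show ?thesis
  proof (rule that)
    show "0 < min \<eta> (min \<eta>2 \<eta>3)" using \<eta>0 reg(1) vel(1) by simp
    fix u assume u: "0 < u" "u < min \<eta> (min \<eta>2 \<eta>3)"
    then have u01: "u \<in> {0<..<1}" "u \<in> {0..1}" using \<eta>(3) by auto
    have pu: "\<bar>par u - t0\<bar> = u" using par_abs[of u 0] u by (simp add: par0)
    have ru: "regular (i, par u)" using reg(2)[of "par u"] par01'[of u] u01 pu u by auto
    define v where "v = velocity T (i, par u)"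
    have v: "norm (v - w) < norm a / 4" using vel(2)[of "par u"] par01[of u] u01 pu u by (auto simp: v_def)
    have "0 < norm a / 4" using a0 by simp
    from left_shade_cone[OF ru this] obtain \<rho> where \<rho>: "0 < \<rho>"
      "\<And>z. \<lbrakk>0 < norm z; norm z < \<rho>; norm a / 4 * norm z \<le> Im (cnj v * z)\<rbrakk> \<Longrightarrow>
        pt T (i, par u) + z \<in> clear_region \<and> shade (pt T (i, par u) + z) = left_shade (i, par u)"
      "\<And>z. \<lbrakk>0 < norm z; norm z < \<rho>; Im (cnj v * z) \<le> - (norm a / 4 * norm z)\<rbrakk> \<Longrightarrow>
        pt T (i, par u) + z \<in> clear_region \<and> shade (pt T (i, par u) + z) = - left_shade (i, par u)"
      unfolding v_def by metis
    define \<epsilon> where "\<epsilon> = min \<epsilon>0 \<rho> / 4"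
    have \<epsilon>: "0 < \<epsilon>" "\<epsilon> < \<epsilon>0" "2 * \<epsilon> < \<rho>" using \<epsilon>0(1) \<rho>(1) by (auto simp: \<epsilon>_def)
    define z where "z = of_real \<epsilon> * n"
    have nz: "norm z = \<epsilon> * norm n" using \<epsilon> by (simp add: z_def norm_mult)
    have aw: "cnj a = of_real sg * cnj w" by (simp add: a_def)
    have "of_real sg * (cnj v * n) = of_real sg * cnj (v - w) * n + cnj a * n"
      by (simp add: aw algebra_simps)
    then have "Im (of_real sg * (cnj v * n)) = Im (of_real sg * cnj (v - w) * n) + norm a * (1 - x)"
      unfolding an by (simp only: plus_complex.sel) simp
    moreover have "Im (of_real sg * (cnj v * n)) = sg * Im (cnj v * n)" by simp
    moreover have "\<bar>Im (of_real sg * cnj (v - w) * n)\<bar> \<le> norm (v - w) * norm n"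
      using abs_Im_le_cmod[of "of_real sg * cnj (v - w) * n"] sg(1)
      by (simp only: norm_mult complex_mod_cnj norm_of_real) auto
    moreover have "norm (v - w) * norm n \<le> norm a / 4 * 2" using v nn a0 by (intro mult_mono) auto
    moreover have "norm a * 1 \<le> norm a * (1 - x)" using x by (intro mult_left_mono) auto
    ultimately have "norm a / 2 \<le> sg * Im (cnj v * n)" by linarith
    moreover have "norm a / 4 * norm n \<le> norm a / 4 * 2" using nn by (intro mult_left_mono) auto
    ultimately have le: "norm a / 4 * norm n \<le> sg * Im (cnj v * n)" and pos: "0 < sg * Im (cnj v * n)" using a0 by linarith+
    have "n \<noteq> 0" using pos by auto
    then have z0: "0 < norm z" using \<epsilon> nz by simp
    have "\<epsilon> * norm n \<le> \<epsilon> * 2" using nn \<epsilon> by (intro mult_left_mono) auto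
    then have zr: "norm z < \<rho>" using \<epsilon>(3) nz by linarith
    have Im: "Im (cnj v * z) = \<epsilon> * Im (cnj v * n)" by (simp add: z_def algebra_simps)
    have lez: "norm a / 4 * norm z \<le> sg * Im (cnj v * z)"
      using mult_left_mono[OF le, of \<epsilon>] \<epsilon>(1) unfolding nz Im by (simp only: mult_ac)
    have sh: "shade (pt T (i, par u) + z) = (-1) ^ l"
      using shade1[of u \<epsilon>] u \<epsilon> by (simp add: z_def \<gamma>_def pt_def)
    have "of_real sg * left_shade (i, par u) = (-1) ^ l"
    proof (cases "sg = 1")
      case True
      then have "norm a / 4 * norm z \<le> Im (cnj v * z)" using lez by (simp only: mult_1)
      then show ?thesis using \<rho>(2)[OF z0 zr] sh True by simp
    next
      case False
      then have sgm: "sg = -1" using sg(1) by simp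
      then have "sg * Im (cnj v * z) = - Im (cnj v * z)" by (simp only: mult_minus1)
      then have "Im (cnj v * z) \<le> - (norm a / 4 * norm z)" using lez by linarith
      then show ?thesis using \<rho>(3)[OF z0 zr] sh sgm by simp
    qed
    with ru show "regular (i, t0 + sg * u) \<and> of_real sg * left_shade (i, t0 + sg * u) = (-1) ^ l"
      by (simp add: par_def)
  qed
qed

end

section \<open>Signed colors\<close>

lemma finite_gap:
  fixes t :: real
  assumes "finite K"
  obtains \<eta> where "0 < \<eta>" "\<And>k. k \<in> K \<Longrightarrow> k \<noteq> t \<Longrightarrow> \<eta> \<le> \<bar>k - t\<bar>"
  using finite_set_avoid[OF assms, of t] by (metis abs_minus_commute dist_real_def)

text \<open>Subtracting from \<open>f\<close> all earlier jumps leaves a locally constant function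
  on a connected interval, so its values near the two ends agree.\<close>

lemma sum_of_jumps:
  fixes f :: "real \<Rightarrow> int"
  assumes K: "finite K" "K \<subseteq> {0<..<1}"
    and const: "\<And>t. t \<in> {0<..<1} - K \<Longrightarrow> \<exists>\<eta>>0. \<forall>t'. \<bar>t' - t\<bar> < \<eta> \<longrightarrow> f t' = f t"
    and jump: "\<And>k. k \<in> K \<Longrightarrow> \<exists>\<eta>>0. \<forall>s\<in>{0<..<\<eta>}. f (k - s) = L k \<and> f (k + s) = R k"
    and ends: "\<exists>\<eta>>0. \<forall>s\<in>{0<..<\<eta>}. f s = a \<and> f (1 - s) = b"
  shows "b - a = (\<Sum>k\<in>K. R k - L k)"
proof -
  define S where "S t = (\<Sum>k\<in>{k \<in> K. k < t}. R k - L k)" for t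
  \<comment> \<open>At a jump, where \<open>f\<close> may have any value, the left value is
    substituted, and \<open>S\<close> counts strictly earlier jumps only; both conventions make
    \<open>G\<close> agree with its left neighborhood.\<close>
  define G where "G t = (if t \<in> K then L t else f t) - S t" for t
  have loc: "\<exists>\<eta>>0. \<forall>t'. \<bar>t' - t\<bar> < \<eta> \<longrightarrow> G t' = G t" if t: "t \<in> {0<..<1}" for t
  proof -
    obtain \<eta>1 where \<eta>1: "0 < \<eta>1" "\<And>k. k \<in> K \<Longrightarrow> k \<noteq> t \<Longrightarrow> \<eta>1 \<le> \<bar>k - t\<bar>"
      using finite_gap[OF K(1)] by metis
    show ?thesis
    proof (cases "t \<in> K")
      case False
      then obtain \<eta>2 where \<eta>2: "0 < \<eta>2" "\<And>t'. \<bar>t' - t\<bar> < \<eta>2 \<Longrightarrow> f t' = f t" using const t by blast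
      have "G t' = G t" if t': "\<bar>t' - t\<bar> < min \<eta>1 \<eta>2" for t'
      proof -
        have nk: "k \<noteq> t \<and> \<eta>1 \<le> \<bar>k - t\<bar>" if "k \<in> K" for k using \<eta>1(2)[OF that] that False by auto
        have "t' \<notin> K" using nk[of t'] t' by auto
        moreover have "{k \<in> K. k < t'} = {k \<in> K. k < t}"
          using nk t' by (auto simp: abs_less_iff abs_le_iff) (smt (verit, best))+
        ultimately show ?thesis using False \<eta>2(2) t' by (simp add: G_def S_def)
      qed
      then show ?thesis using \<eta>1(1) \<eta>2(1) by (metis min_less_iff_conj)
    next
      case True
      then obtain \<eta>2 where \<eta>2: "0 < \<eta>2" "\<And>s. s \<in> {0<..<\<eta>2} \<Longrightarrow> f (t - s) = L t \<and> f (t + s) = R t"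
        using jump by blast
      have "G t' = G t" if t': "\<bar>t' - t\<bar> < min \<eta>1 \<eta>2" for t'
      proof (cases t' t rule: linorder_cases)
        case less
        then have "t' \<notin> K" using \<eta>1(2)[of t'] t' by auto
        moreover have "{k \<in> K. k < t'} = {k \<in> K. k < t}"
        proof -
          have "k < t'" if "k \<in> K" "k < t" for k using \<eta>1(2)[OF that(1)] that t' less by auto
          then show ?thesis using less by auto
        qed
        moreover have "f t' = L t" using \<eta>2(2)[of "t - t'"] less t' by auto
        ultimately show ?thesis using True by (simp add: G_def S_def)
      next
        case greater
        then have "t' \<notin> K" using \<eta>1(2)[of t'] t' by auto
        moreover have "{k \<in> K. k < t'} = insert t {k \<in> K. k < t}"
        proof -
          have "k \<le> t" if "k \<in> K" "k < t'" for k using \<eta>1(2)[OF that(1)] that t' greater by (cases "k = t") auto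
          then show ?thesis using greater True by force
        qed
        then have "S t' = (R t - L t) + S t" using K(1) by (simp add: S_def)
        moreover have "f t' = R t" using \<eta>2(2)[of "t' - t"] greater t' by auto
        ultimately show ?thesis using True by (simp add: G_def)
      qed simp
      then show ?thesis using \<eta>1(1) \<eta>2(1) by (metis min_less_iff_conj)
    qed
  qed
  have "G constant_on {0<..<1}"
  proof (rule locally_constant_imp_constant)
    fix t :: real assume t: "t \<in> {0<..<1}"
    obtain \<eta> where \<eta>: "0 < \<eta>" "\<And>t'. \<bar>t' - t\<bar> < \<eta> \<Longrightarrow> G t' = G t" using loc[OF t] by blast
    have "openin (top_of_set {0<..<1}) ({0<..<1} \<inter> ball t \<eta>)" by (intro openin_open_Int) simp
    moreover have "G x = G t" if "x \<in> {0<..<1} \<inter> ball t \<eta>" for x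
      by (rule \<eta>(2)) (use that in \<open>simp add: dist_real_def abs_minus_commute\<close>)
    moreover have "t \<in> {0<..<1} \<inter> ball t \<eta>" using t \<eta>(1) by simp
    ultimately show "\<exists>U. openin (top_of_set {0<..<1}) U \<and> t \<in> U \<and> (\<forall>x\<in>U. G x = G t)" by blast
  qed simp
  then obtain g where g: "\<And>t. t \<in> {0<..<1} \<Longrightarrow> G t = g" by (auto simp: constant_on_def)
  obtain \<eta> where \<eta>: "0 < \<eta>" "\<And>s. s \<in> {0<..<\<eta>} \<Longrightarrow> f s = a \<and> f (1 - s) = b" using ends by blast
  obtain \<eta>0 where \<eta>0: "0 < \<eta>0" "\<And>k. k \<in> K \<Longrightarrow> k \<noteq> 0 \<Longrightarrow> \<eta>0 \<le> \<bar>k - 0\<bar>" using finite_gap[OF K(1)] by metis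
  obtain \<eta>1 where \<eta>1: "0 < \<eta>1" "\<And>k. k \<in> K \<Longrightarrow> k \<noteq> 1 \<Longrightarrow> \<eta>1 \<le> \<bar>k - 1\<bar>" using finite_gap[OF K(1)] by metis
  obtain s1 where s1: "0 < s1" "s1 < \<eta>" "s1 < 1" using field_lbound_gt_zero[OF \<eta>(1) zero_less_one] by blast
  obtain s2 where s2: "0 < s2" "s2 < \<eta>0" "s2 < \<eta>1" using field_lbound_gt_zero[OF \<eta>0(1) \<eta>1(1)] by blast
  obtain s where "0 < s" "s < s1" "s < s2" using field_lbound_gt_zero[OF s1(1) s2(1)] by blast
  with s1 s2 have s: "0 < s" "s < \<eta>" "s < 1" "s < \<eta>0" "s < \<eta>1" by auto
  have lo: "s < k" and hi: "k < 1 - s" if "k \<in> K" for k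
    using \<eta>0(2)[OF that] \<eta>1(2)[OF that] K(2) that s by (auto simp: subset_iff)
  have "s \<notin> K" "1 - s \<notin> K" using lo hi by auto
  moreover have E: "{k \<in> K. k < s} = {}" "{k \<in> K. k < 1 - s} = K" using lo hi by force+
  have "S s = 0" "S (1 - s) = (\<Sum>k\<in>K. R k - L k)" unfolding S_def E by simp_all
  ultimately have "G s = a" "G (1 - s) = b - (\<Sum>k\<in>K. R k - L k)" using \<eta>(2)[of s] s by (simp_all add: G_def)
  then show ?thesis using g[of s] g[of "1 - s"] s by simp
qed

context diagram
begin

lemma under_crossing: "x \<in> under T \<Longrightarrow> \<exists>y. crossing m T x y"
proof -
  have "\<forall>x\<in>under T. \<exists>y. crossing m T x y" using vtd_unfolded by (elim conjE)
  then show "x \<in> under T \<Longrightarrow> \<exists>y. crossing m T x y" by blast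
qed

lemma under_not_both: "crossing m T x y \<Longrightarrow> x \<in> under T \<Longrightarrow> y \<notin> under T"
proof -
  have "\<forall>x y. crossing m T x y \<longrightarrow> \<not> (x \<in> under T \<and> y \<in> under T)" using vtd_unfolded by (elim conjE)
  then show "crossing m T x y \<Longrightarrow> x \<in> under T \<Longrightarrow> y \<notin> under T" by blast
qed

text \<open>The integer copy of \<open>left_shade\<close>, to be multiplied with colors; at regular
  parameters -1 is the only value besides 1.\<close>

definition lsign :: "param \<Rightarrow> int" where
  "lsign x = (if left_shade x = 1 then 1 else - 1)"

text \<open>Each crossing contributes \<open>\<plusminus>(c(x) + c(z) - 2 c(y))\<close> to the sum of the jumps of the signed colors along the
  strings, and the end values of the strings give the alternating sum of the boundary colors. The crossings
  are counted at both of their parameters, hence \<open>p\<close> has to be odd.\<close>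

lemma alternating_sum_of_colors:
  fixes c :: "param \<Rightarrow> int" and p :: int
  assumes p: "odd p"
    and classical: "\<And>x y. crossing m T x y \<Longrightarrow> x \<in> under T \<or> y \<in> under T"
    and const: "\<And>i t. (i, t) \<in> params m - under T \<Longrightarrow>
       \<exists>\<eta>>0. \<forall>t'\<in>{0..1}. \<bar>t' - t\<bar> < \<eta> \<longrightarrow> c (i, t') = c (i, t)"
    and rel: "\<And>i t v. (i, t) \<in> under T \<Longrightarrow> crossing m T (i, t) v \<Longrightarrow>
       \<exists>a b. p dvd a + b - 2 * c v \<and> (\<exists>\<eta>>0. \<forall>s\<in>{0<..<\<eta>}. c (i, t - s) = a \<and> c (i, t + s) = b)"
  shows "p dvd (\<Sum>k<2 * m. (-1) ^ k * c (e k))"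
proof -
  define f where "f x = lsign x * c x" for x
  define lims where "lims x l r \<longleftrightarrow>
      (\<exists>\<eta>>0. \<forall>s\<in>{0<..<\<eta>}. f (fst x, snd x - s) = l \<and> f (fst x, snd x + s) = r)" for x l r
  have lims_unique: "l = l' \<and> r = r'" if l1: "lims x l r" and l2: "lims x l' r'" for x l r l' r'
  proof -
    obtain \<eta> where \<eta>: "0 < \<eta>" "\<And>s. s \<in> {0<..<\<eta>} \<Longrightarrow> f (fst x, snd x - s) = l \<and> f (fst x, snd x + s) = r"
      using l1 unfolding lims_def by blast
    obtain \<eta>' where \<eta>': "0 < \<eta>'" "\<And>s. s \<in> {0<..<\<eta>'} \<Longrightarrow> f (fst x, snd x - s) = l' \<and> f (fst x, snd x + s) = r'"
      using l2 unfolding lims_def by blast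
    have "min \<eta> \<eta>' / 2 \<in> {0<..<\<eta>} \<inter> {0<..<\<eta>'}" using \<eta>(1) \<eta>'(1) by auto
    then show ?thesis using \<eta>(2) \<eta>'(2) by (metis IntD1 IntD2)
  qed
  \<comment> \<open>With \<open>s\<close> the sign before the under-crossing, the signed color jumps
    from \<open>s * a\<close> to \<open>- s * b\<close> on the lower string and from
    \<open>- s * y\<close> to \<open>s * y\<close> on the upper one. The jumps add up to
    \<open>- s * (a + b - 2 * y)\<close>.\<close>
  have cross: "\<exists>lu ru lv rv. lims u lu ru \<and> lims v lv rv \<and> p dvd (ru - lu) + (rv - lv)"
    if uv: "crossing m T u v" and un: "u \<in> under T" for u v
  proof -
    obtain i t where u: "u = (i, t)" by (cases u)
    obtain j t1 where v: "v = (j, t1)" by (cases v)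
    obtain q \<eta>1 where q: "0 < \<eta>1"
      "\<forall>\<sigma>. 0 < \<sigma> \<longrightarrow> \<sigma> < \<eta>1 \<longrightarrow> regular (i, t - \<sigma>) \<and> regular (i, t + \<sigma>) \<and> regular (j, t1 - \<sigma>) \<and> regular (j, t1 + \<sigma>) \<and>
      left_shade (i, t - \<sigma>) = q \<and> left_shade (i, t + \<sigma>) = - q \<and> left_shade (j, t1 - \<sigma>) = - q \<and> left_shade (j, t1 + \<sigma>) = q"
      by (rule left_shade_at_crossing[OF uv[unfolded u v]]) blast
    have "q \<in> {1, -1}" using left_shade_values[of "(i, t - \<eta>1 / 2)"] spec[OF q(2), of "\<eta>1 / 2"] q(1) by auto
    define s where "s = (if q = 1 then 1 else -1 :: int)"
    have sg: "lsign (i, t - \<sigma>) = s \<and> lsign (i, t + \<sigma>) = - s \<and> lsign (j, t1 - \<sigma>) = - s \<and> lsign (j, t1 + \<sigma>) = s"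
      if "0 < \<sigma>" "\<sigma> < \<eta>1" for \<sigma>
      using q(2) that \<open>q \<in> {1, -1}\<close> by (auto simp: lsign_def s_def)
    obtain a b \<eta>2 where ab: "p dvd a + b - 2 * c v" "0 < \<eta>2" "\<And>s. s \<in> {0<..<\<eta>2} \<Longrightarrow> c (i, t - s) = a \<and> c (i, t + s) = b"
      using rel[of i t v] uv un u by blast
    have "(j, t1) \<in> params m - under T" using under_not_both[OF uv un] uv by (auto simp: v crossing_def)
    then obtain \<eta>3 where \<eta>3: "0 < \<eta>3" "\<And>t'. t' \<in> {0..1} \<Longrightarrow> \<bar>t' - t1\<bar> < \<eta>3 \<Longrightarrow> c (j, t') = c (j, t1)"
      using const by blast
    define y where "y = c v"
    have "lims u (s * a) (- s * b)"
      unfolding lims_def f_def u fst_conv snd_conv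
      using q(1) ab(2,3) sg by (intro exI[of _ "min \<eta>1 \<eta>2"]) auto
    moreover have "lims v (- s * y) (s * y)"
      unfolding lims_def f_def
    proof (intro exI conjI ballI)
      show "0 < min \<eta>1 \<eta>3" using q(1) \<eta>3(1) by simp
      fix x assume x: "x \<in> {0<..<min \<eta>1 \<eta>3}"
      have "regular (j, t1 - x)" "regular (j, t1 + x)" using q(2) x by auto
      then have "t1 - x \<in> {0..1}" "t1 + x \<in> {0..1}" by (auto simp: regular_def params_def)
      then have "c (j, t1 - x) = y" "c (j, t1 + x) = y" using \<eta>3(2)[of "t1 - x"] \<eta>3(2)[of "t1 + x"] x by (auto simp: y_def v)
      then show "lsign (fst v, snd v - x) * c (fst v, snd v - x) = - s * y"
        "lsign (fst v, snd v + x) * c (fst v, snd v + x) = s * y"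
        using sg[of x] x by (auto simp: v)
    qed
    moreover have "p dvd ((- s * b) - s * a) + (s * y - (- s * y))"
    proof -
      have "((- s * b) - s * a) + (s * y - (- s * y)) = - s * (a + b - 2 * c v)" by (simp add: y_def algebra_simps)
      then show ?thesis using ab(1) by simp
    qed
    ultimately show ?thesis by blast
  qed
  define X where "X = {x. \<exists>y. crossing m T x y}"
  have X: "X = fst ` {(x, y). crossing m T x y}" by (force simp: X_def)
  have finX: "finite X" unfolding X by (intro finite_imageI finite_crossings)
  define \<pi> where "\<pi> x = (THE y. crossing m T x y)" for x
  have \<pi>: "\<pi> x = y" if "crossing m T x y" for x y
    unfolding \<pi>_def using that crossing_unique by (intro the_equality)
  define L where "L x = (THE l. \<exists>r. lims x l r)" for x
  define R where "R x = (THE r. \<exists>l. lims x l r)" for x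
  have LR: "L x = l" "R x = r" if "lims x l r" for x l r
    unfolding L_def R_def using that lims_unique by (blast intro!: the_equality)+
  have limsX: "lims x (L x) (R x)" "p dvd (R x - L x) + (R (\<pi> x) - L (\<pi> x))" if xX: "x \<in> X" for x
  proof -
    obtain y where y: "crossing m T x y" using xX unfolding X_def by blast
    have "\<exists>l r l' r'. lims x l r \<and> lims y l' r' \<and> p dvd (r - l) + (r' - l')"
    proof (cases "x \<in> under T")
      case True then show ?thesis using cross[OF y] by blast
    next
      case False
      then have "y \<in> under T" using classical[OF y] by blast
      then show ?thesis using cross[of y x] y crossing_sym by (metis add.commute)
    qed
    then show "lims x (L x) (R x)" "p dvd (R x - L x) + (R (\<pi> x) - L (\<pi> x))"
      using LR \<pi>[OF y] by metis+
  qed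
  have \<pi>X: "\<pi> x \<in> X \<and> \<pi> (\<pi> x) = x" if xX: "x \<in> X" for x
  proof -
    obtain y where y: "crossing m T x y" using xX unfolding X_def by blast
    then have "crossing m T y x" using crossing_sym by blast
    then show ?thesis using \<pi>[OF y] \<pi>[of y x] unfolding X_def by blast
  qed
  have bij: "bij_betw \<pi> X X"
    by (rule bij_betw_byWitness[where f' = \<pi>]) (use \<pi>X in auto)
  have "2 * (\<Sum>x\<in>X. R x - L x) = (\<Sum>x\<in>X. R x - L x) + (\<Sum>x\<in>X. R (\<pi> x) - L (\<pi> x))"
    using sum.reindex_bij_betw[OF bij, of "\<lambda>x. R x - L x"] by simp
  also have "\<dots> = (\<Sum>x\<in>X. (R x - L x) + (R (\<pi> x) - L (\<pi> x)))" by (simp add: sum.distrib)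
  finally have "2 * (\<Sum>x\<in>X. R x - L x) = (\<Sum>x\<in>X. (R x - L x) + (R (\<pi> x) - L (\<pi> x)))" .
  moreover have "p dvd (\<Sum>x\<in>X. (R x - L x) + (R (\<pi> x) - L (\<pi> x)))" using limsX(2) by (rule dvd_sum)
  ultimately have "p dvd 2 * (\<Sum>x\<in>X. R x - L x)" by (simp only:)
  then have dvdX: "p dvd (\<Sum>x\<in>X. R x - L x)" using p coprime_dvd_mult_right_iff[of p 2] by simp
  define pos where "pos x = the_inv_into {..<2 * m} e x" for x
  have pos: "pos x < 2 * m" "e (pos x) = x" if "x \<in> endpoints m" for x
    unfolding pos_def using e_bij that
    by (metis bij_betwE bij_betw_the_inv_into lessThan_iff, metis bij_betw_def f_the_inv_into_f)
  have uncrossed: "x \<notin> under T" if "x \<in> endpoints m" for x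
  proof
    assume "x \<in> under T"
    then obtain y where "crossing m T x y" using under_crossing by blast
    then show False using endpoint_not_crossing[OF that] by blast
  qed
  have string: "(-1) ^ pos (i, 0) * c (i, 0) + (-1) ^ pos (i, 1) * c (i, 1) = - (\<Sum>x\<in>{x \<in> X. fst x = i}. R x - L x)"
    if i: "i < m" for i
  proof -
    define K where "K = {t. (i, t) \<in> X}"
    have K: "finite K" "K \<subseteq> {0<..<1}"
    proof -
      have "K \<subseteq> snd ` X" by (force simp: K_def)
      then show "finite K" using finX by (meson finite_imageI finite_subset)
      show "K \<subseteq> {0<..<1}"
      proof
        fix t assume "t \<in> K"
        then obtain y where "crossing m T (i, t) y" by (auto simp: K_def X_def)
        from crossing_interior(1)[OF this] show "t \<in> {0<..<1}" by (auto simp: params_def endpoints_def)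
      qed
    qed
    have ee: "(i, 0) \<in> endpoints m" "(i, 1) \<in> endpoints m" using i by (auto simp: endpoints_def)
    then have pe: "(i, 0) \<in> params m - under T" "(i, 1) \<in> params m - under T"
      using uncrossed endpoints_subset by blast+
    \<comment> \<open>At time 1 the string runs outward, so its left side is the right side of the
      inward direction. This accounts for the extra sign at the final end.\<close>
    have "- ((-1) ^ pos (i, 1) * c (i, 1)) - (-1) ^ pos (i, 0) * c (i, 0) = (\<Sum>k\<in>K. R (i, k) - L (i, k))"
    proof (rule sum_of_jumps[OF K, where f = "\<lambda>t. f (i, t)"])
      fix t assume t: "t \<in> {0<..<1} - K"
      then have reg: "regular (i, t)" using i by (auto simp: regular_def params_def endpoints_def K_def X_def)
      have "(i, t) \<notin> under T"
      proof
        assume "(i, t) \<in> under T"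
        then obtain y where "crossing m T (i, t) y" using under_crossing by blast
        then show False using reg unfolding regular_def by blast
      qed
      then have "(i, t) \<in> params m - under T" using reg by (auto simp: regular_def)
      then obtain \<eta>1 where \<eta>1: "0 < \<eta>1" "\<And>t'. t' \<in> {0..1} \<Longrightarrow> \<bar>t' - t\<bar> < \<eta>1 \<Longrightarrow> c (i, t') = c (i, t)"
        using const by blast
      obtain \<eta>2 where \<eta>2: "0 < \<eta>2" "\<And>t'. \<bar>t' - t\<bar> < \<eta>2 \<Longrightarrow> regular (i, t') \<and> left_shade (i, t') = left_shade (i, t)"
        using left_shade_locally_constant[OF reg] by metis
      have "f (i, t') = f (i, t)" if "\<bar>t' - t\<bar> < min \<eta>1 \<eta>2" for t'
      proof -
        have "t' \<in> {0..1}" using \<eta>2(2)[of t'] that by (auto simp: regular_def params_def)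
        then show ?thesis using \<eta>1(2)[of t'] \<eta>2(2)[of t'] that by (simp add: f_def lsign_def)
      qed
      then show "\<exists>\<eta>>0. \<forall>t'. \<bar>t' - t\<bar> < \<eta> \<longrightarrow> f (i, t') = f (i, t)"
        using \<eta>1(1) \<eta>2(1) by (metis min_less_iff_conj)
    next
      fix k assume "k \<in> K"
      then have "lims (i, k) (L (i, k)) (R (i, k))" using limsX(1) by (simp add: K_def)
      then show "\<exists>\<eta>>0. \<forall>s\<in>{0<..<\<eta>}. f (i, k - s) = L (i, k) \<and> f (i, k + s) = R (i, k)"
        by (simp add: lims_def)
    next
      obtain \<eta>1 where \<eta>1: "0 < \<eta>1" "\<And>t'. t' \<in> {0..1} \<Longrightarrow> \<bar>t' - 0\<bar> < \<eta>1 \<Longrightarrow> c (i, t') = c (i, 0)"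
        using const[OF pe(1)] by blast
      obtain \<eta>2 where \<eta>2: "0 < \<eta>2" "\<And>t'. t' \<in> {0..1} \<Longrightarrow> \<bar>t' - 1\<bar> < \<eta>2 \<Longrightarrow> c (i, t') = c (i, 1)"
        using const[OF pe(2)] by blast
      obtain \<eta>3 where \<eta>3: "0 < \<eta>3" "\<forall>u. 0 < u \<longrightarrow> u < \<eta>3 \<longrightarrow> left_shade (i, u) = (-1) ^ pos (i, 0)"
        by (rule left_shade_at_endpoint[OF pos[OF ee(1)]]) force
      obtain \<eta>4 where \<eta>4: "0 < \<eta>4" "\<forall>u. 0 < u \<longrightarrow> u < \<eta>4 \<longrightarrow> - left_shade (i, 1 - u) = (-1) ^ pos (i, 1)"
        by (rule left_shade_at_endpoint[OF pos[OF ee(2)]]) force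
      define \<eta> where "\<eta> = min (min \<eta>1 \<eta>2) (min (min \<eta>3 \<eta>4) 1)"
      have "0 < \<eta>" using \<eta>1(1) \<eta>2(1) \<eta>3(1) \<eta>4(1) by (simp add: \<eta>_def)
      moreover have "f (i, s) = (-1) ^ pos (i, 0) * c (i, 0) \<and> f (i, 1 - s) = - ((-1) ^ pos (i, 1) * c (i, 1))"
        if s: "s \<in> {0<..<\<eta>}" for s
      proof -
        have s': "0 < s" "s < \<eta>1" "s < \<eta>2" "s < \<eta>3" "s < \<eta>4" "s < 1" using s by (auto simp: \<eta>_def)
        have "c (i, s) = c (i, 0)" "c (i, 1 - s) = c (i, 1)" using \<eta>1(2)[of s] \<eta>2(2)[of "1 - s"] s' by auto
        moreover have "lsign (i, s) = (-1) ^ pos (i, 0)"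
          using \<eta>3(2) s' by (auto simp: lsign_def minus_one_power_iff)
        moreover have "left_shade (i, 1 - s) = - ((-1) ^ pos (i, 1))" using \<eta>4(2) s' by (metis minus_minus)
        then have "lsign (i, 1 - s) = - ((-1) ^ pos (i, 1))" by (auto simp: lsign_def minus_one_power_iff)
        ultimately show ?thesis by (simp add: f_def)
      qed
      ultimately show "\<exists>\<eta>>0. \<forall>s\<in>{0<..<\<eta>}. f (i, s) = (-1) ^ pos (i, 0) * c (i, 0) \<and>
           f (i, 1 - s) = - ((-1) ^ pos (i, 1) * c (i, 1))" by blast
    qed
    also have "(\<Sum>k\<in>K. R (i, k) - L (i, k)) = (\<Sum>x\<in>Pair i ` K. R x - L x)"
      by (subst sum.reindex) (auto simp: inj_on_def)
    also have "Pair i ` K = {x \<in> X. fst x = i}" by (force simp: K_def)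
    finally show ?thesis by simp
  qed
  have "(\<Sum>k<2 * m. (-1) ^ k * c (e k)) = (\<Sum>k<2 * m. (-1) ^ pos (e k) * c (e k))"
    using e_bij by (intro sum.cong) (auto simp: pos_def the_inv_into_f_f bij_betw_def)
  also have "\<dots> = (\<Sum>x\<in>endpoints m. (-1) ^ pos x * c x)"
    by (rule sum.reindex_bij_betw[OF e_bij])
  also have "\<dots> = (\<Sum>i<m. \<Sum>t\<in>{0, 1}. (-1) ^ pos (i, t) * c (i, t))"
    unfolding endpoints_Times by (subst sum.cartesian_product) (simp add: case_prod_beta)
  also have "\<dots> = (\<Sum>i<m. - (\<Sum>x\<in>{x \<in> X. fst x = i}. R x - L x))"
    using string by (intro sum.cong) auto
  also have "\<dots> = - (\<Sum>i<m. \<Sum>x\<in>{x \<in> X. fst x = i}. R x - L x)" by (simp add: sum_negf)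
  also have "(\<Sum>i<m. \<Sum>x\<in>{x \<in> X. fst x = i}. R x - L x) = (\<Sum>x\<in>X. R x - L x)"
    by (rule sum.group) (use finX in \<open>auto simp: X_def crossing_def params_def\<close>)
  finally show ?thesis using dvdX by simp
qed

end

text \<open>Both kinds of rings are treated as the integers modulo \<open>p\<close>, with
  \<open>p = 0\<close> for the ring of integers since \<open>x mod 0 = x\<close>. In the residue
  case oddness allows a factor 2 to be cancelled.\<close>

lemma coefficient_ring:
  fixes R :: "int ring"
  assumes "R = \<Z> \<or> (\<exists>p. 3 \<le> p \<and> odd p \<and> R = residue_ring p)"
  obtains p where "p = 0 \<or> odd p" "\<zero>\<^bsub>R\<^esub> = 0"
    "\<And>x. x \<in> carrier R \<Longrightarrow> x mod p = x" "\<And>x. x mod p \<in> carrier R"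
    "\<And>x y. \<lbrakk>x \<in> carrier R; y \<in> carrier R\<rbrakk> \<Longrightarrow> x \<oplus>\<^bsub>R\<^esub> y = (x + y) mod p"
    "\<And>x. x \<in> carrier R \<Longrightarrow> [(2::nat)] \<cdot>\<^bsub>R\<^esub> x = (2 * x) mod p"
    "\<And>v. set v \<subseteq> carrier R \<Longrightarrow> alternating_sum R v = (\<Sum>k<length v. (-1) ^ k * v ! k) mod p"
  using assms
proof
  assume R: "R = \<Z>"
  show thesis
  proof (rule that[of 0])
    show "[(2::nat)] \<cdot>\<^bsub>R\<^esub> x = (2 * x) mod 0" for x
      by (simp add: R add_pow_def numeral_2_eq_2 int.add.nat_pow_Suc)
    have pow: "x [^]\<^bsub>\<Z>\<^esub> k = x ^ k" for x :: int and k :: nat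
      by (induction k) (simp_all add: int.nat_pow_Suc)
    have "(\<Oplus>\<^bsub>\<Z>\<^esub>i\<in>{..<n}. f i) = (\<Sum>i<n. f i)" for n :: nat and f :: "nat \<Rightarrow> int"
      by (rule int_finsum_eq)
    moreover have "\<ominus>\<^bsub>\<Z>\<^esub> 1 = (-1 :: int)" by (rule int_a_inv_eq)
    ultimately show "alternating_sum R v = (\<Sum>k<length v. (-1) ^ k * v ! k) mod 0" for v
      by (simp add: alternating_sum_def R pow)
  qed (simp_all add: R)
next
  assume "\<exists>p. 3 \<le> p \<and> odd p \<and> R = residue_ring p"
  then obtain p where p: "3 \<le> p" "odd p" "R = residue_ring p" by blast
  interpret residues p R
    using p(1) by unfold_locales (simp, rule eq_reflection, rule p(3))
  have car: "x \<in> carrier R \<longleftrightarrow> 0 \<le> x \<and> x < p" for x by (auto simp: p(3) residue_ring_def)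
  have fin: "(\<Oplus>\<^bsub>R\<^esub>i\<in>{..<n}. f i) = (\<Sum>i<n. f i) mod p" if "\<And>i. i < n \<Longrightarrow> f i \<in> carrier R" for n :: nat and f
    using that
  proof (induction n)
    case 0 then show ?case by (simp add: res_zero_eq)
  next
    case (Suc n)
    have "(\<Oplus>\<^bsub>R\<^esub>i\<in>insert n {..<n}. f i) = f n \<oplus>\<^bsub>R\<^esub> (\<Oplus>\<^bsub>R\<^esub>i\<in>{..<n}. f i)"
      using Suc.prems by (intro finsum_insert) auto
    also have "\<dots> = (f n + (\<Sum>i<n. f i) mod p) mod p" using Suc by (simp add: res_add_eq)
    also have "\<dots> = (\<Sum>i<Suc n. f i) mod p" by (simp add: mod_simps add.commute)
    finally show ?case by (simp add: lessThan_Suc)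
  qed
  show thesis
  proof (rule that[of p])
    show "x mod p = x" if "x \<in> carrier R" for x using that car by auto
    show "x mod p \<in> carrier R" for x using p car by auto
    show "[(2::nat)] \<cdot>\<^bsub>R\<^esub> x = (2 * x) mod p" if x: "x \<in> carrier R" for x
    proof -
      have "[(2::nat)] \<cdot>\<^bsub>R\<^esub> x = (\<zero>\<^bsub>R\<^esub> \<oplus>\<^bsub>R\<^esub> x) \<oplus>\<^bsub>R\<^esub> x"
        by (simp add: add_pow_def numeral_2_eq_2 add.nat_pow_Suc)
      then show ?thesis unfolding mult_2 by (simp add: res_add_eq res_zero_eq mod_add_left_eq)
    qed
    show "alternating_sum R v = (\<Sum>k<length v. (-1) ^ k * v ! k) mod p" if v: "set v \<subseteq> carrier R" for v
    proof -
      have vk: "v ! k \<in> carrier R" if "k < length v" for k using v that by auto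
      have "(\<ominus>\<^bsub>R\<^esub> \<one>\<^bsub>R\<^esub>) [^]\<^bsub>R\<^esub> k = (-1) ^ k mod p" for k :: nat
      proof -
        have "\<ominus>\<^bsub>R\<^esub> \<one>\<^bsub>R\<^esub> = (-1) mod p" by (simp add: res_neg_eq res_one_eq)
        then show ?thesis by (simp add: pow_cong)
      qed
      then have eq: "((\<ominus>\<^bsub>R\<^esub> \<one>\<^bsub>R\<^esub>) [^]\<^bsub>R\<^esub> k) \<otimes>\<^bsub>R\<^esub> (v ! k) = ((-1) ^ k * v ! k) mod p" for k
        by (simp add: res_mult_eq mod_simps)
      have "alternating_sum R v = (\<Sum>k<length v. ((-1) ^ k * v ! k) mod p) mod p"
        unfolding alternating_sum_def eq by (rule fin) (use p car in auto)
      then show ?thesis by (simp add: mod_sum_eq)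
    qed
  qed (use p(2) in \<open>simp_all add: res_zero_eq res_add_eq\<close>)
qed

section \<open>Arcs and the colors along them\<close>

lemma connected_nat_real_fst:
  fixes X :: "(nat \<times> real) set"
  assumes "connected X" "x \<in> X" "y \<in> X" shows "fst x = fst y"
proof -
  have conn: "connected (fst ` X)" using assms(1) by (intro connected_continuous_image continuous_intros)
  show ?thesis
  proof (rule ccontr)
    assume ne: "fst x \<noteq> fst y"
    have "open {fst x}" "open (- {fst x})" by (simp_all add: open_discrete)
    from connectedD[OF conn this] have "{fst x} \<inter> fst ` X = {} \<or> - {fst x} \<inter> fst ` X = {}" by auto
    moreover have "fst x \<in> fst ` X" "fst y \<in> fst ` X" using assms(2,3) by blast+
    ultimately show False using ne by (metis ComplI IntI empty_iff singletonD singletonI)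
  qed
qed

context diagram
begin

lemma finite_under: "finite (under T)"
proof -
  have "under T \<subseteq> fst ` {(x, y). crossing m T x y}"
  proof
    fix x assume "x \<in> under T"
    then obtain y where "crossing m T x y" using under_crossing by blast
    then show "x \<in> fst ` {(x, y). crossing m T x y}" by (intro image_eqI[of _ _ "(x, y)"]) auto
  qed
  then show ?thesis using finite_crossings by (meson finite_imageI finite_subset)
qed

definition arc_of :: "param \<Rightarrow> param set" where
  "arc_of x = connected_component_set (params m - under T) x"

lemma arc_of: "x \<in> params m - under T \<Longrightarrow> arc_of x \<in> diagram_arcs m T \<and> x \<in> arc_of x"
  by (auto simp: arc_of_def diagram_arcs_def intro: componentsI connected_component_refl)

lemma arc_of_eq: "A \<in> diagram_arcs m T \<Longrightarrow> x \<in> A \<Longrightarrow> arc_of x = A"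
  unfolding arc_of_def diagram_arcs_def
  by (metis components_iff connected_component_eq)

lemma arc_of_interval:
  assumes "connected I" "{i} \<times> I \<subseteq> params m - under T" "s \<in> I" "t \<in> I"
  shows "arc_of (i, s) = arc_of (i, t)"
proof -
  have "connected ({i} \<times> I)" using assms(1) by (intro connected_Times) auto
  then have "connected_component (params m - under T) (i, s) (i, t)"
    unfolding connected_component_def using assms by blast
  then show ?thesis unfolding arc_of_def by (rule connected_component_eq[symmetric, OF CollectI])
qed

lemma under_gap:
  obtains \<eta> where "0 < \<eta>" "\<And>t'. t' \<noteq> t \<Longrightarrow> \<bar>t' - t\<bar> < \<eta> \<Longrightarrow> (i, t') \<notin> under T"
proof -
  have "finite {t'. (i, t') \<in> under T}"
    using finite_under finite_imageI[of "under T" snd] by (rule_tac finite_subset[of _ "snd ` under T"]) force+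
  then obtain \<eta> where "0 < \<eta>" "\<And>k. k \<in> {t'. (i, t') \<in> under T} \<Longrightarrow> k \<noteq> t \<Longrightarrow> \<eta> \<le> \<bar>k - t\<bar>"
    using finite_gap by metis
  then show ?thesis by (intro that[of \<eta>]) force+
qed

lemma under_interior: "(i, t) \<in> under T \<Longrightarrow> i < m \<and> t \<in> {0<..<1}"
  using under_crossing crossing_interior(1)[of "(i, t)"] by (fastforce simp: params_def endpoints_def)

text \<open>There are finitely many under-crossings, so a punctured neighborhood of \<open>t\<close>
  is free of them and each half lies in one arc. The two arcs differ: a connected set reaching both
  halves would have a point at time \<open>t\<close> on the same string, which is the removed
  under-crossing.\<close>

lemma arcs_at_under_crossing:
  assumes u: "(i, t) \<in> under T"
  obtains X Z \<eta> where "X \<in> diagram_arcs m T" "Z \<in> diagram_arcs m T" "X \<noteq> Z"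
    "(i, t) \<in> closure X" "(i, t) \<in> closure Z" "0 < \<eta>"
    "\<And>s. s \<in> {0<..<\<eta>} \<Longrightarrow> (i, t - s) \<in> X \<and> (i, t + s) \<in> Z"
proof -
  have im: "i < m" and t: "0 < t" "t < 1" using under_interior[OF u] by auto
  obtain \<eta>0 where \<eta>0: "0 < \<eta>0" "\<And>t'. t' \<noteq> t \<Longrightarrow> \<bar>t' - t\<bar> < \<eta>0 \<Longrightarrow> (i, t') \<notin> under T"
    using under_gap by metis
  define \<eta> where "\<eta> = min \<eta>0 (min t (1 - t))"
  have \<eta>: "0 < \<eta>" "\<eta> \<le> \<eta>0" "\<eta> \<le> t" "\<eta> \<le> 1 - t" using \<eta>0(1) t by (simp_all add: \<eta>_def)
  let ?I = "{t - \<eta><..<t}" and ?J = "{t<..<t + \<eta>}"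
  have sub': "(i, s) \<in> params m - under T" if "s \<in> ?I \<union> ?J" for s
  proof -
    have "s \<noteq> t" "\<bar>s - t\<bar> < \<eta>" using that by auto
    then show ?thesis using \<eta>0(2)[of s] \<eta> im by (simp add: params_def abs_less_iff)
  qed
  then have sub: "{i} \<times> ?I \<subseteq> params m - under T" "{i} \<times> ?J \<subseteq> params m - under T" by blast+
  define X where "X = arc_of (i, t - \<eta> / 2)"
  define Z where "Z = arc_of (i, t + \<eta> / 2)"
  have arcs: "X \<in> diagram_arcs m T" "Z \<in> diagram_arcs m T"
    unfolding X_def Z_def using arc_of sub'[of "t - \<eta> / 2"] sub'[of "t + \<eta> / 2"] \<eta>(1) by auto
  have XI: "{i} \<times> ?I \<subseteq> X"
  proof
    fix x assume x: "x \<in> {i} \<times> ?I"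
    then obtain s where s: "x = (i, s)" "s \<in> ?I" by auto
    have "arc_of (i, s) = X" unfolding X_def
      by (rule arc_of_interval[OF _ sub(1)]) (use s \<eta>(1) in auto)
    then show "x \<in> X" using arc_of[OF sub'[of s]] s by simp
  qed
  have ZJ: "{i} \<times> ?J \<subseteq> Z"
  proof
    fix x assume x: "x \<in> {i} \<times> ?J"
    then obtain s where s: "x = (i, s)" "s \<in> ?J" by auto
    have "arc_of (i, s) = Z" unfolding Z_def
      by (rule arc_of_interval[OF _ sub(2)]) (use s \<eta>(1) in auto)
    then show "x \<in> Z" using arc_of[OF sub'[of s]] s by simp
  qed
  have ne: "X \<noteq> Z"
  proof
    assume "X = Z"
    then have in2: "(i, t - \<eta> / 2) \<in> X" "(i, t + \<eta> / 2) \<in> X" using XI ZJ \<eta>(1) by auto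
    have conn: "connected X" unfolding X_def arc_of_def by simp
    have "connected (snd ` X)" using conn by (intro connected_continuous_image continuous_intros)
    moreover have "t - \<eta> / 2 \<in> snd ` X" "t + \<eta> / 2 \<in> snd ` X" using in2 by force+
    ultimately have "t \<in> snd ` X" using \<eta>(1) unfolding connected_iff_interval
      by (meson add_increasing2 diff_le_eq half_gt_zero le_add_same_cancel1 less_imp_le)
    then obtain j where j: "(j, t) \<in> X" by auto
    then have "j = i" using connected_nat_real_fst[OF conn j in2(1)] by simp
    moreover have "X \<subseteq> params m - under T" unfolding X_def arc_of_def by (rule connected_component_subset)
    ultimately show False using j u by auto
  qed
  have cl: "(i, t) \<in> closure ({i} \<times> ?I)" "(i, t) \<in> closure ({i} \<times> ?J)"
    using \<eta>(1) by (auto simp: closure_Times)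
  show ?thesis
  proof (rule that[OF arcs ne _ _ \<eta>(1)])
    show "(i, t) \<in> closure X" "(i, t) \<in> closure Z"
      using cl closure_mono[OF XI] closure_mono[OF ZJ] by auto
    show "(i, t - s) \<in> X \<and> (i, t + s) \<in> Z" if "s \<in> {0<..<\<eta>}" for s
      using XI ZJ that by auto
  qed
qed

lemma arc_of_locally_constant:
  assumes x: "(i, t) \<in> params m - under T"
  shows "\<exists>\<eta>>0. \<forall>t'\<in>{0..1}. \<bar>t' - t\<bar> < \<eta> \<longrightarrow> arc_of (i, t') = arc_of (i, t)"
proof -
  obtain \<eta> where \<eta>: "0 < \<eta>" "\<And>t'. t' \<noteq> t \<Longrightarrow> \<bar>t' - t\<bar> < \<eta> \<Longrightarrow> (i, t') \<notin> under T"
    using under_gap by metis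
  have "arc_of (i, t') = arc_of (i, t)" if "t' \<in> {0..1}" "\<bar>t' - t\<bar> < \<eta>" for t'
  proof (rule arc_of_interval)
    show "connected ({0..1} \<inter> ball t \<eta>)" by (intro convex_connected convex_Int) auto
    show "{i} \<times> ({0..1} \<inter> ball t \<eta>) \<subseteq> params m - under T"
    proof
      fix y assume "y \<in> {i} \<times> ({0..1} \<inter> ball t \<eta>)"
      then obtain s where s: "y = (i, s)" "s \<in> {0..1}" "\<bar>s - t\<bar> < \<eta>" by (auto simp: dist_real_def abs_minus_commute)
      then show "y \<in> params m - under T" using \<eta>(2)[of s] x by (cases "s = t") (auto simp: params_def)
    qed
  qed (use that x \<eta>(1) in \<open>auto simp: dist_real_def abs_minus_commute params_def\<close>)
  with \<eta>(1) show ?thesis by blast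
qed

end

text \<open>Colors of arcs are pulled back to parameters, where they are locally constant off the
  under-crossings; the two arcs next to an under-crossing supply the relation that
  \<open>alternating_sum_of_colors\<close> asks for.\<close>

lemma colored_diagram_alternating_sum:
  fixes R :: "int ring"
  assumes R: "R = \<Z> \<or> (\<exists>p. 3 \<le> p \<and> odd p \<and> R = residue_ring p)"
    and v: "set v \<subseteq> carrier R"
    and T: "classical_tangle_diagram m T" and C: "coloring R m T C"
    and bd: "boundary_color_vector m T C v"
  shows "alternating_sum R v = \<zero>\<^bsub>R\<^esub>"
proof -
  obtain p where p: "p = 0 \<or> odd p" "\<zero>\<^bsub>R\<^esub> = 0"
    and red: "\<And>x. x \<in> carrier R \<Longrightarrow> x mod p = x" "\<And>x. x mod p \<in> carrier R"
    and add: "\<And>x y. \<lbrakk>x \<in> carrier R; y \<in> carrier R\<rbrakk> \<Longrightarrow> x \<oplus>\<^bsub>R\<^esub> y = (x + y) mod p"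
    and two: "\<And>x. x \<in> carrier R \<Longrightarrow> [(2::nat)] \<cdot>\<^bsub>R\<^esub> x = (2 * x) mod p"
    and alt: "\<And>v. set v \<subseteq> carrier R \<Longrightarrow> alternating_sum R v = (\<Sum>k<length v. (-1) ^ k * v ! k) mod p"
    by (rule coefficient_ring[OF R], rule that)
  have vtd: "virtual_tangle_diagram m T" and cl: "\<And>x y. crossing m T x y \<Longrightarrow> x \<in> under T \<or> y \<in> under T"
    using T by (auto simp: classical_tangle_diagram_def)
  obtain e \<theta> where e: "bij_betw e {..<2 * m} (endpoints m)" "\<And>k. k < 2 * m \<Longrightarrow> pt T (e k) = cis (\<theta> k)"
    "\<And>k l. k < l \<Longrightarrow> l < 2 * m \<Longrightarrow> \<theta> k < \<theta> l \<and> \<theta> l < \<theta> k + 2 * pi"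
    and ve: "\<And>k. k < 2 * m \<Longrightarrow> \<exists>A\<in>diagram_arcs m T. e k \<in> A \<and> v ! k = C A" and lv: "length v = 2 * m"
    using bd unfolding boundary_color_vector_def by blast
  interpret diagram m T e \<theta> using vtd e by unfold_locales auto
  define c where "c x = C (arc_of x)" for x
  define S where "S = (\<Sum>k<2 * m. (-1) ^ k * c (e k))"
  have ce: "c (e k) = v ! k" if "k < 2 * m" for k
    using ve[OF that] arc_of_eq unfolding c_def by metis
  \<comment> \<open>over the integers, any odd modulus exceeding the sum will do\<close>
  define P where "P = (if p = 0 then 2 * \<bar>S\<bar> + 1 else p)"
  have "P dvd S"
    unfolding S_def
  proof (rule alternating_sum_of_colors)
    show "odd P" using p(1) by (auto simp: P_def)
    show "\<exists>\<eta>>0. \<forall>t'\<in>{0..1}. \<bar>t' - t\<bar> < \<eta> \<longrightarrow> c (i, t') = c (i, t)" if "(i, t) \<in> params m - under T" for i t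
      using arc_of_locally_constant[OF that] unfolding c_def by metis
    show "\<exists>a b. P dvd a + b - 2 * c y \<and> (\<exists>\<eta>>0. \<forall>s\<in>{0<..<\<eta>}. c (i, t - s) = a \<and> c (i, t + s) = b)"
      if un: "(i, t) \<in> under T" and cr: "crossing m T (i, t) y" for i t y
    proof -
      obtain X Z \<eta> where XZ: "X \<in> diagram_arcs m T" "Z \<in> diagram_arcs m T" "X \<noteq> Z"
        "(i, t) \<in> closure X" "(i, t) \<in> closure Z" "0 < \<eta>"
        "\<And>s. s \<in> {0<..<\<eta>} \<Longrightarrow> (i, t - s) \<in> X \<and> (i, t + s) \<in> Z"
        using arcs_at_under_crossing[OF un] by metis
      have y: "y \<in> params m - under T" using under_not_both[OF cr un] cr by (auto simp: crossing_def)
      have "C X \<oplus>\<^bsub>R\<^esub> C Z = [(2::nat)] \<cdot>\<^bsub>R\<^esub> C (arc_of y)"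
      proof -
        have "\<forall>u v X Y Z. u \<in> under T \<and> crossing m T u v \<and>
          X \<in> diagram_arcs m T \<and> Z \<in> diagram_arcs m T \<and> X \<noteq> Z \<and> u \<in> closure X \<and> u \<in> closure Z \<and>
          Y \<in> diagram_arcs m T \<and> v \<in> Y \<longrightarrow> C X \<oplus>\<^bsub>R\<^esub> C Z = [(2::nat)] \<cdot>\<^bsub>R\<^esub> C Y"
          using C unfolding coloring_def by (rule conjunct2)
        from this[rule_format, of "(i, t)" y X Z "arc_of y"] show ?thesis
          using un cr XZ(1-5) arc_of[OF y] by blast
      qed
      moreover have "C X \<in> carrier R" "C Z \<in> carrier R" "C (arc_of y) \<in> carrier R"
        using C[unfolded coloring_def, THEN conjunct1] XZ(1,2) arc_of[OF y] by simp_all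
      ultimately have "(C X + C Z) mod p = (2 * c y) mod p" by (simp add: add two c_def)
      then have "p dvd C X + C Z - 2 * c y" by (simp add: mod_eq_dvd_iff)
      then have "P dvd C X + C Z - 2 * c y" by (auto simp: P_def)
      moreover have "c (i, t - s) = C X \<and> c (i, t + s) = C Z" if "s \<in> {0<..<\<eta>}" for s
        using XZ(7)[OF that] arc_of_eq XZ(1,2) by (simp add: c_def)
      ultimately show ?thesis using XZ(6) by blast
    qed
  qed (use cl in auto)
  have "p dvd S"
  proof (cases "p = 0")
    case True
    then have "2 * \<bar>S\<bar> + 1 dvd S" using \<open>P dvd S\<close> by (simp add: P_def)
    then have "S = 0" using dvd_imp_le_int[of S "2 * \<bar>S\<bar> + 1"] by (cases "S = 0") auto
    then show ?thesis by simp
  qed (use \<open>P dvd S\<close> in \<open>simp add: P_def\<close>)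
  moreover have "S = (\<Sum>k<length v. (-1) ^ k * v ! k)"
    unfolding S_def lv using ce by (intro sum.cong) auto
  ultimately show ?thesis using alt[OF v] p(2) by simp
qed

section \<open>Diagrams in polar coordinates\<close>

definition continuously_differentiable :: "(real \<Rightarrow> real) \<Rightarrow> bool" where
  "continuously_differentiable f \<longleftrightarrow>
     (\<exists>f'. (\<forall>t. (f has_real_derivative f' t) (at t)) \<and> continuous_on UNIV f')"

lemma continuously_differentiable_const: "continuously_differentiable (\<lambda>t. c)"
  unfolding continuously_differentiable_def by (intro exI[of _ "\<lambda>t. 0"]) auto

lemma continuously_differentiable_add:
  assumes "continuously_differentiable f" "continuously_differentiable g"
  shows "continuously_differentiable (\<lambda>t. f t + g t)"
proof -
  obtain f' g' where "\<forall>t. (f has_real_derivative f' t) (at t)" "continuous_on UNIV f'"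
    "\<forall>t. (g has_real_derivative g' t) (at t)" "continuous_on UNIV g'"
    using assms unfolding continuously_differentiable_def by blast
  then show ?thesis unfolding continuously_differentiable_def
    by (intro exI[of _ "\<lambda>t. f' t + g' t"]) (auto intro!: DERIV_add continuous_intros)
qed

lemma continuously_differentiable_affine:
  assumes "continuously_differentiable f"
  shows "continuously_differentiable (\<lambda>t. c * f (a * t + b))"
proof -
  obtain f' where f': "\<And>t. (f has_real_derivative f' t) (at t)" "continuous_on UNIV f'"
    using assms unfolding continuously_differentiable_def by blast
  have "((\<lambda>t. c * f (a * t + b)) has_real_derivative c * (f' (a * t + b) * a)) (at t)" for t
    by (rule DERIV_cmult, rule DERIV_chain2[OF f'(1)]) (auto intro!: derivative_eq_intros)
  moreover have "continuous_on UNIV (\<lambda>t. c * (f' (a * t + b) * a))"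
    by (intro continuous_intros continuous_on_compose2[OF f'(2)]) auto
  ultimately show ?thesis unfolding continuously_differentiable_def
    by (intro exI[of _ "\<lambda>t. c * (f' (a * t + b) * a)"] conjI allI)
qed

lemma DERIV_max_0_squared: "((\<lambda>u::real. (max 0 u)\<^sup>2) has_real_derivative 2 * max 0 u) (at u)"
proof (cases u "0 :: real" rule: linorder_cases)
  case less
  have "((\<lambda>u. 0) has_real_derivative 2 * max 0 u) (at u)" using less by simp
  then show ?thesis
    by (rule has_field_derivative_transform_within_open[where S = "{..<0}"]) (use less in auto)
next
  case greater
  have "((\<lambda>u. u\<^sup>2) has_real_derivative 2 * max 0 u) (at u)"
    using greater by (auto intro!: derivative_eq_intros)
  then show ?thesis
    by (rule has_field_derivative_transform_within_open[where S = "{0<..}"]) (use greater in auto)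
next
  case equal
  have "((\<lambda>h. (max 0 h)\<^sup>2 / h) \<longlongrightarrow> 0) (at (0::real))"
  proof (rule Lim_null_comparison)
    show "\<forall>\<^sub>F h in at (0::real). norm ((max 0 h)\<^sup>2 / h) \<le> \<bar>h\<bar>"
      by (rule always_eventually) (auto simp: max_def power2_eq_square)
    show "((\<lambda>h. \<bar>h\<bar>) \<longlongrightarrow> 0) (at (0::real))" by (intro tendsto_eq_intros) auto
  qed
  then show ?thesis by (simp add: equal DERIV_def)
qed

text \<open>On the unit interval this consists of the parabolas \<open>2 * u^2\<close> and
  \<open>1 - 2 * (1 - u)^2\<close>, joined at \<open>1 / 2\<close>. The truncated squares allow it
  to be differentiated term by term.\<close>

definition smooth_step :: "real \<Rightarrow> real" where
  "smooth_step u = 2 * (max 0 u)\<^sup>2 - 4 * (max 0 (u - 1 / 2))\<^sup>2 + 2 * (max 0 (u - 1))\<^sup>2"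

definition smooth_step_deriv :: "real \<Rightarrow> real" where
  "smooth_step_deriv u = 4 * max 0 u - 8 * max 0 (u - 1 / 2) + 4 * max 0 (u - 1)"

lemma DERIV_smooth_step: "(smooth_step has_real_derivative smooth_step_deriv u) (at u)"
proof -
  have *: "((\<lambda>u::real. (max 0 (u - c))\<^sup>2) has_real_derivative 2 * max 0 (u - c)) (at u)" for c
  proof -
    have "((\<lambda>u. u - c) has_real_derivative 1) (at u)" by (auto intro!: derivative_eq_intros)
    from DERIV_chain2[OF DERIV_max_0_squared this] show ?thesis by simp
  qed
  have "((\<lambda>u. 2 * (max 0 u)\<^sup>2 - 4 * (max 0 (u - 1 / 2))\<^sup>2 + 2 * (max 0 (u - 1))\<^sup>2)
     has_real_derivative 2 * (2 * max 0 u) - 4 * (2 * max 0 (u - 1 / 2)) + 2 * (2 * max 0 (u - 1))) (at u)"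
    by (intro DERIV_add DERIV_diff DERIV_cmult DERIV_max_0_squared *)
  then show ?thesis by (simp add: smooth_step_def[abs_def] smooth_step_deriv_def)
qed

lemma continuously_differentiable_smooth_step: "continuously_differentiable smooth_step"
  unfolding continuously_differentiable_def using DERIV_smooth_step
  by (intro exI[of _ smooth_step_deriv]) (auto simp: smooth_step_deriv_def[abs_def] intro!: continuous_intros)

lemma smooth_step_0: "u \<le> 0 \<Longrightarrow> smooth_step u = 0"
  by (simp add: smooth_step_def max_def)

lemma smooth_step_1: "1 \<le> u \<Longrightarrow> smooth_step u = 1"
  by (simp add: smooth_step_def max_def power2_eq_square algebra_simps)

lemma smooth_step_lower: "0 \<le> u \<Longrightarrow> u \<le> 1 / 2 \<Longrightarrow> smooth_step u = 2 * u\<^sup>2"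
  by (simp add: smooth_step_def max_def)

lemma smooth_step_upper: "1 / 2 \<le> u \<Longrightarrow> u \<le> 1 \<Longrightarrow> smooth_step u = 1 - 2 * (1 - u)\<^sup>2"
  by (simp add: smooth_step_def max_def power2_eq_square algebra_simps)

text \<open>That the middle value is taken only once makes two interchanged strings meet exactly
  once.\<close>

lemma smooth_step_half: "smooth_step u = 1 / 2 \<longleftrightarrow> u = 1 / 2"
proof -
  have sq: "x\<^sup>2 < 1 / 4" if "0 \<le> x" "x < 1 / 2" for x :: real
    using power_strict_mono[of x "1 / 2" 2] that by (simp add: power2_eq_square)
  consider "u \<le> 0" | "0 \<le> u" "u < 1 / 2" | "u = 1 / 2" | "1 / 2 < u" "u \<le> 1" | "1 \<le> u" by linarith
  then show ?thesis
  proof cases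
    case 2 then show ?thesis using sq[of u] by (simp add: smooth_step_lower)
  next
    case 3
    have "smooth_step (1 / 2) = 1 / 2" by (simp add: smooth_step_lower power2_eq_square)
    with 3 show ?thesis by (simp only:)
  next
    case 4 then show ?thesis using sq[of "1 - u"] by (simp add: smooth_step_upper)
  qed (simp_all add: smooth_step_0 smooth_step_1)
qed

lemma smooth_step_bounds: "0 \<le> smooth_step u \<and> smooth_step u \<le> 1"
proof -
  have sq: "x\<^sup>2 \<le> 1 / 4" if "0 \<le> x" "x \<le> 1 / 2" for x :: real
    using power_mono[of x "1 / 2" 2] that by (simp add: power2_eq_square)
  consider "u \<le> 0" | "0 \<le> u" "u \<le> 1 / 2" | "1 / 2 \<le> u" "u \<le> 1" | "1 \<le> u" by linarith
  then show ?thesis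
  proof cases
    case 2 then show ?thesis using sq[of u] by (simp add: smooth_step_lower)
  next
    case 3 then show ?thesis using sq[of "1 - u"] by (simp add: smooth_step_upper)
  qed (simp_all add: smooth_step_0 smooth_step_1)
qed

lemma smooth_step_symmetric: "smooth_step (1 - u) = 1 - smooth_step u"
proof -
  consider "u \<le> 0" | "0 \<le> u" "u \<le> 1 / 2" | "1 / 2 \<le> u" "u \<le> 1" | "1 \<le> u" by linarith
  then show ?thesis
    by cases (simp_all add: smooth_step_0 smooth_step_1 smooth_step_lower smooth_step_upper)
qed

text \<open>A profile that is positive, symmetric about \<open>1 / 2\<close>, equal to 1 at the ends
  of the unit interval and strictly decreasing up to its middle. Its derivative
  \<open>2 * t - 1\<close> vanishes only at the middle.\<close>

definition radius :: "real \<Rightarrow> real" where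
  "radius t = 1 - t + t\<^sup>2"

lemma radius_reflect: "radius (1 - t) = radius t"
  by (simp add: radius_def power2_eq_square algebra_simps)

lemma radius_le_iff: "0 \<le> s \<Longrightarrow> s \<le> 1 / 2 \<Longrightarrow> 0 \<le> t \<Longrightarrow> t \<le> 1 / 2 \<Longrightarrow> radius s \<le> radius t \<longleftrightarrow> t \<le> s"
proof -
  assume st: "0 \<le> s" "s \<le> 1 / 2" "0 \<le> t" "t \<le> 1 / 2"
  have eq: "radius t - radius s = (s - t) * (1 - s - t)"
    by (simp add: radius_def power2_eq_square algebra_simps)
  show ?thesis
  proof (cases "s + t = 1")
    case True
    then have "s = t" using st by linarith
    then show ?thesis by simp
  next
    case False
    then have "0 < 1 - s - t" using st by linarith
    moreover have "radius s \<le> radius t \<longleftrightarrow> 0 \<le> (s - t) * (1 - s - t)" using eq by linarith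
    ultimately show ?thesis by (simp add: zero_le_mult_iff)
  qed
qed

lemma radius_pos: "0 < radius t"
proof -
  have "radius t = (t - 1 / 2)\<^sup>2 + 3 / 4" by (simp add: radius_def power2_eq_square algebra_simps)
  then show ?thesis by (metis add_nonneg_pos zero_le_power2 zero_less_divide_iff zero_less_numeral)
qed

lemma radius_eq_iff: "radius s = radius t \<longleftrightarrow> s = t \<or> s = 1 - t"
proof -
  have "radius s - radius t = (s - t) * (s + t - 1)" by (simp add: radius_def power2_eq_square algebra_simps)
  then have "radius s = radius t \<longleftrightarrow> (s - t) * (s + t - 1) = 0" by linarith
  then show ?thesis by auto
qed

lemma radius_bounds: "t \<in> {0..1} \<Longrightarrow> radius t \<le> 1" "t \<in> {0..1} \<Longrightarrow> radius t = 1 \<longleftrightarrow> t = 0 \<or> t = 1"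
proof -
  have eq: "radius t = 1 - t * (1 - t)" by (simp add: radius_def power2_eq_square algebra_simps)
  show "t \<in> {0..1} \<Longrightarrow> radius t \<le> 1" "t \<in> {0..1} \<Longrightarrow> radius t = 1 \<longleftrightarrow> t = 0 \<or> t = 1"
    unfolding eq by auto
qed

text \<open>All strings have the same distance from 0 at the same time. Hence only points at the same distance \<open>\<tau>\<close> from the ends of
  their parameter intervals can meet, and they do so if and only if their angles agree.\<close>

definition polar_tangle :: "(nat \<Rightarrow> real \<Rightarrow> real) \<Rightarrow> param set \<Rightarrow> tangle" where
  "polar_tangle \<phi> U = \<lparr>strand = \<lambda>i t. of_real (radius t) * cis (\<phi> i t), under = U\<rparr>"

lemma under_polar [simp]: "under (polar_tangle \<phi> U) = U" by (simp add: polar_tangle_def)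

lemma pt_polar: "pt (polar_tangle \<phi> U) (i, t) = of_real (radius t) * cis (\<phi> i t)"
  by (simp add: polar_tangle_def pt_def)

lemma norm_pt_polar: "norm (pt (polar_tangle \<phi> U) x) = radius (snd x)"
  using radius_pos[of "snd x"] by (cases x) (simp add: pt_polar norm_mult)

text \<open>In the frame turned by the angle, the velocity has radial component
  \<open>2 * t - 1\<close> and angular component \<open>radius t * d\<close>. Thus a string is
  automatically immersed except possibly at its middle.\<close>

lemma polar_strand_deriv:
  assumes "(\<phi> i has_real_derivative d) (at t)"
  shows "(strand (polar_tangle \<phi> U) i has_vector_derivative cis (\<phi> i t) * Complex (2 * t - 1) (radius t * d)) (at t)"
  unfolding has_vector_derivative_complex_iff polar_tangle_def radius_def
  using assms
  by (auto intro!: derivative_eq_intros simp: power2_eq_square algebra_simps)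

lemma velocity_polar:
  assumes "(\<phi> i has_real_derivative d) (at t)"
  shows "velocity (polar_tangle \<phi> U) (i, t) = cis (\<phi> i t) * Complex (2 * t - 1) (radius t * d)"
  using polar_strand_deriv[of \<phi> i, OF assms] by (simp add: velocity_def vector_derivative_at)

lemma C1_polar:
  assumes "continuously_differentiable (\<phi> i)"
  shows "strand (polar_tangle \<phi> U) i C1_differentiable_on {0..1}"
proof -
  obtain f' where f': "\<And>t. (\<phi> i has_real_derivative f' t) (at t)" "continuous_on UNIV f'"
    using assms unfolding continuously_differentiable_def by blast
  have "continuous_on UNIV (\<phi> i)" using f'(1) by (meson DERIV_isCont continuous_at_imp_continuous_on)
  then have "continuous_on {0..1} (\<phi> i)" "continuous_on {0..1} f'" using f'(2) continuous_on_subset by blast+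
  then have "continuous_on {0..1} (\<lambda>t. cis (\<phi> i t) * Complex (2 * t - 1) (radius t * f' t))"
    unfolding radius_def complex_eq
    by (intro continuous_intros continuous_on_compose2[OF continuous_on_cis]) auto
  then show ?thesis unfolding C1_differentiable_on_def
    by (intro exI[of _ "\<lambda>t. cis (\<phi> i t) * Complex (2 * t - 1) (radius t * f' t)"] conjI ballI
        polar_strand_deriv f'(1))
qed

text \<open>Angles are taken from an interval in which \<open>cis\<close> is injective.\<close>

lemma polar_eq_iff:
  assumes "0 < r" "0 < s" "a \<in> {0..1}" "b \<in> {0..1}"
  shows "of_real r * cis a = of_real s * cis b \<longleftrightarrow> r = s \<and> a = b"
proof
  assume eq: "of_real r * cis a = of_real s * cis b"
  then have "norm (of_real r * cis a) = norm (of_real s * cis b)" by simp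
  then have "r = s" using assms by (simp add: norm_mult)
  moreover from this eq assms have "cis a = cis b" by simp
  then have "a = b"
  proof -
    assume "cis a = cis b"
    then have "cos a = cos b" by (metis cis.sel(1))
    moreover have "a \<le> pi" "b \<le> pi" using assms pi_gt3 by auto
    ultimately show "a = b" using cos_inj_pi assms by auto
  qed
  ultimately show "r = s \<and> a = b" by simp
qed simp

section \<open>Sectors at the boundary of the disk\<close>

definition sector :: "real \<Rightarrow> real \<Rightarrow> real \<Rightarrow> complex set" where
  "sector r \<alpha> \<beta> = (\<lambda>(s, a). of_real s * cis a) ` ({r..1} \<times> {\<alpha>..\<beta>})"

lemma sector_homeomorphic:
  assumes "0 < r" "0 \<le> \<alpha>" "\<beta> \<le> 1"
  shows "({r..1} \<times> {\<alpha>..\<beta>}) homeomorphic sector r \<alpha> \<beta>"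
proof -
  have "continuous_on ({r..1} \<times> {\<alpha>..\<beta>}) (\<lambda>(s, a). of_real s * cis a)"
    unfolding case_prod_beta
    by (intro continuous_intros continuous_on_compose2[OF continuous_on_cis]) auto
  moreover have "inj_on (\<lambda>(s, a). of_real s * cis a) ({r..1} \<times> {\<alpha>..\<beta>})"
    using assms by (auto simp: inj_on_def polar_eq_iff)
  moreover have "compact ({r..1} \<times> {\<alpha>..\<beta>})" by (intro compact_Times) auto
  ultimately show ?thesis
    unfolding homeomorphic_def sector_def using homeomorphism_compact by blast
qed

lemma sector_homeomorphic_cball:
  assumes "0 < r" "r < 1" "0 \<le> \<alpha>" "\<alpha> < \<beta>" "\<beta> \<le> 1"
  shows "sector r \<alpha> \<beta> homeomorphic (cball 0 1 :: complex set)"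
proof -
  have "({r..1} \<times> {\<alpha>..\<beta>}) homeomorphic (cball 0 1 :: complex set)"
  proof (rule homeomorphic_convex_compact_sets)
    have "interior ({r..1} \<times> {\<alpha>..\<beta>}) \<noteq> {}" using assms by (simp add: interior_Times)
    then have "aff_dim ({r..1} \<times> {\<alpha>..\<beta>}) = 2" by (simp add: aff_dim_nonempty_interior)
    then show "aff_dim ({r..1} \<times> {\<alpha>..\<beta>}) = aff_dim (cball 0 1 :: complex set)"
      by (simp add: aff_dim_cball)
  qed (auto intro!: convex_Times compact_Times)
  then show ?thesis using sector_homeomorphic[of r \<alpha> \<beta>] assms
    by (meson homeomorphic_sym homeomorphic_trans less_imp_le)
qed

text \<open>The complement of the sector is connected and unbounded, the sector being homeomorphic
  to a rectangle, and it is disjoint from \<open>K\<close>. So none of its points is enclosed by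
  \<open>K\<close>.\<close>

lemma inside_sector:
  assumes "0 < r" "0 \<le> \<alpha>" "\<beta> \<le> 1" and K: "K \<subseteq> sector r \<alpha> \<beta>"
  shows "inside K \<subseteq> sector r \<alpha> \<beta> - K"
proof (rule inside_subset)
  have "compact ({r..1} \<times> {\<alpha>..\<beta>})" by (intro compact_Times) auto
  then have c: "compact (sector r \<alpha> \<beta>)"
    using homeomorphic_compactness[OF sector_homeomorphic[OF assms(1-3)]] by blast
  show "connected (- sector r \<alpha> \<beta>)"
  proof (rule connected_complement_homeomorphic_convex_compact)
    show "sector r \<alpha> \<beta> homeomorphic ({r..1} \<times> {\<alpha>..\<beta>})"
      using sector_homeomorphic[OF assms(1-3)] homeomorphic_sym by blast
  qed (auto intro!: convex_Times compact_Times)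
  show "\<not> bounded (- sector r \<alpha> \<beta>)"
    using cobounded_imp_unbounded[of "- sector r \<alpha> \<beta>"] compact_imp_bounded[OF c] by simp
  show "(sector r \<alpha> \<beta> - K) \<union> - sector r \<alpha> \<beta> = - K" using K by blast
qed

text \<open>A parameter is addressed by an end of its string and the depth, at most
  \<open>1 / 2\<close>, below this end, since the distance from 0 depends on the depth only. Depth
  and time are converted into each other by the same involution.\<close>

definition end_dist :: "param \<Rightarrow> real \<Rightarrow> real" where
  "end_dist z t = (if snd z = 0 then t else 1 - t)"

definition near_end :: "param \<Rightarrow> real \<Rightarrow> param" where
  "near_end z \<tau> = (fst z, end_dist z \<tau>)"

lemma end_dist_end_dist [simp]: "end_dist z (end_dist z t) = t" by (simp add: end_dist_def)

lemma radius_end_dist [simp]: "radius (end_dist z t) = radius t" by (simp add: end_dist_def radius_reflect)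

lemma end_dist_unit: "end_dist z t \<in> {0..1} \<longleftrightarrow> t \<in> {0..1}" by (auto simp: end_dist_def)

lemma near_end_0: "z \<in> endpoints m \<Longrightarrow> near_end z 0 = z"
  by (auto simp: near_end_def end_dist_def endpoints_def)

lemma param_near_end:
  assumes "p \<in> params m"
  obtains z \<tau> where "z \<in> endpoints m" "\<tau> \<in> {0..1 / 2}" "p = near_end z \<tau>"
proof -
  obtain i t where p: "p = (i, t)" "i < m" "t \<in> {0..1}" using assms by (auto simp: params_def)
  show ?thesis
  proof (cases "t \<le> 1 / 2")
    case True
    show ?thesis by (rule that[of "(i, 0)" t]) (use p True in \<open>auto simp: endpoints_def near_end_def end_dist_def\<close>)
  next
    case False
    show ?thesis by (rule that[of "(i, 1)" "1 - t"]) (use p False in \<open>auto simp: endpoints_def near_end_def end_dist_def\<close>)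
  qed
qed

lemma near_end_in_params: "z \<in> endpoints m \<Longrightarrow> \<tau> \<in> {0..1} \<Longrightarrow> near_end z \<tau> \<in> params m"
  by (auto simp: near_end_def end_dist_def endpoints_def params_def)

lemma near_end_endpoint_iff:
  "z \<in> endpoints m \<Longrightarrow> \<tau> \<in> {0..1 / 2} \<Longrightarrow> near_end z \<tau> \<in> endpoints m \<longleftrightarrow> \<tau> = 0"
  by (auto simp: near_end_def end_dist_def endpoints_def)

lemma near_end_eq_depth:
  assumes "near_end z s = near_end z' t" "s \<in> {0..1 / 2}" "t \<in> {0..1 / 2}"
  shows "s = t"
  using assms by (auto simp: near_end_def end_dist_def split: if_splits)

lemma near_end_eq:
  assumes "near_end z s = near_end z' s" "z \<in> endpoints m" "z' \<in> endpoints m" "s < 1 / 2"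
  shows "z = z'"
  using assms by (auto simp: near_end_def end_dist_def endpoints_def split: if_splits)

lemma end_dist_other:
  assumes "z \<in> endpoints m" "z' \<in> endpoints m" "fst z = fst z'" "z \<noteq> z'"
  shows "end_dist z' t = 1 - end_dist z t"
  using assms by (auto simp: end_dist_def endpoints_def)

definition position :: "nat \<Rightarrow> nat \<Rightarrow> real" where
  "position m k = real k / real (2 * m)"

text \<open>The last clause is the collar: down to depth \<open>\<epsilon>\<close> the
  \<open>k\<close>-th end runs radially at its own angle. Angles are confined to the unit interval
  so that \<open>cis\<close> is injective on them.\<close>

definition plat :: "nat \<Rightarrow> (nat \<Rightarrow> real \<Rightarrow> real) \<Rightarrow> param set \<Rightarrow> (nat \<Rightarrow> param) \<Rightarrow> real \<Rightarrow> bool" where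
  "plat m \<phi> U e \<epsilon> \<longleftrightarrow>
     classical_tangle_diagram m (polar_tangle \<phi> U) \<and>
     (\<forall>i<m. continuously_differentiable (\<phi> i) \<and> \<phi> i ` {0..1} \<subseteq> {0..1}) \<and>
     bij_betw e {..<2 * m} (endpoints m) \<and> 0 < \<epsilon> \<and> \<epsilon> < 1 / 2 \<and>
     (\<forall>k<2 * m. \<forall>\<tau>\<in>{0..\<epsilon>}. \<phi> (fst (e k)) (end_dist (e k) \<tau>) = position m k)"

lemma pt_polar_near_end:
  "pt (polar_tangle \<phi> U) (near_end z \<tau>) = of_real (radius \<tau>) * cis (\<phi> (fst z) (end_dist z \<tau>))"
  by (simp add: near_end_def pt_polar)

lemma pt_polar_eq_iff:
  assumes "\<And>i. i < m \<Longrightarrow> \<phi> i ` {0..1} \<subseteq> {0..1}" "z \<in> endpoints m" "z' \<in> endpoints m"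
    and st: "s \<in> {0..1 / 2}" "t \<in> {0..1 / 2}"
  shows "pt (polar_tangle \<phi> U) (near_end z s) = pt (polar_tangle \<phi> U') (near_end z' t) \<longleftrightarrow>
    s = t \<and> \<phi> (fst z) (end_dist z s) = \<phi> (fst z') (end_dist z' t)"
proof -
  have m: "fst z < m" "fst z' < m" using assms by (auto simp: endpoints_def)
  have "end_dist z s \<in> {0..1}" "end_dist z' t \<in> {0..1}" using st by (simp_all add: end_dist_unit del: atLeastAtMost_iff) auto
  then have "\<phi> (fst z) (end_dist z s) \<in> {0..1}" "\<phi> (fst z') (end_dist z' t) \<in> {0..1}"
    using assms(1)[OF m(1)] assms(1)[OF m(2)] by blast+
  then have "pt (polar_tangle \<phi> U) (near_end z s) = pt (polar_tangle \<phi> U') (near_end z' t) \<longleftrightarrow>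
      radius s = radius t \<and> \<phi> (fst z) (end_dist z s) = \<phi> (fst z') (end_dist z' t)"
    unfolding pt_polar_near_end by (intro polar_eq_iff radius_pos)
  also have "radius s = radius t \<longleftrightarrow> s = t" using st by (auto simp: radius_eq_iff)
  finally show ?thesis .
qed

section \<open>Adding a crossing next to the boundary\<close>

locale plat_step =
  fixes m :: nat and \<phi> :: "nat \<Rightarrow> real \<Rightarrow> real" and U :: "param set" and e :: "nat \<Rightarrow> param" and \<epsilon> :: real
    and k :: nat and up :: bool
  assumes plat: "plat m \<phi> U e \<epsilon>" and k: "Suc k < 2 * m"
begin

abbreviation x where "x \<equiv> e k"
abbreviation y where "y \<equiv> e (Suc k)"

definition width :: real where "width = 1 / real (2 * m)"

text \<open>It rises from 0 to 1 between the depths \<open>\<epsilon> / 3\<close> and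
  \<open>2 * \<epsilon> / 3\<close>. The outer third of the collar becomes the new collar, and in
  the inner third the old diagram is already resumed.\<close>

definition g :: "real \<Rightarrow> real" where "g \<tau> = smooth_step (3 / \<epsilon> * \<tau> - 1)"

text \<open>The angles at the ends \<open>k\<close> and \<open>k + 1\<close> are interchanged at times before \<open>\<epsilon> / 3\<close>; the strings meet at time \<open>\<epsilon> / 2\<close>, where \<open>g\<close>
  is \<open>1 / 2\<close>.\<close>

definition \<phi>2 :: "nat \<Rightarrow> real \<Rightarrow> real" where
  "\<phi>2 i t = \<phi> i t + (if i = fst x then width * (1 - g (end_dist x t)) else 0)
     + (if i = fst y then - width * (1 - g (end_dist y t)) else 0)"

definition px where "px = near_end x (\<epsilon> / 2)"
definition py where "py = near_end y (\<epsilon> / 2)"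
definition new_under where "new_under = (if up then py else px)"
definition new_over where "new_over = (if up then px else py)"
definition U2 where "U2 = insert new_under U"
definition e2 where "e2 = e \<circ> Transposition.transpose k (Suc k)"

abbreviation T where "T \<equiv> polar_tangle \<phi> U"
abbreviation T2 where "T2 \<equiv> polar_tangle \<phi>2 U2"

lemma classical: "classical_tangle_diagram m T" using plat by (simp add: plat_def)
lemma virtual: "virtual_tangle_diagram m T" using classical by (simp add: classical_tangle_diagram_def)
lemma cd: "i < m \<Longrightarrow> continuously_differentiable (\<phi> i)" using plat by (simp add: plat_def)
lemma range: "i < m \<Longrightarrow> \<phi> i ` {0..1} \<subseteq> {0..1}" using plat by (simp add: plat_def)
lemma e_bij: "bij_betw e {..<2 * m} (endpoints m)" using plat by (simp add: plat_def)
lemma \<epsilon>: "0 < \<epsilon>" "\<epsilon> < 1 / 2" using plat by (simp_all add: plat_def)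
lemma at_end: "l < 2 * m \<Longrightarrow> 0 \<le> \<tau> \<Longrightarrow> \<tau> \<le> \<epsilon> \<Longrightarrow> \<phi> (fst (e l)) (end_dist (e l) \<tau>) = position m l"
  using plat by (simp add: plat_def)
lemma m_pos: "0 < m" using k by simp
lemma width_pos: "0 < width" using m_pos by (simp add: width_def)

lemma e_endpoint: "l < 2 * m \<Longrightarrow> e l \<in> endpoints m" using bij_betwE[OF e_bij] by simp
lemma e_inj: "l < 2 * m \<Longrightarrow> l' < 2 * m \<Longrightarrow> e l = e l' \<longleftrightarrow> l = l'"
  using e_bij by (auto simp: bij_betw_def dest: inj_onD)
lemma e_surj: "z \<in> endpoints m \<Longrightarrow> \<exists>l<2 * m. z = e l"
  using bij_betw_imp_surj_on[OF e_bij] by (metis imageE lessThan_iff)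
lemma xy: "x \<in> endpoints m" "y \<in> endpoints m" "x \<noteq> y" using k e_inj e_endpoint by auto

lemma g_0: "\<tau> \<le> \<epsilon> / 3 \<Longrightarrow> g \<tau> = 0"
  unfolding g_def using \<epsilon> by (intro smooth_step_0) (simp add: field_simps)
lemma g_1: "2 * \<epsilon> / 3 \<le> \<tau> \<Longrightarrow> g \<tau> = 1"
  unfolding g_def using \<epsilon> by (intro smooth_step_1) (simp add: field_simps)
lemma g_half: "g \<tau> = 1 / 2 \<longleftrightarrow> \<tau> = \<epsilon> / 2"
  unfolding g_def smooth_step_half using \<epsilon> by (auto simp: field_simps)
lemma g_bounds: "0 \<le> g \<tau> \<and> g \<tau> \<le> 1" unfolding g_def by (rule smooth_step_bounds)

lemma position_mult: "position m l = real l * width" by (simp add: position_def width_def)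

text \<open>The ends \<open>x\<close> and \<open>y\<close> may belong to the same string. Still each
  change of angle is felt at its own end only, because measured from the other end the depth is at
  least \<open>1 / 2\<close>, where \<open>g\<close> is 1.\<close>

lemma \<phi>2_near_end:
  assumes z: "z \<in> endpoints m" and \<tau>: "\<tau> \<in> {0..1 / 2}"
  shows "\<phi>2 (fst z) (end_dist z \<tau>) = \<phi> (fst z) (end_dist z \<tau>) +
    (if z = x then width * (1 - g \<tau>) else if z = y then - width * (1 - g \<tau>) else 0)"
proof -
  have *: "1 - g (end_dist z' (end_dist z \<tau>)) = 0" if z': "z' \<in> endpoints m" "fst z = fst z'" "z \<noteq> z'" for z'
  proof -
    have "end_dist z' (end_dist z \<tau>) = 1 - \<tau>" using end_dist_other[OF z z'] by simp
    then show ?thesis using g_1[of "1 - \<tau>"] \<tau> \<epsilon> by simp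
  qed
  have bump: "(if fst z = fst z' then c * (1 - g (end_dist z' (end_dist z \<tau>))) else 0) = (if z = z' then c * (1 - g \<tau>) else 0)"
    if "z' \<in> endpoints m" for z' c
  proof (cases "z = z'")
    case False
    then show ?thesis using *[OF that] by simp
  qed simp
  show ?thesis
    unfolding \<phi>2_def bump[OF xy(1)] bump[OF xy(2)] using xy(3) by simp
qed

lemma \<phi>2_deep:
  assumes "2 * \<epsilon> / 3 \<le> end_dist x t" "2 * \<epsilon> / 3 \<le> end_dist y t"
  shows "\<phi>2 i t = \<phi> i t"
  using g_1[OF assms(1)] g_1[OF assms(2)] by (simp add: \<phi>2_def)

lemma end_dist_near_end: "\<tau> \<le> 1 / 2 \<Longrightarrow> \<tau> \<le> end_dist z' (end_dist z \<tau>)"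
  by (simp add: end_dist_def)

lemma \<phi>2_near_end_deep:
  assumes "2 * \<epsilon> / 3 \<le> \<tau>" "\<tau> \<le> 1 / 2"
  shows "\<phi>2 i (end_dist z \<tau>) = \<phi> i (end_dist z \<tau>)"
  by (intro \<phi>2_deep order_trans[OF assms(1)] end_dist_near_end assms(2))

lemma angle2:
  assumes l: "l < 2 * m" and \<tau>: "0 \<le> \<tau>" "\<tau> \<le> \<epsilon>"
  shows "\<phi>2 (fst (e l)) (end_dist (e l) \<tau>) =
    (if l = k then real k + 1 - g \<tau> else if l = Suc k then real k + g \<tau> else real l) * width"
  using \<phi>2_near_end[OF e_endpoint[OF l], of \<tau>] at_end[OF l \<tau>] \<tau> \<epsilon> l k e_inj[of l k] e_inj[of l "Suc k"]
  by (auto simp: position_mult algebra_simps)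

lemma range2: assumes i: "i < m" shows "\<phi>2 i ` {0..1} \<subseteq> {0..1}"
proof
  fix a assume "a \<in> \<phi>2 i ` {0..1}"
  then obtain t where t: "t \<in> {0..1}" "a = \<phi>2 i t" by auto
  then have "(i, t) \<in> params m" using i by (simp add: params_def)
  then obtain z \<tau> where z: "z \<in> endpoints m" "\<tau> \<in> {0..1 / 2}" "(i, t) = near_end z \<tau>" by (rule param_near_end)
  then have it: "i = fst z" "t = end_dist z \<tau>" by (auto simp: near_end_def)
  show "a \<in> {0..1}"
  proof (cases "\<tau> \<le> \<epsilon>")
    case False
    then have "\<phi>2 i t = \<phi> i t" unfolding it using z(2) \<epsilon> by (intro \<phi>2_near_end_deep) auto
    then show ?thesis using range[OF i] t by blast
  next
    case True
    obtain l where l: "l < 2 * m" "z = e l" using e_surj z(1) by blast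
    define c where "c = (if l = k then real k + 1 - g \<tau> else if l = Suc k then real k + g \<tau> else real l)"
    have a: "a = c * width" using angle2[OF l(1), of \<tau>] z(2) True by (simp add: t it l(2) c_def)
    have "0 \<le> c" using g_bounds[of \<tau>] by (simp add: c_def)
    moreover have "c \<le> real (2 * m)" using g_bounds[of \<tau>] l k by (auto simp: c_def)
    ultimately show ?thesis using width_pos unfolding a by (auto simp: width_def divide_simps)
  qed
qed

lemma cd2: "i < m \<Longrightarrow> continuously_differentiable (\<phi>2 i)"
proof -
  assume i: "i < m"
  have bump: "continuously_differentiable (\<lambda>t. if i = i' then c * (1 - g (end_dist z t)) else 0)" for i' c z
  proof -
    \<comment> \<open>Depth is affine in time with slope 1 or -1, so each change of angle is an
      affine reparametrization of \<open>smooth_step\<close>.\<close>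
    have "\<exists>a b. \<forall>t. 3 / \<epsilon> * end_dist z t - 1 = a * t + b"
    proof (cases "snd z = 0")
      case True
      then show ?thesis by (intro exI[of _ "3 / \<epsilon>"] exI[of _ "- 1"]) (simp add: end_dist_def)
    next
      case False
      then show ?thesis by (intro exI[of _ "- 3 / \<epsilon>"] exI[of _ "3 / \<epsilon> - 1"]) (simp add: end_dist_def right_diff_distrib)
    qed
    then obtain a b where ab: "\<And>t. 3 / \<epsilon> * end_dist z t - 1 = a * t + b" by blast
    have "continuously_differentiable (\<lambda>t. c + (- c) * smooth_step (a * t + b))"
      by (intro continuously_differentiable_add continuously_differentiable_const
          continuously_differentiable_affine continuously_differentiable_smooth_step)
    then have "continuously_differentiable (\<lambda>t. c * (1 - g (end_dist z t)))"
      unfolding g_def ab by (simp add: algebra_simps)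
    then show ?thesis by (cases "i = i'") (auto simp: continuously_differentiable_const)
  qed
  show "continuously_differentiable (\<phi>2 i)"
    unfolding \<phi>2_def[abs_def] by (intro continuously_differentiable_add cd[OF i] bump)
qed

lemma px_py: "px \<in> params m" "py \<in> params m" "px \<noteq> py" "pt T2 px = pt T2 py"
proof -
  show "px \<in> params m" "py \<in> params m" unfolding px_def py_def using xy \<epsilon> by (auto intro: near_end_in_params)
  show "px \<noteq> py" unfolding px_def py_def using xy \<epsilon> near_end_eq[of x "\<epsilon> / 2" y m] by auto
  have gh: "g (\<epsilon> / 2) = 1 / 2" using g_half by simp
  have "\<phi>2 (fst x) (end_dist x (\<epsilon> / 2)) = (real k + 1 / 2) * width"
    "\<phi>2 (fst y) (end_dist y (\<epsilon> / 2)) = (real k + 1 / 2) * width"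
    using angle2[of k "\<epsilon> / 2", unfolded gh] angle2[of "Suc k" "\<epsilon> / 2", unfolded gh] k \<epsilon> by simp_all
  then show "pt T2 px = pt T2 py" unfolding px_def py_def pt_polar_near_end by (simp only:)
qed

text \<open>In the collar, distinct ends run at distinct constant angles.\<close>

lemma shallow_not_crossing:
  assumes z: "z \<in> endpoints m" and \<tau>: "0 \<le> \<tau>" "\<tau> \<le> \<epsilon>"
  shows "\<not> crossing m T (near_end z \<tau>) q"
proof
  assume c: "crossing m T (near_end z \<tau>) q"
  then obtain z' \<tau>' where z': "z' \<in> endpoints m" "\<tau>' \<in> {0..1 / 2}" "q = near_end z' \<tau>'"
    by (auto simp: crossing_def elim: param_near_end)
  have "pt T (near_end z \<tau>) = pt T (near_end z' \<tau>')" using c z' by (simp add: crossing_def)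
  then have eq: "\<tau> = \<tau>'" "\<phi> (fst z) (end_dist z \<tau>) = \<phi> (fst z') (end_dist z' \<tau>)"
    using pt_polar_eq_iff[where s = \<tau> and t = \<tau>' and U = U and U' = U, OF range z z'(1) _ z'(2)] \<tau> \<epsilon> by auto
  obtain l l' where l: "l < 2 * m" "z = e l" "l' < 2 * m" "z' = e l'" using e_surj z z' by metis
  have "position m l = position m l'" using eq(2) at_end[OF l(1) \<tau>] at_end[OF l(3) \<tau>] l by simp
  then have "l = l'" using width_pos by (simp add: position_mult)
  then show False using c z' eq l by (simp add: crossing_def)
qed

text \<open>From depth \<open>2 * \<epsilon> / 3\<close> on nothing changes, and in the collar the
  old diagram has no crossings. There the angles, in units of \<open>width\<close>, are
  \<open>k + 1 - g\<close> and \<open>k + g\<close> for the two chosen ends and integers outside the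
  interval from \<open>k\<close> to \<open>k + 1\<close> for all others, so they coincide only where
  \<open>g\<close> is \<open>1 / 2\<close>.\<close>

lemma crossing2: "crossing m T2 p q \<longleftrightarrow> crossing m T p q \<or> (p, q) = (px, py) \<or> (p, q) = (py, px)"
proof (cases "p \<in> params m \<and> q \<in> params m \<and> p \<noteq> q")
  case False
  then show ?thesis using px_py by (auto simp: crossing_def)
next
  case True
  obtain z s where z: "z \<in> endpoints m" "s \<in> {0..1 / 2}" "p = near_end z s"
    using True by (auto elim: param_near_end)
  obtain z' t where z': "z' \<in> endpoints m" "t \<in> {0..1 / 2}" "q = near_end z' t"
    using True by (auto elim: param_near_end)
  have T: "crossing m T p q \<longleftrightarrow> s = t \<and> \<phi> (fst z) (end_dist z s) = \<phi> (fst z') (end_dist z' t)"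
    using True pt_polar_eq_iff[OF range z(1) z'(1) z(2) z'(2)] by (simp add: crossing_def z(3) z'(3))
  have T2: "crossing m T2 p q \<longleftrightarrow> s = t \<and> \<phi>2 (fst z) (end_dist z s) = \<phi>2 (fst z') (end_dist z' t)"
    using True pt_polar_eq_iff[OF range2 z(1) z'(1) z(2) z'(2)] by (simp add: crossing_def z(3) z'(3))
  have depth: "s = \<epsilon> / 2 \<and> t = \<epsilon> / 2" if "(p, q) = (px, py) \<or> (p, q) = (py, px)"
    using that z z' \<epsilon> near_end_eq_depth[of z s x "\<epsilon> / 2"] near_end_eq_depth[of z s y "\<epsilon> / 2"]
      near_end_eq_depth[of z' t x "\<epsilon> / 2"] near_end_eq_depth[of z' t y "\<epsilon> / 2"]
    by (auto simp: px_def py_def)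
  show ?thesis
  proof (cases "s = t")
    case False then show ?thesis using T T2 depth by auto
  next
    case st: True
    show ?thesis
    proof (cases "2 * \<epsilon> / 3 \<le> s")
      case True
      then have "crossing m T2 p q \<longleftrightarrow> crossing m T p q"
        unfolding T T2 using st z(2) \<phi>2_near_end_deep[of s] by simp
      moreover have "\<not> ((p, q) = (px, py) \<or> (p, q) = (py, px))" using depth True \<epsilon> by auto
      ultimately show ?thesis by blast
    next
      case False
      then have s: "0 \<le> s" "s \<le> \<epsilon>" using z(2) \<epsilon> by auto
      have noT: "\<not> crossing m T p q" unfolding z(3) by (rule shallow_not_crossing[OF z(1) s])
      obtain l l' where l: "l < 2 * m" "z = e l" "l' < 2 * m" "z' = e l'" using e_surj z z' by metis
      have ll: "l \<noteq> l'" using True z z' l st by auto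
      define c where "c l = (if l = k then real k + 1 - g s else if l = Suc k then real k + g s else real l)" for l
      have "crossing m T2 p q \<longleftrightarrow> c l * width = c l' * width"
        unfolding T2 using st angle2[OF l(1) s] angle2[OF l(3) s] by (simp add: l c_def)
      also have "\<dots> \<longleftrightarrow> c l = c l'" using width_pos by simp
      also have "\<dots> \<longleftrightarrow> g s = 1 / 2 \<and> (l = k \<and> l' = Suc k \<or> l = Suc k \<and> l' = k)"
      proof -
        have other: "c j = real j" "real j < real k \<or> real k + 1 < real j" if "j \<noteq> k" "j \<noteq> Suc k" for j
          using that by (auto simp: c_def)
        have in_range: "real k \<le> c j \<and> c j \<le> real k + 1" if "j = k \<or> j = Suc k" for j
          using that g_bounds[of s] by (auto simp: c_def)
        show ?thesis
        proof (cases "(l = k \<or> l = Suc k) \<and> (l' = k \<or> l' = Suc k)")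
          case True
          then show ?thesis using ll by (auto simp: c_def)
        next
          case False
          then have "c l \<noteq> c l'" using other[of l] other[of l'] in_range[of l] in_range[of l'] ll by (auto; linarith)
          then show ?thesis using False by auto
        qed
      qed
      also have "\<dots> \<longleftrightarrow> (p, q) = (px, py) \<or> (p, q) = (py, px)"
      proof -
        have "p = px \<longleftrightarrow> s = \<epsilon> / 2 \<and> l = k" "p = py \<longleftrightarrow> s = \<epsilon> / 2 \<and> l = Suc k"
          "q = px \<longleftrightarrow> s = \<epsilon> / 2 \<and> l' = k" "q = py \<longleftrightarrow> s = \<epsilon> / 2 \<and> l' = Suc k"
          using z z' st l k s \<epsilon> xy near_end_eq_depth[of z s x "\<epsilon> / 2"] near_end_eq_depth[of z s y "\<epsilon> / 2"]
            near_end_eq_depth[of z' s x "\<epsilon> / 2"] near_end_eq_depth[of z' s y "\<epsilon> / 2"]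
            near_end_eq[of z s x m] near_end_eq[of z s y m] near_end_eq[of z' s x m] near_end_eq[of z' s y m]
            e_inj[of l k] e_inj[of l "Suc k"] e_inj[of l' k] e_inj[of l' "Suc k"]
          by (auto simp: px_def py_def)
        then show ?thesis using g_half by auto
      qed
      finally show ?thesis using noT by blast
    qed
  qed
qed

text \<open>Strict inequality in the depth makes the angles agree on an open set of times, hence
  also their derivatives.\<close>

lemma velocity_deep:
  assumes z: "z \<in> endpoints m" and \<tau>: "2 * \<epsilon> / 3 < \<tau>" "\<tau> \<le> 1 / 2"
  shows "velocity T2 (near_end z \<tau>) = velocity T (near_end z \<tau>)"
proof -
  let ?t = "end_dist z \<tau>"
  have i: "fst z < m" using z by (auto simp: endpoints_def)
  obtain d where d: "(\<phi> (fst z) has_real_derivative d) (at ?t)"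
    using cd[OF i] by (auto simp: continuously_differentiable_def)
  let ?S = "{t. 2 * \<epsilon> / 3 < end_dist x t \<and> 2 * \<epsilon> / 3 < end_dist y t}"
  have cont: "continuous_on UNIV (end_dist z)" for z
    by (cases "snd z = 0") (auto simp: end_dist_def[abs_def] intro: continuous_intros)
  have "(\<phi>2 (fst z) has_real_derivative d) (at ?t)"
  proof (rule has_field_derivative_transform_within_open[OF d, where S = ?S])
    show "open ?S" by (intro open_Collect_conj open_Collect_less cont continuous_intros)
    show "?t \<in> ?S" using \<tau> end_dist_near_end[OF \<tau>(2), of x z] end_dist_near_end[OF \<tau>(2), of y z] by simp
    show "\<phi> (fst z) t = \<phi>2 (fst z) t" if "t \<in> ?S" for t using that \<phi>2_deep[of t] by simp
  qed
  moreover have "\<phi>2 (fst z) ?t = \<phi> (fst z) ?t" using \<tau> by (intro \<phi>2_near_end_deep) auto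
  ultimately show ?thesis unfolding near_end_def by (simp add: velocity_polar[of \<phi>, OF d] velocity_polar[of \<phi>2])
qed

text \<open>The factor \<open>6 / \<epsilon>\<close> is the slope of \<open>g\<close> at depth
  \<open>\<epsilon> / 2\<close>: the slope 2 of \<open>smooth_step\<close> at its middle times the
  scaling \<open>3 / \<epsilon>\<close>.\<close>

lemma velocity_new:
  assumes l: "l = k \<or> l = Suc k"
  defines "sg \<equiv> (if snd (e l) = 0 then 1 else - 1 :: real)"
  defines "\<kappa> \<equiv> (if l = k then - 1 else 1) * (6 / \<epsilon> * width)"
  shows "velocity T2 (near_end (e l) (\<epsilon> / 2)) =
    cis ((real k + 1 / 2) * width) * Complex (sg * (\<epsilon> - 1)) (radius (\<epsilon> / 2) * (sg * \<kappa>))"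
proof -
  let ?z = "e l" let ?t = "end_dist ?z (\<epsilon> / 2)"
  have lm: "l < 2 * m" using l k by auto
  have gh: "g (\<epsilon> / 2) = 1 / 2" using g_half by simp
  have ang: "\<phi>2 (fst ?z) ?t = (real k + 1 / 2) * width"
    using angle2[OF lm, of "\<epsilon> / 2", unfolded gh] \<epsilon> l by auto
  have g': "(g has_real_derivative 6 / \<epsilon>) (at (\<epsilon> / 2))"
  proof -
    have "((\<lambda>\<tau>. 3 / \<epsilon> * \<tau> - 1) has_real_derivative 3 / \<epsilon>) (at (\<epsilon> / 2))"
      using \<epsilon>(1) by (auto intro!: derivative_eq_intros)
    from DERIV_chain2[OF DERIV_smooth_step this]
    have "(g has_real_derivative smooth_step_deriv (3 / \<epsilon> * (\<epsilon> / 2) - 1) * (3 / \<epsilon>)) (at (\<epsilon> / 2))"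
      by (simp add: g_def[abs_def])
    moreover have "smooth_step_deriv (3 / \<epsilon> * (\<epsilon> / 2) - 1) = 2" using \<epsilon> by (simp add: smooth_step_deriv_def)
    ultimately show ?thesis by simp
  qed
  have ed: "(end_dist ?z has_real_derivative sg) (at ?t)"
    by (cases "snd ?z = 0") (auto simp: end_dist_def[abs_def] sg_def intro!: derivative_eq_intros)
  have "((\<lambda>t. g (end_dist ?z t)) has_real_derivative 6 / \<epsilon> * sg) (at ?t)"
    by (rule DERIV_chain2[OF _ ed]) (simp add: g')
  then have "((\<lambda>t. ((if l = k then real k + 1 - g (end_dist ?z t) else real k + g (end_dist ?z t))) * width)
      has_real_derivative sg * \<kappa>) (at ?t)"
    by (cases "l = k") (auto intro!: derivative_eq_intros simp: \<kappa>_def)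
  then have "(\<phi>2 (fst ?z) has_real_derivative sg * \<kappa>) (at ?t)"
  proof (rule has_field_derivative_transform_within_open)
    have cont: "continuous_on UNIV (end_dist ?z)"
      by (cases "snd ?z = 0") (auto simp: end_dist_def[abs_def] intro: continuous_intros)
    show "open {t. 0 < end_dist ?z t \<and> end_dist ?z t < \<epsilon>}"
      by (intro open_Collect_conj open_Collect_less cont continuous_intros)
    show "?t \<in> {t. 0 < end_dist ?z t \<and> end_dist ?z t < \<epsilon>}" using \<epsilon> by simp
    show "(if l = k then real k + 1 - g (end_dist ?z t) else real k + g (end_dist ?z t)) * width = \<phi>2 (fst ?z) t"
      if "t \<in> {t. 0 < end_dist ?z t \<and> end_dist ?z t < \<epsilon>}" for t
      using angle2[OF lm, of "end_dist ?z t"] that l by auto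
  qed
  from velocity_polar[of \<phi>2, OF this]
  have "velocity T2 (near_end ?z (\<epsilon> / 2)) = cis ((real k + 1 / 2) * width) * Complex (2 * ?t - 1) (radius ?t * (sg * \<kappa>))"
    unfolding near_end_def ang .
  moreover have "2 * ?t - 1 = sg * (\<epsilon> - 1)" by (simp add: sg_def end_dist_def)
  ultimately show ?thesis by simp
qed

text \<open>Up to the orientations \<open>sx\<close> and \<open>sy\<close> the two velocities have
  the same nonzero radial component and opposite nonzero angular components.\<close>

lemma transversal_new: "Im (cnj (velocity T2 px) * velocity T2 py) \<noteq> 0"
proof -
  define c where "c = cis ((real k + 1 / 2) * width)"
  define sx sy where "sx = (if snd x = 0 then 1 else - 1 :: real)" and "sy = (if snd y = 0 then 1 else - 1 :: real)"
  define K where "K = 6 / \<epsilon> * width"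
  define r where "r = radius (\<epsilon> / 2)"
  have vx: "velocity T2 px = c * Complex (sx * (\<epsilon> - 1)) (r * (sx * - K))"
    using velocity_new[of k] by (simp add: px_def c_def sx_def K_def r_def)
  have vy: "velocity T2 py = c * Complex (sy * (\<epsilon> - 1)) (r * (sy * K))"
    using velocity_new[of "Suc k"] by (simp add: py_def c_def sy_def K_def r_def)
  have cc: "cnj c * c = 1" by (simp add: c_def cis_cnj cis_mult)
  have "cnj (velocity T2 px) * velocity T2 py =
      (cnj c * c) * (cnj (Complex (sx * (\<epsilon> - 1)) (r * (sx * - K))) * Complex (sy * (\<epsilon> - 1)) (r * (sy * K)))"
    unfolding vx vy by (simp only: complex_cnj_mult mult_ac)
  then have "Im (cnj (velocity T2 px) * velocity T2 py) = 2 * (sx * sy) * ((\<epsilon> - 1) * (r * K))"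
    unfolding cc by (simp only: mult_1) (simp add: algebra_simps)
  moreover have "sx * sy \<noteq> 0" "\<epsilon> - 1 \<noteq> 0" "r \<noteq> 0" "K \<noteq> 0"
    using \<epsilon> width_pos radius_pos[of "\<epsilon> / 2"] by (auto simp: sx_def sy_def r_def K_def)
  ultimately show ?thesis by simp
qed

lemma px_py_not_crossing: "\<not> crossing m T px q" "\<not> crossing m T py q" "\<not> crossing m T q px" "\<not> crossing m T q py"
proof -
  show *: "\<not> crossing m T px q" "\<not> crossing m T py q" for q
    unfolding px_def py_def
    using \<epsilon> shallow_not_crossing[OF xy(1), of "\<epsilon> / 2" q] shallow_not_crossing[OF xy(2), of "\<epsilon> / 2" q] by simp_all
  have "crossing m T q p \<Longrightarrow> crossing m T p q" for p by (auto simp: crossing_def)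
  then show "\<not> crossing m T q px" "\<not> crossing m T q py" using * by blast+
qed

lemma classical2: "classical_tangle_diagram m T2"
proof -
  note V = virtual[unfolded virtual_tangle_diagram_def]
  have V_vel: "\<forall>p\<in>params m. velocity T p \<noteq> 0" and V_inj: "inj_on (pt T) (endpoints m)"
    and V_trans: "\<forall>p q. crossing m T p q \<longrightarrow> \<not> collinear {0, velocity T p, velocity T q}"
    and V_uniq: "\<forall>p q r. crossing m T p q \<and> crossing m T p r \<longrightarrow> q = r"
    and V_under: "\<forall>p\<in>under T. \<exists>q. crossing m T p q"
    and V_both: "\<forall>p q. crossing m T p q \<longrightarrow> \<not> (p \<in> under T \<and> q \<in> under T)"
    using V by - (elim conjE, assumption)+
  have C: "\<forall>p q. crossing m T p q \<longrightarrow> p \<in> U \<or> q \<in> U"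
    using classical unfolding classical_tangle_diagram_def under_polar by (rule conjunct2)
  have pU: "px \<notin> U" "py \<notin> U" using V_under px_py_not_crossing by auto
  have depth: "velocity T2 p = velocity T p" if c: "crossing m T p q" for p q
  proof -
    have "p \<in> params m" using c by (simp add: crossing_def)
    then obtain z \<tau> where z: "z \<in> endpoints m" "\<tau> \<in> {0..1 / 2}" "p = near_end z \<tau>" by (rule param_near_end)
    have "\<epsilon> < \<tau>" using shallow_not_crossing[OF z(1), of \<tau> q] c z by force
    then show ?thesis unfolding z(3) using z \<epsilon> by (intro velocity_deep) auto
  qed
  have Im_sym: "Im (cnj a * b) = - Im (cnj b * a)" for a b by simp
  have "virtual_tangle_diagram m T2"
    unfolding virtual_tangle_diagram_def
  proof (intro conjI allI impI ballI)
    show "1 \<le> m" using m_pos by simp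
    show "strand T2 i C1_differentiable_on {0..1}" if "i < m" for i by (rule C1_polar[of \<phi>2, OF cd2[OF that]])
    show "velocity T2 p \<noteq> 0" if p: "p \<in> params m" for p
    proof -
      obtain z \<tau> where z: "z \<in> endpoints m" "\<tau> \<in> {0..1 / 2}" "p = near_end z \<tau>" using p by (rule param_near_end)
      have i: "fst z < m" using z by (auto simp: endpoints_def)
      show ?thesis
      \<comment> \<open>Off the middle of a string the radial component alone is nonzero; the middle
        lies deeper than the collar, where the old velocity applies.\<close>
      proof (cases "\<tau> = 1 / 2")
        case True
        then have "velocity T2 p = velocity T p" unfolding z(3) using z \<epsilon> by (intro velocity_deep) auto
        then show ?thesis using V_vel p by simp
      next
        case False
        obtain d where "(\<phi>2 (fst z) has_real_derivative d) (at (end_dist z \<tau>))"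
          using cd2[OF i] by (auto simp: continuously_differentiable_def)
        from velocity_polar[of \<phi>2, OF this] have "velocity T2 p =
            cis (\<phi>2 (fst z) (end_dist z \<tau>)) * Complex (2 * end_dist z \<tau> - 1) (radius (end_dist z \<tau>) * d)"
          by (simp add: z(3) near_end_def)
        moreover have "2 * end_dist z \<tau> - 1 \<noteq> 0" using False by (auto simp: end_dist_def)
        then have "Complex (2 * end_dist z \<tau> - 1) (radius (end_dist z \<tau>) * d) \<noteq> 0" by (simp add: complex_eq_iff)
        ultimately show ?thesis by simp
      qed
    qed
    show "pt T2 ` params m \<subseteq> cball 0 1"
      using radius_bounds(1) by (auto simp: norm_pt_polar params_def)
    show "pt T2 p \<in> sphere 0 1 \<longleftrightarrow> p \<in> endpoints m" if "p \<in> params m" for p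
      using that radius_bounds(2)[of "snd p"] by (auto simp: norm_pt_polar params_def endpoints_def)
    show "inj_on (pt T2) (endpoints m)"
    proof (rule inj_onI, rule ccontr)
      fix p q assume pq: "p \<in> endpoints m" "q \<in> endpoints m" "pt T2 p = pt T2 q" "p \<noteq> q"
      then have "crossing m T2 p q" by (auto simp: crossing_def endpoints_def params_def)
      moreover have "px \<notin> endpoints m" "py \<notin> endpoints m"
        unfolding px_def py_def using xy \<epsilon> by (simp_all add: near_end_endpoint_iff)
      ultimately have "crossing m T p q" using pq crossing2 by auto
      then show False using V_inj pq by (auto simp: crossing_def dest: inj_onD)
    qed
    show "\<not> collinear {0, velocity T2 p, velocity T2 q}" if "crossing m T2 p q" for p q
    proof -
      have "crossing m T p q \<or> p = px \<and> q = py \<or> p = py \<and> q = px"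
        using that unfolding crossing2 by simp
      then consider "crossing m T p q" | "p = px" "q = py" | "p = py" "q = px" by blast
      then show ?thesis
      proof cases
        case 1
        then have "crossing m T q p" by (auto simp: crossing_def)
        then show ?thesis using V_trans 1 depth by metis
      next
        case 2 then show ?thesis using transversal_new by (simp only: collinear_0_iff_Im) simp
      next
        case 3
        then show ?thesis using transversal_new Im_sym[of "velocity T2 py" "velocity T2 px"]
          unfolding collinear_0_iff_Im by (simp only:)
      qed
    qed
    show "q = r" if "crossing m T2 p q \<and> crossing m T2 p r" for p q r
    proof -
      have q: "crossing m T p q \<or> p = px \<and> q = py \<or> p = py \<and> q = px"
        and r: "crossing m T p r \<or> p = px \<and> r = py \<or> p = py \<and> r = px"
        using that unfolding crossing2 by simp_all
      show ?thesis
      proof (cases "p = px \<or> p = py")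
        case True
        then have "\<not> crossing m T p q" "\<not> crossing m T p r" using px_py_not_crossing by metis+
        then show ?thesis using q r px_py(3) by metis
      next
        case False
        then have "crossing m T p q \<and> crossing m T p r" using q r by metis
        then show ?thesis using V_uniq by metis
      qed
    qed
    show "\<exists>q. crossing m T2 p q" if "p \<in> under T2" for p
    proof (cases "p \<in> U")
      case True
      then show ?thesis using V_under unfolding crossing2 under_polar by blast
    next
      case False
      then have "p = px \<or> p = py" using that by (auto simp: U2_def new_under_def)
      then show ?thesis unfolding crossing2 by blast
    qed
    show "\<not> (p \<in> under T2 \<and> q \<in> under T2)" if "crossing m T2 p q" for p q
    proof -
      have nu: "new_under = px \<or> new_under = py" by (simp add: new_under_def)
      have c: "crossing m T p q \<or> p = px \<and> q = py \<or> p = py \<and> q = px"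
        using that unfolding crossing2 by simp
      have "\<not> (p \<in> insert new_under U \<and> q \<in> insert new_under U)"
        using c V_both px_py_not_crossing px_py(3) pU nu unfolding under_polar by (metis insert_iff)
      then show ?thesis unfolding under_polar U2_def .
    qed
  qed
  moreover have "p \<in> under T2 \<or> q \<in> under T2" if "crossing m T2 p q" for p q
  proof -
    have nu: "new_under = px \<or> new_under = py" by (simp add: new_under_def)
    have c: "crossing m T p q \<or> p = px \<and> q = py \<or> p = py \<and> q = px"
      using that unfolding crossing2 by simp
    have "p \<in> insert new_under U \<or> q \<in> insert new_under U" using c C nu by (metis insert_iff)
    then show ?thesis by (simp only: under_polar U2_def)
  qed
  ultimately show ?thesis by (simp add: classical_tangle_diagram_def)
qed

lemma new_crossing_not_old: "px \<notin> U" "py \<notin> U"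
proof -
  have "\<forall>p\<in>under T. \<exists>q. crossing m T p q"
    using virtual[unfolded virtual_tangle_diagram_def] by - (elim conjE, assumption)
  then show "px \<notin> U" "py \<notin> U" using px_py_not_crossing by auto
qed

lemma e2: "e2 k = y" "e2 (Suc k) = x" "l \<noteq> k \<Longrightarrow> l \<noteq> Suc k \<Longrightarrow> e2 l = e l"
  by (simp_all add: e2_def)

lemma plat2: "plat m \<phi>2 U2 e2 (\<epsilon> / 3)"
  unfolding plat_def
proof (intro conjI allI impI ballI)
  show "bij_betw e2 {..<2 * m} (endpoints m)"
  proof -
    have "bij_betw (Transposition.transpose k (Suc k)) {..<2 * m} {..<2 * m}"
      using k by (intro permutes_imp_bij permutes_swap_id) auto
    then show ?thesis unfolding e2_def using e_bij by (rule bij_betw_trans)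
  qed
  fix l \<tau> assume l: "l < 2 * m" and \<tau>: "\<tau> \<in> {0..\<epsilon> / 3}"
  then have g0: "g \<tau> = 0" by (intro g_0) simp
  have *: "\<phi>2 (fst (e l')) (end_dist (e l') \<tau>) =
    (if l' = k then real k + 1 else if l' = Suc k then real k else real l') * width" if "l' < 2 * m" for l'
    using angle2[OF that, of \<tau>] \<tau> \<epsilon> g0 by simp
  consider "l = k" | "l = Suc k" | "l \<noteq> k" "l \<noteq> Suc k" by blast
  then show "\<phi>2 (fst (e2 l)) (end_dist (e2 l) \<tau>) = position m l"
    by cases (use *[of l] *[of k] *[of "Suc k"] l k e2 in \<open>simp_all add: position_mult\<close>)
qed (use classical2 cd2 range2 \<epsilon> in auto)

end

section \<open>Undoing the new crossing by the move (a)\<close>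

lemma param_segment_near_end:
  assumes "z \<in> endpoints m" "0 \<le> d"
  shows "param_segment z (near_end z d) = near_end z ` {0..d}"
proof (cases "snd z = 0")
  case True
  then show ?thesis using assms(2)
    by (auto simp: param_segment_def near_end_def end_dist_def closed_segment_eq_real_ivl)
next
  case False
  then have z: "snd z = 1" using assms(1) by (auto simp: endpoints_def)
  have "{1 - d..1} = (\<lambda>t. 1 - t) ` {0..d}" by (simp add: image_diff_atLeastAtMost)
  moreover have "near_end z ` {0..d} = {fst z} \<times> (\<lambda>t. 1 - t) ` {0..d}"
  proof -
    have "near_end z = (\<lambda>t. (fst z, 1 - t))" using z by (simp add: near_end_def end_dist_def fun_eq_iff)
    then show ?thesis by (simp only:) blast
  qed
  moreover have "param_segment z (near_end z d) = {fst z} \<times> {1 - d..1}"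
    using assms(2) z by (simp add: param_segment_def near_end_def end_dist_def closed_segment_eq_real_ivl)
  ultimately show ?thesis by simp
qed

lemma pt_in_sector_iff:
  assumes "\<And>i. i < m \<Longrightarrow> \<phi> i ` {0..1} \<subseteq> {0..1}" "z \<in> endpoints m"
    and t: "\<tau> \<in> {0..1 / 2}" "d \<in> {0..1 / 2}" and ab: "0 \<le> \<alpha>" "\<beta> \<le> 1"
  shows "pt (polar_tangle \<phi> U) (near_end z \<tau>) \<in> sector (radius d) \<alpha> \<beta> \<longleftrightarrow>
    \<tau> \<le> d \<and> \<phi> (fst z) (end_dist z \<tau>) \<in> {\<alpha>..\<beta>}"
proof -
  define a where "a = \<phi> (fst z) (end_dist z \<tau>)"
  have "fst z < m" using assms(2) by (auto simp: endpoints_def)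
  moreover have "end_dist z \<tau> \<in> {0..1}" using t by (simp add: end_dist_unit del: atLeastAtMost_iff) auto
  ultimately have a: "a \<in> {0..1}" using assms(1) unfolding a_def by blast
  have "of_real (radius \<tau>) * cis a \<in> sector (radius d) \<alpha> \<beta> \<longleftrightarrow> radius d \<le> radius \<tau> \<and> a \<in> {\<alpha>..\<beta>}"
  proof
    assume "of_real (radius \<tau>) * cis a \<in> sector (radius d) \<alpha> \<beta>"
    then obtain s b where sb: "of_real (radius \<tau>) * cis a = of_real s * cis b" "radius d \<le> s" "\<alpha> \<le> b" "b \<le> \<beta>"
      by (auto simp: sector_def)
    moreover have "0 < s" using sb(2) radius_pos[of d] by simp
    ultimately have "radius \<tau> = s \<and> a = b" using ab a polar_eq_iff[OF radius_pos[of \<tau>] _ a, of s b] by auto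
    then show "radius d \<le> radius \<tau> \<and> a \<in> {\<alpha>..\<beta>}" using sb by auto
  next
    assume *: "radius d \<le> radius \<tau> \<and> a \<in> {\<alpha>..\<beta>}"
    have "radius \<tau> \<le> 1" using t by (intro radius_bounds) auto
    with * show "of_real (radius \<tau>) * cis a \<in> sector (radius d) \<alpha> \<beta>"
      by (auto simp: sector_def intro!: image_eqI[of _ _ "(radius \<tau>, a)"])
  qed
  also have "radius d \<le> radius \<tau> \<longleftrightarrow> \<tau> \<le> d" using t by (intro radius_le_iff) auto
  finally show ?thesis unfolding pt_polar_near_end a_def .
qed

context plat_step
begin

lemma position_bounds: "0 \<le> position m k" "position m k < position m (Suc k)" "position m (Suc k) \<le> 1"
proof -
  show "0 \<le> position m k" "position m k < position m (Suc k)" using m_pos by (simp_all add: position_def divide_strict_right_mono)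
  have "real (Suc k) \<le> real (2 * m)" using k by linarith
  then show "position m (Suc k) \<le> 1" unfolding position_def using m_pos by (simp add: divide_le_eq_1)
qed

lemma angle_in_range_iff:
  assumes l: "l < 2 * m" and \<tau>: "0 \<le> \<tau>" "\<tau> \<le> \<epsilon>"
  shows "\<phi>2 (fst (e l)) (end_dist (e l) \<tau>) \<in> {position m k..position m (Suc k)} \<longleftrightarrow> l = k \<or> l = Suc k"
proof -
  define c where "c = (if l = k then real k + 1 - g \<tau> else if l = Suc k then real k + g \<tau> else real l)"
  have "\<phi>2 (fst (e l)) (end_dist (e l) \<tau>) = c * width" unfolding c_def by (rule angle2[OF assms])
  then have "\<phi>2 (fst (e l)) (end_dist (e l) \<tau>) \<in> {position m k..position m (Suc k)} \<longleftrightarrow>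
      real k \<le> c \<and> c \<le> real (Suc k)"
    using width_pos by (simp only: position_mult atLeastAtMost_iff mult_le_cancel_right) auto
  also have "\<dots> \<longleftrightarrow> l = k \<or> l = Suc k" using g_bounds[of \<tau>] by (auto simp: c_def)
  finally show ?thesis .
qed

lemma angle_in_range_iff_old:
  assumes l: "l < 2 * m" and \<tau>: "0 \<le> \<tau>" "\<tau> \<le> \<epsilon>"
  shows "\<phi> (fst (e l)) (end_dist (e l) \<tau>) \<in> {position m k..position m (Suc k)} \<longleftrightarrow> l = k \<or> l = Suc k"
proof -
  have "\<phi> (fst (e l)) (end_dist (e l) \<tau>) \<in> {position m k..position m (Suc k)} \<longleftrightarrow> real k \<le> real l \<and> real l \<le> real (Suc k)"
    unfolding at_end[OF assms] using width_pos by (simp only: position_mult atLeastAtMost_iff mult_le_cancel_right) auto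
  then show ?thesis by auto
qed

text \<open>The sector between two neighboring positions contains only initial pieces of the two
  interchanged strings. Depth \<open>\<epsilon> / 2\<close> confines the triangular region, depth
  \<open>\<epsilon>\<close> gives the disk of the move.\<close>

lemma in_sector_iff:
  assumes p: "p \<in> params m" and d: "0 \<le> d" "d \<le> \<epsilon>"
  shows "pt T2 p \<in> sector (radius d) (position m k) (position m (Suc k)) \<longleftrightarrow> p \<in> near_end x ` {0..d} \<union> near_end y ` {0..d}"
proof -
  obtain z \<tau> where z: "z \<in> endpoints m" "\<tau> \<in> {0..1 / 2}" "p = near_end z \<tau>" using p by (rule param_near_end)
  obtain l where l: "l < 2 * m" "z = e l" using e_surj z by blast
  have "pt T2 p \<in> sector (radius d) (position m k) (position m (Suc k)) \<longleftrightarrow>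
      \<tau> \<le> d \<and> \<phi>2 (fst z) (end_dist z \<tau>) \<in> {position m k..position m (Suc k)}"
    unfolding z(3) using z d \<epsilon> position_bounds by (intro pt_in_sector_iff range2) auto
  also have "\<dots> \<longleftrightarrow> \<tau> \<le> d \<and> (z = x \<or> z = y)"
  proof (cases "\<tau> \<le> d")
    case True
    have "z = x \<longleftrightarrow> l = k" "z = y \<longleftrightarrow> l = Suc k" unfolding l(2) using e_inj l(1) k by auto
    moreover have "\<phi>2 (fst z) (end_dist z \<tau>) \<in> {position m k..position m (Suc k)} \<longleftrightarrow> l = k \<or> l = Suc k"
      unfolding l(2) by (rule angle_in_range_iff[OF l(1)]) (use z(2) True d in auto)
    ultimately show ?thesis by simp
  qed simp
  also have "\<dots> \<longleftrightarrow> p \<in> near_end x ` {0..d} \<union> near_end y ` {0..d}"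
  proof
    assume "\<tau> \<le> d \<and> (z = x \<or> z = y)"
    then show "p \<in> near_end x ` {0..d} \<union> near_end y ` {0..d}" using z by auto
  next
    assume "p \<in> near_end x ` {0..d} \<union> near_end y ` {0..d}"
    moreover have "\<tau> \<le> d \<and> z = z'" if s: "p = near_end z' s" "s \<in> {0..d}" and z': "z' \<in> endpoints m" for z' s
    proof -
      have eq: "near_end z \<tau> = near_end z' s" using z(3) s by simp
      have "\<tau> = s" using near_end_eq_depth[OF eq z(2)] s(2) d \<epsilon> by auto
      moreover from this have "z = z'" using near_end_eq[of z s z' m] eq s z(1) z' d \<epsilon> by auto
      ultimately show ?thesis using s by auto
    qed
    ultimately show "\<tau> \<le> d \<and> (z = x \<or> z = y)" using xy by blast
  qed
  finally show ?thesis .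
qed

lemma inj_pt2_near_end:
  assumes "z \<in> endpoints m" "0 \<le> d" "d \<le> 1 / 2"
  shows "inj_on (pt T2) (near_end z ` {0..d})"
proof (rule inj_onI)
  fix p q assume "p \<in> near_end z ` {0..d}" "q \<in> near_end z ` {0..d}" and eq: "pt T2 p = pt T2 q"
  then obtain s t where st: "p = near_end z s" "q = near_end z t" "s \<in> {0..d}" "t \<in> {0..d}" by auto
  then have "s = t" using eq pt_polar_eq_iff[where \<phi> = \<phi>2 and m = m and s = s and t = t and U = U2 and U' = U2, OF range2 assms(1) assms(1)] assms by auto
  then show "p = q" using st by simp
qed

text \<open>After the interchange \<open>y\<close> sits at position \<open>k\<close> and is
  therefore named first. The closed curve lies in the sector of depth \<open>\<epsilon> / 2\<close>,
  hence so does its inside, and in that sector the diagram consists of points of the curve.\<close>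

lemma boundary_crossing: "boundary_crossing m T2 y x py px (position m k) (position m (Suc k))"
  unfolding boundary_crossing_def
proof (intro conjI)
  let ?A = "near_end x ` {0..\<epsilon> / 2}" and ?B = "near_end y ` {0..\<epsilon> / 2}"
  have seg: "param_segment y py = ?B" "param_segment x px = ?A"
    unfolding px_def py_def using \<epsilon> xy by (simp_all add: param_segment_near_end)
  show "y \<in> endpoints m" "x \<in> endpoints m" using xy by simp_all
  show "position m k < position m (Suc k)" "position m (Suc k) < position m k + 2 * pi"
    using position_bounds pi_gt3 by linarith+
  have ends: "pt T2 (e l) = cis (\<phi>2 (fst (e l)) (end_dist (e l) 0))" if "l < 2 * m" for l
    using pt_polar_near_end[of \<phi>2 U2 "e l" 0] near_end_0[OF e_endpoint[OF that]] by (simp add: radius_def)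
  have g00: "g 0 = 0" using \<epsilon> by (intro g_0) simp
  show "pt T2 y = cis (position m k)" "pt T2 x = cis (position m (Suc k))"
    using ends[of k] ends[of "Suc k"] angle2[of k 0] angle2[of "Suc k" 0] k \<epsilon> g00
    by (simp_all add: position_mult algebra_simps)
  show "pt T2 ` endpoints m \<inter> cis ` {position m k<..<position m (Suc k)} = {}"
  proof (rule ccontr)
    assume "pt T2 ` endpoints m \<inter> cis ` {position m k<..<position m (Suc k)} \<noteq> {}"
    then obtain z b where z: "z \<in> endpoints m" "pt T2 z = cis b" "position m k < b" "b < position m (Suc k)" by auto
    obtain l where l: "l < 2 * m" "z = e l" using e_surj z by blast
    define a where "a = \<phi>2 (fst z) (end_dist z 0)"
    have "fst z < m" "end_dist z 0 \<in> {0..1}" using z by (auto simp: endpoints_def end_dist_def)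
    then have a: "a \<in> {0..1}" using range2 unfolding a_def by blast
    have "of_real 1 * cis a = of_real 1 * cis b" using ends[OF l(1)] z l by (simp add: a_def)
    moreover have b: "b \<in> {0..1}" unfolding atLeastAtMost_iff using z(3,4) position_bounds by linarith
    ultimately have "a = b" using iffD1[OF polar_eq_iff[OF zero_less_one zero_less_one a b]] by blast
    define c where "c = (if l = k then Suc k else if l = Suc k then k else l)"
    have "a = real c * width"
      using angle2[OF l(1), of 0] \<epsilon> g00 by (simp add: a_def l c_def add.commute)
    then have "real k * width < real c * width" "real c * width < real (Suc k) * width"
      using z(3,4) \<open>a = b\<close> unfolding position_mult by simp_all
    then have "k < c" "c < Suc k" using width_pos by simp_all
    then show False by simp
  qed
  show "fst py = fst y" "fst px = fst x" by (simp_all add: px_def py_def near_end_def)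
  show "crossing m T2 py px" unfolding crossing2 by simp
  show "py \<in> under T2 \<or> px \<in> under T2" by (simp add: U2_def new_under_def)
  show "inj_on (pt T2) (param_segment y py)" "inj_on (pt T2) (param_segment x px)"
    unfolding seg using \<epsilon> by (auto intro!: inj_pt2_near_end xy)
  show "pt T2 ` param_segment y py \<inter> pt T2 ` param_segment x px = {pt T2 py}"
  proof
    show "{pt T2 py} \<subseteq> pt T2 ` param_segment y py \<inter> pt T2 ` param_segment x px"
    proof -
      have "px \<in> ?A" "py \<in> ?B" using \<epsilon> by (auto simp: px_def py_def)
      then have "pt T2 px \<in> pt T2 ` ?A" "pt T2 py \<in> pt T2 ` ?B" by blast+
      then show ?thesis unfolding seg px_py(4) by blast
    qed
    show "pt T2 ` param_segment y py \<inter> pt T2 ` param_segment x px \<subseteq> {pt T2 py}"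
    proof
      fix w assume "w \<in> pt T2 ` param_segment y py \<inter> pt T2 ` param_segment x px"
      then obtain s t where st: "w = pt T2 (near_end y s)" "w = pt T2 (near_end x t)" "s \<in> {0..\<epsilon> / 2}" "t \<in> {0..\<epsilon> / 2}"
        unfolding seg by blast
      then have *: "s = t" "\<phi>2 (fst y) (end_dist y s) = \<phi>2 (fst x) (end_dist x t)"
        using pt_polar_eq_iff[where \<phi> = \<phi>2 and m = m and s = s and t = t and U = U2 and U' = U2, OF range2 xy(2) xy(1)] \<epsilon> by auto
      have "(real k + g s) * width = (real k + 1 - g s) * width"
        using *(2) angle2[of k s] angle2[of "Suc k" s] k st \<epsilon> *(1) by simp
      then have "g s = 1 / 2" using width_pos by simp
      then have "s = \<epsilon> / 2" by (simp only: g_half)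
      then show "w \<in> {pt T2 py}" using st(1) unfolding py_def by (simp only: singleton_iff)
    qed
  qed
  let ?N = "sector (radius (\<epsilon> / 2)) (position m k) (position m (Suc k))"
  let ?K = "pt T2 ` param_segment y py \<union> pt T2 ` param_segment x px \<union> cis ` {position m k..position m (Suc k)}"
  have sub: "?A \<subseteq> params m" "?B \<subseteq> params m" using xy \<epsilon> by (auto intro!: near_end_in_params)
  have r1: "radius (\<epsilon> / 2) \<le> 1" using \<epsilon> by (intro radius_bounds) auto
  have "?K \<subseteq> ?N"
  proof -
    have "pt T2 p \<in> ?N" if "p \<in> ?A \<union> ?B" for p
      using in_sector_iff[of p "\<epsilon> / 2"] that sub \<epsilon> by auto
    moreover have "cis a \<in> ?N" if "a \<in> {position m k..position m (Suc k)}" for a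
      unfolding sector_def using that r1 by (intro image_eqI[of _ _ "(1, a)"]) auto
    ultimately show ?thesis unfolding seg by blast
  qed
  then have "inside ?K \<subseteq> ?N - ?K" using position_bounds radius_pos by (intro inside_sector) auto
  moreover have "pt T2 p \<in> ?K" if "p \<in> params m" "pt T2 p \<in> ?N" for p
    using in_sector_iff[OF that(1), of "\<epsilon> / 2"] that(2) \<epsilon> unfolding seg by auto
  ultimately show "inside ?K \<inter> pt T2 ` params m = {}" by blast
qed

text \<open>The move leads back to exactly the old diagram: outside the sector of depth
  \<open>\<epsilon>\<close> both diagrams agree, and inside it the old one has two disjoint radial
  pieces.\<close>

lemma move: "move_a m T2 T"
proof -
  let ?N = "sector (radius \<epsilon>) (position m k) (position m (Suc k))"
  let ?E = "near_end y ` {0..\<epsilon>}" and ?F = "near_end x ` {0..\<epsilon>}"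
  have E: "?E = param_segment y (near_end y \<epsilon>)" and F: "?F = param_segment x (near_end x \<epsilon>)"
    using \<epsilon> xy by (simp_all add: param_segment_near_end)
  have sub: "?E \<subseteq> params m" "?F \<subseteq> params m" using xy \<epsilon> by (auto intro!: near_end_in_params)
  have r1: "radius \<epsilon> < 1" using \<epsilon> radius_bounds(1)[of \<epsilon>] radius_bounds(2)[of \<epsilon>] by auto
  have disj: "near_end y s \<noteq> near_end x t" if "s \<in> {0..\<epsilon>}" "t \<in> {0..\<epsilon>}" for s t
  proof
    assume eq: "near_end y s = near_end x t"
    then have "s = t" using near_end_eq_depth[OF eq] that \<epsilon> by auto
    then show False using near_end_eq[of y s x m] eq xy that \<epsilon> by auto
  qed
  have far: "pt T p = pt T2 p" if p: "p \<in> params m - (?E \<union> ?F)" for p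
  proof -
    obtain z \<tau> where z: "z \<in> endpoints m" "\<tau> \<in> {0..1 / 2}" "p = near_end z \<tau>"
      using p by (auto elim: param_near_end)
    have "\<phi>2 (fst z) (end_dist z \<tau>) = \<phi> (fst z) (end_dist z \<tau>)"
    proof (cases "2 * \<epsilon> / 3 \<le> \<tau>")
      case True then show ?thesis using z by (intro \<phi>2_near_end_deep) auto
    next
      case False
      then have "z \<noteq> x" "z \<noteq> y" using p z \<epsilon> by auto
      then show ?thesis using \<phi>2_near_end[OF z(1,2)] by simp
    qed
    then show ?thesis by (simp add: z(3) pt_polar_near_end)
  qed
  have no: "\<not> crossing m T p q" if "p \<in> ?E \<union> ?F" for p q
    using that shallow_not_crossing[OF xy(1), of _ q] shallow_not_crossing[OF xy(2), of _ q]
    by (elim UnE imageE) simp_all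
  show ?thesis
    unfolding move_a_def
  proof (intro conjI)
    show "virtual_tangle_diagram m T2" using classical2 by (simp add: classical_tangle_diagram_def)
    show "virtual_tangle_diagram m T" by (rule virtual)
    show "\<exists>ea fa u w \<theta> \<theta>' e' f' E F (N :: complex set).
        boundary_crossing m T2 ea fa u w \<theta> \<theta>' \<and>
        e' \<in> params m - endpoints m \<and> f' \<in> params m - endpoints m \<and>
        fst e' = fst ea \<and> fst f' = fst fa \<and>
        E = param_segment ea e' \<and> F = param_segment fa f' \<and> E \<inter> F = {} \<and>
        u \<in> E - {e'} \<and> w \<in> F - {f'} \<and>
        N homeomorphic (cball 0 1 :: complex set) \<and> N \<subseteq> cball 0 1 \<and> cis ` {\<theta>..\<theta>'} \<subseteq> N \<and>
        (\<forall>x\<in>params m. pt T2 x \<in> N \<longleftrightarrow> x \<in> E \<union> F) \<and>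
        (\<forall>x\<in>E \<union> F. \<forall>y. crossing m T2 x y \<longrightarrow> {x, y} = {u, w}) \<and>
        pt T ea = pt T2 fa \<and> pt T fa = pt T2 ea \<and>
        pt T ` (E \<union> F) \<subseteq> N \<and> inj_on (pt T) (E \<union> F) \<and>
        (\<forall>x\<in>params m - (E \<union> F). pt T x = pt T2 x) \<and>
        under T = under T2 - {u, w}"
    proof (intro exI conjI)
      show "boundary_crossing m T2 y x py px (position m k) (position m (Suc k))" by (rule boundary_crossing)
      show "near_end y \<epsilon> \<in> params m - endpoints m" "near_end x \<epsilon> \<in> params m - endpoints m"
        using \<epsilon> xy by (auto simp: near_end_endpoint_iff intro!: near_end_in_params)
      show "fst (near_end y \<epsilon>) = fst y" "fst (near_end x \<epsilon>) = fst x" by (simp_all add: near_end_def)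
      show "?E = param_segment y (near_end y \<epsilon>)" "?F = param_segment x (near_end x \<epsilon>)" by (fact E, fact F)
      show "?E \<inter> ?F = {}" using disj by blast
      have "py \<noteq> near_end y \<epsilon>" "px \<noteq> near_end x \<epsilon>"
        using near_end_eq_depth[of y "\<epsilon> / 2" y \<epsilon>] near_end_eq_depth[of x "\<epsilon> / 2" x \<epsilon>] \<epsilon> by (auto simp: px_def py_def)
      then show "py \<in> ?E - {near_end y \<epsilon>}" "px \<in> ?F - {near_end x \<epsilon>}"
        using \<epsilon> by (auto simp: px_def py_def)
      show "?N homeomorphic (cball 0 1 :: complex set)"
        using radius_pos r1 position_bounds by (intro sector_homeomorphic_cball) auto
      show "?N \<subseteq> cball 0 1" using radius_pos[of \<epsilon>] by (auto simp: sector_def norm_mult)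
      show "cis ` {position m k..position m (Suc k)} \<subseteq> ?N"
        using r1 by (auto simp: sector_def intro!: image_eqI[of _ _ "(1, _)"])
      show "\<forall>p\<in>params m. pt T2 p \<in> ?N \<longleftrightarrow> p \<in> ?E \<union> ?F"
        using in_sector_iff[of _ \<epsilon>] \<epsilon> by auto
      show "\<forall>p\<in>?E \<union> ?F. \<forall>q. crossing m T2 p q \<longrightarrow> {p, q} = {py, px}"
        using no unfolding crossing2 by blast
      have ends: "pt T (e l) = cis (position m l)" if "l < 2 * m" for l
        using pt_polar_near_end[of \<phi> U "e l" 0] near_end_0[OF e_endpoint[OF that]] at_end[OF that, of 0] \<epsilon>
        by (simp add: radius_def)
      show "pt T y = pt T2 x" "pt T x = pt T2 y"
        using ends k boundary_crossing unfolding boundary_crossing_def by simp_all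
      show "pt T ` (?E \<union> ?F) \<subseteq> ?N"
      proof -
        have "pt T (near_end (e l) \<tau>) \<in> ?N" if "l = k \<or> l = Suc k" "\<tau> \<in> {0..\<epsilon>}" for l \<tau>
        proof -
          have l: "l < 2 * m" using that k by auto
          show ?thesis
            using pt_in_sector_iff[of m \<phi> "e l" \<tau> \<epsilon> "position m k" "position m (Suc k)" U, OF range e_endpoint[OF l]]
              angle_in_range_iff_old[OF l, of \<tau>] that \<epsilon> position_bounds by auto
        qed
        then show ?thesis by blast
      qed
      show "inj_on (pt T) (?E \<union> ?F)"
      proof (rule inj_onI, rule ccontr)
        fix p q assume pq: "p \<in> ?E \<union> ?F" "q \<in> ?E \<union> ?F" "pt T p = pt T q" "p \<noteq> q"
        then have "crossing m T p q" using sub by (auto simp: crossing_def)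
        with no[OF pq(1)] show False by blast
      qed
      show "\<forall>p\<in>params m - (?E \<union> ?F). pt T p = pt T2 p" using far by blast
      show "under T = under T2 - {py, px}"
        using new_crossing_not_old by (auto simp: U2_def new_under_def)
    qed
  qed
qed

lemma property_P1_step:
  assumes "property_P1 m T" shows "property_P1 m T2"
proof -
  obtain T0 where T0: "trivial_tangle_diagram m T0"
    "(\<lambda>S S'. planar_isotopic m S S' \<or> move_a m S S')\<^sup>*\<^sup>* T T0"
    using assms unfolding property_P1_def by blast
  have "(\<lambda>S S'. planar_isotopic m S S' \<or> move_a m S S')\<^sup>*\<^sup>* T2 T0"
    by (rule converse_rtranclp_into_rtranclp[OF _ T0(2)]) (rule disjI2[OF move])
  with T0(1) show ?thesis unfolding property_P1_def by blast
qed

end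

section \<open>Colored plats\<close>

text \<open>Colors are integers attached to parameters: constant along arcs, and reduced modulo \<open>p\<close> only at the end.\<close>

definition plat_coloring ::
    "nat \<Rightarrow> (nat \<Rightarrow> real \<Rightarrow> real) \<Rightarrow> param set \<Rightarrow> (nat \<Rightarrow> param) \<Rightarrow> real \<Rightarrow> (param \<Rightarrow> int) \<Rightarrow> int list \<Rightarrow> bool" where
  "plat_coloring m \<phi> U e \<epsilon> c v \<longleftrightarrow> length v = 2 * m \<and>
     (\<forall>i t. (i, t) \<in> params m - U \<longrightarrow> (\<exists>\<eta>>0. \<forall>t'\<in>{0..1}. \<bar>t' - t\<bar> < \<eta> \<longrightarrow> c (i, t') = c (i, t))) \<and>
     (\<forall>i t q. (i, t) \<in> U \<and> crossing m (polar_tangle \<phi> U) (i, t) q \<longrightarrow>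
        (\<exists>a b. a + b = 2 * c q \<and> (\<exists>\<eta>>0. \<forall>s\<in>{0<..<\<eta>}. c (i, t - s) = a \<and> c (i, t + s) = b))) \<and>
     (\<forall>l<2 * m. \<forall>\<tau>\<in>{0..\<epsilon>}. c (near_end (e l) \<tau>) = v ! l)"

context plat_step
begin

definition zu where "zu = (if up then y else x)"

text \<open>Solves the coloring relation at the new crossing for the outer arc of the
  under-string.\<close>

definition new_color :: "int list \<Rightarrow> int" where
  "new_color v = (if up then 2 * v ! k - v ! Suc k else 2 * v ! Suc k - v ! k)"

definition c2 :: "(param \<Rightarrow> int) \<Rightarrow> int list \<Rightarrow> param \<Rightarrow> int" where
  "c2 c v p = (if fst p = fst zu \<and> end_dist zu (snd p) < \<epsilon> / 2 then new_color v else c p)"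

definition v2 :: "int list \<Rightarrow> int list" where
  "v2 v = (if up then v[k := 2 * v ! k - v ! Suc k, Suc k := v ! k]
     else v[k := v ! Suc k, Suc k := 2 * v ! Suc k - v ! k])"

lemma crossing_depth:
  assumes "crossing m T p q" shows "\<epsilon> < end_dist z (snd p)" "\<epsilon> < end_dist z (snd q)"
proof -
  have *: "\<epsilon> < end_dist z (snd p)" if c: "crossing m T p q" for p q
  proof -
    have "p \<in> params m" using c by (simp add: crossing_def)
    then obtain z' \<tau> where z': "z' \<in> endpoints m" "\<tau> \<in> {0..1 / 2}" "p = near_end z' \<tau>" by (rule param_near_end)
    have "\<epsilon> < \<tau>" using shallow_not_crossing[OF z'(1), of \<tau> q] c z' by force
    also have "\<tau> \<le> end_dist z (snd p)" using z' end_dist_near_end[of \<tau> z z'] by (simp add: near_end_def)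
    finally show ?thesis .
  qed
  have "crossing m T q p" using assms by (auto simp: crossing_def)
  then show "\<epsilon> < end_dist z (snd p)" "\<epsilon> < end_dist z (snd q)" using *[of p q] *[of q p] assms by simp_all
qed

lemma zu: "zu \<in> endpoints m" "new_under = near_end zu (\<epsilon> / 2)"
  using xy by (simp_all add: zu_def new_under_def px_def py_def)

lemma end_dist_diff: "\<bar>end_dist z s - end_dist z t\<bar> = \<bar>s - t\<bar>" by (simp add: end_dist_def abs_minus_commute)

lemma end_dist_lt_half:
  assumes "z \<in> endpoints m" "0 \<le> \<tau>" "\<tau> \<le> 1 / 2"
  shows "fst z = fst zu \<and> end_dist zu (end_dist z \<tau>) < \<epsilon> / 2 \<longleftrightarrow> z = zu \<and> \<tau> < \<epsilon> / 2"
proof (cases "z = zu")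
  case False
  then show ?thesis using end_dist_other[OF assms(1) zu(1), of "end_dist z \<tau>"] assms \<epsilon> by auto
qed simp

lemma c2_near_end:
  "z \<in> endpoints m \<Longrightarrow> 0 \<le> \<tau> \<Longrightarrow> \<tau> \<le> 1 / 2 \<Longrightarrow>
    c2 c v (near_end z \<tau>) = (if z = zu \<and> \<tau> < \<epsilon> / 2 then new_color v else c (near_end z \<tau>))"
  using end_dist_lt_half[of z \<tau>] by (simp add: c2_def near_end_def)

text \<open>Only the piece between the new under-crossing and the boundary is recolored, so colors
  stay locally constant elsewhere. At the new crossing the relation holds by the choice of
  \<open>new_color\<close>; the old crossings lie deeper than the collar and keep their
  colors.\<close>

lemma plat_coloring2:
  assumes c: "plat_coloring m \<phi> U e \<epsilon> c v"
  shows "plat_coloring m \<phi>2 U2 e2 (\<epsilon> / 3) (c2 c v) (v2 v)"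
proof -
  have len: "length v = 2 * m"
    and const: "\<And>i t. (i, t) \<in> params m - U \<Longrightarrow> \<exists>\<eta>>0. \<forall>t'\<in>{0..1}. \<bar>t' - t\<bar> < \<eta> \<longrightarrow> c (i, t') = c (i, t)"
    and rel: "\<And>i t q. (i, t) \<in> U \<Longrightarrow> crossing m T (i, t) q \<Longrightarrow>
        \<exists>a b. a + b = 2 * c q \<and> (\<exists>\<eta>>0. \<forall>s\<in>{0<..<\<eta>}. c (i, t - s) = a \<and> c (i, t + s) = b)"
    and ends: "\<And>l \<tau>. l < 2 * m \<Longrightarrow> 0 \<le> \<tau> \<Longrightarrow> \<tau> \<le> \<epsilon> \<Longrightarrow> c (near_end (e l) \<tau>) = v ! l"
    using c unfolding plat_coloring_def by auto
  have A: "\<exists>\<eta>>0. \<forall>t'\<in>{0..1}. \<bar>t' - t\<bar> < \<eta> \<longrightarrow> c2 c v (i, t') = c2 c v (i, t)" if it: "(i, t) \<in> params m - U2" for i t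
  proof -
    obtain \<eta> where \<eta>: "0 < \<eta>" "\<And>t'. t' \<in> {0..1} \<Longrightarrow> \<bar>t' - t\<bar> < \<eta> \<Longrightarrow> c (i, t') = c (i, t)"
      using const[of i t] it by (auto simp: U2_def)
    show ?thesis
    proof (cases "i = fst zu")
      case False
      then show ?thesis using \<eta> by (auto simp: c2_def)
    next
      case True
      have "end_dist zu t \<noteq> \<epsilon> / 2"
      proof
        assume "end_dist zu t = \<epsilon> / 2"
        then have "t = end_dist zu (\<epsilon> / 2)" by (metis end_dist_end_dist)
        then have "(i, t) = new_under" using True by (simp add: zu(2) near_end_def)
        then show False using it by (simp add: U2_def)
      qed
      then consider "end_dist zu t < \<epsilon> / 2" | "\<epsilon> / 2 < end_dist zu t" by linarith
      then show ?thesis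
      proof cases
        case 1
        have c2_eq: "c2 c v (i, t') = c2 c v (i, t)" if "\<bar>t' - t\<bar> < \<epsilon> / 2 - end_dist zu t" for t'
        proof -
          have "end_dist zu t' < \<epsilon> / 2" using that end_dist_diff[of zu t' t] by linarith
          then show ?thesis using 1 True by (simp add: c2_def)
        qed
        have "0 < \<epsilon> / 2 - end_dist zu t" using 1 by simp
        then show ?thesis using c2_eq by blast
      next
        case 2
        have c2_eq: "c2 c v (i, t') = c2 c v (i, t)" if "t' \<in> {0..1}" "\<bar>t' - t\<bar> < min \<eta> (end_dist zu t - \<epsilon> / 2)" for t'
        proof -
          have "\<epsilon> / 2 < end_dist zu t'" using that end_dist_diff[of zu t' t] by linarith
          moreover have "c (i, t') = c (i, t)" using that by (intro \<eta>(2)) simp_all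
          ultimately show ?thesis using 2 by (simp add: c2_def)
        qed
        have "0 < min \<eta> (end_dist zu t - \<epsilon> / 2)" using 2 \<eta>(1) by simp
        then show ?thesis using c2_eq by blast
      qed
    qed
  qed
  have B: "\<exists>a b. a + b = 2 * c2 c v q \<and> (\<exists>\<eta>>0. \<forall>s\<in>{0<..<\<eta>}. c2 c v (i, t - s) = a \<and> c2 c v (i, t + s) = b)"
    if un: "(i, t) \<in> U2" and cr: "crossing m T2 (i, t) q" for i t q
  proof (cases "(i, t) \<in> U")
    case True
    have "(i, t) \<noteq> px" "(i, t) \<noteq> py" using True new_crossing_not_old by metis+
    then have crT: "crossing m T (i, t) q" using cr unfolding crossing2 by simp
    have deep: "\<epsilon> < end_dist zu t" "\<epsilon> < end_dist zu (snd q)" using crossing_depth[OF crT, of zu] by simp_all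
    obtain a b \<eta> where ab: "a + b = 2 * c q" "0 < \<eta>" "\<And>s. s \<in> {0<..<\<eta>} \<Longrightarrow> c (i, t - s) = a \<and> c (i, t + s) = b"
      using rel[OF True crT] by blast
    have "c2 c v (i, t - s) = a \<and> c2 c v (i, t + s) = b" if s: "s \<in> {0<..<min \<eta> (\<epsilon> / 2)}" for s
    proof -
      have "\<epsilon> / 2 < end_dist zu (t - s)" "\<epsilon> / 2 < end_dist zu (t + s)"
        using end_dist_diff[of zu "t - s" t] end_dist_diff[of zu "t + s" t] deep s by auto
      then show ?thesis using ab(3)[of s] s by (simp add: c2_def)
    qed
    moreover have "c2 c v q = c q" using deep \<epsilon> by (simp add: c2_def)
    ultimately show ?thesis using ab(1,2) \<epsilon>(1)
      by (intro exI[of _ a] exI[of _ b] conjI exI[of _ "min \<eta> (\<epsilon> / 2)"]) auto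
  next
    case False
    define zo where "zo = (if up then x else y)"
    have it: "(i, t) = new_under" using un False by (simp add: U2_def)
    then have i: "i = fst zu" and t: "t = end_dist zu (\<epsilon> / 2)" by (simp_all add: zu(2) near_end_def)
    have "crossing m T (i, t) q \<or> (i, t) = px \<and> q = py \<or> (i, t) = py \<and> q = px"
      using cr unfolding crossing2 by simp
    then have "q = new_over"
      using it px_py_not_crossing px_py(3) unfolding new_under_def new_over_def by metis
    then have q: "q = near_end zo (\<epsilon> / 2)" by (simp add: new_over_def zo_def px_def py_def)
    have zo: "zo \<in> endpoints m" "zo \<noteq> zu" using xy by (auto simp: zo_def zu_def)
    define a where "a = (if up then v ! k else v ! Suc k)"
    define b where "b = (if up then v ! Suc k else v ! k)"
    have nc: "new_color v = 2 * a - b" by (simp add: new_color_def a_def b_def)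
    have "c (near_end zo (\<epsilon> / 2)) = a"
      using ends[of k "\<epsilon> / 2"] ends[of "Suc k" "\<epsilon> / 2"] k \<epsilon> by (auto simp: zo_def a_def)
    then have cq: "c2 c v q = a" unfolding q using c2_near_end[OF zo(1), of "\<epsilon> / 2"] zo(2) \<epsilon> by simp
    have side: "c2 c v (near_end zu \<tau>) = (if \<tau> < \<epsilon> / 2 then new_color v else b)" if "0 \<le> \<tau>" "\<tau> \<le> \<epsilon>" for \<tau>
      using c2_near_end[OF zu(1), of \<tau>] that ends[of k \<tau>] ends[of "Suc k" \<tau>] k \<epsilon> by (auto simp: zu_def b_def)
    have pt: "(i, end_dist zu \<tau>) = near_end zu \<tau>" for \<tau> by (simp add: near_end_def i)
    show ?thesis
    \<comment> \<open>Whether the string starts or finishes at \<open>zu\<close> decides on which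
      side of the crossing, in time, the new color appears.\<close>
    proof (cases "snd zu = 0")
      case True
      then have ed: "end_dist zu \<tau> = \<tau>" for \<tau> by (simp add: end_dist_def)
      have "c2 c v (i, t - s) = new_color v \<and> c2 c v (i, t + s) = b" if "s \<in> {0<..<\<epsilon> / 2}" for s
        using side[of "\<epsilon> / 2 - s"] side[of "\<epsilon> / 2 + s"] pt[of "\<epsilon> / 2 - s"] pt[of "\<epsilon> / 2 + s"] that
        by (simp add: t ed)
      then show ?thesis using cq nc \<epsilon>(1)
        by (intro exI[of _ "new_color v"] exI[of _ b] conjI exI[of _ "\<epsilon> / 2"]) auto
    next
      case False
      then have ed: "end_dist zu \<tau> = 1 - \<tau>" for \<tau> by (simp add: end_dist_def)
      have "c2 c v (i, t - s) = b \<and> c2 c v (i, t + s) = new_color v" if "s \<in> {0<..<\<epsilon> / 2}" for s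
        using side[of "\<epsilon> / 2 - s"] side[of "\<epsilon> / 2 + s"] pt[of "\<epsilon> / 2 - s"] pt[of "\<epsilon> / 2 + s"] that
        by (simp add: t ed algebra_simps)
      then show ?thesis using cq nc \<epsilon>(1)
        by (intro exI[of _ b] exI[of _ "new_color v"] conjI exI[of _ "\<epsilon> / 2"]) auto
    qed
  qed
  have E: "c2 c v (near_end (e2 l) \<tau>) = v2 v ! l" if l: "l < 2 * m" and \<tau>: "0 \<le> \<tau>" "\<tau> \<le> \<epsilon> / 3" for l \<tau>
  proof -
    have \<tau>': "\<tau> < \<epsilon> / 2" "\<tau> \<le> \<epsilon>" "\<tau> \<le> 1 / 2" using \<tau> \<epsilon> by auto
    have *: "c2 c v (near_end (e j) \<tau>) = (if e j = zu then new_color v else v ! j)" if "j < 2 * m" for j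
      using c2_near_end[OF e_endpoint[OF that] \<tau>(1) \<tau>'(3)] ends[OF that \<tau>(1) \<tau>'(2)] \<tau>' by simp
    have ne: "e j = zu \<longleftrightarrow> j = (if up then Suc k else k)" if "j < 2 * m" for j
      using e_inj[OF that] k by (simp add: zu_def)
    consider "l = k" | "l = Suc k" | "l \<noteq> k" "l \<noteq> Suc k" by blast
    then show ?thesis
    proof cases
      case 1
      then show ?thesis using *[of "Suc k"] ne[of "Suc k"] k len e2(1) by (simp add: v2_def new_color_def)
    next
      case 2
      then show ?thesis using *[of k] ne[of k] k len e2(2) by (simp add: v2_def new_color_def)
    next
      case 3
      then show ?thesis using *[of l] ne[of l] l len e2(3)[of l] by (simp add: v2_def)
    qed
  qed
  show ?thesis
    unfolding plat_coloring_def
  proof (intro conjI allI impI ballI)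
    show "length (v2 v) = 2 * m" using len by (simp add: v2_def)
    fix l \<tau> assume "l < 2 * m" "\<tau> \<in> {0..\<epsilon> / 3}"
    then show "c2 c v (near_end (e2 l) \<tau>) = v2 v ! l" using E by simp
  qed (use A B in blast)+
qed

end

section \<open>The crossingless diagram of cups\<close>

definition cup_angle :: "nat \<Rightarrow> nat \<Rightarrow> real \<Rightarrow> real" where
  "cup_angle m i t = (2 * real i + smooth_step (2 * t - 1 / 2)) / real (2 * m)"

definition cup_end :: "nat \<Rightarrow> param" where
  "cup_end l = (l div 2, real (l mod 2))"

text \<open>String \<open>i\<close> moves from position \<open>2 * i\<close> to position
  \<open>2 * i + 1\<close> and changes its angle only between the times \<open>1 / 4\<close> and
  \<open>3 / 4\<close>, whence the collar of depth \<open>1 / 4\<close>.\<close>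

lemma cup_plat:
  assumes m: "1 \<le> m"
  shows "plat m (cup_angle m) {} cup_end (1 / 4)"
    and "trivial_tangle_diagram m (polar_tangle (cup_angle m) {})"
    and "plat_coloring m (cup_angle m) {} cup_end (1 / 4) (\<lambda>p. a (fst p)) (map (\<lambda>l. a (l div 2)) [0..<2 * m])"
proof -
  let ?T = "polar_tangle (cup_angle m) {}"
  have h: "0 \<le> smooth_step u" "smooth_step u \<le> 1" for u using smooth_step_bounds[of u] by simp_all
  have cd: "continuously_differentiable (cup_angle m i)" for i
  proof -
    have "continuously_differentiable (\<lambda>t. 2 * real i / real (2 * m) + 1 / real (2 * m) * smooth_step (2 * t + - 1 / 2))"
      by (intro continuously_differentiable_add continuously_differentiable_const
          continuously_differentiable_affine continuously_differentiable_smooth_step)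
    then show ?thesis by (simp add: cup_angle_def[abs_def] add_divide_distrib)
  qed
  have rng: "cup_angle m i ` {0..1} \<subseteq> {0..1}" if "i < m" for i
  proof (rule image_subsetI)
    fix t :: real
    have "2 * real i + smooth_step (2 * t - 1 / 2) \<le> real (2 * m)"
      using that h(2)[of "2 * t - 1 / 2"] by linarith
    then show "cup_angle m i t \<in> {0..1}" using m h(1)[of "2 * t - 1 / 2"] by (simp add: cup_angle_def divide_le_eq_1)
  qed
  have e_bij: "bij_betw cup_end {..<2 * m} (endpoints m)"
  proof (rule bij_betw_byWitness[where f' = "\<lambda>z. 2 * fst z + (if snd z = 0 then 0 else 1)"])
    show "\<forall>l\<in>{..<2 * m}. 2 * fst (cup_end l) + (if snd (cup_end l) = 0 then 0 else 1) = l"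
    proof
      fix l :: nat
      have "(if snd (cup_end l) = 0 then 0 else 1) = l mod 2" by (simp add: cup_end_def)
      then show "2 * fst (cup_end l) + (if snd (cup_end l) = 0 then 0 else 1) = l"
        by (simp only: cup_end_def fst_conv mult_div_mod_eq)
    qed
    show "\<forall>z\<in>endpoints m. cup_end (2 * fst z + (if snd z = 0 then 0 else 1)) = z"
      by (auto simp: cup_end_def endpoints_def)
    show "cup_end ` {..<2 * m} \<subseteq> endpoints m"
    proof (rule image_subsetI)
      fix l assume "l \<in> {..<2 * m}"
      moreover have "l mod 2 = 0 \<or> l mod 2 = 1" by auto
      ultimately show "cup_end l \<in> endpoints m" by (auto simp: cup_end_def endpoints_def)
    qed
    show "(\<lambda>z. 2 * fst z + (if snd z = 0 then 0 else 1)) ` endpoints m \<subseteq> {..<2 * m}"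
      by (auto simp: endpoints_def)
  qed
  have no: "\<not> crossing m ?T p q" for p q
  proof
    assume c: "crossing m ?T p q"
    then have pq: "p \<in> params m" "q \<in> params m" "p \<noteq> q" "pt ?T p = pt ?T q" by (simp_all add: crossing_def)
    obtain i s where p: "p = (i, s)" "i < m" "s \<in> {0..1}" using pq by (auto simp: params_def)
    obtain j t where q: "q = (j, t)" "j < m" "t \<in> {0..1}" using pq by (auto simp: params_def)
    have "cup_angle m i s \<in> {0..1}" "cup_angle m j t \<in> {0..1}" using rng p q by blast+
    then have eq: "radius s = radius t" "cup_angle m i s = cup_angle m j t"
      using pq(4) polar_eq_iff[OF radius_pos radius_pos] by (simp_all add: p q pt_polar)
    have eq2: "2 * real i + smooth_step (2 * s - 1 / 2) = 2 * real j + smooth_step (2 * t - 1 / 2)"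
      using eq(2) m by (simp add: cup_angle_def)
    then have "\<bar>2 * real i - 2 * real j\<bar> \<le> 1"
      using h[of "2 * s - 1 / 2"] h[of "2 * t - 1 / 2"] by linarith
    \<comment> \<open>Different strings occupy disjoint ranges of angles. On one string equal radii
      at different times mean reflected times, and by the symmetry of \<open>smooth_step\<close> the
      angles then agree only at the middle.\<close>
    then have ij: "i = j" by linarith
    then have "t \<noteq> s" using pq p q by auto
    then have st: "t = 1 - s" using eq(1) by (auto simp: radius_eq_iff)
    then have "2 * t - 1 / 2 = 1 - (2 * s - 1 / 2)" by simp
    then have "smooth_step (2 * s - 1 / 2) = 1 - smooth_step (2 * s - 1 / 2)"
      using eq2 ij smooth_step_symmetric[of "2 * s - 1 / 2"] by simp
    then have "smooth_step (2 * s - 1 / 2) = 1 / 2" by simp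
    then have "2 * s - 1 / 2 = 1 / 2" by (simp only: smooth_step_half)
    then show False using st \<open>t \<noteq> s\<close> by simp
  qed
  have vel: "velocity ?T p \<noteq> 0" if p: "p \<in> params m" for p
  proof -
    obtain i t where it: "p = (i, t)" by (cases p)
    have "((\<lambda>t. 2 * t - 1 / 2 :: real) has_real_derivative 2) (at t)" by (auto intro!: derivative_eq_intros)
    from DERIV_chain2[OF DERIV_smooth_step this]
    have "(cup_angle m i has_real_derivative (0 + smooth_step_deriv (2 * t - 1 / 2) * 2) / real (2 * m)) (at t)"
      unfolding cup_angle_def[abs_def] by (intro DERIV_cdivide DERIV_add DERIV_const)
    from velocity_polar[of "cup_angle m", OF this]
    have "velocity ?T p = cis (cup_angle m i t) *
        Complex (2 * t - 1) (radius t * ((0 + smooth_step_deriv (2 * t - 1 / 2) * 2) / real (2 * m)))"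
      unfolding it .
    moreover have "Complex (2 * t - 1) (radius t * ((0 + smooth_step_deriv (2 * t - 1 / 2) * 2) / real (2 * m))) \<noteq> 0"
    \<comment> \<open>At the middle the radial velocity vanishes, but there the angle changes
      fastest.\<close>
    proof (cases "t = 1 / 2")
      case True
      then have "smooth_step_deriv (2 * t - 1 / 2) = 2" by (simp add: smooth_step_deriv_def)
      then show ?thesis using radius_pos[of t] m by (simp add: complex_eq_iff)
    next
      case False
      then show ?thesis by (simp add: complex_eq_iff)
    qed
    ultimately show ?thesis by simp
  qed
  have vtd: "virtual_tangle_diagram m ?T"
    unfolding virtual_tangle_diagram_def
  proof (intro conjI allI impI ballI)
    show "strand ?T i C1_differentiable_on {0..1}" for i by (rule C1_polar[of "cup_angle m", OF cd])
    show "pt ?T ` params m \<subseteq> cball 0 1"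
      using radius_bounds(1) by (auto simp: norm_pt_polar params_def)
    show "pt ?T p \<in> sphere 0 1 \<longleftrightarrow> p \<in> endpoints m" if "p \<in> params m" for p
      using that radius_bounds(2)[of "snd p"] by (auto simp: norm_pt_polar params_def endpoints_def)
    show "inj_on (pt ?T) (endpoints m)"
    proof (rule inj_onI, rule ccontr)
      fix p q assume "p \<in> endpoints m" "q \<in> endpoints m" "pt ?T p = pt ?T q" "p \<noteq> q"
      then have "crossing m ?T p q" by (auto simp: crossing_def endpoints_def params_def)
      with no show False by blast
    qed
  qed (use m no vel in auto)
  show "trivial_tangle_diagram m ?T" using vtd no by (simp add: trivial_tangle_diagram_def)
  have cl: "classical_tangle_diagram m ?T" using vtd no by (simp add: classical_tangle_diagram_def)
  show "plat m (cup_angle m) {} cup_end (1 / 4)"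
    unfolding plat_def
  proof (intro conjI allI impI ballI)
    fix l \<tau> assume l: "l < 2 * m" and \<tau>: "\<tau> \<in> {0..1 / 4 :: real}"
    have "l mod 2 = 0 \<or> l mod 2 = 1" by auto
    then show "cup_angle m (fst (cup_end l)) (end_dist (cup_end l) \<tau>) = position m l"
    proof
      assume l2: "l mod 2 = 0"
      then have "2 * real (l div 2) = real l" by (metis add.right_neutral mult_div_mod_eq of_nat_mult of_nat_numeral)
      then show ?thesis using \<tau> l2 by (simp add: cup_angle_def cup_end_def end_dist_def position_def smooth_step_0)
    next
      assume l2: "l mod 2 = 1"
      then have "2 * real (l div 2) + 1 = real l" by (metis mult_div_mod_eq of_nat_1 of_nat_add of_nat_mult of_nat_numeral)
      then show ?thesis using \<tau> l2 by (simp add: cup_angle_def cup_end_def end_dist_def position_def smooth_step_1)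
    qed
  qed (use cl cd rng e_bij in auto)
  show "plat_coloring m (cup_angle m) {} cup_end (1 / 4) (\<lambda>p. a (fst p)) (map (\<lambda>l. a (l div 2)) [0..<2 * m])"
    unfolding plat_coloring_def
    by (auto simp: near_end_def cup_end_def intro!: exI[of _ 1])
qed

section \<open>Color vectors and Euclid's algorithm\<close>

inductive reachable :: "nat \<Rightarrow> int list \<Rightarrow> bool" for m where
  cups: "reachable m (map (\<lambda>l. a (l div 2)) [0..<2 * m])"
| up: "reachable m v \<Longrightarrow> Suc k < 2 * m \<Longrightarrow> reachable m (v[k := 2 * v ! k - v ! Suc k, Suc k := v ! k])"
| down: "reachable m v \<Longrightarrow> Suc k < 2 * m \<Longrightarrow> reachable m (v[k := v ! Suc k, Suc k := 2 * v ! Suc k - v ! k])"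

text \<open>This separates geometry from arithmetic: it remains to reach integer vectors by the
  rules of \<open>reachable\<close>. The rules \<open>up\<close> and \<open>down\<close> correspond
  to the two choices of the under-string at a new crossing.\<close>

lemma reachable_plat:
  assumes "1 \<le> m" "reachable m v"
  shows "\<exists>\<phi> U e \<epsilon> c. plat m \<phi> U e \<epsilon> \<and> property_P1 m (polar_tangle \<phi> U) \<and> plat_coloring m \<phi> U e \<epsilon> c v"
  using assms(2)
proof induction
  case (cups a)
  have "property_P1 m (polar_tangle (cup_angle m) {})"
    unfolding property_P1_def using cup_plat(2)[OF assms(1)] by blast
  then show ?case using cup_plat(1)[OF assms(1)] cup_plat(3)[OF assms(1), of a] by blast
next
  case (up v k)
  then obtain \<phi> U e \<epsilon> c where IH: "plat m \<phi> U e \<epsilon>" "property_P1 m (polar_tangle \<phi> U)" "plat_coloring m \<phi> U e \<epsilon> c v" by blast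
  interpret plat_step m \<phi> U e \<epsilon> k True using IH up by unfold_locales
  have "v2 v = v[k := 2 * v ! k - v ! Suc k, Suc k := v ! k]" by (simp add: v2_def)
  then show ?case using plat2 property_P1_step[OF IH(2)] plat_coloring2[OF IH(3)] by metis
next
  case (down v k)
  then obtain \<phi> U e \<epsilon> c where IH: "plat m \<phi> U e \<epsilon>" "property_P1 m (polar_tangle \<phi> U)" "plat_coloring m \<phi> U e \<epsilon> c v" by blast
  interpret plat_step m \<phi> U e \<epsilon> k False using IH down by unfold_locales
  have "v2 v = v[k := v ! Suc k, Suc k := 2 * v ! Suc k - v ! k]" by (simp add: v2_def)
  then show ?case using plat2 property_P1_step[OF IH(2)] plat_coloring2[OF IH(3)] by metis
qed

text \<open>A pair of equal colors in front is one more cup preceding the others; all crossings are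
  shifted by two positions.\<close>

lemma reachable_Cons_Cons:
  assumes "reachable m v" shows "reachable (Suc m) (a # a # v)"
  using assms
proof induction
  case (cups b)
  have "a # a # map (\<lambda>l. b (l div 2)) [0..<2 * m] = map (\<lambda>l. (case l div 2 of 0 \<Rightarrow> a | Suc i \<Rightarrow> b i)) [0..<2 * Suc m]"
  proof (rule nth_equalityI)
    fix l assume l: "l < length (a # a # map (\<lambda>l. b (l div 2)) [0..<2 * m])"
    consider "l = 0" | "l = Suc 0" | l' where "l = Suc (Suc l')" by (metis not0_implies_Suc)
    then show "(a # a # map (\<lambda>l. b (l div 2)) [0..<2 * m]) ! l =
        map (\<lambda>l. (case l div 2 of 0 \<Rightarrow> a | Suc i \<Rightarrow> b i)) [0..<2 * Suc m] ! l"
    proof cases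
      case 3
      then have "l' < 2 * m" using l by simp
      then show ?thesis by (simp add: 3 del: upt_Suc)
    qed (simp_all del: upt_Suc)
  qed simp
  then show ?case using reachable.cups[of "Suc m" "\<lambda>l. case l of 0 \<Rightarrow> a | Suc i \<Rightarrow> b i"] by metis
next
  case (up v k)
  then show ?case using reachable.up[of "Suc m" "a # a # v" "Suc (Suc k)"] by simp
next
  case (down v k)
  then show ?case using reachable.down[of "Suc m" "a # a # v" "Suc (Suc k)"] by simp
qed

fun alternating :: "int list \<Rightarrow> int" where
  "alternating [] = 0"
| "alternating (x # xs) = x - alternating xs"

lemma alternating_eq_sum: "alternating v = (\<Sum>k<length v. (-1) ^ k * v ! k)"
proof (induction v)
  case (Cons x xs)
  have "(\<Sum>k<length (x # xs). (-1) ^ k * (x # xs) ! k) = x + (\<Sum>k<length xs. - ((-1) ^ k * xs ! k))"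
    by (simp add: sum.lessThan_Suc_shift del: sum.lessThan_Suc)
  then show ?case using Cons by (simp add: sum_negf)
qed simp

text \<open>On the differences \<open>b - a\<close> and \<open>c - b\<close> the moves act like the steps of Euclid's algorithm.\<close>

lemma reachable_first_moves:
  assumes "Suc 0 < 2 * m"
  shows "reachable m ((2 * a - b) # a # w) \<Longrightarrow> reachable m (a # b # w)"
    and "reachable m (b # (2 * b - a) # w) \<Longrightarrow> reachable m (a # b # w)"
  \<comment> \<open>At the same position \<open>up\<close> and \<open>down\<close> are inverse to
    each other, so a vector is reachable as soon as its image under either of them is.\<close>
  using reachable.down[of m "(2 * a - b) # a # w" 0] reachable.up[of m "b # (2 * b - a) # w" 0] assms by simp_all

lemma reachable_second_moves:
  assumes "Suc (Suc 0) < 2 * m"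
  shows "reachable m (a # (2 * b - c) # b # w) \<Longrightarrow> reachable m (a # b # c # w)"
    and "reachable m (a # c # (2 * c - b) # w) \<Longrightarrow> reachable m (a # b # c # w)"
  using reachable.down[of m "a # (2 * b - c) # b # w" "Suc 0"] reachable.up[of m "a # c # (2 * c - b) # w" "Suc 0"] assms
  by simp_all

text \<open>The outer induction is on the number of strings, the inner one on
  \<open>\<bar>b - a\<bar> + \<bar>c - b\<bar>\<close> for the first three entries. Splitting off an
  equal pair keeps the alternating sum of the rest at 0. For one string, sum 0 already means two
  equal colors.\<close>

lemma alternating_reachable:
  assumes "length v = 2 * m" "alternating v = 0" shows "reachable m v"
  using assms
proof (induction m arbitrary: v)
  case 0
  then show ?case using reachable.cups[of 0] by simp
next
  case (Suc m)
  show ?case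
  proof (cases "m = 0")
    case True
    then obtain a b where v: "v = [a, b]" using Suc.prems(1) by (auto simp: length_Suc_conv numeral_2_eq_2)
    then have "a = b" using Suc.prems(2) by simp
    moreover have "reachable m []" using reachable.cups[of 0] True by simp
    ultimately show ?thesis using reachable_Cons_Cons v by simp
  next
    case False
    have equal: "reachable (Suc m) (a # a # w)" if "length w = 2 * m" "alternating w = 0" for a w
      using Suc.IH that by (intro reachable_Cons_Cons)
    have m: "Suc 0 < 2 * Suc m" "Suc (Suc 0) < 2 * Suc m" using False by auto
    have three: "reachable (Suc m) (a # b # c # w)"
      if "length (a # b # c # w) = 2 * Suc m" "alternating (a # b # c # w) = 0" for a b c w
      using that
    proof (induction "nat (\<bar>b - a\<bar> + \<bar>c - b\<bar>)" arbitrary: a b c rule: less_induct)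
      case less
      have len: "length (u # w) = 2 * m" for u :: int using less.prems(1) by simp
      \<comment> \<open>The four alternatives are the effects of the four moves on the differences
        \<open>d\<close> and \<open>f\<close>. For nonzero \<open>d\<close> and \<open>f\<close>,
        adding or subtracting the one of smaller absolute value shrinks the other.\<close>
      have euclid: "\<bar>d + f\<bar> < \<bar>f\<bar> \<or> \<bar>f - d\<bar> < \<bar>f\<bar> \<or> \<bar>d - f\<bar> < \<bar>d\<bar> \<or> \<bar>d + f\<bar> < \<bar>d\<bar>"
        if "d \<noteq> 0" "f \<noteq> 0" for d f :: int
        using that by (cases "d > 0"; cases "f > 0") linarith+
      have diffs: "\<bar>a - (2 * a - b)\<bar> = \<bar>b - a\<bar>" "\<bar>(2 * b - a) - b\<bar> = \<bar>b - a\<bar>" "\<bar>c - (2 * b - a)\<bar> = \<bar>(c - b) - (b - a)\<bar>"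
        "\<bar>(2 * b - c) - a\<bar> = \<bar>(b - a) - (c - b)\<bar>" "\<bar>b - (2 * b - c)\<bar> = \<bar>c - b\<bar>" "\<bar>(2 * c - b) - c\<bar> = \<bar>c - b\<bar>"
        "\<bar>c - a\<bar> = \<bar>(b - a) + (c - b)\<bar>" by simp_all
      have lt: "nat (\<bar>r\<bar> + \<bar>s\<bar>) < nat (\<bar>t\<bar> + \<bar>u\<bar>) \<longleftrightarrow> \<bar>r\<bar> + \<bar>s\<bar> < \<bar>t\<bar> + \<bar>u\<bar>" for r s t u :: int
        by (rule nat_less_eq_zless) simp
      consider "a = b" | "a \<noteq> b" "b = c"
        | "a \<noteq> b" "b \<noteq> c" "nat (\<bar>a - (2 * a - b)\<bar> + \<bar>c - a\<bar>) < nat (\<bar>b - a\<bar> + \<bar>c - b\<bar>)"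
        | "a \<noteq> b" "b \<noteq> c" "nat (\<bar>(2 * b - a) - b\<bar> + \<bar>c - (2 * b - a)\<bar>) < nat (\<bar>b - a\<bar> + \<bar>c - b\<bar>)"
        | "a \<noteq> b" "b \<noteq> c" "nat (\<bar>(2 * b - c) - a\<bar> + \<bar>b - (2 * b - c)\<bar>) < nat (\<bar>b - a\<bar> + \<bar>c - b\<bar>)"
        | "a \<noteq> b" "b \<noteq> c" "nat (\<bar>c - a\<bar> + \<bar>(2 * c - b) - c\<bar>) < nat (\<bar>b - a\<bar> + \<bar>c - b\<bar>)"
        unfolding diffs lt add_less_cancel_left add_less_cancel_right
        using euclid[of "b - a" "c - b"] right_minus_eq[of b a] right_minus_eq[of c b] by blast
      then show ?case
      proof cases
        case 1
        then show ?thesis using equal[of "c # w" a] less.prems by simp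
      next
        case 2
        \<comment> \<open>Carries the pair \<open>b, b\<close> to the front past \<open>a\<close>,
          which turns both of its entries into \<open>2 * a - b\<close>.\<close>
        have "reachable (Suc m) ((2 * a - b) # (2 * a - b) # a # w)"
          using less.prems 2 by (intro equal) simp_all
        then have "reachable (Suc m) ((2 * a - b) # a # b # w)"
          using reachable_second_moves(1)[OF m(2), of "2 * a - b" a b w] by simp
        then show ?thesis using reachable_first_moves(1)[OF m(1)] 2 by simp
      next
        case 3
        have "reachable (Suc m) ((2 * a - b) # a # c # w)"
          using less.prems by (intro less.hyps 3(3)) simp_all
        then show ?thesis by (rule reachable_first_moves(1)[OF m(1)])
      next
        case 4
        have "reachable (Suc m) (b # (2 * b - a) # c # w)"
          using less.prems by (intro less.hyps 4(3)) simp_all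
        then show ?thesis by (rule reachable_first_moves(2)[OF m(1)])
      next
        case 5
        have "reachable (Suc m) (a # (2 * b - c) # b # w)"
          using less.prems by (intro less.hyps 5(3)) simp_all
        then show ?thesis by (rule reachable_second_moves(1)[OF m(2)])
      next
        case 6
        have "reachable (Suc m) (a # c # (2 * c - b) # w)"
          using less.prems by (intro less.hyps 6(3)) simp_all
        then show ?thesis by (rule reachable_second_moves(2)[OF m(2)])
      qed
    qed
    obtain a b c w where "v = a # b # c # w"
    proof -
      have "3 \<le> length v" using Suc.prems(1) False by simp
      then show ?thesis using that by (metis Suc_le_length_iff numeral_3_eq_3)
    qed
    then show ?thesis using three Suc.prems by blast
  qed
qed

text \<open>Locally constant integer colors are constant on arcs, which are connected, so the color
  of an arc may be read off at any of its points and reduced modulo \<open>p\<close>.\<close>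

lemma plat_coloring_diagram:
  fixes R :: "int ring" and p :: int
  assumes pl: "plat m \<phi> U e \<epsilon>" and c: "plat_coloring m \<phi> U e \<epsilon> c w"
    and v: "length v = 2 * m" "\<And>k. k < 2 * m \<Longrightarrow> v ! k = w ! k mod p"
    and car: "\<And>x. x mod p \<in> carrier R"
    and add: "\<And>x y. \<lbrakk>x \<in> carrier R; y \<in> carrier R\<rbrakk> \<Longrightarrow> x \<oplus>\<^bsub>R\<^esub> y = (x + y) mod p"
    and two: "\<And>x. x \<in> carrier R \<Longrightarrow> [(2::nat)] \<cdot>\<^bsub>R\<^esub> x = (2 * x) mod p"
  shows "\<exists>C. coloring R m (polar_tangle \<phi> U) C \<and> boundary_color_vector m (polar_tangle \<phi> U) C v"
proof -
  let ?T = "polar_tangle \<phi> U"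
  have vtd: "virtual_tangle_diagram m ?T" using pl by (simp add: plat_def classical_tangle_diagram_def)
  have m: "1 \<le> m" using vtd by (simp add: virtual_tangle_diagram_def)
  have bij: "bij_betw e {..<2 * m} (endpoints m)" and \<epsilon>: "0 < \<epsilon>"
    and pos: "\<And>k. k < 2 * m \<Longrightarrow> \<phi> (fst (e k)) (end_dist (e k) 0) = position m k"
    using pl by (simp_all add: plat_def)
  have const: "\<And>i t. (i, t) \<in> params m - U \<Longrightarrow> \<exists>\<eta>>0. \<forall>t'\<in>{0..1}. \<bar>t' - t\<bar> < \<eta> \<longrightarrow> c (i, t') = c (i, t)"
    and rel: "\<And>i t q. (i, t) \<in> U \<Longrightarrow> crossing m ?T (i, t) q \<Longrightarrow>
        \<exists>a b. a + b = 2 * c q \<and> (\<exists>\<eta>>0. \<forall>s\<in>{0<..<\<eta>}. c (i, t - s) = a \<and> c (i, t + s) = b)"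
    and ends: "\<And>l. l < 2 * m \<Longrightarrow> c (near_end (e l) 0) = w ! l"
    using c \<epsilon> unfolding plat_coloring_def by auto
  have ek: "near_end (e k) 0 = e k" "e k \<in> endpoints m" if "k < 2 * m" for k
    using bij_betwE[OF bij] that near_end_0[of "e k" m] by simp_all
  have pt_e: "pt ?T (e k) = cis (position m k)" if "k < 2 * m" for k
    using pt_polar_near_end[of \<phi> U "e k" 0] pos[OF that] ek[OF that] by (simp add: radius_def)
  have order: "position m k < position m l \<and> position m l < position m k + 2 * pi" if "k < l" "l < 2 * m" for k l
  proof -
    have "position m k < position m l" "0 \<le> position m k" "position m l < 1"
      using that m by (simp_all add: position_def divide_strict_right_mono)
    then show ?thesis using pi_gt3 by linarith
  qed
  interpret diagram m ?T e "position m" using vtd bij pt_e order by unfold_locales auto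
  define C where "C A = c (SOME x. x \<in> A) mod p" for A
  have arc_sub: "A \<subseteq> params m - U" if "A \<in> diagram_arcs m ?T" for A
    using that in_components_subset unfolding diagram_arcs_def by fastforce
  have C: "C A = c x mod p" if A: "A \<in> diagram_arcs m ?T" and x: "x \<in> A" for A x
  proof -
    have "c constant_on A"
    proof (rule locally_constant_imp_constant)
      show "connected A" using A unfolding diagram_arcs_def by (rule in_components_connected)
      fix a assume a: "a \<in> A"
      obtain i t where it: "a = (i, t)" by (cases a)
      then have "(i, t) \<in> params m - U" using a arc_sub[OF A] by blast
      then obtain \<eta> where \<eta>: "0 < \<eta>" "\<forall>t'\<in>{0..1}. \<bar>t' - t\<bar> < \<eta> \<longrightarrow> c (i, t') = c (i, t)" using const by blast
      have "open ({i} \<times> ball t \<eta>)" by (intro open_Times open_discrete open_ball)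
      then have "openin (top_of_set A) (A \<inter> ({i} \<times> ball t \<eta>))" by (rule openin_open_Int)
      moreover have "c x = c a" if x: "x \<in> A \<inter> ({i} \<times> ball t \<eta>)" for x
      proof -
        obtain s where s: "x = (i, s)" "\<bar>s - t\<bar> < \<eta>" using x by (auto simp: dist_real_def abs_minus_commute)
        then have "s \<in> {0..1}" using x arc_sub[OF A] by (auto simp: params_def)
        then show ?thesis using \<eta>(2) s it by blast
      qed
      moreover have "a \<in> A \<inter> ({i} \<times> ball t \<eta>)" using a it \<eta>(1) by simp
      ultimately show "\<exists>S. openin (top_of_set A) S \<and> a \<in> S \<and> (\<forall>x\<in>S. c x = c a)"
        by blast
    qed
    then have "c (SOME x. x \<in> A) = c x" using x unfolding constant_on_def by (metis someI)
    then show ?thesis by (simp add: C_def)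
  qed
  have "coloring R m ?T C"
    unfolding coloring_def
  proof (intro conjI ballI allI impI)
    show "C A \<in> carrier R" for A unfolding C_def by (rule car)
    fix u q X Y Z
    assume asm: "u \<in> under ?T \<and> crossing m ?T u q \<and> X \<in> diagram_arcs m ?T \<and> Z \<in> diagram_arcs m ?T \<and> X \<noteq> Z \<and>
      u \<in> closure X \<and> u \<in> closure Z \<and> Y \<in> diagram_arcs m ?T \<and> q \<in> Y"
    obtain i t where it: "u = (i, t)" by (cases u)
    have un: "(i, t) \<in> under ?T" using asm it by simp
    obtain X' Z' \<eta> where XZ: "X' \<in> diagram_arcs m ?T" "Z' \<in> diagram_arcs m ?T" "0 < \<eta>"
      "\<And>s. s \<in> {0<..<\<eta>} \<Longrightarrow> (i, t - s) \<in> X' \<and> (i, t + s) \<in> Z'"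
      using arcs_at_under_crossing[OF un] by metis
    \<comment> \<open>\<open>coloring\<close> speaks of all arcs having the under-crossing as a
      limit point; these are just the two arcs on its two sides, since they fill a punctured
      neighborhood.\<close>
    have near: "W = X' \<or> W = Z'" if W: "W \<in> diagram_arcs m ?T" "(i, t) \<in> closure W" for W
    proof -
      have "open ({i} \<times> ball t \<eta>)" by (intro open_Times open_discrete open_ball)
      moreover have "(i, t) \<in> {i} \<times> ball t \<eta>" using XZ(3) by simp
      ultimately have "{i} \<times> ball t \<eta> \<inter> W \<noteq> {}" using W(2) open_Int_closure_eq_empty by blast
      then obtain s where s: "(i, s) \<in> W" "\<bar>s - t\<bar> < \<eta>" by (auto simp: dist_real_def abs_minus_commute)
      have "s \<noteq> t" using s(1) arc_sub[OF W(1)] un by auto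
      then have "(i, s) \<in> X' \<or> (i, s) \<in> Z'"
        using XZ(4)[of "t - s"] XZ(4)[of "s - t"] s(2) by (cases "s < t") auto
      then show ?thesis using arc_of_eq[OF W(1) s(1)] arc_of_eq[OF XZ(1)] arc_of_eq[OF XZ(2)] by metis
    qed
    have "crossing m ?T (i, t) q" "(i, t) \<in> U" using asm it un by simp_all
    then obtain a b \<eta>' where ab: "a + b = 2 * c q" "0 < \<eta>'"
      "\<And>s. s \<in> {0<..<\<eta>'} \<Longrightarrow> c (i, t - s) = a \<and> c (i, t + s) = b"
      using rel by metis
    define s where "s = min \<eta> \<eta>' / 2"
    have s: "s \<in> {0<..<\<eta>}" "s \<in> {0<..<\<eta>'}" using XZ(3) ab(2) by (auto simp: s_def)
    have "C X' = a mod p" "C Z' = b mod p"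
      using C[OF XZ(1)] C[OF XZ(2)] XZ(4)[OF s(1)] ab(3)[OF s(2)] by metis+
    moreover have "X = X' \<and> Z = Z' \<or> X = Z' \<and> Z = X'" using near[of X] near[of Z] asm it by metis
    ultimately have "(C X + C Z) mod p = (a + b) mod p" by (auto simp: mod_simps add.commute)
    moreover have "C Y = c q mod p" using C asm by blast
    then have "(2 * C Y) mod p = (2 * c q) mod p" by (simp add: mod_simps)
    moreover have "C A \<in> carrier R" for A unfolding C_def by (rule car)
    ultimately show "C X \<oplus>\<^bsub>R\<^esub> C Z = [(2::nat)] \<cdot>\<^bsub>R\<^esub> C Y" using ab(1) add two by simp
  qed
  moreover have "boundary_color_vector m ?T C v"
    unfolding boundary_color_vector_def
  proof (intro conjI exI)
    show "\<forall>k<2 * m. \<exists>A\<in>diagram_arcs m ?T. e k \<in> A \<and> v ! k = C A"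
    proof (intro allI impI)
      fix k assume k: "k < 2 * m"
      have "e k \<notin> under ?T" using under_interior[of "fst (e k)" "snd (e k)"] ek(2)[OF k] by (auto simp: endpoints_def)
      then have "e k \<in> params m - under ?T" using ek(2)[OF k] endpoints_subset by blast
      note A = arc_of[OF this]
      have "v ! k = C (arc_of (e k))" using C[of "arc_of (e k)" "e k"] A ends[OF k] ek(1)[OF k] v(2)[OF k] by simp
      then show "\<exists>A\<in>diagram_arcs m ?T. e k \<in> A \<and> v ! k = C A" using A by blast
    qed
  qed (use v(1) bij pt_e order in auto)
  ultimately show ?thesis by blast
qed

lemma alternating_list_update_0:
  "0 < length v \<Longrightarrow> alternating (v[0 := v ! 0 - a]) = alternating v - a"
  by (cases v) simp_all

theorem proposition1p1:
  fixes R :: "int ring" and m :: nat and v :: "int list"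
  assumes "R = \<Z> \<or> (\<exists>p. 3 \<le> p \<and> odd p \<and> R = residue_ring p)"
    and "1 \<le> m"
    and "length v = 2 * m"
    and "set v \<subseteq> carrier R"
  shows "((\<exists>T C. classical_tangle_diagram m T \<and> coloring R m T C \<and> boundary_color_vector m T C v)
            \<longleftrightarrow> alternating_sum R v = \<zero>\<^bsub>R\<^esub>)
       \<and> (alternating_sum R v = \<zero>\<^bsub>R\<^esub> \<longrightarrow>
            (\<exists>T C. classical_tangle_diagram m T \<and> coloring R m T C \<and> boundary_color_vector m T C v
               \<and> property_P1 m T))"
proof -
  have "\<exists>T C. classical_tangle_diagram m T \<and> coloring R m T C \<and> boundary_color_vector m T C v \<and> property_P1 m T"
    if zero: "alternating_sum R v = \<zero>\<^bsub>R\<^esub>"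
  proof -
    obtain p where p: "p = 0 \<or> odd p" "\<zero>\<^bsub>R\<^esub> = 0"
      and red: "\<And>x. x \<in> carrier R \<Longrightarrow> x mod p = x" "\<And>x. x mod p \<in> carrier R"
      and add: "\<And>x y. \<lbrakk>x \<in> carrier R; y \<in> carrier R\<rbrakk> \<Longrightarrow> x \<oplus>\<^bsub>R\<^esub> y = (x + y) mod p"
      and two: "\<And>x. x \<in> carrier R \<Longrightarrow> [(2::nat)] \<cdot>\<^bsub>R\<^esub> x = (2 * x) mod p"
      and alt: "\<And>v. set v \<subseteq> carrier R \<Longrightarrow> alternating_sum R v = (\<Sum>k<length v. (-1) ^ k * v ! k) mod p"
      by (rule coefficient_ring[OF assms(1)], rule that)
    have dvd: "alternating v mod p = 0" using zero alt[OF assms(4)] p(2) by (simp add: alternating_eq_sum)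
    \<comment> \<open>The lift with integer alternating sum 0: the whole sum is taken off the first
      entry, and being a multiple of \<open>p\<close> it does not change that entry modulo
      \<open>p\<close>.\<close>
    define w where "w = v[0 := v ! 0 - alternating v]"
    have "length w = 2 * m" using assms(3) by (simp add: w_def)
    moreover have "alternating w = 0"
      unfolding w_def using assms(2,3) by (subst alternating_list_update_0) simp_all
    ultimately have "reachable m w" by (rule alternating_reachable)
    then obtain \<phi> U e \<epsilon> c where plat: "plat m \<phi> U e \<epsilon>" "property_P1 m (polar_tangle \<phi> U)" "plat_coloring m \<phi> U e \<epsilon> c w"
      using reachable_plat[OF assms(2)] by blast
    have vw: "v ! k = w ! k mod p" if "k < 2 * m" for k
    proof -
      have "v ! k mod p = v ! k" using that assms(3,4) by (intro red(1)) auto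
      moreover have "(v ! k - alternating v) mod p = v ! k mod p"
        using mod_diff_right_eq[of "v ! k" "alternating v" p] dvd by simp
      ultimately show ?thesis using that assms(3) by (cases k) (simp_all add: w_def)
    qed
    obtain C where "coloring R m (polar_tangle \<phi> U) C" "boundary_color_vector m (polar_tangle \<phi> U) C v"
      using plat_coloring_diagram[OF plat(1,3) assms(3) vw red(2) add two] by blast
    moreover have "classical_tangle_diagram m (polar_tangle \<phi> U)" using plat(1) by (simp add: plat_def)
    ultimately show ?thesis using plat(2) by blast
  qed
  then show ?thesis using colored_diagram_alternating_sum[OF assms(1,4)] by blast
qed

end
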